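(* Fix $T>0$. Assume the cubic nonlinearity is stabilizing, i.e. there exists $C_G>0$ such that $$\frac{\omega_c}{2\pi}\int_0^{2\pi/\omega_c}\Big((e^{tB}z)^*\tilde\Psi\int_{-r}^0(\Phi(\theta)e^{tB}z)^3d\nu_3(\theta)\Big)dt<-C_G\|z\|_2^4\qquad\text{for all }z\in\mathbb R^2\setminus\{0\}.$$ There is a constant $\hat C>0$, independent of $a,\delta,q,\varepsilon$, such that the following holds. Fix any $a\in[0,1)$ and $\delta\in(2a,2)$ and put $$p_\varepsilon:=1-\hat C\varepsilon^{-a}\sqrt{r\varepsilon^\delta\ln\Big(\frac{T}{r\varepsilon^\delta}\Big)}$$ (so $p_\varepsilon\to1$ as $\varepsilon\to0$). For any $q>0$ there exists $\varepsilon_q>0$ such that for all $0<\varepsilon<\varepsilon_q$ $$\mathbb P\Big[\sup_{s\in[0,T]}\big|X^\varepsilon(s)-\big(\Phi(0)e^{sB/\varepsilon^2}\widetilde{\mathfrak z}^\varepsilon_s+\mathfrak Y^\varepsilon_s(0)\big)\big|>6\varepsilon^{a/4}\Big]<3q+4(1-p_\varepsilon).$$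
   Context: Equation. Let $r>0$ and let $\mathcal C=C([-r,0];\mathbb R)$ with the sup norm $\|\cdot\|$; $\|\cdot\|_2$ is the Euclidean norm on $\mathbb R^2$ and $^*$ denotes transpose. For $\varepsilon>0$ and a continuous function $f$ on $[-\varepsilon^2r,T]$ let $\Pi^\varepsilon_tf\in\mathcal C$ be $(\Pi^\varepsilon_tf)(\theta)=f(t+\varepsilon^2\theta)$. Let $L_0:\mathcal C\to\mathbb R$ be bounded linear, and assume that the characteristic equation $\lambda-L_0(e^{\lambda\,\cdot})=0$ has exactly two roots (counted with multiplicity) on the imaginary axis, $\pm i\omega_c$ with $\omega_c>0$, and that all other roots have negative real parts. Let $G(\eta)=\int_{-r}^0\eta(\theta)d\nu_1(\theta)+\int_{-r}^0\eta^3(\theta)d\nu_3(\theta)$, where $\nu_1,\nu_3:[-r,0]\to\mathbb R$ are functions of bounded variation, continuous from the left on $(-r,0)$, with $\nu_i(0)=0$. Let $\sigma\in\mathbb R$, $W$ a one-dimensional Wiener process, $\xi\in\mathcal C$ deterministic. $X^\varepsilon$ is the solution of $dX^\varepsilon(t)=\varepsilon^{-2}L_0(\Pi^\varepsilon_tX^\varepsilon)dt+G(\Pi^\varepsilon_tX^\varepsilon)dt+\sigma dW(t)$ for $t\in[0,T]$, $X^\varepsilon(t)=\xi(\varepsilon^{-2}t)$ for $t\in[-\varepsilon^2r,0]$. Splitting. Let $\hat{\mathcal C}$ be the space of bounded measurable functions $[-r,0]\to\mathbb R$ with sup norm; $L_0$ is extended to $\hat{\mathcal C}$ via its Riesz representation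 as integration against a finite signed measure. For $\phi\in\hat{\mathcal C}$, $\hat T(t)\phi\in\hat{\mathcal C}$ is $\theta\mapsto x(t+\theta)$, where $x=\phi$ on $[-r,0]$ and $x(t)=\phi(0)+\int_0^tL_0(x(s+\cdot))ds$ for $t\ge0$. Put $\Phi_1(\theta)=\cos(\omega_c\theta)$, $\Phi_2(\theta)=\sin(\omega_c\theta)$, $\Phi=[\Phi_1,\Phi_2]$, $\Phi v=v_1\Phi_1+v_2\Phi_2$ for $v\in\mathbb R^2$, $P=\mathrm{span}\{\Phi_1,\Phi_2\}$, $B=\begin{pmatrix}0&\omega_c\\-\omega_c&0\end{pmatrix}$. Then $\hat{\mathcal C}=P\oplus\hat Q$, where $\hat Q$ is the $\hat T$-invariant set of $\phi$ with $\hat T(t)\phi\to0$ as $t\to\infty$; $\hat\pi$ is the projection onto $P$ along $\hat Q$ and $\pi$ its restriction to $\mathcal C$. With $\mathbf 1_{\{0\}}$ the indicator function of $\{0\}$ on $[-r,0]$, $\tilde\Psi\in\mathbb R^2$ is defined by $\hat\pi\mathbf 1_{\{0\}}=\Phi\tilde\Psi$. Processes. Write $\Pi^\varepsilon_tX^\varepsilon=\Phi z^\varepsilon_t+y^\varepsilon_t$ with $\Phi z^\varepsilon_t=\pi\Pi^\varepsilon_tX^\varepsilon$, $y^\varepsilon_t=(1-\pi)\Pi^\varepsilon_tX^\varepsilon$; $\mathfrak Y^\varepsilon_t=\hat T(t/\varepsilon^2)y^\varepsilon_0$ (deterministic). The $\mathbb R^2$-valued process without delay $\widetilde{\mathfrak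 z}^\varepsilon$ solves $d\widetilde{\mathfrak z}^\varepsilon_t=e^{-tB/\varepsilon^2}\tilde\Psi\,G(\Phi e^{tB/\varepsilon^2}\widetilde{\mathfrak z}^\varepsilon_t)dt+e^{-tB/\varepsilon^2}\tilde\Psi\sigma dW_t$, $\widetilde{\mathfrak z}^\varepsilon_0=z^\varepsilon_0$. The constant $\hat C$ may depend on $T$ and the data ($r,L_0,\sigma$). *)

theory Defs
  imports "HOL-Probability.Probability" "HOL-Complex_Analysis.Complex_Analysis"
begin

text \<open>
  Elements of \<open>C([-r,0])\<close> and of the space of bounded measurable functions on \<open>[-r,0]\<close> are
  represented by functions on the whole line; only their values on \<open>[-r,0]\<close> are ever used.
\<close>

section \<open>The linear delay equation\<close>

definition sup_on :: "real \<Rightarrow> (real \<Rightarrow> real) \<Rightarrow> real" where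
  "sup_on r \<phi> = (SUP \<theta>\<in>{-r..0}. \<bar>\<phi> \<theta>\<bar>)"

text \<open>The bound below forces \<open>L \<phi>\<close> to depend on \<open>\<phi>\<close> restricted to \<open>[-r,0]\<close> only.\<close>

definition bounded_linear_on_C :: "real \<Rightarrow> ((real \<Rightarrow> real) \<Rightarrow> real) \<Rightarrow> bool" where
  "bounded_linear_on_C r L \<longleftrightarrow>
     (\<forall>\<phi> \<psi>. continuous_on {-r..0} \<phi> \<longrightarrow> continuous_on {-r..0} \<psi> \<longrightarrow>
        L (\<lambda>\<theta>. \<phi> \<theta> + \<psi> \<theta>) = L \<phi> + L \<psi>) \<and>
     (\<forall>c \<phi>. continuous_on {-r..0} \<phi> \<longrightarrow> L (\<lambda>\<theta>. c * \<phi> \<theta>) = c * L \<phi>) \<and>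
     (\<exists>K. \<forall>\<phi>. continuous_on {-r..0} \<phi> \<longrightarrow> \<bar>L \<phi>\<bar> \<le> K * sup_on r \<phi>)"

text \<open>The characteristic function \<open>z - L(exp(z \<cdot>))\<close>, with \<open>L\<close> extended complex-linearly.\<close>

definition char_fun :: "((real \<Rightarrow> real) \<Rightarrow> real) \<Rightarrow> complex \<Rightarrow> complex" where
  "char_fun L z =
     z - Complex (L (\<lambda>\<theta>. Re (exp (z * of_real \<theta>)))) (L (\<lambda>\<theta>. Im (exp (z * of_real \<theta>))))"

definition critical_spectrum :: "((real \<Rightarrow> real) \<Rightarrow> real) \<Rightarrow> real \<Rightarrow> bool" where
  "critical_spectrum L \<omega>c \<longleftrightarrow>
     \<omega>c > 0 \<and>
     {z. char_fun L z = 0 \<and> Re z = 0} = {\<i> * of_real \<omega>c, - \<i> * of_real \<omega>c} \<and>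
     zorder (char_fun L) (\<i> * of_real \<omega>c) = 1 \<and>
     zorder (char_fun L) (- \<i> * of_real \<omega>c) = 1 \<and>
     (\<forall>z. char_fun L z = 0 \<longrightarrow> Re z \<noteq> 0 \<longrightarrow> Re z < 0)"

text \<open>
  A finite signed measure on \<open>[-r,0]\<close> is given as a difference of two finite Borel measures;
  by the Riesz representation theorem such a pair exists for every bounded linear \<open>L\<close>, and the
  resulting extension does not depend on the choice of the pair.
\<close>

definition riesz_pair ::
    "real \<Rightarrow> ((real \<Rightarrow> real) \<Rightarrow> real) \<Rightarrow> real measure \<times> real measure \<Rightarrow> bool" where
  "riesz_pair r L = (\<lambda>(\<mu>p, \<mu>n).
     finite_measure \<mu>p \<and> sets \<mu>p = sets borel \<and> finite_measure \<mu>n \<and> sets \<mu>n = sets borel \<and>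
     (\<forall>\<phi>. continuous_on {-r..0} \<phi> \<longrightarrow>
        L \<phi> = (LINT \<theta>:{-r..0}|\<mu>p. \<phi> \<theta>) - (LINT \<theta>:{-r..0}|\<mu>n. \<phi> \<theta>)))"

definition L_ext :: "real \<Rightarrow> ((real \<Rightarrow> real) \<Rightarrow> real) \<Rightarrow> (real \<Rightarrow> real) \<Rightarrow> real" where
  "L_ext r L \<phi> = (case (SOME \<mu>. riesz_pair r L \<mu>) of (\<mu>p, \<mu>n) \<Rightarrow>
     (LINT \<theta>:{-r..0}|\<mu>p. \<phi> \<theta>) - (LINT \<theta>:{-r..0}|\<mu>n. \<phi> \<theta>))"

definition C_hat :: "real \<Rightarrow> (real \<Rightarrow> real) set" where
  "C_hat r = {\<phi>. set_borel_measurable borel {-r..0} \<phi> \<and> bounded (\<phi> ` {-r..0})}"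

definition is_delay_sol ::
    "real \<Rightarrow> ((real \<Rightarrow> real) \<Rightarrow> real) \<Rightarrow> (real \<Rightarrow> real) \<Rightarrow> (real \<Rightarrow> real) \<Rightarrow> bool" where
  "is_delay_sol r L \<phi> x \<longleftrightarrow>
     (\<forall>\<theta>\<in>{-r..0}. x \<theta> = \<phi> \<theta>) \<and>
     (\<forall>t\<ge>0. set_integrable lborel {0..t} (\<lambda>s. L_ext r L (\<lambda>\<theta>. x (s + \<theta>))) \<and>
        x t = \<phi> 0 + (LINT s:{0..t}|lborel. L_ext r L (\<lambda>\<theta>. x (s + \<theta>))))"

text \<open>The solution is unique on \<open>[-r,\<infinity>)\<close>, the only place where it is evaluated.\<close>

definition T_hat ::
    "real \<Rightarrow> ((real \<Rightarrow> real) \<Rightarrow> real) \<Rightarrow> real \<Rightarrow> (real \<Rightarrow> real) \<Rightarrow> (real \<Rightarrow> real)" where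
  "T_hat r L t \<phi> = (\<lambda>\<theta>. (SOME x. is_delay_sol r L \<phi> x) (t + \<theta>))"

definition Q_hat :: "real \<Rightarrow> ((real \<Rightarrow> real) \<Rightarrow> real) \<Rightarrow> (real \<Rightarrow> real) set" where
  "Q_hat r L = {\<phi> \<in> C_hat r. ((\<lambda>t. sup_on r (T_hat r L t \<phi>)) \<longlongrightarrow> 0) at_top}"

definition Phi :: "real \<Rightarrow> real^2 \<Rightarrow> real \<Rightarrow> real" where
  "Phi \<omega>c v = (\<lambda>\<theta>. v $ 1 * cos (\<omega>c * \<theta>) + v $ 2 * sin (\<omega>c * \<theta>))"

definition P_space :: "real \<Rightarrow> (real \<Rightarrow> real) set" where
  "P_space \<omega>c = range (Phi \<omega>c)"

text \<open>Projection onto \<open>P\<close> along \<open>Q_hat\<close>.\<close>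

definition pi_hat ::
    "real \<Rightarrow> ((real \<Rightarrow> real) \<Rightarrow> real) \<Rightarrow> real \<Rightarrow> (real \<Rightarrow> real) \<Rightarrow> (real \<Rightarrow> real)" where
  "pi_hat r L \<omega>c \<phi> = (THE p. p \<in> P_space \<omega>c \<and> (\<lambda>\<theta>. \<phi> \<theta> - p \<theta>) \<in> Q_hat r L)"

definition pi_coord :: "real \<Rightarrow> ((real \<Rightarrow> real) \<Rightarrow> real) \<Rightarrow> real \<Rightarrow> (real \<Rightarrow> real) \<Rightarrow> real^2" where
  "pi_coord r L \<omega>c \<phi> = (THE v. pi_hat r L \<omega>c \<phi> = Phi \<omega>c v)"

definition Psi_tilde :: "real \<Rightarrow> ((real \<Rightarrow> real) \<Rightarrow> real) \<Rightarrow> real \<Rightarrow> real^2" where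
  "Psi_tilde r L \<omega>c = pi_coord r L \<omega>c (indicator {0})"

definition mat_B :: "real \<Rightarrow> real^2^2" where
  "mat_B \<omega>c = vector [vector [0, \<omega>c], vector [- \<omega>c, 0]]"

definition mat_exp :: "real^2^2 \<Rightarrow> real^2^2" where
  "mat_exp A = (\<Sum>n. (1 / fact n) *\<^sub>R (((**) A ^^ n) (mat 1)))"

section \<open>Riemann-Stieltjes integrals and the nonlinearity\<close>

definition has_RS_integral :: 
    "(real \<Rightarrow> real) \<Rightarrow> (real \<Rightarrow> real) \<Rightarrow> real \<Rightarrow> real \<Rightarrow> real \<Rightarrow> bool" where
  "has_RS_integral f \<nu> a b I \<longleftrightarrow>
     (\<forall>e>0. \<exists>d>0. \<forall>D. D tagged_division_of {a..b} \<and> (\<forall>(x, K)\<in>D. Sup K - Inf K < d) \<longrightarrow>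
        \<bar>(\<Sum>(x, K)\<in>D. f x * (\<nu> (Sup K) - \<nu> (Inf K))) - I\<bar> < e)"

definition RS_integral :: "(real \<Rightarrow> real) \<Rightarrow> (real \<Rightarrow> real) \<Rightarrow> real \<Rightarrow> real \<Rightarrow> real" where
  "RS_integral f \<nu> a b = (THE I. has_RS_integral f \<nu> a b I)"

definition bounded_variation :: "(real \<Rightarrow> real) \<Rightarrow> real \<Rightarrow> real \<Rightarrow> bool" where
  "bounded_variation \<nu> a b \<longleftrightarrow>
     (\<exists>V. \<forall>D. D division_of {a..b} \<longrightarrow> (\<Sum>K\<in>D. \<bar>\<nu> (Sup K) - \<nu> (Inf K)\<bar>) \<le> V)"

definition admissible_BV :: "real \<Rightarrow> (real \<Rightarrow> real) \<Rightarrow> bool" where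
  "admissible_BV r \<nu> \<longleftrightarrow>
     bounded_variation \<nu> (-r) 0 \<and>
     (\<forall>\<theta>\<in>{-r<..<0}. continuous (at_left \<theta>) \<nu>) \<and> \<nu> 0 = 0"

definition G_fun :: "real \<Rightarrow> (real \<Rightarrow> real) \<Rightarrow> (real \<Rightarrow> real) \<Rightarrow> (real \<Rightarrow> real) \<Rightarrow> real" where
  "G_fun r \<nu>1 \<nu>3 \<eta> = RS_integral \<eta> \<nu>1 (-r) 0 + RS_integral (\<lambda>\<theta>. \<eta> \<theta> ^ 3) \<nu>3 (-r) 0"

definition stabilizing ::
    "real \<Rightarrow> ((real \<Rightarrow> real) \<Rightarrow> real) \<Rightarrow> real \<Rightarrow> (real \<Rightarrow> real) \<Rightarrow> real \<Rightarrow> bool" where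
  "stabilizing r L \<omega>c \<nu>3 CG \<longleftrightarrow>
     (\<forall>z::real^2. z \<noteq> 0 \<longrightarrow>
        \<omega>c / (2 * pi) *
          integral {0..2 * pi / \<omega>c} (\<lambda>t.
            ((mat_exp (t *\<^sub>R mat_B \<omega>c) *v z) \<bullet> Psi_tilde r L \<omega>c) *
            RS_integral (\<lambda>\<theta>. (Phi \<omega>c (mat_exp (t *\<^sub>R mat_B \<omega>c) *v z) \<theta>) ^ 3) \<nu>3 (-r) 0)
        < - CG * norm z ^ 4)"

section \<open>Wiener process and Wiener integral\<close>

definition wiener_process :: "'w measure \<Rightarrow> (real \<Rightarrow> 'w \<Rightarrow> real) \<Rightarrow> bool" where
  "wiener_process M W \<longleftrightarrow>
     (\<forall>t\<ge>0. W t \<in> borel_measurable M) \<and>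
     (AE \<omega> in M. W 0 \<omega> = 0) \<and>
     (AE \<omega> in M. continuous_on {0..} (\<lambda>t. W t \<omega>)) \<and>
     (\<forall>s t. 0 \<le> s \<longrightarrow> s < t \<longrightarrow>
        distributed M lborel (\<lambda>\<omega>. W t \<omega> - W s \<omega>) (normal_density 0 (sqrt (t - s)))) \<and>
     (\<forall>n (ts::nat \<Rightarrow> real). 0 \<le> ts 0 \<longrightarrow> (\<forall>i<n. ts i < ts (Suc i)) \<longrightarrow>
        prob_space.indep_vars M (\<lambda>_. borel) (\<lambda>i \<omega>. W (ts (Suc i)) \<omega> - W (ts i) \<omega>) {..<n})"

text \<open>
  A step function \<open>(n, ts, c)\<close> takes the value \<open>c i\<close> on \<open>(ts i, ts (i+1)]\<close> for \<open>i < n\<close>.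
\<close>

type_synonym step = "nat \<times> (nat \<Rightarrow> real) \<times> (nat \<Rightarrow> real)"

definition step_on :: "real \<Rightarrow> step \<Rightarrow> bool" where
  "step_on t = (\<lambda>(n, ts, c). 0 \<le> ts 0 \<and> (\<forall>i<n. ts i \<le> ts (Suc i)) \<and> ts n \<le> t)"

definition step_fun :: "step \<Rightarrow> real \<Rightarrow> real" where
  "step_fun = (\<lambda>(n, ts, c) s. \<Sum>i<n. c i * indicator {ts i<..ts (Suc i)} s)"

definition step_integral :: "(real \<Rightarrow> 'w \<Rightarrow> real) \<Rightarrow> step \<Rightarrow> 'w \<Rightarrow> real" where
  "step_integral W = (\<lambda>(n, ts, c) \<omega>. \<Sum>i<n. c i * (W (ts (Suc i)) \<omega> - W (ts i) \<omega>))"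

text \<open>
  \<open>Y = \<integral>\<^sub>0\<^sup>t f dW\<close> for deterministic \<open>f\<close>: the \<open>L\<^sup>2(M)\<close>-limit of integrals of step functions
  converging to \<open>f\<close> in \<open>L\<^sup>2([0,t])\<close>. It determines \<open>Y\<close> up to almost sure equality.
\<close>

definition has_wiener_integral ::
    "'w measure \<Rightarrow> (real \<Rightarrow> 'w \<Rightarrow> real) \<Rightarrow> real \<Rightarrow> (real \<Rightarrow> real) \<Rightarrow> ('w \<Rightarrow> real) \<Rightarrow> bool" where
  "has_wiener_integral M W t f Y \<longleftrightarrow>
     Y \<in> borel_measurable M \<and>
     (\<exists>F :: nat \<Rightarrow> step. (\<forall>k. step_on t (F k)) \<and>
        (\<lambda>k. \<integral>\<^sup>+ s\<in>{0..t}. ennreal ((step_fun (F k) s - f s)\<^sup>2) \<partial>lborel) \<longlonglongrightarrow> 0 \<and>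
        (\<lambda>k. \<integral>\<^sup>+ \<omega>. ennreal ((step_integral W (F k) \<omega> - Y \<omega>)\<^sup>2) \<partial>M) \<longlonglongrightarrow> 0)"

section \<open>The two processes\<close>

definition segment :: "real \<Rightarrow> real \<Rightarrow> (real \<Rightarrow> real) \<Rightarrow> (real \<Rightarrow> real)" where
  "segment \<epsilon> t f = (\<lambda>\<theta>. f (t + \<epsilon>\<^sup>2 * \<theta>))"

text \<open>The noise is additive, so the stochastic term of the delay equation is \<open>\<sigma> W\<close>.\<close>

definition solves_delay_eq ::
    "'w measure \<Rightarrow> (real \<Rightarrow> 'w \<Rightarrow> real) \<Rightarrow> real \<Rightarrow> ((real \<Rightarrow> real) \<Rightarrow> real) \<Rightarrow>
     (real \<Rightarrow> real) \<Rightarrow> (real \<Rightarrow> real) \<Rightarrow> real \<Rightarrow> (real \<Rightarrow> real) \<Rightarrow> real \<Rightarrow> real \<Rightarrow>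
     (real \<Rightarrow> 'w \<Rightarrow> real) \<Rightarrow> bool" where
  "solves_delay_eq M W r L \<nu>1 \<nu>3 \<sigma> \<xi> T \<epsilon> X \<longleftrightarrow>
     (\<forall>t\<in>{- (\<epsilon>\<^sup>2 * r)..T}. X t \<in> borel_measurable M) \<and>
     (\<forall>\<omega>\<in>space M. continuous_on {- (\<epsilon>\<^sup>2 * r)..T} (\<lambda>t. X t \<omega>)) \<and>
     (AE \<omega> in M.
        (\<forall>t\<in>{- (\<epsilon>\<^sup>2 * r)..0}. X t \<omega> = \<xi> (t / \<epsilon>\<^sup>2)) \<and>
        (\<forall>t\<in>{0..T}. X t \<omega> = \<xi> 0 +
           integral {0..t} (\<lambda>s. L (segment \<epsilon> s (\<lambda>u. X u \<omega>)) / \<epsilon>\<^sup>2 +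
                                G_fun r \<nu>1 \<nu>3 (segment \<epsilon> s (\<lambda>u. X u \<omega>))) +
           \<sigma> * W t \<omega>))"

text \<open>
  The delay equation starts from \<open>\<xi>\<close> for every \<open>\<epsilon>\<close>, hence the initial coordinates on \<open>P\<close>
  and the initial complementary part do not depend on \<open>\<epsilon>\<close>.
\<close>

definition z_init :: "real \<Rightarrow> ((real \<Rightarrow> real) \<Rightarrow> real) \<Rightarrow> real \<Rightarrow> (real \<Rightarrow> real) \<Rightarrow> real^2" where
  "z_init r L \<omega>c \<xi> = pi_coord r L \<omega>c \<xi>"

definition y_init ::
    "real \<Rightarrow> ((real \<Rightarrow> real) \<Rightarrow> real) \<Rightarrow> real \<Rightarrow> (real \<Rightarrow> real) \<Rightarrow> (real \<Rightarrow> real)" where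
  "y_init r L \<omega>c \<xi> = (\<lambda>\<theta>. \<xi> \<theta> - pi_hat r L \<omega>c \<xi> \<theta>)"

definition Y_frak ::
    "real \<Rightarrow> ((real \<Rightarrow> real) \<Rightarrow> real) \<Rightarrow> real \<Rightarrow> (real \<Rightarrow> real) \<Rightarrow> real \<Rightarrow> real \<Rightarrow> (real \<Rightarrow> real)" where
  "Y_frak r L \<omega>c \<xi> \<epsilon> t = T_hat r L (t / \<epsilon>\<^sup>2) (y_init r L \<omega>c \<xi>)"

text \<open>
  The stochastic differential equation without delay, in integrated form: for every \<open>t\<close> and
  each component, \<open>z\<^sub>t - z\<^sub>0 - drift\<close> is the Wiener integral of the diffusion coefficient.
\<close>

definition solves_reduced_eq ::
    "'w measure \<Rightarrow> (real \<Rightarrow> 'w \<Rightarrow> real) \<Rightarrow> real \<Rightarrow> ((real \<Rightarrow> real) \<Rightarrow> real) \<Rightarrow> real \<Rightarrow>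
     (real \<Rightarrow> real) \<Rightarrow> (real \<Rightarrow> real) \<Rightarrow> real \<Rightarrow> (real \<Rightarrow> real) \<Rightarrow> real \<Rightarrow> real \<Rightarrow>
     (real \<Rightarrow> 'w \<Rightarrow> real^2) \<Rightarrow> bool" where
  "solves_reduced_eq M W r L \<omega>c \<nu>1 \<nu>3 \<sigma> \<xi> T \<epsilon> z \<longleftrightarrow>
     (\<forall>t\<in>{0..T}. z t \<in> borel_measurable M) \<and>
     (\<forall>\<omega>\<in>space M. continuous_on {0..T} (\<lambda>t. z t \<omega>)) \<and>
     (AE \<omega> in M. z 0 \<omega> = z_init r L \<omega>c \<xi>) \<and>
     (\<forall>t\<in>{0..T}. \<forall>i.
        has_wiener_integral M W t
          (\<lambda>s. \<sigma> * (mat_exp ((- s / \<epsilon>\<^sup>2) *\<^sub>R mat_B \<omega>c) *v Psi_tilde r L \<omega>c) $ i)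
          (\<lambda>\<omega>. (z t \<omega> - z 0 \<omega> -
             integral {0..t} (\<lambda>s.
               G_fun r \<nu>1 \<nu>3 (Phi \<omega>c (mat_exp ((s / \<epsilon>\<^sup>2) *\<^sub>R mat_B \<omega>c) *v z s \<omega>)) *\<^sub>R
               (mat_exp ((- s / \<epsilon>\<^sup>2) *\<^sub>R mat_B \<omega>c) *v Psi_tilde r L \<omega>c))) $ i))"

definition p_eps :: "real \<Rightarrow> real \<Rightarrow> real \<Rightarrow> real \<Rightarrow> real \<Rightarrow> real \<Rightarrow> real" where
  "p_eps C r T a \<delta> \<epsilon> =
     1 - C * \<epsilon> powr (- a) * sqrt (r * \<epsilon> powr \<delta> * ln (T / (r * \<epsilon> powr \<delta>)))"

end

theory Submission
 imports Defs "HOL-Real_Asymp.Real_Asymp"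
begin

text \<open>
 Since \<open>q\<close> is fixed while \<open>\<epsilon>\<close> tends to 0, it is enough that for small \<open>\<epsilon>\<close> the error exceeds
 \<open>6 \<epsilon> powr (a/4)\<close> with probability at most \<open>q\<close>; any constant, for instance 1, then serves in \<open>p_eps\<close>.
 The argument is pathwise, in the time scale \<open>t / \<epsilon>\<^sup>2\<close> of the delay, on the event that the noise terms are
 Hoelder continuous of exponent \<open>1/8\<close> with a constant \<open>N\<close>; fourth moments and chaining bound the
 probability of its complement uniformly in \<open>\<epsilon>\<close>.
 Variation of constants expresses the solution through the fundamental solution, which by Laplace inversion
 and a shift of the contour across the spectral gap is a rotation in the critical plane plus an exponentially
 decaying remainder. The remainder contributes \<open>O(\<epsilon>\<^sup>2)\<close> from the drift and \<open>O(\<epsilon> powr (1/4))\<close> from the noise.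
 The reduced process stays in a ball not depending on \<open>\<epsilon>\<close>, because averaged over one period its energy is
 driven inwards by the cubic term. A continuity argument combined with Gronwall's inequality now bounds the
 error by a multiple of \<open>\<epsilon> powr (1/4)\<close>, which is \<open>o(\<epsilon> powr (a/4))\<close> since \<open>a < 1\<close>.
\<close>

section \<open>Fourier inversion\<close>

text \<open>The exponents are matched with a margin. Fourth moments of Gaussian increments allow
  every Hoelder exponent below 1/4; the choice 1/8 turns a time step of length
  \<open>\<epsilon>\<^sup>2\<close> into an increment of size \<open>\<epsilon> powr (1/4)\<close>,
  the limiting case a = 1 of the admissible errors. On the side of the delay equation, integration
  by parts moves the differential of W onto the fundamental solution, whose derivative is the
  resolvent kernel, so that everything there is an integral along a path. The fundamental solution
  starts from the indicator of {0}; this is why \<open>Psi_tilde\<close> is the vector of its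
  critical part. The Wiener integral of the reduced equation is determined only almost surely at
  each single time and has to be identified with an integral along paths for all times at once. The
  main obstacle is the cubic drift: it is Lipschitz only on bounded sets, and neither solution is
  bounded beforehand. The energy of the reduced process is computed after removal of its noise,
  where the path is differentiable; the delay solution is then confined by comparison with the
  reduced one.\<close>

lemma (in pair_sigma_finite) integrable_dominated_product:
 fixes f :: "'a \<Rightarrow> 'b \<Rightarrow> 'c::{banach,second_countable_topology}" and u :: "'a \<Rightarrow> real" and v :: "'b \<Rightarrow> real"
 assumes meas: "case_prod f \<in> borel_measurable (M1 \<Otimes>\<^sub>M M2)"
  and u: "integrable M1 u" and v: "integrable M2 v"
  and bd: "\<And>x y. norm (f x y) \<le> u x * v y"
 shows "integrable (M1 \<Otimes>\<^sub>M M2) (case_prod f)"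
proof (rule Bochner_Integration.integrable_bound[where f = "\<lambda>(x,y). u x * v y"])
 show "integrable (M1 \<Otimes>\<^sub>M M2) (\<lambda>(x, y). u x * v y)"
 proof (rule Fubini_integrable)
  show "(\<lambda>(x, y). u x * v y) \<in> borel_measurable (M1 \<Otimes>\<^sub>M M2)"
   using u v by measurable
  have "(\<lambda>x. LINT y|M2. norm (case (x, y) of (x, y) \<Rightarrow> u x * v y)) = (\<lambda>x. \<bar>u x\<bar> * (LINT y|M2. \<bar>v y\<bar>))"
   by (simp add: abs_mult)
  then show "integrable M1 (\<lambda>x. LINT y|M2. norm (case (x, y) of (x, y) \<Rightarrow> u x * v y))"
   using u by simp
  show "AE x in M1. integrable M2 (\<lambda>y. case (x, y) of (x, y) \<Rightarrow> u x * v y)"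
   using v by simp
 qed
 show "AE z in M1 \<Otimes>\<^sub>M M2. norm (case_prod f z) \<le> norm (case z of (x, y) \<Rightarrow> u x * v y)"
 proof (intro always_eventually allI)
  fix z :: "'a \<times> 'b"
  obtain x y where z: "z = (x, y)" by (cases z)
  show "norm (case_prod f z) \<le> norm (case z of (x, y) \<Rightarrow> u x * v y)"
   using bd[of x y] unfolding z by simp
 qed
qed (use meas in simp)

text \<open>Every later interchange of two integrals has a majorant of product form; this version
  reduces it to one integrability fact per variable.\<close>

lemma (in pair_sigma_finite) Fubini_dominated:
 fixes f :: "'a \<Rightarrow> 'b \<Rightarrow> 'c::{banach,second_countable_topology}" and u :: "'a \<Rightarrow> real" and v :: "'b \<Rightarrow> real"
 assumes "case_prod f \<in> borel_measurable (M1 \<Otimes>\<^sub>M M2)"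
  and "integrable M1 u" and "integrable M2 v"
  and "\<And>x y. norm (f x y) \<le> u x * v y"
 shows "(LINT y|M2. LINT x|M1. f x y) = (LINT x|M1. LINT y|M2. f x y)"
 using Fubini_integral[OF integrable_dominated_product[OF assms]] .

lemma integrable_exp_minus_square:
 "0 < h \<Longrightarrow> integrable lborel (\<lambda>s::real. exp (- (h * s)\<^sup>2 / 2))"
proof -
 assume d: "0 < h"
 have "integrable lborel (\<lambda>s. sqrt (2 * pi) * std_normal_density s)"
  by (intro integrable_mult_right integrable_normal_density) simp
 then have "integrable lborel (\<lambda>s::real. exp (- s\<^sup>2 / 2))"
  by (simp add: std_normal_density_def)
 from lborel_integrable_real_affine[OF this, of h 0] d show ?thesis
  by simp
qed

text \<open>The characteristic function of the standard normal law, read after a rescaling of the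
  variable by h.\<close>

lemma integral_Gaussian_iexp:
 assumes d: "0 < h"
 shows "(CLBINT s. of_real (exp (- (h * s)\<^sup>2 / 2)) * iexp (s * u)) =
  of_real (sqrt (2 * pi) / h * exp (- (u / h)\<^sup>2 / 2))"
proof -
 have "char std_normal_distribution (u / h) = of_real (exp (- (u / h)\<^sup>2 / 2))"
  by (simp add: char_std_normal_distribution)
 moreover have "char std_normal_distribution (u / h) =
   (CLBINT s. of_real (std_normal_density s) * iexp (u / h * s))"
  by (simp add: char_def integral_density scaleR_conv_of_real)
 moreover have "\<dots> = \<bar>h\<bar> *\<^sub>R (CLBINT s. of_real (std_normal_density (0 + h * s)) * iexp (u / h * (0 + h * s)))"
  by (rule lborel_integral_real_affine) (use d in simp)
 moreover have "\<dots> = h *\<^sub>R (CLBINT s. of_real (1 / sqrt (2 * pi)) * (of_real (exp (- (h * s)\<^sup>2 / 2)) * iexp (s * u)))"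
  using d by (simp add: std_normal_density_def mult_ac)
 moreover have "\<dots> = of_real (h / sqrt (2 * pi)) * (CLBINT s. of_real (exp (- (h * s)\<^sup>2 / 2)) * iexp (s * u))"
  by (subst integral_mult_right_zero) (simp add: scaleR_conv_of_real)
 ultimately have "of_real (h / sqrt (2 * pi)) * (CLBINT s. of_real (exp (- (h * s)\<^sup>2 / 2)) * iexp (s * u))
   = of_real (exp (- (u / h)\<^sup>2 / 2))" by simp
 then show ?thesis
  using d by (simp add: field_simps)
qed

text \<open>Gaussian damping of parameter d n makes the double integral absolutely convergent. After
  Fubini, the damped inverse transform is an average of f over a normal law that concentrates at x.
  As d n tends to 0, the transform side converges because F is integrable, and the average because f
  is bounded and continuous at x.\<close>

lemma Fourier_inversion:
 fixes f :: "real \<Rightarrow> complex"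
 defines "F \<equiv> \<lambda>t. CLBINT y. f y * iexp (- (t * y))"
 assumes f: "integrable lborel f" and B: "\<And>y. norm (f y) \<le> B" and cont: "isCont f x"
  and F: "integrable lborel F"
 shows "(CLBINT t. F t * iexp (t * x)) = of_real (2 * pi) * f x"
proof -
 define d where "d n = inverse (real (Suc n))" for n
 have d0: "d n > 0" for n by (simp add: d_def)
 have dlim: "d \<longlonglongrightarrow> 0" unfolding d_def by (rule LIMSEQ_inverse_real_of_nat)
 have fm[measurable]: "f \<in> borel_measurable borel" using f by (simp add: borel_measurable_integrable)
 have Fm[measurable]: "F \<in> borel_measurable borel" using F by (simp add: borel_measurable_integrable)
 have eq: "(CLBINT t. F t * iexp (t * x) * of_real (exp (- (d n * t)\<^sup>2 / 2))) =
   of_real (2 * pi) * (CLBINT s. f (x + d n * s) * of_real (std_normal_density s))" for n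
 proof -
  have "(CLBINT t. F t * iexp (t * x) * of_real (exp (- (d n * t)\<^sup>2 / 2))) =
   (CLBINT t. CLBINT y. f y * (of_real (exp (- (d n * t)\<^sup>2 / 2)) * iexp (t * (x - y))))"
  proof (intro Bochner_Integration.integral_cong refl)
   fix t
   have "F t * iexp (t * x) * of_real (exp (- (d n * t)\<^sup>2 / 2)) =
     (CLBINT y. f y * iexp (- (t * y)) * (iexp (t * x) * of_real (exp (- (d n * t)\<^sup>2 / 2))))"
    unfolding F_def by (subst integral_mult_left_zero) (simp add: mult_ac)
   also have "\<dots> = (CLBINT y. f y * (of_real (exp (- (d n * t)\<^sup>2 / 2)) * iexp (t * (x - y))))"
    by (intro Bochner_Integration.integral_cong refl) (simp add: mult_ac algebra_simps flip: exp_add)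
   finally show "F t * iexp (t * x) * of_real (exp (- (d n * t)\<^sup>2 / 2)) = \<dots>" .
  qed
  also have "\<dots> = (CLBINT y. CLBINT t. f y * (of_real (exp (- (d n * t)\<^sup>2 / 2)) * iexp (t * (x - y))))"
  proof (rule lborel_pair.Fubini_dominated)
   show "integrable lborel (\<lambda>y. norm (f y))" using f by simp
   show "integrable lborel (\<lambda>t::real. exp (- (d n * t)\<^sup>2 / 2))"
    by (rule integrable_exp_minus_square[OF d0])
  qed (auto simp: norm_mult)
  also have "\<dots> = (CLBINT y. f y * of_real (sqrt (2 * pi) / d n * exp (- ((x - y) / d n)\<^sup>2 / 2)))"
   by (subst integral_mult_right_zero) (simp only: integral_Gaussian_iexp[OF d0])
  \<comment> \<open>The substitution y = x + d n * s turns the Gaussian kernel into the standard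
    normal density.\<close>
  also have "\<dots> = \<bar>d n\<bar> *\<^sub>R (CLBINT s. f (x + d n * s) * of_real (sqrt (2 * pi) / d n * exp (- ((x - (x + d n * s)) / d n)\<^sup>2 / 2)))"
   by (rule lborel_integral_real_affine) (use d0[of n] in simp)
  also have "\<dots> = d n *\<^sub>R (CLBINT s. of_real (2 * pi / d n) * (f (x + d n * s) * of_real (std_normal_density s)))"
  proof -
   have *: "f (x + d n * s) * of_real (sqrt (2 * pi) / d n * exp (- ((x - (x + d n * s)) / d n)\<^sup>2 / 2))
    = of_real (2 * pi / d n) * (f (x + d n * s) * of_real (std_normal_density s))" for s
   proof -
    have "sqrt (2 * pi) / d n * exp (- ((x - (x + d n * s)) / d n)\<^sup>2 / 2) = 2 * pi / d n * std_normal_density s"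
     using d0[of n] by (simp add: std_normal_density_def field_simps)
    then show ?thesis by (simp only: of_real_mult mult_ac)
   qed
   show ?thesis unfolding * using d0[of n] by simp
  qed
  also have "\<dots> = of_real (2 * pi) * (CLBINT s. f (x + d n * s) * of_real (std_normal_density s))"
   using d0[of n] by (subst integral_mult_right_zero) (simp add: scaleR_conv_of_real)
  finally show ?thesis .
 qed
 have "(\<lambda>n. CLBINT t. F t * iexp (t * x) * of_real (exp (- (d n * t)\<^sup>2 / 2))) \<longlonglongrightarrow>
    (CLBINT t. F t * iexp (t * x) * of_real (exp (- (0 * t)\<^sup>2 / 2)))"
 proof (rule integral_dominated_convergence[where w = "\<lambda>t. norm (F t)"])
  show "AE t in lborel. (\<lambda>n. F t * iexp (t * x) * of_real (exp (- (d n * t)\<^sup>2 / 2)))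
    \<longlonglongrightarrow> F t * iexp (t * x) * of_real (exp (- (0 * t)\<^sup>2 / 2))"
   by (intro always_eventually allI tendsto_intros dlim) auto
 qed (use F in \<open>auto simp: norm_mult mult_left_le\<close>)
 moreover have "(\<lambda>n. of_real (2 * pi) * (CLBINT s. f (x + d n * s) * of_real (std_normal_density s))) \<longlonglongrightarrow>
   of_real (2 * pi) * (CLBINT s. f x * of_real (std_normal_density s))"
 proof (intro tendsto_intros integral_dominated_convergence[where w = "\<lambda>s. B * std_normal_density s"])
  have "(\<lambda>n. f (x + d n * s)) \<longlonglongrightarrow> f x" for s
  proof (rule isCont_tendsto_compose[OF cont])
   have "(\<lambda>n. x + d n * s) \<longlonglongrightarrow> x + 0 * s" by (intro tendsto_intros dlim)
   then show "(\<lambda>n. x + d n * s) \<longlonglongrightarrow> x" by simp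
  qed
  then show "AE s in lborel. (\<lambda>n. f (x + d n * s) * of_real (std_normal_density s)) \<longlonglongrightarrow> f x * of_real (std_normal_density s)"
   by (intro always_eventually allI tendsto_intros)
  show "integrable lborel (\<lambda>s. B * std_normal_density s)"
   by (intro integrable_mult_right integrable_normal_density) simp
  show "AE s in lborel. norm (f (x + d n * s) * of_real (std_normal_density s)) \<le> B * std_normal_density s" for n
   by (intro always_eventually allI) (simp add: norm_mult mult_right_mono B)
 qed auto
 moreover have "(CLBINT s. f x * of_real (std_normal_density s)) = f x"
  by (subst integral_mult_right_zero) (simp add: integral_normal_density)
 ultimately show ?thesis
  unfolding eq by (simp add: LIMSEQ_unique)
qed

section \<open>The Riesz representation of bounded functionals on an interval\<close>

text \<open>Unit tents centred at 0, ..., N. The value to the right of N is recorded as well,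
  because the induction step needs the descending flank of the last tent.\<close>

lemma sum_hat_functions:
 fixes y :: real
 assumes "0 \<le> y"
 shows "(\<Sum>i\<le>N. max 0 (1 - \<bar>y - real i\<bar>)) = (if y \<le> real N then 1 else max 0 (real N + 1 - y))"
proof (induction N)
 case (Suc N)
 have "(\<Sum>i\<le>Suc N. max 0 (1 - \<bar>y - real i\<bar>)) =
   (if y \<le> real N then 1 else max 0 (real N + 1 - y)) + max 0 (1 - \<bar>y - real (Suc N)\<bar>)"
  using Suc by simp
 then show ?case by (auto simp: max_def)
qed (use assms in auto)

text \<open>Realises a discretised positive functional as a probability law, so that tightness and
  weak convergence of distributions on the line become available. The law is the image of a law on
  the indices, so the points t i may coincide.\<close>

lemma discrete_distribution:
 fixes w :: "nat \<Rightarrow> real" and t :: "nat \<Rightarrow> real"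
 assumes A: "finite A" and w: "\<And>i. i \<in> A \<Longrightarrow> 0 \<le> w i" and s: "sum w A = 1"
 shows "\<exists>M. real_distribution M \<and> measure M (t ` A) = 1 \<and>
  (\<forall>f::real \<Rightarrow> real. f \<in> borel_measurable borel \<longrightarrow> integral\<^sup>L M f = (\<Sum>i\<in>A. w i * f (t i)))"
proof -
 define v where "v i = (if i \<in> A then w i else 0)" for i
 have v0: "0 \<le> v i" for i using w by (simp add: v_def)
 have "(\<integral>\<^sup>+ i. ennreal (v i) \<partial>count_space UNIV) = (\<Sum>i\<in>A. ennreal (v i))"
  by (rule nn_integral_count_space'[OF A]) (auto simp: v_def)
 also have "\<dots> = ennreal (sum v A)" using v0 by (simp add: sum_ennreal)
 also have "sum v A = 1" using s by (simp add: v_def)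
 finally have v1: "(\<integral>\<^sup>+ i. ennreal (v i) \<partial>count_space UNIV) = 1" by simp
 define p where "p = embed_pmf v"
 have p: "pmf p i = v i" for i unfolding p_def by (rule pmf_embed_pmf[OF v0 v1])
 have setp: "set_pmf p \<subseteq> A" by (auto simp: set_pmf_eq p v_def)
 define M where "M = distr (measure_pmf p) borel t"
 have M: "real_distribution M" unfolding M_def
  by (rule prob_space.real_distribution_distr) (auto simp: measure_pmf.prob_space_axioms)
 have tA: "t ` A \<in> sets borel" by (intro borel_closed finite_imp_closed finite_imageI A)
 have MI: "integral\<^sup>L M f = (\<Sum>i\<in>A. w i * f (t i))" if "f \<in> borel_measurable borel" for f :: "real \<Rightarrow> real"
 proof -
  have "integral\<^sup>L M f = (\<integral>i. f (t i) \<partial>measure_pmf p)"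
   unfolding M_def by (rule integral_distr) (use that in auto)
  also have "\<dots> = (\<Sum>i\<in>A. f (t i) * pmf p i)"
   by (rule integral_measure_pmf_real[OF A]) (use setp in auto)
  also have "\<dots> = (\<Sum>i\<in>A. w i * f (t i))" by (rule sum.cong) (auto simp: p v_def)
  finally show ?thesis .
 qed
 have M1: "measure M (t ` A) = 1"
 proof -
  have "measure M (t ` A) = measure (measure_pmf p) (t -` (t ` A))"
   unfolding M_def by (subst measure_distr) (use tA in auto)
  also have "\<dots> = 1"
   by (rule measure_pmf.prob_eq_1[THEN iffD2]) (use setp in \<open>auto simp: AE_measure_pmf_iff\<close>)
  finally show ?thesis .
 qed
 show ?thesis using M MI M1 by blast
qed

lemma hat_partition_of_unity:
 assumes r: "0 < r" and N: "0 < N" and th: "v \<in> {-r..0}"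
 shows "(\<Sum>i\<le>N. max 0 (1 - \<bar>v - (real i * r / real N - r)\<bar> * real N / r)) = 1"
proof -
 have *: "\<bar>v - (real i * r / real N - r)\<bar> * real N / r = \<bar>(v + r) * real N / r - real i\<bar>" for i
 proof -
  have "(v + r) * real N / r - real i = (v - (real i * r / real N - r)) * (real N / r)"
   using r N by (simp add: field_simps)
  also have "\<bar>\<dots>\<bar> = \<bar>v - (real i * r / real N - r)\<bar> * real N / r"
   using r N by (simp add: abs_mult)
  finally show ?thesis by simp
 qed
 have "(v + r) * real N \<le> r * real N" using th by (intro mult_right_mono) auto
 then have "(v + r) * real N / r \<le> real N" using r by (simp add: field_simps)
 moreover have "0 \<le> (v + r) * real N / r" using th r by auto
 ultimately show ?thesis unfolding * using sum_hat_functions[of "(v + r) * real N / r" N] by simp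
qed

lemma tight_if_concentrated_on_interval:
 assumes M: "\<And>n. real_distribution (M n)" and S: "\<And>n::nat. measure (M n) (S n) = 1"
  and sub: "\<And>n. S n \<subseteq> {a..b}" and meas: "\<And>n. S n \<in> sets borel" and ab: "a \<le> b"
 shows "tight M"
 unfolding tight_def
proof (intro conjI allI impI)
 fix e :: real assume e: "0 < e"
 show "\<exists>c d. c < d \<and> (\<forall>n. 1 - e < measure (M n) {c<..d})"
 proof (rule exI[of _ "a - 1"], rule exI[of _ b], intro conjI allI)
  fix n
  interpret real_distribution "M n" by (rule M)
  have "measure (M n) (S n) \<le> measure (M n) {a - 1<..b}"
   by (rule finite_measure_mono) (use sub[of n] in \<open>auto simp: subset_iff intro: less_le_trans\<close>)
  then show "1 - e < measure (M n) {a - 1<..b}" using S[of n] e by simp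
 qed (use ab in simp)
qed (rule M)

text \<open>The test function \<open>min 1 (infdist x C)\<close> is bounded, continuous and zero
  exactly on the closed set C; its integrals vanish along the sequence, hence also in the
  limit.\<close>

lemma weak_limit_concentrated:
 assumes M: "\<And>n. real_distribution (M n)" and S: "\<And>n::nat. measure (M n) (S n) = 1"
  and sub: "\<And>n. S n \<subseteq> C" and meas: "\<And>n. S n \<in> sets borel" and C: "closed C" "C \<noteq> {}"
  and M': "real_distribution M'" and lim: "weak_conv_m M M'"
 shows "AE x in M'. x \<in> C"
proof -
 interpret M': real_distribution M' by (rule M')
 define \<psi> where "\<psi> x = min 1 (infdist x C)" for x :: real
 have cont: "isCont \<psi> x" for x unfolding \<psi>_def by (intro continuous_intros)
 have bd: "norm (\<psi> x) \<le> 1" for x unfolding \<psi>_def by (simp add: infdist_nonneg)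
 have [measurable]: "\<psi> \<in> borel_measurable borel"
  using cont by (intro borel_measurable_continuous_onI continuous_at_imp_continuous_on) auto
 have "(\<lambda>n. integral\<^sup>L (M n) \<psi>) \<longlonglongrightarrow> integral\<^sup>L M' \<psi>"
  by (rule weak_conv_imp_integral_bdd_continuous_conv[OF M M' lim cont bd])
 moreover have "integral\<^sup>L (M n) \<psi> = 0" for n
 proof -
  interpret real_distribution "M n" by (rule M)
  have "AE x in M n. x \<in> S n" using S[of n] prob_eq_1[of "S n"] meas[of n] by simp
  then have "AE x in M n. \<psi> x = 0"
   by eventually_elim (use sub[of n] in \<open>auto simp: \<psi>_def\<close>)
  then show ?thesis using integral_eq_zero_AE by blast
 qed
 ultimately have "integral\<^sup>L M' \<psi> = 0" by (simp add: LIMSEQ_const_iff)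
 moreover have "integrable M' \<psi>"
  by (rule M'.integrable_const_bound[where B=1]) (use bd in auto)
 moreover have "0 \<le> \<psi> x" for x by (simp add: \<psi>_def infdist_nonneg)
 ultimately have "AE x in M'. \<psi> x = 0"
  by (subst (asm) integral_nonneg_eq_0_iff_AE) auto
 then show ?thesis
 proof eventually_elim
  case (elim x)
  then have "infdist x C = 0" by (auto simp: \<psi>_def min_def split: if_splits)
  then show "x \<in> C" using C by (simp add: in_closed_iff_infdist_zero)
 qed
qed

section \<open>Bounded functionals and their representation by two finite measures\<close>

lemma bounded_linear_on_C_add:
 "bounded_linear_on_C r L \<Longrightarrow> continuous_on {-r..0} f \<Longrightarrow> continuous_on {-r..0} \<psi> \<Longrightarrow>
  L (\<lambda>v. f v + \<psi> v) = L f + L \<psi>"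
 unfolding bounded_linear_on_C_def by blast

lemma bounded_linear_on_C_scale:
 "bounded_linear_on_C r L \<Longrightarrow> continuous_on {-r..0} f \<Longrightarrow> L (\<lambda>v. c * f v) = c * L f"
 unfolding bounded_linear_on_C_def by blast

lemma bounded_linear_on_C_sum:
 assumes L: "bounded_linear_on_C r L" and fin: "finite A"
  and cont: "\<And>i. i \<in> A \<Longrightarrow> continuous_on {-r..0} (h i)"
 shows "L (\<lambda>v. \<Sum>i\<in>A. c i * h i v) = (\<Sum>i\<in>A. c i * L (h i))"
 using fin cont
proof (induction A rule: finite_induct)
 case empty
 have "L (\<lambda>v. 0 * 0) = 0 * L (\<lambda>v. 0)"
  by (rule bounded_linear_on_C_scale[OF L continuous_on_const])
 then show ?case by simp
next
 case (insert x F)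
 have "L (\<lambda>v. c x * h x v + (\<Sum>i\<in>F. c i * h i v)) = L (\<lambda>v. c x * h x v) + L (\<lambda>v. \<Sum>i\<in>F. c i * h i v)"
  using insert.prems by (intro bounded_linear_on_C_add[OF L] continuous_intros) auto
 also have "L (\<lambda>v. c x * h x v) = c x * L (h x)"
  using insert.prems by (intro bounded_linear_on_C_scale[OF L]) auto
 finally show ?case using insert by simp
qed

lemma sup_on_le:
 assumes "\<And>v. v \<in> {-r..0} \<Longrightarrow> \<bar>f v\<bar> \<le> B" "0 < r"
 shows "sup_on r f \<le> B"
 unfolding sup_on_def by (rule cSUP_least) (use assms in auto)

text \<open>Replaces \<open>sup_on\<close> by an arbitrary pointwise bound, and makes K at least 1
  so that weights may be divided by it.\<close>

lemma bounded_linear_on_C_bound: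
 assumes "bounded_linear_on_C r L" "0 < r"
 obtains K where "1 \<le> K"
  and "\<And>f B. continuous_on {-r..0} f \<Longrightarrow> (\<And>v. v \<in> {-r..0} \<Longrightarrow> \<bar>f v\<bar> \<le> B) \<Longrightarrow> \<bar>L f\<bar> \<le> K * B"
proof -
 obtain K where K: "\<And>f. continuous_on {-r..0} f \<Longrightarrow> \<bar>L f\<bar> \<le> K * sup_on r f"
  using assms(1) unfolding bounded_linear_on_C_def by blast
 show thesis
 proof (rule that[of "max K 1"])
  fix f :: "real \<Rightarrow> real" and B assume c: "continuous_on {-r..0} f" and B: "\<And>v. v \<in> {-r..0} \<Longrightarrow> \<bar>f v\<bar> \<le> B"
  have bdd: "bdd_above ((\<lambda>v. \<bar>f v\<bar>) ` {-r..0})" using B by (intro bdd_aboveI2[where M = B])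
  have "\<bar>f 0\<bar> \<le> sup_on r f"
   unfolding sup_on_def by (rule cSUP_upper[OF _ bdd]) (use assms in auto)
  then have "0 \<le> sup_on r f" by linarith
  have "K * sup_on r f \<le> max K 1 * sup_on r f"
   using \<open>0 \<le> sup_on r f\<close> by (intro mult_right_mono) auto
  also have "\<dots> \<le> max K 1 * B"
   by (intro mult_left_mono sup_on_le B) (use assms in auto)
  finally show "\<bar>L f\<bar> \<le> max K 1 * B" using K[OF c] by linarith
 qed simp
qed

text \<open>The functional is sampled on a partition of unity by tents with nodes at distance r / (n
  + 1). The positive and negative parts of the samples, divided by K, are subprobability weights on
  the nodes. After completion to probability laws, tightness gives weak limits along a common
  subsequence, and K times these limits represent L. The theorem also ensures that the
  \<open>SOME\<close> in \<open>L_ext\<close> selects a representing pair.\<close>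

theorem riesz_pair_exists:
 assumes r: "0 < r" and L: "bounded_linear_on_C r L"
 shows "\<exists>\<mu>. riesz_pair r L \<mu>"
proof -
 obtain K where K1: "1 \<le> K"
  and K: "\<And>p B. continuous_on {-r..0} p \<Longrightarrow> (\<And>v. v \<in> {-r..0} \<Longrightarrow> \<bar>p v\<bar> \<le> B) \<Longrightarrow> \<bar>L p\<bar> \<le> K * B"
  by (rule bounded_linear_on_C_bound[OF L r]) blast
 \<comment> \<open>The additional node 1 lies outside [-r,0]: it will carry the mass missing from a
   probability law.\<close>
 define t where "t n i = (if i \<le> Suc n then real i * r / real (Suc n) - r else 1)" for n i :: nat
 define h where "h n i v = max 0 (1 - \<bar>v - (real i * r / real (Suc n) - r)\<bar> * real (Suc n) / r)" for n i :: nat and v :: real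
 have h0: "0 \<le> h n i v" for n i v by (simp add: h_def)
 have hcont: "continuous_on {-r..0} (h n i)" for n i
  unfolding h_def using r by (intro continuous_intros) auto
 have hsum: "(\<Sum>i\<le>Suc n. h n i v) = 1" if "v \<in> {-r..0}" for n v
  unfolding h_def by (rule hat_partition_of_unity[OF r _ that]) simp
 have t_in: "t n i \<in> {-r..0}" if "i \<le> Suc n" for n i
  using that r mult_right_mono[of "real i" "real (Suc n)" r]
  by (auto simp: t_def field_simps simp del: of_nat_Suc)
 define c where "c n i = L (h n i)" for n i
 have csum: "(\<Sum>i\<le>Suc n. \<bar>c n i\<bar>) \<le> K" for n
 proof -
  \<comment> \<open>L is applied to the sum of the tents with signs \<open>sgn (c n i)\<close>, a
    function bounded by 1.\<close>
  have "(\<Sum>i\<le>Suc n. \<bar>c n i\<bar>) = (\<Sum>i\<le>Suc n. sgn (c n i) * L (h n i))"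
   by (simp add: c_def abs_sgn mult.commute)
  also have "\<dots> = L (\<lambda>v. \<Sum>i\<le>Suc n. sgn (c n i) * h n i v)"
   using bounded_linear_on_C_sum[OF L, of "{..Suc n}" "h n" "\<lambda>i. sgn (c n i)"] hcont by simp
  also have "\<dots> \<le> K * 1"
  proof (rule order_trans[OF abs_ge_self K])
   show "continuous_on {- r..0} (\<lambda>v. \<Sum>i\<le>Suc n. sgn (c n i) * h n i v)"
    by (intro continuous_intros hcont)
   fix v assume th: "v \<in> {-r..0}"
   have "\<bar>\<Sum>i\<le>Suc n. sgn (c n i) * h n i v\<bar> \<le> (\<Sum>i\<le>Suc n. \<bar>sgn (c n i) * h n i v\<bar>)" by (rule sum_abs)
   also have "\<dots> \<le> (\<Sum>i\<le>Suc n. h n i v)"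
    by (intro sum_mono) (auto simp: abs_mult sgn_if h0)
   finally show "\<bar>\<Sum>i\<le>Suc n. sgn (c n i) * h n i v\<bar> \<le> 1" using hsum[OF th] by simp
  qed
  finally show ?thesis by simp
 qed
 define wp where "wp n i = (if i \<le> Suc n then max 0 (c n i) / K else 1 - (\<Sum>j\<le>Suc n. max 0 (c n j) / K))" for n i
 define wn where "wn n i = (if i \<le> Suc n then max 0 (- c n i) / K else 1 - (\<Sum>j\<le>Suc n. max 0 (- c n j) / K))" for n i
 define A where "A n = {..Suc (Suc n)}" for n :: nat
 have aux: "(\<Sum>j\<le>Suc n. max 0 (d j) / K) \<le> 1" if "(\<Sum>i\<le>Suc n. \<bar>d i\<bar>) \<le> K" for d :: "nat \<Rightarrow> real" and n
 proof -
  have "(\<Sum>j\<le>Suc n. max 0 (d j)) \<le> (\<Sum>i\<le>Suc n. \<bar>d i\<bar>)" by (intro sum_mono) auto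
  then have "(\<Sum>j\<le>Suc n. max 0 (d j)) \<le> K" using that by linarith
  then have "(\<Sum>j\<le>Suc n. max 0 (d j)) / K \<le> 1" using K1 by (simp add: divide_le_eq)
  then show ?thesis by (simp only: sum_divide_distrib)
 qed
 have wp0: "0 \<le> wp n i" for n i
  using aux[OF csum[of n]] K1 by (auto simp: wp_def)
 have wn0: "0 \<le> wn n i" for n i
  using aux[of "\<lambda>i. - c n i" n] csum[of n] K1 by (auto simp: wn_def)
 have wp1: "sum (wp n) (A n) = 1" for n
 proof -
  have "sum (wp n) (A n) = (\<Sum>j\<le>Suc n. max 0 (c n j) / K) + (1 - (\<Sum>j\<le>Suc n. max 0 (c n j) / K))"
   unfolding A_def sum.atMost_Suc[of _ "Suc n"] by (simp add: wp_def)
  then show ?thesis by simp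
 qed
 have wn1: "sum (wn n) (A n) = 1" for n
 proof -
  have "sum (wn n) (A n) = (\<Sum>j\<le>Suc n. max 0 (- c n j) / K) + (1 - (\<Sum>j\<le>Suc n. max 0 (- c n j) / K))"
   unfolding A_def sum.atMost_Suc[of _ "Suc n"] by (simp add: wn_def)
  then show ?thesis by simp
 qed
 have "\<exists>M. real_distribution M \<and> measure M (t n ` A n) = 1 \<and>
   (\<forall>f::real \<Rightarrow> real. f \<in> borel_measurable borel \<longrightarrow> integral\<^sup>L M f = (\<Sum>i\<in>A n. wp n i * f (t n i)))" for n
  by (rule discrete_distribution) (use wp0 wp1 A_def in auto)
 then obtain Mp where Mp: "\<And>n. real_distribution (Mp n)" and Mp1: "\<And>n. measure (Mp n) (t n ` A n) = 1"
  and Mpi: "\<And>n f::real \<Rightarrow> real. f \<in> borel_measurable borel \<Longrightarrow> integral\<^sup>L (Mp n) f = (\<Sum>i\<in>A n. wp n i * f (t n i))"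
  by metis
 have "\<exists>M. real_distribution M \<and> measure M (t n ` A n) = 1 \<and>
   (\<forall>f::real \<Rightarrow> real. f \<in> borel_measurable borel \<longrightarrow> integral\<^sup>L M f = (\<Sum>i\<in>A n. wn n i * f (t n i)))" for n
  by (rule discrete_distribution) (use wn0 wn1 A_def in auto)
 then obtain Mn where Mn: "\<And>n. real_distribution (Mn n)" and Mn1: "\<And>n. measure (Mn n) (t n ` A n) = 1"
  and Mni: "\<And>n f::real \<Rightarrow> real. f \<in> borel_measurable borel \<Longrightarrow> integral\<^sup>L (Mn n) f = (\<Sum>i\<in>A n. wn n i * f (t n i))"
  by metis
 define C where "C = insert 1 {-r..0}"
 have tA: "t n ` A n \<subseteq> C" for n
 proof -
  have "t n i \<in> C" if "i \<in> A n" for i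
   using t_in[of i n] that unfolding C_def by (cases "i \<le> Suc n") (auto simp: t_def)
  then show ?thesis by auto
 qed
 have tA': "t n ` A n \<subseteq> {-r..1}" for n using tA[of n] r unfolding C_def by auto
 have tAm: "t n ` A n \<in> sets borel" for n unfolding A_def by (intro borel_closed finite_imp_closed) simp
 have "tight Mp" "tight Mn"
  by (rule tight_if_concentrated_on_interval[where S = "\<lambda>n. t n ` A n" and a = "-r" and b = 1],
    use Mp Mp1 Mn Mn1 tA' tAm r in auto)+
 from tight_imp_convergent_subsubsequence[OF \<open>tight Mp\<close> strict_mono_id]
 obtain s1 P where s1: "strict_mono s1" and P: "real_distribution P" and wP: "weak_conv_m (Mp \<circ> s1) P"
  by auto
 from tight_imp_convergent_subsubsequence[OF \<open>tight Mn\<close> s1]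
 obtain s2 Q where s2: "strict_mono s2" and Q: "real_distribution Q" and wQ: "weak_conv_m (Mn \<circ> s1 \<circ> s2) Q"
  by auto
 define s where "s = s1 \<circ> s2"
 have s: "strict_mono s" unfolding s_def using s1 s2 by (simp add: strict_mono_o)
 have wP': "weak_conv_m (Mp \<circ> s) P"
  using wP s2 unfolding weak_conv_m_def weak_conv_def s_def
  using LIMSEQ_subseq_LIMSEQ[OF _ s2] by (fastforce simp: o_def)
 have wQ': "weak_conv_m (Mn \<circ> s) Q" using wQ by (simp add: s_def o_assoc)
 have C: "closed C" "C \<noteq> {}" unfolding C_def by auto
 have PC: "AE x in P. x \<in> C"
  by (rule weak_limit_concentrated[OF _ _ _ _ C P wP', where S = "\<lambda>n. t (s n) ` A (s n)"])
   (use Mp Mp1 tA tAm in auto)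
 have QC: "AE x in Q. x \<in> C"
  by (rule weak_limit_concentrated[OF _ _ _ _ C Q wQ', where S = "\<lambda>n. t (s n) ` A (s n)"])
   (use Mn Mn1 tA tAm in auto)
 interpret P: real_distribution P by (rule P)
 interpret Q: real_distribution Q by (rule Q)
 define \<mu>p where "\<mu>p = density P (\<lambda>_. ennreal K)"
 define \<mu>n where "\<mu>n = density Q (\<lambda>_. ennreal K)"
 have "finite_measure \<mu>p" unfolding \<mu>p_def
  by (rule finite_measureI) (simp add: emeasure_density nn_integral_cmult_indicator ennreal_mult_eq_top_iff)
 moreover have "finite_measure \<mu>n" unfolding \<mu>n_def
  by (rule finite_measureI) (simp add: emeasure_density nn_integral_cmult_indicator ennreal_mult_eq_top_iff)
 moreover have "sets \<mu>p = sets borel" "sets \<mu>n = sets borel" by (simp_all add: \<mu>p_def \<mu>n_def)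
 moreover have "L p = (LINT v:{-r..0}|\<mu>p. p v) - (LINT v:{-r..0}|\<mu>n. p v)"
  if cont: "continuous_on {-r..0} p" for p
 proof -
  \<comment> \<open>A continuous extension of p to the line that vanishes at 1, so that the mass at
    the additional node does not contribute.\<close>
  define g where "g x = p (max (-r) (min 0 x)) * max 0 (1 - max 0 x)" for x
  have g_in: "g x = p x" if "x \<in> {-r..0}" for x
  proof -
   have "max (-r) (min 0 x) = x" "max 0 x = 0" using that by auto
   then show ?thesis by (simp add: g_def)
  qed
  have g1: "g 1 = 0" by (simp add: g_def)
  have gcont: "continuous_on UNIV g" unfolding g_def
   by (intro continuous_intros continuous_on_compose2[OF cont]) (use r in auto)
  have "\<exists>B. \<forall>v\<in>{-r..0}. \<bar>p v\<bar> \<le> B"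
   using compact_imp_bounded[OF compact_continuous_image[OF cont compact_Icc]]
   unfolding bounded_iff by simp
  then obtain B where B: "\<And>v. v \<in> {-r..0} \<Longrightarrow> \<bar>p v\<bar> \<le> B" by blast
  have gB: "norm (g x) \<le> B" for x
  proof -
   have "\<bar>p (max (-r) (min 0 x))\<bar> \<le> B" using r by (intro B) auto
   moreover have "\<bar>max 0 (1 - max 0 x)\<bar> \<le> 1" by auto
   ultimately have "\<bar>p (max (-r) (min 0 x))\<bar> * \<bar>max 0 (1 - max 0 x)\<bar> \<le> B * 1"
    by (rule mult_mono) (use B[of 0] r in auto)
   then show ?thesis unfolding g_def real_norm_def abs_mult mult_1_right .
  qed
  have gm[measurable]: "g \<in> borel_measurable borel" by (rule borel_measurable_continuous_onI[OF gcont])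
  have gisC: "isCont g x" for x using gcont by (simp add: continuous_on_eq_continuous_at)
  have limP: "(\<lambda>n. integral\<^sup>L ((Mp \<circ> s) n) g) \<longlonglongrightarrow> integral\<^sup>L P g"
   by (rule weak_conv_imp_integral_bdd_continuous_conv[OF _ P wP' gisC gB]) (simp add: Mp)
  have limQ: "(\<lambda>n. integral\<^sup>L ((Mn \<circ> s) n) g) \<longlonglongrightarrow> integral\<^sup>L Q g"
   by (rule weak_conv_imp_integral_bdd_continuous_conv[OF _ Q wQ' gisC gB]) (simp add: Mn)
  have split: "(\<Sum>i\<in>A n. w i * g (t n i)) = (\<Sum>i\<le>Suc n. w i * p (t n i))" for w n
  proof -
   have "t n (Suc (Suc n)) = 1" by (simp add: t_def)
   then have "(\<Sum>i\<in>A n. w i * g (t n i)) = (\<Sum>i\<le>Suc n. w i * g (t n i))"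
    unfolding A_def sum.atMost_Suc[of _ "Suc n"] by (simp add: g1)
   also have "\<dots> = (\<Sum>i\<le>Suc n. w i * p (t n i))"
    by (intro sum.cong refl) (use g_in t_in in auto)
   finally show ?thesis .
  qed
  have diff: "K * (integral\<^sup>L (Mp n) g - integral\<^sup>L (Mn n) g) = (\<Sum>i\<le>Suc n. p (t n i) * c n i)" for n
  proof -
   have "integral\<^sup>L (Mp n) g - integral\<^sup>L (Mn n) g = (\<Sum>i\<le>Suc n. (wp n i - wn n i) * p (t n i))"
    by (simp only: Mpi[OF gm] Mni[OF gm] split flip: sum_subtractf) (simp only: left_diff_distrib)
   also have "K * \<dots> = (\<Sum>i\<le>Suc n. p (t n i) * c n i)"
    unfolding sum_distrib_left
   proof (intro sum.cong refl)
    fix i assume "i \<in> {..Suc n}"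
    then have "wp n i - wn n i = c n i / K" using K1 by (simp add: wp_def wn_def max_def field_simps)
    then show "K * ((wp n i - wn n i) * p (t n i)) = p (t n i) * c n i" using K1 by simp
   qed
   finally show ?thesis .
  qed
  \<comment> \<open>The sum is L applied to the piecewise linear interpolant of p, which converges
    to p uniformly.\<close>
  have conv: "(\<lambda>n. \<Sum>i\<le>Suc n. p (t n i) * c n i) \<longlonglongrightarrow> L p"
  proof (rule LIMSEQ_I)
   fix e :: real assume e: "0 < e"
   have e2: "0 < e / (2 * K)" using e K1 by simp
   have "uniformly_continuous_on {-r..0} p" by (rule compact_uniformly_continuous[OF cont compact_Icc])
   then have "\<exists>d>0. \<forall>x\<in>{-r..0}. \<forall>y\<in>{-r..0}. dist y x < d \<longrightarrow> dist (p y) (p x) < e / (2 * K)"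
    using e2 unfolding uniformly_continuous_on_def by simp
   then obtain d where d: "d > 0" and du: "\<And>x y. x \<in> {-r..0} \<Longrightarrow> y \<in> {-r..0} \<Longrightarrow> \<bar>y - x\<bar> < d \<Longrightarrow> \<bar>p y - p x\<bar> < e / (2 * K)"
    unfolding dist_real_def by metis
   obtain N where N: "r / d < real N" using reals_Archimedean2 by blast
   show "\<exists>no. \<forall>n\<ge>no. norm ((\<Sum>i\<le>Suc n. p (t n i) * c n i) - L p) < e"
   proof (intro exI[of _ N] allI impI)
    fix n assume n: "N \<le> n"
    have small: "r / real (Suc n) < d"
    proof -
     have "r / d < real (Suc n)" using N n by simp
     then show ?thesis using d r by (simp add: field_simps)
    qed
    have "L (\<lambda>v. (\<Sum>i\<le>Suc n. p (t n i) * h n i v) + (-1) * p v) =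
      L (\<lambda>v. \<Sum>i\<le>Suc n. p (t n i) * h n i v) + L (\<lambda>v. (-1) * p v)"
     by (intro bounded_linear_on_C_add[OF L] continuous_intros cont hcont)
    also have "L (\<lambda>v. (-1) * p v) = (-1) * L p"
     by (rule bounded_linear_on_C_scale[OF L cont])
    also have "L (\<lambda>v. \<Sum>i\<le>Suc n. p (t n i) * h n i v) = (\<Sum>i\<le>Suc n. p (t n i) * c n i)"
     unfolding c_def by (rule bounded_linear_on_C_sum[OF L]) (use hcont in auto)
    finally have eq: "(\<Sum>i\<le>Suc n. p (t n i) * c n i) - L p = L (\<lambda>v. (\<Sum>i\<le>Suc n. p (t n i) * h n i v) + (-1) * p v)"
     by simp
    have "\<bar>L (\<lambda>v. (\<Sum>i\<le>Suc n. p (t n i) * h n i v) + (-1) * p v)\<bar> \<le> K * (e / (2 * K))"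
    proof (rule K)
     show "continuous_on {- r..0} (\<lambda>v. (\<Sum>i\<le>Suc n. p (t n i) * h n i v) + - 1 * p v)"
      by (intro continuous_intros hcont cont)
     fix v assume th: "v \<in> {-r..0}"
     have "(\<Sum>i\<le>Suc n. p (t n i) * h n i v) + - 1 * p v = (\<Sum>i\<le>Suc n. p (t n i) * h n i v) - p v * (\<Sum>i\<le>Suc n. h n i v)"
      using hsum[OF th, of n] by simp
     also have "\<dots> = (\<Sum>i\<le>Suc n. (p (t n i) - p v) * h n i v)"
      by (simp only: sum_distrib_left left_diff_distrib sum_subtractf)
     also have "\<bar>\<dots>\<bar> \<le> (\<Sum>i\<le>Suc n. \<bar>(p (t n i) - p v) * h n i v\<bar>)" by (rule sum_abs)
     also have "\<dots> \<le> (\<Sum>i\<le>Suc n. e / (2 * K) * h n i v)"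
     proof (rule sum_mono)
      fix i assume i: "i \<in> {..Suc n}"
      show "\<bar>(p (t n i) - p v) * h n i v\<bar> \<le> e / (2 * K) * h n i v"
      proof (cases "h n i v = 0")
       case False
       define y where "y = 1 - \<bar>v - t n i\<bar> * real (Suc n) / r"
       have "h n i v = max 0 y" using i by (simp add: h_def t_def y_def del: of_nat_Suc)
       with False have "0 < y" by (cases "y \<le> 0") auto
       then have "0 < 1 - \<bar>v - t n i\<bar> * real (Suc n) / r" by (simp only: y_def)
       then have "\<bar>v - t n i\<bar> < r / real (Suc n)"
        using r by (simp add: pos_divide_less_eq pos_less_divide_eq del: of_nat_Suc)
       then have "\<bar>t n i - v\<bar> < d" using small by linarith
       then have "\<bar>p (t n i) - p v\<bar> < e / (2 * K)" using i by (intro du th t_in) auto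
       then show ?thesis unfolding abs_mult using h0[of n i v] by (intro mult_mono) auto
      qed simp
     qed
     also have "\<dots> = e / (2 * K)" using hsum[OF th, of n] by (simp only: mult_1_right flip: sum_distrib_left)
     finally show "\<bar>(\<Sum>i\<le>Suc n. p (t n i) * h n i v) + - 1 * p v\<bar> \<le> e / (2 * K)" .
    qed
    also have "\<dots> < e" using e K1 by simp
    finally show "norm ((\<Sum>i\<le>Suc n. p (t n i) * c n i) - L p) < e" unfolding eq real_norm_def .
   qed
  qed
  have "(\<lambda>n. K * (integral\<^sup>L ((Mp \<circ> s) n) g - integral\<^sup>L ((Mn \<circ> s) n) g)) \<longlonglongrightarrow> K * (integral\<^sup>L P g - integral\<^sup>L Q g)"
   by (intro tendsto_intros limP limQ)
  moreover have "(\<lambda>n. K * (integral\<^sup>L ((Mp \<circ> s) n) g - integral\<^sup>L ((Mn \<circ> s) n) g)) \<longlonglongrightarrow> L p"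
   using LIMSEQ_subseq_LIMSEQ[OF conv s] by (simp add: o_def diff)
  ultimately have "L p = K * (integral\<^sup>L P g - integral\<^sup>L Q g)" by (rule LIMSEQ_unique[rotated])
  moreover have ind: "(LINT v:{-r..0}|density D (\<lambda>_. ennreal K). p v) = K * integral\<^sup>L D g"
   if D: "real_distribution D" and AE: "AE x in D. x \<in> C" for D
  proof -
   interpret D: real_distribution D by (rule D)
   have eqi: "(\<lambda>v. indicator {-r..0} v *\<^sub>R p v) = (\<lambda>v. indicator {-r..0} v *\<^sub>R g v)"
    using g_in by (auto simp: indicator_def)
   have "(LINT v:{-r..0}|density D (\<lambda>_. ennreal K). p v) = (LINT v|density D (\<lambda>_. ennreal K). indicator {-r..0} v *\<^sub>R g v)"
    unfolding set_lebesgue_integral_def eqi ..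
   also have "\<dots> = (LINT v|D. K *\<^sub>R (indicator {-r..0} v *\<^sub>R g v))"
    by (rule integral_density) (use K1 in auto)
   also have "\<dots> = (LINT v|D. K * g v)"
   proof (rule integral_cong_AE)
    show "AE v in D. K *\<^sub>R indicat_real {- r..0} v *\<^sub>R g v = K * g v"
     using AE by eventually_elim (auto simp: C_def g1)
   qed auto
   finally show ?thesis by simp
  qed
  ultimately show ?thesis
   unfolding \<mu>p_def \<mu>n_def ind[OF P PC] ind[OF Q QC] by (simp only: right_diff_distrib)
 qed
 ultimately have "riesz_pair r L (\<mu>p, \<mu>n)" unfolding riesz_pair_def by simp
 then show ?thesis by blast
qed

section \<open>Riemann-Stieltjes integrals of continuous functions\<close>

text \<open>The function w is the variation of n on [a,t], a supremum over divisions; appending the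
  interval [s,t] to a division of [a,s] gives the inequality.\<close>

lemma bounded_variation_dominated:
 assumes bv: "bounded_variation n a b"
 obtains w where "\<And>s t. a \<le> s \<Longrightarrow> s \<le> t \<Longrightarrow> t \<le> b \<Longrightarrow> \<bar>n t - n s\<bar> \<le> w t - w s"
proof -
 define v where "v D = (\<Sum>K\<in>D. \<bar>n (Sup K) - n (Inf K)\<bar>)" for D :: "real set set"
 obtain V where V: "\<And>D. D division_of {a..b} \<Longrightarrow> v D \<le> V"
  using bv unfolding bounded_variation_def v_def by blast
 define w where "w t = Sup (v ` {D. D division_of {a..t}})" for t
 have ext: "\<exists>D'. D' division_of {a..t} \<and> v D' = v D + \<bar>n t - n s\<bar>"
  if "D division_of {a..s}" "a \<le> s" "s \<le> t" for D s t
 proof (cases "s = t")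
  case True
  then show ?thesis using that by auto
 next
  case False
  then have st: "s < t" using that by simp
  have fin: "finite D" using that(1) by (rule division_of_finite)
  have "{{s..t}} division_of {s..t}" using division_of_self[of s t] st by simp
  then have "(D \<union> {{s..t}}) division_of ({a..s} \<union> {s..t})"
   by (intro division_disjoint_union that(1)) auto
  moreover have "{a..s} \<union> {s..t} = {a..t}" using that by auto
  \<comment> \<open>Divisions are sets, so the sum splits only if the new interval is not already a
    member of D.\<close>
  moreover have "{s..t} \<notin> D"
  proof
   assume "{s..t} \<in> D"
   then have "{s..t} \<subseteq> {a..s}" using that(1) by (auto simp: division_of_def)
   then show False using st by auto
  qed
  then have "v (D \<union> {{s..t}}) = v D + \<bar>n t - n s\<bar>"
   using fin st by (simp add: v_def)
  ultimately show ?thesis by auto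
 qed
 have ne: "v ` {D. D division_of {a..t}} \<noteq> {}" if "a \<le> t" for t
  using division_of_self[of a t] that by auto
 have bdd: "bdd_above (v ` {D. D division_of {a..t}})" if t: "a \<le> t" "t \<le> b" for t
 proof (rule bdd_aboveI[where M = V])
  fix x assume "x \<in> v ` {D. D division_of {a..t}}"
  then obtain D where D: "D division_of {a..t}" and x: "x = v D" by auto
  obtain D' where "D' division_of {a..b}" "v D' = v D + \<bar>n b - n t\<bar>"
   using ext[OF D _ t(2)] t(1) by blast
  then show "x \<le> V" using V[of D'] x by simp
 qed
 show thesis
 proof (rule that)
  fix s t assume st: "a \<le> s" "s \<le> t" "t \<le> b"
  have "w s \<le> w t - \<bar>n t - n s\<bar>"
   unfolding w_def
  proof (rule cSup_least[OF ne[OF st(1)]])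
   fix x assume "x \<in> v ` {D. D division_of {a..s}}"
   then obtain D where D: "D division_of {a..s}" and x: "x = v D" by auto
   obtain D' where D': "D' division_of {a..t}" "v D' = v D + \<bar>n t - n s\<bar>"
    using ext[OF D st(1,2)] by auto
   have "v D' \<le> Sup (v ` {D. D division_of {a..t}})"
    by (rule cSup_upper[OF imageI bdd]) (use D'(1) st in auto)
   then show "x \<le> Sup (v ` {D. D division_of {a..t}}) - \<bar>n t - n s\<bar>" using D' x by simp
  qed
  then show "\<bar>n t - n s\<bar> \<le> w t - w s" by simp
 qed
qed

section \<open>Comparison of Riemann-Stieltjes sums over two divisions\<close>

definition overlap_incr :: "(real \<Rightarrow> real) \<Rightarrow> real set \<Rightarrow> real set \<Rightarrow> real" where
 "overlap_incr \<nu> K J = \<nu> (max (Inf K) (min (Sup K) (Sup J))) - \<nu> (max (Inf K) (min (Sup K) (Inf J)))"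

text \<open>For a fixed interval the overlap increments are the increments of \<open>\<nu>\<close> composed with the
 clamping onto it, so that they telescope over a tagged division.\<close>

lemma tagged_division_of_realD:
 fixes a b :: real
 assumes "D tagged_division_of {a..b}" "(x, K) \<in> D"
 shows "K = {Inf K..Sup K}" "Inf K \<le> Sup K" "a \<le> Inf K" "Sup K \<le> b" "Inf K \<le> x" "x \<le> Sup K"
proof -
 obtain u v where K: "K = {u..v}" using tagged_division_ofD(4)[OF assms] by auto
 have x: "x \<in> K" and sub: "K \<subseteq> {a..b}" using tagged_division_ofD(2,3)[OF assms] by auto
 have uv: "u \<le> v" using x K by auto
 have i: "Inf K = u" "Sup K = v" using uv by (auto simp: K)
 show "K = {Inf K..Sup K}" "Inf K \<le> Sup K" "a \<le> Inf K" "Sup K \<le> b" "Inf K \<le> x" "x \<le> Sup K"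
  using x sub uv unfolding i K by auto
qed

lemma sum_overlap_incr:
 fixes a b :: real
 assumes D: "D tagged_division_of {a..b}" and ab: "a \<le> b" and K: "a \<le> Inf K" "Inf K \<le> Sup K" "Sup K \<le> b"
 shows "(\<Sum>(y, J)\<in>D. overlap_incr v K J) = v (Sup K) - v (Inf K)"
proof -
 define f where "f t = v (max (Inf K) (min (Sup K) t))" for t
 have "(\<Sum>(y, J)\<in>D. f (Sup J) - f (Inf J)) = f b - f a"
  by (rule additive_tagged_division_1[OF ab D])
 moreover have "f b = v (Sup K)" "f a = v (Inf K)"
  using K ab by (auto simp: f_def max_def min_def) (metis order_antisym order_trans)
 ultimately show ?thesis unfolding overlap_incr_def f_def by simp
qed

text \<open>Both sides are the increment of v over the intersection, or zero if the intervals do not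
  meet. The symmetry lets a sum over pairs of intervals be expanded from either division.\<close>

lemma overlap_incr_commute:
 assumes "Inf K \<le> Sup K" "Inf J \<le> Sup J"
 shows "overlap_incr v K J = overlap_incr v J K"
 using assms unfolding overlap_incr_def by (auto simp: max_def min_def)

lemma overlap_incr_disjoint:
 assumes "Inf K \<le> Sup K" "Inf J \<le> Sup J" "Sup K < Inf J \<or> Sup J < Inf K"
 shows "overlap_incr \<nu> K J = 0"
 using assms unfolding overlap_incr_def by (auto simp: max_def min_def)

lemma sum_overlap_incr_tags:
 fixes a b :: real
 assumes D: "D tagged_division_of {a..b}" and D': "D' tagged_division_of {a..b}" and ab: "a \<le> b"
 shows "(\<Sum>(x, K)\<in>D. f x * (v (Sup K) - v (Inf K))) = (\<Sum>(x, K)\<in>D. \<Sum>(y, J)\<in>D'. f x * overlap_incr v K J)"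
proof (rule sum.cong[OF refl], clarify)
 fix x K assume K: "(x, K) \<in> D"
 note K = tagged_division_of_realD[OF D K]
 have "(\<Sum>(y, J)\<in>D'. f x * overlap_incr v K J) = f x * (\<Sum>(y, J)\<in>D'. overlap_incr v K J)"
  by (simp add: sum_distrib_left split_def)
 then show "f x * (v (Sup K) - v (Inf K)) = (\<Sum>(y, J)\<in>D'. f x * overlap_incr v K J)"
  using sum_overlap_incr[OF D' ab] K by simp
qed

definition mesh_less :: "(real \<times> real set) set \<Rightarrow> real \<Rightarrow> bool" where
 "mesh_less D d \<longleftrightarrow> (\<forall>(x, K)\<in>D. Sup K - Inf K < d)"

lemma mesh_lessD: "mesh_less D d \<Longrightarrow> (x, K) \<in> D \<Longrightarrow> Sup K - Inf K < d"
 unfolding mesh_less_def by blast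

lemma mesh_less_mono: "mesh_less D d \<Longrightarrow> d \<le> d' \<Longrightarrow> mesh_less D d'"
 unfolding mesh_less_def by fastforce

definition RS_sum :: "(real \<Rightarrow> real) \<Rightarrow> (real \<Rightarrow> real) \<Rightarrow> (real \<times> real set) set \<Rightarrow> real" where
 "RS_sum f \<nu> D = (\<Sum>(x, K)\<in>D. f x * (\<nu> (Sup K) - \<nu> (Inf K)))"

text \<open>Both sums are written over all pairs (K, J), which replaces a common refinement. A pair
  contributes f x - f y times the increment over the overlap. It vanishes unless K and J meet, and
  then the tags are less than 2 d apart; the dominating increments add up to w b - w a.\<close>

lemma RS_sum_diff_le:
 fixes a b :: real
 assumes D: "D tagged_division_of {a..b}" and D': "D' tagged_division_of {a..b}" and ab: "a \<le> b"
  and w: "\<And>s t. a \<le> s \<Longrightarrow> s \<le> t \<Longrightarrow> t \<le> b \<Longrightarrow> \<bar>v t - v s\<bar> \<le> w t - w s"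
  and mesh: "mesh_less D d" "mesh_less D' d"
  and osc: "\<And>x y. x \<in> {a..b} \<Longrightarrow> y \<in> {a..b} \<Longrightarrow> \<bar>x - y\<bar> < 2 * d \<Longrightarrow> \<bar>f x - f y\<bar> \<le> e"
 shows "\<bar>RS_sum f v D - RS_sum f v D'\<bar> \<le> e * (w b - w a)"
proof -
 have fin: "finite D" "finite D'" using D D' by (auto intro: tagged_division_of_finite)
 have 1: "RS_sum f v D = (\<Sum>p\<in>D. \<Sum>q\<in>D'. f (fst p) * overlap_incr v (snd p) (snd q))"
  unfolding RS_sum_def sum_overlap_incr_tags[OF D D' ab] by (simp add: split_def)
 have "RS_sum f v D' = (\<Sum>q\<in>D'. \<Sum>p\<in>D. f (fst q) * overlap_incr v (snd q) (snd p))"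
  unfolding RS_sum_def sum_overlap_incr_tags[OF D' D ab] by (simp add: split_def)
 also have "\<dots> = (\<Sum>p\<in>D. \<Sum>q\<in>D'. f (fst q) * overlap_incr v (snd q) (snd p))" by (rule sum.swap)
 also have "\<dots> = (\<Sum>p\<in>D. \<Sum>q\<in>D'. f (fst q) * overlap_incr v (snd p) (snd q))"
 proof (intro sum.cong refl)
  fix p q assume "p \<in> D" "q \<in> D'"
  then have "Inf (snd p) \<le> Sup (snd p)" "Inf (snd q) \<le> Sup (snd q)"
   using tagged_division_of_realD(2)[OF D, of "fst p" "snd p"] tagged_division_of_realD(2)[OF D', of "fst q" "snd q"] by auto
  then show "f (fst q) * overlap_incr v (snd q) (snd p) = f (fst q) * overlap_incr v (snd p) (snd q)"
   using overlap_incr_commute by metis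
 qed
 finally have 2: "RS_sum f v D' = (\<Sum>p\<in>D. \<Sum>q\<in>D'. f (fst q) * overlap_incr v (snd p) (snd q))" .
 have "RS_sum f v D - RS_sum f v D' = (\<Sum>p\<in>D. \<Sum>q\<in>D'. (f (fst p) - f (fst q)) * overlap_incr v (snd p) (snd q))"
  unfolding 1 2 by (simp add: sum_subtractf left_diff_distrib)
 also have "\<bar>\<dots>\<bar> \<le> (\<Sum>p\<in>D. \<Sum>q\<in>D'. \<bar>(f (fst p) - f (fst q)) * overlap_incr v (snd p) (snd q)\<bar>)"
  by (rule order_trans[OF sum_abs]) (intro sum_mono sum_abs)
 also have "\<dots> \<le> (\<Sum>p\<in>D. \<Sum>q\<in>D'. e * overlap_incr w (snd p) (snd q))"
 proof (intro sum_mono)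
  fix p q assume p: "p \<in> D" and q: "q \<in> D'"
  obtain x K where pK: "p = (x, K)" by (cases p)
  obtain y J where qJ: "q = (y, J)" by (cases q)
  note K = tagged_division_of_realD[OF D p[unfolded pK]] and J = tagged_division_of_realD[OF D' q[unfolded qJ]]
  show "\<bar>(f (fst p) - f (fst q)) * overlap_incr v (snd p) (snd q)\<bar> \<le> e * overlap_incr w (snd p) (snd q)"
  proof (cases "Sup K < Inf J \<or> Sup J < Inf K")
   case True
   then show ?thesis using overlap_incr_disjoint[OF K(2) J(2)] by (simp add: pK qJ)
  next
   case False
   have "\<bar>x - y\<bar> < 2 * d"
    using False K J mesh_lessD[OF mesh(1) p[unfolded pK]] mesh_lessD[OF mesh(2) q[unfolded qJ]] by (auto simp: pK qJ)
   then have fe: "\<bar>f x - f y\<bar> \<le> e" using K J by (intro osc) auto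
   have "\<bar>overlap_incr v K J\<bar> \<le> overlap_incr w K J"
    unfolding overlap_incr_def by (rule w) (use K J in auto)
   with fe show ?thesis unfolding pK qJ fst_conv snd_conv abs_mult by (intro mult_mono) auto
  qed
 qed
 also have "\<dots> = (\<Sum>(x, K)\<in>D. e * (w (Sup K) - w (Inf K)))"
  unfolding sum_overlap_incr_tags[OF D D' ab, where f = "\<lambda>_. e"] by (simp add: split_def)
 also have "\<dots> = e * (\<Sum>(x, K)\<in>D. w (Sup K) - w (Inf K))"
  by (simp add: sum_distrib_left split_def)
 also have "\<dots> = e * (w b - w a)" using additive_tagged_division_1[OF ab D, of w] by simp
 finally show ?thesis .
qed

lemma fine_tagged_division_exists:
 fixes a b :: real
 assumes "0 < d"
 obtains D where "D tagged_division_of {a..b}" "mesh_less D d"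
proof -
 have "gauge (\<lambda>x::real. ball x (d / 3))" using assms by (intro gauge_ball) simp
 then obtain D where D: "D tagged_division_of {a..b}" and f: "(\<lambda>x. ball x (d / 3)) fine D"
  using fine_division_exists_real by blast
 show thesis
 proof (rule that[OF D], unfold mesh_less_def, clarify)
  fix x K assume xK: "(x, K) \<in> D"
  note K = tagged_division_of_realD[OF D xK]
  have "K \<subseteq> ball x (d / 3)" using f xK by (auto simp: fine_def)
  moreover have "Inf K \<in> K" "Sup K \<in> K" using K(1,2) by (metis atLeastAtMost_iff order_refl)+
  ultimately have "dist x (Inf K) < d / 3" "dist x (Sup K) < d / 3" by auto
  then show "Sup K - Inf K < d" using assms unfolding dist_real_def by linarith
 qed
qed

section \<open>Uniqueness, existence and bounds of the Riemann-Stieltjes integral\<close>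

lemma has_RS_integral_iff:
 "has_RS_integral f v a b I \<longleftrightarrow> (\<forall>e>0. \<exists>d>0. \<forall>D. D tagged_division_of {a..b} \<and> mesh_less (D) (d) \<longrightarrow>
   \<bar>RS_sum f v D - I\<bar> < e)"
 unfolding has_RS_integral_def RS_sum_def mesh_less_def ..

text \<open>One division fine enough for three integrals at once: the difference rule compares the
  sums of f, g and f - g, while uniqueness and the norm bound use repeated entries.\<close>

lemma has_RS_integral_common:
 assumes "has_RS_integral f1 v a b I1" "has_RS_integral f2 v a b I2" "has_RS_integral f3 v a b I3" "0 < e"
 obtains D where "D tagged_division_of {a..b}"
  "\<bar>RS_sum f1 v D - I1\<bar> < e" "\<bar>RS_sum f2 v D - I2\<bar> < e" "\<bar>RS_sum f3 v D - I3\<bar> < e"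
proof -
 obtain d1 where d1: "d1 > 0" "\<And>D. D tagged_division_of {a..b} \<and> mesh_less (D) (d1) \<longrightarrow> \<bar>RS_sum f1 v D - I1\<bar> < e"
  using assms(1,4) unfolding has_RS_integral_iff by blast
 obtain d2 where d2: "d2 > 0" "\<And>D. D tagged_division_of {a..b} \<and> mesh_less (D) (d2) \<longrightarrow> \<bar>RS_sum f2 v D - I2\<bar> < e"
  using assms(2,4) unfolding has_RS_integral_iff by blast
 obtain d3 where d3: "d3 > 0" "\<And>D. D tagged_division_of {a..b} \<and> mesh_less (D) (d3) \<longrightarrow> \<bar>RS_sum f3 v D - I3\<bar> < e"
  using assms(3,4) unfolding has_RS_integral_iff by blast
 have "0 < min d1 (min d2 d3)" using d1 d2 d3 by simp
 then obtain D where D: "D tagged_division_of {a..b}" and m: "mesh_less D (min d1 (min d2 d3))"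
  using fine_tagged_division_exists[of _ a b] by blast
 have "mesh_less D d1" "mesh_less D d2" "mesh_less D d3" by (rule mesh_less_mono[OF m], simp)+
 show thesis
  by (rule that[OF D]) (use d1(2)[of D] d2(2)[of D] d3(2)[of D] D \<open>mesh_less D d1\<close> \<open>mesh_less D d2\<close> \<open>mesh_less D d3\<close> in blast)+
qed

lemma has_RS_integral_unique:
 assumes "has_RS_integral f v a b I" "has_RS_integral f v a b I'"
 shows "I = I'"
proof (rule ccontr)
 assume "I \<noteq> I'"
 then have "0 < \<bar>I - I'\<bar> / 2" by simp
 then obtain D where "\<bar>RS_sum f v D - I\<bar> < \<bar>I - I'\<bar> / 2" "\<bar>RS_sum f v D - I'\<bar> < \<bar>I - I'\<bar> / 2"
  using has_RS_integral_common[OF assms(1) assms(2) assms(2)] by blast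
 from add_strict_mono[OF this]
 have "\<bar>RS_sum f v D - I\<bar> + \<bar>RS_sum f v D - I'\<bar> < \<bar>I - I'\<bar>" by simp
 moreover have "\<bar>I - I'\<bar> \<le> \<bar>RS_sum f v D - I\<bar> + \<bar>RS_sum f v D - I'\<bar>" by linarith
 ultimately show False by simp
qed

lemma RS_integral_eqI: "has_RS_integral f v a b I \<Longrightarrow> RS_integral f v a b = I"
 unfolding RS_integral_def by (rule the_equality) (auto intro: has_RS_integral_unique)

text \<open>Sums over fine divisions form a Cauchy family by uniform continuity of f. Existence is
  what gives the \<open>THE\<close> in \<open>RS_integral\<close> its value.\<close>

theorem RS_integrable_continuous:
 assumes bv: "bounded_variation v a b" and f: "continuous_on {a..b} f" and ab: "a \<le> b"
 shows "has_RS_integral f v a b (RS_integral f v a b)"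
proof -
 obtain w where w: "\<And>s t. a \<le> s \<Longrightarrow> s \<le> t \<Longrightarrow> t \<le> b \<Longrightarrow> \<bar>v t - v s\<bar> \<le> w t - w s"
  using bounded_variation_dominated[OF bv] by blast
 have wab: "0 \<le> w b - w a" using w[of a b] ab by simp
 have uc: "\<exists>d>0. \<forall>D D'. D tagged_division_of {a..b} \<longrightarrow> D' tagged_division_of {a..b} \<longrightarrow>
   mesh_less (D) (d) \<longrightarrow> mesh_less (D') (d) \<longrightarrow>
   \<bar>RS_sum f v D - RS_sum f v D'\<bar> < e" if e: "0 < e" for e
 proof -
  \<comment> \<open>The added 1 covers an integrator without variation.\<close>
  define e' where "e' = e / (w b - w a + 1)"
  have e': "0 < e'" using e wab by (simp add: e'_def)
  have ee: "e' * (w b - w a) < e" using e wab by (simp add: e'_def field_simps)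
  have "uniformly_continuous_on {a..b} f" by (rule compact_uniformly_continuous[OF f compact_Icc])
  then have "\<exists>d>0. \<forall>x\<in>{a..b}. \<forall>y\<in>{a..b}. dist y x < d \<longrightarrow> dist (f y) (f x) < e'"
   using e' unfolding uniformly_continuous_on_def by simp
  then obtain d where d: "d > 0" and du: "\<And>x y. x \<in> {a..b} \<Longrightarrow> y \<in> {a..b} \<Longrightarrow> \<bar>y - x\<bar> < d \<Longrightarrow> \<bar>f y - f x\<bar> < e'"
   unfolding dist_real_def by metis
  have osc: "\<bar>f x - f y\<bar> \<le> e'" if "x \<in> {a..b}" "y \<in> {a..b}" "\<bar>x - y\<bar> < 2 * (d / 2)" for x y
   using du[of y x] that by simp
  show ?thesis
  proof (intro exI[of _ "d / 2"] conjI allI impI)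
   fix D D' assume D: "D tagged_division_of {a..b}" "D' tagged_division_of {a..b}"
    and m: "mesh_less (D) (d / 2)" "mesh_less (D') (d / 2)"
   have "\<bar>RS_sum f v D - RS_sum f v D'\<bar> \<le> e' * (w b - w a)"
    by (rule RS_sum_diff_le[OF D ab w m osc])
   then show "\<bar>RS_sum f v D - RS_sum f v D'\<bar> < e" using ee by linarith
  qed (use d in simp)
 qed
 have "\<exists>D. D tagged_division_of {a..b} \<and> (mesh_less (D) (inverse (real (Suc n))))" for n
  using fine_tagged_division_exists[of "inverse (real (Suc n))" a b] by (metis inverse_positive_iff_positive of_nat_0_less_iff zero_less_Suc)
 then obtain Dn where Dn: "\<And>n. Dn n tagged_division_of {a..b}"
  and Dm: "\<And>n. mesh_less (Dn n) (inverse (real (Suc n)))" by metis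
 have small: "mesh_less (Dn n) (d)" if "N \<le> n" "inverse (real (Suc N)) < d" for n N d
 proof -
  have "inverse (real (Suc n)) \<le> inverse (real (Suc N))" using that by simp
  then show ?thesis by (rule mesh_less_mono[OF Dm, OF order_trans]) (use that in simp)
 qed
 have "Cauchy (\<lambda>n. RS_sum f v (Dn n))"
 proof (rule CauchyI)
  fix e :: real assume "0 < e"
  from uc[OF this] obtain d where d: "d > 0" "\<And>D D'. D tagged_division_of {a..b} \<Longrightarrow> D' tagged_division_of {a..b} \<Longrightarrow>
   mesh_less (D) (d) \<Longrightarrow> mesh_less (D') (d) \<Longrightarrow> \<bar>RS_sum f v D - RS_sum f v D'\<bar> < e"
   by blast
  obtain N where N: "inverse (real (Suc N)) < d" using reals_Archimedean[OF d(1)] by blast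
  then show "\<exists>M. \<forall>m\<ge>M. \<forall>n\<ge>M. norm (RS_sum f v (Dn m) - RS_sum f v (Dn n)) < e"
   using d(2)[OF Dn Dn small[OF _ N] small[OF _ N]] unfolding real_norm_def by blast
 qed
 then obtain I where I: "(\<lambda>n. RS_sum f v (Dn n)) \<longlonglongrightarrow> I" using Cauchy_convergent_iff convergent_def by blast
 have "has_RS_integral f v a b I"
  unfolding has_RS_integral_iff
 proof (intro allI impI)
  fix e :: real assume e: "0 < e"
  then have "0 < e / 2" by simp
  from uc[OF this] obtain d where d: "d > 0" "\<And>D D'. D tagged_division_of {a..b} \<Longrightarrow> D' tagged_division_of {a..b} \<Longrightarrow>
   mesh_less (D) (d) \<Longrightarrow> mesh_less (D') (d) \<Longrightarrow> \<bar>RS_sum f v D - RS_sum f v D'\<bar> < e / 2"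
   by blast
  obtain N where N: "inverse (real (Suc N)) < d" using reals_Archimedean[OF d(1)] by blast
  obtain N' where N': "\<And>n. n \<ge> N' \<Longrightarrow> norm (RS_sum f v (Dn n) - I) < e / 2"
   using LIMSEQ_D[OF I \<open>0 < e / 2\<close>] by blast
  show "\<exists>d>0. \<forall>D. D tagged_division_of {a..b} \<and> mesh_less (D) (d) \<longrightarrow> \<bar>RS_sum f v D - I\<bar> < e"
  proof (intro exI[of _ d] conjI allI impI d(1))
   fix D assume D: "D tagged_division_of {a..b} \<and> (mesh_less (D) (d))"
   have "\<bar>RS_sum f v D - RS_sum f v (Dn (max N N'))\<bar> < e / 2"
    by (rule d(2)) (use D Dn small[OF _ N, of "max N N'"] in auto)
   moreover have "\<bar>RS_sum f v (Dn (max N N')) - I\<bar> < e / 2" using N'[of "max N N'"] by simp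
   ultimately show "\<bar>RS_sum f v D - I\<bar> < e" by linarith
  qed
 qed
 then show ?thesis using RS_integral_eqI by metis
qed

lemma RS_integral_diff:
 assumes bv: "bounded_variation v a b" and f: "continuous_on {a..b} f" and g: "continuous_on {a..b} g" and ab: "a \<le> b"
 shows "RS_integral (\<lambda>x. f x - g x) v a b = RS_integral f v a b - RS_integral g v a b"
proof -
 let ?I = "\<lambda>f. RS_integral f v a b"
 have "\<bar>?I (\<lambda>x. f x - g x) - (?I f - ?I g)\<bar> \<le> e" if "0 < e" for e
 proof -
  have "0 < e / 3" using that by simp
  from has_RS_integral_common[OF RS_integrable_continuous[OF bv f ab] RS_integrable_continuous[OF bv g ab]
    RS_integrable_continuous[OF bv continuous_on_diff[OF f g] ab] this]
  obtain D where D: "\<bar>RS_sum f v D - ?I f\<bar> < e / 3" "\<bar>RS_sum g v D - ?I g\<bar> < e / 3"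
   "\<bar>RS_sum (\<lambda>x. f x - g x) v D - ?I (\<lambda>x. f x - g x)\<bar> < e / 3" by metis
  have "RS_sum (\<lambda>x. f x - g x) v D = RS_sum f v D - RS_sum g v D"
   unfolding RS_sum_def by (simp add: split_def left_diff_distrib sum_subtractf)
  then show ?thesis using D by linarith
 qed
 then have "\<bar>?I (\<lambda>x. f x - g x) - (?I f - ?I g)\<bar> \<le> 0" by (rule field_le_epsilon) simp
 then show ?thesis by simp
qed

text \<open>V is the variation of the integrator; applied to differences of segments and of their
  cubes, the bound yields the Lipschitz estimates of the nonlinearity.\<close>

lemma RS_integral_bound:
 assumes bv: "bounded_variation v a b" and ab: "a \<le> b"
 obtains V where "0 \<le> V"
  and "\<And>f B. continuous_on {a..b} f \<Longrightarrow> (\<And>x. x \<in> {a..b} \<Longrightarrow> \<bar>f x\<bar> \<le> B) \<Longrightarrow> \<bar>RS_integral f v a b\<bar> \<le> V * B"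
proof -
 obtain w where w: "\<And>s t. a \<le> s \<Longrightarrow> s \<le> t \<Longrightarrow> t \<le> b \<Longrightarrow> \<bar>v t - v s\<bar> \<le> w t - w s"
  using bounded_variation_dominated[OF bv] by blast
 show thesis
 proof (rule that[of "w b - w a"])
  show "0 \<le> w b - w a" using w[of a b] ab by simp
  fix f :: "real \<Rightarrow> real" and B assume f: "continuous_on {a..b} f" and B: "\<And>x. x \<in> {a..b} \<Longrightarrow> \<bar>f x\<bar> \<le> B"
  show "\<bar>RS_integral f v a b\<bar> \<le> (w b - w a) * B"
  proof (rule field_le_epsilon)
   fix e :: real assume e: "0 < e"
   note i = RS_integrable_continuous[OF bv f ab]
   obtain D where D: "D tagged_division_of {a..b}" and s: "\<bar>RS_sum f v D - RS_integral f v a b\<bar> < e"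
    by (rule has_RS_integral_common[OF i i i e]) blast
   have "\<bar>RS_sum f v D\<bar> \<le> (\<Sum>(x, K)\<in>D. \<bar>f x * (v (Sup K) - v (Inf K))\<bar>)"
    unfolding RS_sum_def split_def by (rule sum_abs)
   also have "\<dots> \<le> (\<Sum>(x, K)\<in>D. B * (w (Sup K) - w (Inf K)))"
   proof (rule sum_mono, clarify)
    fix x K assume "(x, K) \<in> D"
    note K = tagged_division_of_realD[OF D this]
    show "\<bar>f x * (v (Sup K) - v (Inf K))\<bar> \<le> B * (w (Sup K) - w (Inf K))"
     unfolding abs_mult using K B[of x] w[of "Inf K" "Sup K"] by (intro mult_mono) auto
   qed
   also have "\<dots> = B * (w b - w a)"
    using additive_tagged_division_1[OF ab D, of w] by (simp add: split_def flip: sum_distrib_left)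
   finally show "\<bar>RS_integral f v a b\<bar> \<le> (w b - w a) * B + e" using s by (simp add: mult.commute)
  qed
 qed
qed

section \<open>Volterra convolution equations\<close>

text \<open>Bounds are local to [0,T], where \<open>conv\<close> evaluates its arguments;
  measurability is global, so that Fubini applies on the whole line.\<close>

definition loc_bdd :: "(real \<Rightarrow> real) \<Rightarrow> bool" where
 "loc_bdd f \<longleftrightarrow> f \<in> borel_measurable borel \<and> (\<forall>T. \<exists>B. \<forall>t\<in>{0..T}. \<bar>f t\<bar> \<le> B)"

text \<open>Convolution on the half-line, written as an integral over the line with a cut-off so
  that affine substitutions act directly.\<close>

definition conv :: "(real \<Rightarrow> real) \<Rightarrow> (real \<Rightarrow> real) \<Rightarrow> real \<Rightarrow> real" where
 "conv f g t = (LBINT s. if 0 \<le> s \<and> s \<le> t then f s * g (t - s) else 0)"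

lemma loc_bdd_measurable[measurable_dest]: "loc_bdd f \<Longrightarrow> f \<in> borel_measurable borel"
 by (simp add: loc_bdd_def)

lemma loc_bdd_obtain:
 assumes "loc_bdd f"
 obtains B where "0 \<le> B" "\<And>s. 0 \<le> s \<Longrightarrow> s \<le> t \<Longrightarrow> \<bar>f s\<bar> \<le> B"
proof -
 obtain B where "\<forall>s\<in>{0..t}. \<bar>f s\<bar> \<le> B" using assms by (auto simp: loc_bdd_def)
 then show thesis by (intro that[of "max B 0"]) (auto simp: le_max_iff_disj)
qed

lemma integrable_indicator_Icc [simp]: "integrable lborel (indicator {a..b::real} :: real \<Rightarrow> real)"
 by (rule integrable_real_indicator) (auto simp: emeasure_lborel_Icc_eq)

lemma integral_indicator_Icc: "a \<le> b \<Longrightarrow> (LBINT s. c * indicator {a..b} s) = c * (b - a :: real)"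
 by simp

lemma integrable_if_interval:
 fixes h :: "real \<Rightarrow> real"
 assumes [measurable]: "h \<in> borel_measurable borel" and B: "\<And>s. a \<le> s \<Longrightarrow> s \<le> t \<Longrightarrow> \<bar>h s\<bar> \<le> B"
 shows "integrable lborel (\<lambda>s. if a \<le> s \<and> s \<le> t then h s else 0)"
proof (rule Bochner_Integration.integrable_bound[where f = "\<lambda>s. B * indicator {a..t} s"])
 show "integrable lborel (\<lambda>s. B * indicator {a..t} s :: real)" by (intro integrable_mult_right integrable_indicator_Icc)
 show "AE s in lborel. norm (if a \<le> s \<and> s \<le> t then h s else 0) \<le> norm (B * indicator {a..t} s)"
  using B by (intro always_eventually allI) (auto simp: indicator_def intro: order_trans[OF _ abs_ge_self])
qed simp

lemma conv_integrable:
 assumes f: "loc_bdd f" and g: "loc_bdd g"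
 shows "integrable lborel (\<lambda>s. if 0 \<le> s \<and> s \<le> t then f s * g (t - s) else 0)"
proof -
 note [measurable] = loc_bdd_measurable[OF f] loc_bdd_measurable[OF g]
 obtain B where B: "0 \<le> B" "\<And>s. 0 \<le> s \<Longrightarrow> s \<le> t \<Longrightarrow> \<bar>f s\<bar> \<le> B" using loc_bdd_obtain[OF f, of t] by blast
 obtain C where C: "0 \<le> C" "\<And>s. 0 \<le> s \<Longrightarrow> s \<le> t \<Longrightarrow> \<bar>g s\<bar> \<le> C" using loc_bdd_obtain[OF g, of t] by blast
 show ?thesis
  by (rule integrable_if_interval[where B = "B * C"]) (use B C in \<open>auto simp: abs_mult intro!: mult_mono\<close>)
qed

lemma integral_if_le:
 fixes h :: "real \<Rightarrow> real"
 assumes B: "\<And>s. a \<le> s \<Longrightarrow> s \<le> t \<Longrightarrow> \<bar>h s\<bar> \<le> B" and at: "a \<le> t" and h: "h \<in> borel_measurable borel"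
 shows "\<bar>LBINT s. if a \<le> s \<and> s \<le> t then h s else 0\<bar> \<le> B * (t - a)"
proof -
 have "norm (LBINT s. if a \<le> s \<and> s \<le> t then h s else 0) \<le> (LBINT s. norm (if a \<le> s \<and> s \<le> t then h s else 0))"
  by (rule integral_norm_bound)
 also have "\<dots> \<le> (LBINT s. B * indicator {a..t} s)"
 proof (rule integral_mono)
  show "integrable lborel (\<lambda>s. norm (if a \<le> s \<and> s \<le> t then h s else 0))"
   using integrable_if_interval[OF h B] by (rule integrable_norm)
  show "integrable lborel (\<lambda>s. B * indicator {a..t} s)" by (intro integrable_mult_right integrable_indicator_Icc)
 qed (use B in \<open>auto simp: indicator_def\<close>)
 also have "\<dots> = B * (t - a)" by (rule integral_indicator_Icc[OF at])
 finally show ?thesis by simp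
qed

lemma conv_measurable:
 assumes [measurable]: "f \<in> borel_measurable borel" "g \<in> borel_measurable borel"
 shows "conv f g \<in> borel_measurable borel"
 unfolding conv_def[abs_def] by measurable

lemma conv_bound:
 assumes f: "loc_bdd f" and g: "loc_bdd g" and t: "0 \<le> t"
  and B: "\<And>s. 0 \<le> s \<Longrightarrow> s \<le> t \<Longrightarrow> \<bar>f s * g (t - s)\<bar> \<le> B"
 shows "\<bar>conv f g t\<bar> \<le> B * t"
proof -
 note [measurable] = loc_bdd_measurable[OF f] loc_bdd_measurable[OF g]
 show ?thesis unfolding conv_def using integral_if_le[OF B t] by simp
qed

lemma loc_bdd_conv:
 assumes f: "loc_bdd f" and g: "loc_bdd g"
 shows "loc_bdd (conv f g)"
 unfolding loc_bdd_def
proof (intro conjI allI)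
 note [measurable] = loc_bdd_measurable[OF f] loc_bdd_measurable[OF g]
 show "conv f g \<in> borel_measurable borel" by (rule conv_measurable) simp_all
 fix T
 obtain B where B: "0 \<le> B" "\<And>s. 0 \<le> s \<Longrightarrow> s \<le> T \<Longrightarrow> \<bar>f s\<bar> \<le> B" using loc_bdd_obtain[OF f, of T] by blast
 obtain C where C: "0 \<le> C" "\<And>s. 0 \<le> s \<Longrightarrow> s \<le> T \<Longrightarrow> \<bar>g s\<bar> \<le> C" using loc_bdd_obtain[OF g, of T] by blast
 have "\<bar>conv f g t\<bar> \<le> B * C * T" if "t \<in> {0..T}" for t
 proof -
  have "\<bar>conv f g t\<bar> \<le> B * C * t"
   by (rule conv_bound[OF f g]) (use that B C in \<open>auto simp: abs_mult intro!: mult_mono\<close>)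
  also have "\<dots> \<le> B * C * T" using that B C by (intro mult_left_mono) auto
  finally show ?thesis .
 qed
 then show "\<exists>B. \<forall>t\<in>{0..T}. \<bar>conv f g t\<bar> \<le> B" by blast
qed

lemma loc_bdd_const[simp]: "loc_bdd (\<lambda>_. c)"
 by (auto simp: loc_bdd_def)

lemma loc_bdd_add: "loc_bdd f \<Longrightarrow> loc_bdd g \<Longrightarrow> loc_bdd (\<lambda>t. f t + g t)"
proof -
 assume f: "loc_bdd f" and g: "loc_bdd g"
 note [measurable] = loc_bdd_measurable[OF f] loc_bdd_measurable[OF g]
 have "\<exists>B. \<forall>t\<in>{0..T}. \<bar>f t + g t\<bar> \<le> B" for T
 proof -
  obtain B where B: "0 \<le> B" "\<And>s. 0 \<le> s \<Longrightarrow> s \<le> T \<Longrightarrow> \<bar>f s\<bar> \<le> B" using loc_bdd_obtain[OF f, of T] by blast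
  obtain C where C: "0 \<le> C" "\<And>s. 0 \<le> s \<Longrightarrow> s \<le> T \<Longrightarrow> \<bar>g s\<bar> \<le> C" using loc_bdd_obtain[OF g, of T] by blast
  show ?thesis by (rule exI[of _ "B + C"]) (use B C in \<open>auto intro!: order_trans[OF abs_triangle_ineq] add_mono\<close>)
 qed
 then show ?thesis by (simp add: loc_bdd_def)
qed

lemma loc_bdd_cmult: "loc_bdd f \<Longrightarrow> loc_bdd (\<lambda>t. c * f t)"
proof -
 assume f: "loc_bdd f"
 note [measurable] = loc_bdd_measurable[OF f]
 have "\<exists>B. \<forall>t\<in>{0..T}. \<bar>c * f t\<bar> \<le> B" for T
 proof -
  obtain B where B: "0 \<le> B" "\<And>s. 0 \<le> s \<Longrightarrow> s \<le> T \<Longrightarrow> \<bar>f s\<bar> \<le> B" using loc_bdd_obtain[OF f, of T] by blast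
  show ?thesis by (rule exI[of _ "\<bar>c\<bar> * B"]) (use B in \<open>auto simp: abs_mult intro!: mult_left_mono\<close>)
 qed
 then show ?thesis by (simp add: loc_bdd_def)
qed

lemma loc_bdd_diff: "loc_bdd f \<Longrightarrow> loc_bdd g \<Longrightarrow> loc_bdd (\<lambda>t. f t - g t)"
 using loc_bdd_add[of f "\<lambda>t. -1 * g t"] loc_bdd_cmult[of g "-1"] by simp

lemma loc_bdd_continuous: "continuous_on UNIV f \<Longrightarrow> loc_bdd f"
proof -
 assume f: "continuous_on UNIV f"
 have "\<exists>B. \<forall>t\<in>{0..T}. \<bar>f t\<bar> \<le> B" for T
  using compact_imp_bounded[OF compact_continuous_image[OF continuous_on_subset[OF f subset_UNIV] compact_Icc], of 0 T]
  by (simp add: bounded_iff)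
 then show ?thesis using f by (auto simp: loc_bdd_def borel_measurable_continuous_onI)
qed

section \<open>Algebra of the half-line convolution\<close>

lemma conv_commute: "conv f g = conv g f"
proof
 fix t
 have "conv f g t = \<bar>- 1\<bar> *\<^sub>R (LBINT s. if 0 \<le> t + (- 1) * s \<and> t + (- 1) * s \<le> t then f (t + (- 1) * s) * g (t - (t + (- 1) * s)) else 0)"
  unfolding conv_def by (rule lborel_integral_real_affine) simp
 also have "\<dots> = conv g f t"
  unfolding conv_def by (auto intro!: Bochner_Integration.integral_cong)
 finally show "conv f g t = conv g f t" .
qed

lemma conv_cong:
 assumes "\<And>s. 0 \<le> s \<Longrightarrow> s \<le> t \<Longrightarrow> f s = f' s" "\<And>s. 0 \<le> s \<Longrightarrow> s \<le> t \<Longrightarrow> g s = g' s"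
 shows "conv f g t = conv f' g' t"
 unfolding conv_def by (rule Bochner_Integration.integral_cong) (use assms in auto)

lemma conv_add_right:
 assumes f: "loc_bdd f" and g: "loc_bdd g" and h: "loc_bdd h"
 shows "conv f (\<lambda>s. g s + h s) t = conv f g t + conv f h t"
 unfolding conv_def
 by (subst Bochner_Integration.integral_add[symmetric, OF conv_integrable[OF f g] conv_integrable[OF f h]])
  (auto intro!: Bochner_Integration.integral_cong simp: algebra_simps)

lemma conv_diff_right:
 assumes f: "loc_bdd f" and g: "loc_bdd g" and h: "loc_bdd h"
 shows "conv f (\<lambda>s. g s - h s) t = conv f g t - conv f h t"
 unfolding conv_def
 by (subst Bochner_Integration.integral_diff[symmetric, OF conv_integrable[OF f g] conv_integrable[OF f h]])
  (auto intro!: Bochner_Integration.integral_cong simp: algebra_simps)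

lemma conv_cmult_right: "conv f (\<lambda>s. c * g s) t = c * conv f g t"
 unfolding conv_def
 by (subst integral_mult_right_zero[symmetric], rule Bochner_Integration.integral_cong) auto

lemma conv_add_left:
 "loc_bdd f \<Longrightarrow> loc_bdd g \<Longrightarrow> loc_bdd h \<Longrightarrow> conv (\<lambda>s. g s + h s) f t = conv g f t + conv h f t"
 using conv_add_right[of f g h t] by (simp add: conv_commute)

lemma conv_diff_left:
 "loc_bdd f \<Longrightarrow> loc_bdd g \<Longrightarrow> loc_bdd h \<Longrightarrow> conv (\<lambda>s. g s - h s) f t = conv g f t - conv h f t"
 using conv_diff_right[of f g h t] by (simp add: conv_commute)

text \<open>Both sides integrate f u * g (s - u) * h (t - s) over the triangle 0 \<le> u \<le> s
  \<le> t; the substitution s = u + v produces the right-hand side.\<close>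

lemma conv_assoc:
 assumes f: "loc_bdd f" and g: "loc_bdd g" and h: "loc_bdd h"
 shows "conv (conv f g) h t = conv f (conv g h) t"
proof -
 note [measurable] = loc_bdd_measurable[OF f] loc_bdd_measurable[OF g] loc_bdd_measurable[OF h]
 obtain B where B: "0 \<le> B" "\<And>s. 0 \<le> s \<Longrightarrow> s \<le> t \<Longrightarrow> \<bar>f s\<bar> \<le> B" using loc_bdd_obtain[OF f, of t] by blast
 obtain C where C: "0 \<le> C" "\<And>s. 0 \<le> s \<Longrightarrow> s \<le> t \<Longrightarrow> \<bar>g s\<bar> \<le> C" using loc_bdd_obtain[OF g, of t] by blast
 obtain D where D: "0 \<le> D" "\<And>s. 0 \<le> s \<Longrightarrow> s \<le> t \<Longrightarrow> \<bar>h s\<bar> \<le> D" using loc_bdd_obtain[OF h, of t] by blast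
 define F where "F u s = (if 0 \<le> u \<and> u \<le> s \<and> s \<le> t then f u * g (s - u) * h (t - s) else 0)" for u s
 have "conv (conv f g) h t = (LBINT s. LBINT u. F u s)"
  unfolding conv_def F_def
 proof (intro Bochner_Integration.integral_cong refl)
  fix s
  show "(if 0 \<le> s \<and> s \<le> t then (LBINT u. if 0 \<le> u \<and> u \<le> s then f u * g (s - u) else 0) * h (t - s) else 0) =
   (LBINT u. if 0 \<le> u \<and> u \<le> s \<and> s \<le> t then f u * g (s - u) * h (t - s) else 0)"
  proof (cases "0 \<le> s \<and> s \<le> t")
   case True
   have "(LBINT u. if 0 \<le> u \<and> u \<le> s \<and> s \<le> t then f u * g (s - u) * h (t - s) else 0) =
     (LBINT u. (if 0 \<le> u \<and> u \<le> s then f u * g (s - u) else 0) * h (t - s))"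
    by (rule Bochner_Integration.integral_cong) (use True in auto)
   then show ?thesis using True by simp
  next
   case False
   then have *: "(if 0 \<le> u \<and> u \<le> s \<and> s \<le> t then f u * g (s - u) * h (t - s) else 0) = 0" for u by auto
   show ?thesis unfolding if_not_P[OF False] * by simp
  qed
 qed
 also have "\<dots> = (LBINT u. LBINT s. F u s)"
 proof (rule lborel_pair.Fubini_dominated)
  show "case_prod F \<in> borel_measurable (lborel \<Otimes>\<^sub>M lborel)"
   unfolding F_def[abs_def] by measurable
  show "integrable lborel (\<lambda>u. B * C * indicator {0..t} u :: real)" "integrable lborel (\<lambda>u. D * indicator {0..t} u :: real)"
   by simp_all
  fix u s
  have "\<bar>f u * g (s - u) * h (t - s)\<bar> \<le> B * C * D" if "0 \<le> u" "u \<le> s" "s \<le> t"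
   unfolding abs_mult using that B C D by (intro mult_mono) auto
  then show "norm (F u s) \<le> B * C * indicator {0..t} u * (D * indicator {0..t} s)"
   using B C D by (auto simp: F_def indicator_def)
 qed
 also have "\<dots> = conv f (conv g h) t"
  unfolding conv_def
 proof (intro Bochner_Integration.integral_cong refl)
  fix u
  have "(LBINT s. F u s) = \<bar>1\<bar> *\<^sub>R (LBINT v. F u (u + 1 * v))"
   by (rule lborel_integral_real_affine) simp
  also have "\<dots> = (LBINT v. if 0 \<le> u \<and> u \<le> t then f u * (if 0 \<le> v \<and> v \<le> t - u then g v * h (t - u - v) else 0) else 0)"
   by (auto intro!: Bochner_Integration.integral_cong simp: F_def diff_diff_eq)
  also have "\<dots> = (if 0 \<le> u \<and> u \<le> t then f u * (LBINT v. if 0 \<le> v \<and> v \<le> t - u then g v * h (t - u - v) else 0) else 0)"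
  proof (cases "0 \<le> u \<and> u \<le> t")
   case True
   show ?thesis unfolding if_P[OF True] by (rule integral_mult_right_zero)
  next
   case False
   show ?thesis unfolding if_not_P[OF False] by simp
  qed
  finally show "(LBINT s. F u s) = \<dots>" .
 qed
 finally show ?thesis .
qed

text \<open>Integration from 0 is convolution with the constant 1, so that commutativity and
  associativity of \<open>conv\<close> also handle primitives.\<close>

lemma conv_one_alt: "conv (\<lambda>_. 1) f t = (LBINT s. if 0 \<le> s \<and> s \<le> t then f s else 0)"
 unfolding conv_commute[of "\<lambda>_. 1"] by (simp add: conv_def cong: if_cong)

lemma conv_one_integral:
 assumes "loc_bdd f"
 shows "(f has_integral conv (\<lambda>_. 1) f t) {0..t}"
proof -
 have "integrable lborel (\<lambda>s. if 0 \<le> s \<and> s \<le> t then f s else 0)"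
  using conv_integrable[OF assms loc_bdd_const[of 1], of t] by (simp cong: if_cong)
 then have "((\<lambda>s. if 0 \<le> s \<and> s \<le> t then f s else 0) has_integral conv (\<lambda>_. 1) f t) UNIV"
  unfolding conv_one_alt by (rule has_integral_integral_lborel)
 then show ?thesis by (subst has_integral_restrict_UNIV[symmetric]) (simp only: atLeastAtMost_iff)
qed

lemma conv_one_lipschitz:
 assumes f: "loc_bdd f" and st: "0 \<le> s" "s \<le> t" and B: "\<And>u. s \<le> u \<Longrightarrow> u \<le> t \<Longrightarrow> \<bar>f u\<bar> \<le> B"
 shows "\<bar>conv (\<lambda>_. 1) f t - conv (\<lambda>_. 1) f s\<bar> \<le> B * (t - s)"
proof -
 have i: "(f has_integral conv (\<lambda>_. 1) f t) {0..t}" "(f has_integral conv (\<lambda>_. 1) f s) {0..s}"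
  by (rule conv_one_integral[OF f])+
 have int: "f integrable_on {0..t}" using i by blast
 have "integral {0..s} f + integral {s..t} f = integral {0..t} f"
  by (rule Henstock_Kurzweil_Integration.integral_combine[OF st int])
 then have "conv (\<lambda>_. 1) f t - conv (\<lambda>_. 1) f s = integral {s..t} f"
  using i by (simp add: integral_unique)
 moreover have "norm (integral {s..t} f) \<le> B * measure lborel (cbox s t)"
 proof (rule has_integral_bound)
  show "0 \<le> B" using B[of s] st by linarith
  show "(f has_integral integral {s..t} f) (cbox s t)"
   using integrable_on_subinterval[OF int, of s t] st by (simp add: integrable_integral)
 qed (use B in auto)
 ultimately show ?thesis using st by simp
qed

lemma continuous_on_atLeast_if_Icc:
 fixes f :: "real \<Rightarrow> 'a::topological_space"
 assumes "\<And>T. continuous_on {0..T} f"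
 shows "continuous_on {0..} f"
 unfolding continuous_on_eq_continuous_within
proof
 fix x :: real assume x: "x \<in> {0..}"
 have "at x within {0..} = at x within {0..x + 1}"
  by (rule at_within_nhd[of x "{..<x + 1}"]) auto
 moreover have "continuous (at x within {0..x + 1}) f"
  using assms[of "x + 1"] x unfolding continuous_on_eq_continuous_within by simp
 ultimately show "continuous (at x within {0..}) f" by (simp add: continuous_within)
qed

lemma continuous_on_conv_one:
 assumes f: "loc_bdd f"
 shows "continuous_on {0..} (conv (\<lambda>_. 1) f)"
proof -
 have "continuous_on {0..T} (conv (\<lambda>_. 1) f)" for T
 proof -
  obtain B where B: "0 \<le> B" "\<And>s. 0 \<le> s \<Longrightarrow> s \<le> T \<Longrightarrow> \<bar>f s\<bar> \<le> B" using loc_bdd_obtain[OF f, of T] by blast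
  have "B-lipschitz_on {0..T} (conv (\<lambda>_. 1) f)"
  proof (rule lipschitz_onI)
   fix x y assume xy: "x \<in> {0..T}" "y \<in> {0..T}"
   show "dist (conv (\<lambda>_. 1) f x) (conv (\<lambda>_. 1) f y) \<le> B * dist x y"
   proof (cases "x \<le> y")
    case True
    then show ?thesis using conv_one_lipschitz[OF f, of x y B] xy B by (simp add: dist_real_def abs_minus_commute)
   next
    case False
    then show ?thesis using conv_one_lipschitz[OF f, of y x B] xy B by (simp add: dist_real_def)
   qed
  qed (rule B)
  then show ?thesis by (rule lipschitz_on_continuous_on)
 qed
 then show ?thesis by (rule continuous_on_atLeast_if_Icc)
qed

section \<open>Finite measures on the past and the history operator\<close>

locale past_measure = finite_measure \<mu> for \<mu> :: "real measure" +
 fixes r :: real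
 assumes r_pos: "0 < r" and sets_mu [measurable_cong]: "sets \<mu> = sets borel"
  and support: "AE \<theta> in \<mu>. -r \<le> \<theta> \<and> \<theta> \<le> 0"
begin

text \<open>The mass of the delays not exceeding v; it is the kernel that appears when the delay
  term is integrated in time.\<close>

definition ker :: "real \<Rightarrow> real" where
 "ker v = measure \<mu> {-v..}"

text \<open>The part of the delay term that sees x at nonnegative times: x is extended by zero, and
  the initial segment is treated separately as a forcing.\<close>

definition hist :: "(real \<Rightarrow> real) \<Rightarrow> real \<Rightarrow> real" where
 "hist x t = (LINT \<theta>|\<mu>. (if 0 \<le> t + \<theta> then x (t + \<theta>) else 0))"

abbreviation mass :: real where "mass \<equiv> measure \<mu> (space \<mu>)"

lemma space_mu [simp]: "space \<mu> = UNIV"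
 using sets_eq_imp_space_eq[OF sets_mu] by simp

lemma ker_bounds: "0 \<le> ker v" "ker v \<le> mass"
 unfolding ker_def by (simp, rule bounded_measure)

lemma ker_mono: "mono ker"
 unfolding ker_def by (intro monoI finite_measure_mono) auto

lemma loc_bdd_ker: "loc_bdd ker"
 unfolding loc_bdd_def using borel_measurable_mono[OF ker_mono] ker_bounds
 by (auto intro!: exI[of _ mass] simp del: space_mu)

lemma pair_lborel: "pair_sigma_finite \<mu> lborel" "pair_sigma_finite lborel \<mu>"
 by (intro pair_sigma_finite.intro sigma_finite_measure_axioms lborel.sigma_finite_measure_axioms)+

lemma hist_measurable:
 assumes [measurable]: "x \<in> borel_measurable borel"
 shows "hist x \<in> borel_measurable borel"
 unfolding hist_def[abs_def] by measurable

lemma hist_bound: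
 assumes [measurable]: "x \<in> borel_measurable borel" and B: "\<And>s. 0 \<le> s \<Longrightarrow> t - r \<le> s \<Longrightarrow> s \<le> t \<Longrightarrow> \<bar>x s\<bar> \<le> B" and B0: "0 \<le> B"
 shows "\<bar>hist x t\<bar> \<le> mass * B"
proof -
 have "norm (hist x t) \<le> (LINT v|\<mu>. norm (if 0 \<le> t + v then x (t + v) else 0))"
  unfolding hist_def by (rule integral_norm_bound)
 also have "\<dots> \<le> (LINT v|\<mu>. B)"
 proof (rule integral_mono_AE)
  have *: "AE v in \<mu>. norm (if 0 \<le> t + v then x (t + v) else 0) \<le> B"
   using support by eventually_elim (use B B0 in auto)
  then show "AE v in \<mu>. norm (if 0 \<le> t + v then x (t + v) else 0) \<le> B" .
  show "integrable \<mu> (\<lambda>v. norm (if 0 \<le> t + v then x (t + v) else 0))"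
   by (rule integrable_const_bound[where B = B]) (use * in \<open>auto elim: eventually_mono\<close>)
 qed simp
 finally show ?thesis by simp
qed

lemma loc_bdd_hist:
 assumes x: "loc_bdd x"
 shows "loc_bdd (hist x)"
 unfolding loc_bdd_def
proof (intro conjI allI)
 note [measurable] = loc_bdd_measurable[OF x]
 show "hist x \<in> borel_measurable borel" by (rule hist_measurable) simp
 fix T
 obtain B where B: "0 \<le> B" "\<And>s. 0 \<le> s \<Longrightarrow> s \<le> T \<Longrightarrow> \<bar>x s\<bar> \<le> B" using loc_bdd_obtain[OF x, of T] by blast
 show "\<exists>B. \<forall>t\<in>{0..T}. \<bar>hist x t\<bar> \<le> B"
  by (rule exI[of _ "mass * B"]) (use B in \<open>auto intro!: hist_bound simp del: space_mu\<close>)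
qed

text \<open>Fubini: the value x u enters with the mass of those v for which u \<le> t + v.\<close>

lemma hist_conv_one:
 assumes x: "loc_bdd x" and t: "0 \<le> t"
 shows "hist (conv (\<lambda>_. 1) x) t = conv ker x t"
proof -
 note [measurable] = loc_bdd_measurable[OF x]
 obtain B where B: "0 \<le> B" "\<And>s. 0 \<le> s \<Longrightarrow> s \<le> t \<Longrightarrow> \<bar>x s\<bar> \<le> B" using loc_bdd_obtain[OF x, of t] by blast
 define F where "F v u = (if 0 \<le> u \<and> u \<le> t \<and> u \<le> t + v then x u else 0)" for v u
 have "hist (conv (\<lambda>_. 1) x) t = (LINT v|\<mu>. (LBINT u. F v u))"
  unfolding hist_def conv_one_alt
 proof (rule integral_cong_AE)
  show "AE v in \<mu>. (if 0 \<le> t + v then (LBINT s. if 0 \<le> s \<and> s \<le> t + v then x s else 0) else 0) = (LBINT u. F v u)"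
   using support
  proof eventually_elim
   case (elim v)
   show ?case
   proof (cases "0 \<le> t + v")
    case True
    then show ?thesis using elim by (auto simp: F_def intro!: Bochner_Integration.integral_cong)
   next
    case False
    then have "F v u = 0" for u by (auto simp: F_def)
    then show ?thesis using False by simp
   qed
  qed
  show "(\<lambda>v. LBINT u. F v u) \<in> borel_measurable \<mu>"
   unfolding F_def by measurable
 qed measurable
 also have "\<dots> = (LBINT u. (LINT v|\<mu>. F v u))"
 proof (rule pair_sigma_finite.Fubini_dominated[OF pair_lborel(1), symmetric])
  show "case_prod F \<in> borel_measurable (\<mu> \<Otimes>\<^sub>M lborel)" unfolding F_def[abs_def] by measurable
  show "integrable \<mu> (\<lambda>_. 1::real)" by simp
  show "integrable lborel (\<lambda>u. B * indicator {0..t} u)" by (intro integrable_mult_right integrable_indicator_Icc)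
  show "norm (F v u) \<le> 1 * (B * indicator {0..t} u)" for v u
   using B by (auto simp: F_def indicator_def)
 qed
 also have "\<dots> = conv x ker t"
  unfolding conv_def
 proof (intro Bochner_Integration.integral_cong refl)
  fix u
  have "F v u = (if 0 \<le> u \<and> u \<le> t then x u else 0) * indicator {-(t - u)..} v" for v
   by (auto simp: F_def indicator_def)
  then have "(LINT v|\<mu>. F v u) = (if 0 \<le> u \<and> u \<le> t then x u else 0) * ker (t - u)"
   by (simp add: ker_def)
  then show "(LINT v|\<mu>. F v u) = (if 0 \<le> u \<and> u \<le> t then x u * ker (t - u) else 0)" by simp
 qed
 finally show ?thesis by (simp add: conv_commute)
qed

text \<open>A shift by v commutes with integration from 0, because the extension by zero makes both
  primitives start at time 0. Together with \<open>hist_conv_one\<close>, integrating the delay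
  equation in time yields a Volterra equation with kernel \<open>ker\<close>.\<close>

lemma conv_one_hist:
 assumes x: "loc_bdd x" and t: "0 \<le> t"
 shows "conv (\<lambda>_. 1) (hist x) t = hist (conv (\<lambda>_. 1) x) t"
proof -
 note [measurable] = loc_bdd_measurable[OF x]
 obtain B where B: "0 \<le> B" "\<And>s. 0 \<le> s \<Longrightarrow> s \<le> t \<Longrightarrow> \<bar>x s\<bar> \<le> B" using loc_bdd_obtain[OF x, of t] by blast
 define F where "F s v = (if 0 \<le> s \<and> s \<le> t \<and> v \<le> 0 \<and> 0 \<le> s + v then x (s + v) else 0)" for s v
 have "conv (\<lambda>_. 1) (hist x) t = (LBINT s. (LINT v|\<mu>. F s v))"
  unfolding conv_one_alt hist_def
 proof (intro Bochner_Integration.integral_cong refl)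
  fix s
  show "(if 0 \<le> s \<and> s \<le> t then (LINT v|\<mu>. (if 0 \<le> s + v then x (s + v) else 0)) else 0) = (LINT v|\<mu>. F s v)"
  proof (cases "0 \<le> s \<and> s \<le> t")
   case True
   have "(LINT v|\<mu>. (if 0 \<le> s + v then x (s + v) else 0)) = (LINT v|\<mu>. F s v)"
   proof (rule integral_cong_AE)
    show "AE v in \<mu>. (if 0 \<le> s + v then x (s + v) else 0) = F s v"
     using support by eventually_elim (use True in \<open>auto simp: F_def\<close>)
   qed (unfold F_def, measurable)
   then show ?thesis using True by simp
  next
   case False
   then have *: "F s v = 0" for v by (auto simp: F_def)
   show ?thesis unfolding if_not_P[OF False] * by simp
  qed
 qed
 also have "\<dots> = (LINT v|\<mu>. (LBINT s. F s v))"
 proof (rule pair_sigma_finite.Fubini_dominated[OF pair_lborel(2), symmetric])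
  show "case_prod F \<in> borel_measurable (lborel \<Otimes>\<^sub>M \<mu>)" unfolding F_def[abs_def] by measurable
  show "integrable \<mu> (\<lambda>_. 1::real)" by simp
  show "integrable lborel (\<lambda>u. B * indicator {0..t} u)" by (intro integrable_mult_right integrable_indicator_Icc)
  show "norm (F s v) \<le> B * indicator {0..t} s * 1" for v s
   using B by (auto simp: F_def indicator_def)
 qed
 also have "\<dots> = hist (conv (\<lambda>_. 1) x) t"
  unfolding hist_def conv_one_alt
 proof (rule integral_cong_AE)
  show "AE v in \<mu>. (LBINT s. F s v) = (if 0 \<le> t + v then (LBINT s. if 0 \<le> s \<and> s \<le> t + v then x s else 0) else 0)"
   using support
  proof eventually_elim
   case (elim v)
   have "(LBINT s. F s v) = \<bar>1\<bar> *\<^sub>R (LBINT u. F (- v + 1 * u) v)"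
    by (rule lborel_integral_real_affine) simp
   also have "\<dots> = (LBINT u. if 0 \<le> u \<and> u \<le> t + v then x u else 0)"
    unfolding abs_one scaleR_one
    by (intro Bochner_Integration.integral_cong refl) (use elim in \<open>auto simp: F_def\<close>)
   also have "\<dots> = (if 0 \<le> t + v then (LBINT s. if 0 \<le> s \<and> s \<le> t + v then x s else 0) else 0)"
   proof (cases "0 \<le> t + v")
    case False
    then have *: "(if 0 \<le> u \<and> u \<le> t + v then x u else 0) = 0" for u by auto
    show ?thesis unfolding if_not_P[OF False] * by simp
   qed simp
   finally show ?case .
  qed
  show "(\<lambda>v. LBINT s. F s v) \<in> borel_measurable \<mu>"
   unfolding F_def by measurable
 qed measurable
 finally show ?thesis .
qed

lemma hist_const_one: "0 \<le> t \<Longrightarrow> hist (\<lambda>_. 1) t = ker t"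
proof -
 have "hist (\<lambda>_. 1) t = (LINT v|\<mu>. indicator {-t..} v)"
  unfolding hist_def by (intro Bochner_Integration.integral_cong) (auto simp: indicator_def)
 then show ?thesis by (simp add: ker_def)
qed

lemma hist_integrable:
 assumes x: "loc_bdd x"
 shows "integrable \<mu> (\<lambda>v. if 0 \<le> t + v then x (t + v) else 0)"
proof -
 note [measurable] = loc_bdd_measurable[OF x]
 obtain B where B: "0 \<le> B" "\<And>s. 0 \<le> s \<Longrightarrow> s \<le> t \<Longrightarrow> \<bar>x s\<bar> \<le> B" using loc_bdd_obtain[OF x, of t] by blast
 show ?thesis
 proof (rule integrable_const_bound[where B = B])
  show "AE v in \<mu>. norm (if 0 \<le> t + v then x (t + v) else 0) \<le> B"
   using support by eventually_elim (use B in auto)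
 qed measurable
qed

lemma hist_add:
 assumes x: "loc_bdd x" and y: "loc_bdd y"
 shows "hist (\<lambda>t. x t + y t) t = hist x t + hist y t"
 unfolding hist_def
 by (subst Bochner_Integration.integral_add[symmetric, OF hist_integrable[OF x] hist_integrable[OF y]])
  (rule Bochner_Integration.integral_cong, auto)

lemma hist_cmult: "hist (\<lambda>t. c * x t) t = c * hist x t"
 unfolding hist_def
 by (subst integral_mult_right_zero[symmetric]) (rule Bochner_Integration.integral_cong, auto)

lemma hist_cong: "(\<And>s. 0 \<le> s \<Longrightarrow> s \<le> t \<Longrightarrow> x s = y s) \<Longrightarrow> x \<in> borel_measurable borel \<Longrightarrow>
  y \<in> borel_measurable borel \<Longrightarrow> hist x t = hist y t"
proof -
 assume e: "\<And>s. 0 \<le> s \<Longrightarrow> s \<le> t \<Longrightarrow> x s = y s" and [measurable]: "x \<in> borel_measurable borel" "y \<in> borel_measurable borel"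
 show ?thesis unfolding hist_def
 proof (rule integral_cong_AE)
  show "AE v in \<mu>. (if 0 \<le> t + v then x (t + v) else 0) = (if 0 \<le> t + v then y (t + v) else 0)"
   using support by eventually_elim (use e in auto)
 qed measurable
qed

end

section \<open>Resolvent kernel and fundamental solution\<close>

locale delay_kernel =
 p: past_measure \<mu>p r + n: past_measure \<mu>n r for \<mu>p \<mu>n :: "real measure" and r :: real
begin

text \<open>The added 1 makes K at least 1, whatever the measures.\<close>

definition K :: real where "K = measure \<mu>p UNIV + measure \<mu>n UNIV + 1"

text \<open>Polymorphic, since the same functional acts on real segments and on complex
  exponentials.\<close>

definition lin :: "(real \<Rightarrow> 'c::{banach, second_countable_topology}) \<Rightarrow> 'c" where
 "lin f = integral\<^sup>L \<mu>p f - integral\<^sup>L \<mu>n f"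

definition k :: "real \<Rightarrow> real" where "k v = p.ker v - n.ker v"

definition hist :: "(real \<Rightarrow> real) \<Rightarrow> real \<Rightarrow> real" where
 "hist x t = lin (\<lambda>\<theta>. if 0 \<le> t + \<theta> then x (t + \<theta>) else 0)"

lemma hist_alt: "hist x t = p.hist x t - n.hist x t"
 by (simp add: hist_def lin_def p.hist_def n.hist_def)

lemma K_pos: "1 \<le> K" by (simp add: K_def)

lemma k_bound: "\<bar>k v\<bar> \<le> K"
 using p.ker_bounds[of v] n.ker_bounds[of v] by (auto simp: k_def K_def)

lemma loc_bdd_k: "loc_bdd k"
 unfolding k_def[abs_def] by (intro loc_bdd_diff p.loc_bdd_ker n.loc_bdd_ker)

lemma loc_bdd_hist: "loc_bdd x \<Longrightarrow> loc_bdd (hist x)"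
 unfolding hist_alt[abs_def] by (intro loc_bdd_diff p.loc_bdd_hist n.loc_bdd_hist)

lemma hist_conv_one:
 assumes x: "loc_bdd x" and t: "0 \<le> t"
 shows "hist (conv (\<lambda>_. 1) x) t = conv k x t"
 unfolding hist_alt k_def[abs_def] p.hist_conv_one[OF x t] n.hist_conv_one[OF x t]
 by (rule conv_diff_left[OF x p.loc_bdd_ker n.loc_bdd_ker, symmetric])

lemma conv_one_hist:
 assumes x: "loc_bdd x" and t: "0 \<le> t"
 shows "conv (\<lambda>_. 1) (hist x) t = conv k x t"
proof -
 have "conv (\<lambda>_. 1) (hist x) t = p.hist (conv (\<lambda>_. 1) x) t - n.hist (conv (\<lambda>_. 1) x) t"
  unfolding hist_alt[abs_def] p.conv_one_hist[OF x t, symmetric] n.conv_one_hist[OF x t, symmetric]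
  by (rule conv_diff_right[OF loc_bdd_const p.loc_bdd_hist[OF x] n.loc_bdd_hist[OF x]])
 then show ?thesis using hist_conv_one[OF x t] by (simp add: hist_alt)
qed

lemma hist_bound:
 assumes "x \<in> borel_measurable borel" "\<And>s. 0 \<le> s \<Longrightarrow> t - r \<le> s \<Longrightarrow> s \<le> t \<Longrightarrow> \<bar>x s\<bar> \<le> B" "0 \<le> B"
 shows "\<bar>hist x t\<bar> \<le> K * B"
proof -
 have "\<bar>hist x t\<bar> \<le> \<bar>p.hist x t\<bar> + \<bar>n.hist x t\<bar>" by (simp add: hist_alt)
 also have "\<dots> \<le> measure \<mu>p UNIV * B + measure \<mu>n UNIV * B"
  using p.hist_bound[of x t B] n.hist_bound[of x t B] assms by (intro add_mono) auto
 also have "\<dots> \<le> K * B" using \<open>0 \<le> B\<close> by (simp add: K_def algebra_simps)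
 finally show ?thesis .
qed

primrec iter_ker :: "nat \<Rightarrow> real \<Rightarrow> real" where
 "iter_ker 0 = k"
| "iter_ker (Suc n) = conv k (iter_ker n)"

text \<open>The Neumann series of the convolution powers of k: the resolvent of the Volterra
  equation x = F + conv k x.\<close>

definition R :: "real \<Rightarrow> real" where "R t = (\<Sum>n. iter_ker n t)"

text \<open>The fundamental solution, a primitive of R with S 0 = 1; \<open>sol_indicator\<close>
  identifies it with the solution started from the indicator of {0}.\<close>

definition S :: "real \<Rightarrow> real" where "S t = 1 + conv (\<lambda>_. 1) R t"

lemma loc_bdd_iter_ker: "loc_bdd (iter_ker n)"
 by (induction n) (auto intro: loc_bdd_k loc_bdd_conv)

text \<open>Each convolution integrates a power of s once more, which produces the factorial; hence
  the series converges at every time and R grows at most exponentially.\<close>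

lemma iter_ker_bound: "0 \<le> t \<Longrightarrow> \<bar>iter_ker n t\<bar> \<le> K * ((K * t) ^ n / fact n)"
proof (induction n arbitrary: t)
 case 0
 then show ?case using k_bound by simp
next
 case (Suc n)
 have m[measurable]: "iter_ker n \<in> borel_measurable borel" "k \<in> borel_measurable borel"
  using loc_bdd_iter_ker loc_bdd_k by (auto dest: loc_bdd_measurable)
 have "\<bar>iter_ker (Suc n) t\<bar> = \<bar>conv (iter_ker n) k t\<bar>" by (simp add: conv_commute)
 also have "\<dots> \<le> (LBINT s. norm (if 0 \<le> s \<and> s \<le> t then iter_ker n s * k (t - s) else 0))"
  unfolding conv_def real_norm_def[symmetric] by (rule integral_norm_bound)
 also have "\<dots> \<le> (LBINT s. if 0 \<le> s \<and> s \<le> t then K * K * (K ^ n / fact n) * s ^ n else 0)"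
 proof (rule integral_mono)
  show "integrable lborel (\<lambda>s. norm (if 0 \<le> s \<and> s \<le> t then iter_ker n s * k (t - s) else 0))"
   by (intro integrable_norm conv_integrable loc_bdd_iter_ker loc_bdd_k)
  show "integrable lborel (\<lambda>s. if 0 \<le> s \<and> s \<le> t then K * K * (K ^ n / fact n) * s ^ n else 0)"
   by (rule integrable_if_interval[where B = "K * K * (K ^ n / fact n) * t ^ n"])
    (use K_pos in \<open>auto simp: abs_mult intro!: mult_mono power_mono divide_right_mono\<close>)
  fix s
  have "\<bar>iter_ker n s * k (t - s)\<bar> \<le> K * ((K * s) ^ n / fact n) * K" if "0 \<le> s"
   unfolding abs_mult by (intro mult_mono Suc.IH that k_bound) (use K_pos that in auto)
  then show "norm (if 0 \<le> s \<and> s \<le> t then iter_ker n s * k (t - s) else 0) \<le>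
    (if 0 \<le> s \<and> s \<le> t then K * K * (K ^ n / fact n) * s ^ n else 0)"
   by (auto simp: power_mult_distrib mult_ac)
 qed
 also have "\<dots> = K * K * (K ^ n / fact n) * (LBINT s. if 0 \<le> s \<and> s \<le> t then s ^ n else 0)"
  by (subst integral_mult_right_zero[symmetric], rule Bochner_Integration.integral_cong) auto
 also have "(LBINT s. if 0 \<le> s \<and> s \<le> t then s ^ n else 0) = t ^ Suc n / Suc n"
 proof -
  have "(LBINT s. if 0 \<le> s \<and> s \<le> t then s ^ n else 0) = (LBINT s. s ^ n * indicator {0..t} s)"
   by (rule Bochner_Integration.integral_cong) (auto simp: indicator_def)
  also have "\<dots> = t ^ Suc n / Suc n" using integral_power[OF Suc.prems, of n] by simp
  finally show ?thesis .
 qed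
 finally show ?case by (simp add: power_mult_distrib field_simps)
qed

lemma summable_iter_ker_bound: "summable (\<lambda>n. K * ((K * t) ^ n / fact n))"
 using summable_exp[of "K * t"] by (intro summable_mult) (simp add: divide_inverse mult.commute)

lemma summable_iter_ker: "0 \<le> t \<Longrightarrow> summable (\<lambda>n. iter_ker n t)"
 by (rule summable_comparison_test[OF _ summable_iter_ker_bound[of t]]) (use iter_ker_bound in auto)

lemma R_bound: "0 \<le> t \<Longrightarrow> \<bar>R t\<bar> \<le> K * exp (K * t)"
proof -
 assume t: "0 \<le> t"
 have e: "(\<lambda>n. (K * t) ^ n / fact n) sums exp (K * t)"
  using exp_converges[of "K * t"] by (simp add: divide_inverse mult.commute)
 have s: "summable (\<lambda>n. norm (iter_ker n t))"
  by (rule summable_comparison_test[OF _ summable_iter_ker_bound[of t]]) (use iter_ker_bound t in auto)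
 have "norm (R t) \<le> (\<Sum>n. norm (iter_ker n t))" unfolding R_def by (rule summable_norm[OF s])
 also have "\<dots> \<le> (\<Sum>n. K * ((K * t) ^ n / fact n))"
  by (rule suminf_le[OF _ s summable_iter_ker_bound]) (use iter_ker_bound t in auto)
 also have "\<dots> = K * exp (K * t)" using sums_mult[OF e, of K] by (simp add: sums_iff)
 finally show ?thesis by simp
qed

lemma loc_bdd_R: "loc_bdd R"
 unfolding loc_bdd_def
proof (intro conjI allI)
 have [measurable]: "iter_ker n \<in> borel_measurable borel" for n
  using loc_bdd_iter_ker by (auto dest: loc_bdd_measurable)
 show "R \<in> borel_measurable borel" unfolding R_def[abs_def] by measurable
 fix T
 have "\<bar>R t\<bar> \<le> K * exp (K * T)" if "t \<in> {0..T}" for t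
 proof -
  have "\<bar>R t\<bar> \<le> K * exp (K * t)" using R_bound that by auto
  also have "\<dots> \<le> K * exp (K * T)" using that K_pos by auto
  finally show ?thesis .
 qed
 then show "\<exists>B. \<forall>t\<in>{0..T}. \<bar>R t\<bar> \<le> B" by blast
qed

text \<open>Convolution with k shifts the Neumann series by one term. The factorial bounds justify
  summation under the integral.\<close>

lemma R_eq: 
 assumes t: "0 \<le> t"
 shows "R t = k t + conv k R t"
proof -
 have m[measurable]: "iter_ker n \<in> borel_measurable borel" "k \<in> borel_measurable borel" for n
  using loc_bdd_iter_ker loc_bdd_k by (auto dest: loc_bdd_measurable)
 have "(\<lambda>n. LBINT s. if 0 \<le> s \<and> s \<le> t then k s * iter_ker n (t - s) else 0) sums
   (LBINT s. \<Sum>n. if 0 \<le> s \<and> s \<le> t then k s * iter_ker n (t - s) else 0)"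
 proof (rule sums_integral)
  show "integrable lborel (\<lambda>s. if 0 \<le> s \<and> s \<le> t then k s * iter_ker n (t - s) else 0)" for n
   by (intro conv_integrable loc_bdd_iter_ker loc_bdd_k)
  have bd: "norm (if 0 \<le> s \<and> s \<le> t then k s * iter_ker n (t - s) else 0) \<le> K * (K * ((K * t) ^ n / fact n)) * indicator {0..t} s" for n s
  proof (cases "0 \<le> s \<and> s \<le> t")
   case True
   have "\<bar>iter_ker n (t - s)\<bar> \<le> K * ((K * (t - s)) ^ n / fact n)" using True by (intro iter_ker_bound) auto
   also have "\<dots> \<le> K * ((K * t) ^ n / fact n)"
    using True K_pos by (intro mult_left_mono divide_right_mono power_mono) auto
   finally have "\<bar>k s\<bar> * \<bar>iter_ker n (t - s)\<bar> \<le> K * (K * ((K * t) ^ n / fact n))"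
    by (intro mult_mono k_bound) (use K_pos in auto)
   then show ?thesis using True by (simp add: abs_mult)
  qed (auto simp: indicator_def)
  have sm: "summable (\<lambda>n. K * (K * ((K * t) ^ n / fact n)))"
   by (rule summable_mult[OF summable_iter_ker_bound])
  show "AE s in lborel. summable (\<lambda>n. norm (if 0 \<le> s \<and> s \<le> t then k s * iter_ker n (t - s) else 0))"
  proof (intro always_eventually allI)
   fix s
   show "summable (\<lambda>n. norm (if 0 \<le> s \<and> s \<le> t then k s * iter_ker n (t - s) else 0))"
    by (rule summable_comparison_test[OF _ summable_mult2[OF sm, of "indicator {0..t} s"]]) (use bd in auto)
  qed
  show "summable (\<lambda>n. LBINT s. norm (if 0 \<le> s \<and> s \<le> t then k s * iter_ker n (t - s) else 0))"
  proof (rule summable_comparison_test[OF _ summable_mult2[OF sm, of t]], intro exI[of _ 0] allI impI)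
   fix n
   have "(LBINT s. norm (if 0 \<le> s \<and> s \<le> t then k s * iter_ker n (t - s) else 0)) \<le> (LBINT s. K * (K * ((K * t) ^ n / fact n)) * indicator {0..t} s)"
    by (rule integral_mono) (use bd in \<open>auto intro!: integrable_norm conv_integrable loc_bdd_iter_ker loc_bdd_k simp del: real_norm_def\<close>)
   also have "\<dots> = K * (K * ((K * t) ^ n / fact n)) * t" by (simp only: integral_indicator_Icc[OF t] diff_zero)
   finally show "norm (LBINT s. norm (if 0 \<le> s \<and> s \<le> t then k s * iter_ker n (t - s) else 0)) \<le> K * (K * ((K * t) ^ n / fact n)) * t"
    by simp
  qed
 qed
 moreover have "(LBINT s. \<Sum>n. if 0 \<le> s \<and> s \<le> t then k s * iter_ker n (t - s) else 0) = conv k R t"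
  unfolding conv_def
 proof (intro Bochner_Integration.integral_cong refl)
  fix s
  show "(\<Sum>n. if 0 \<le> s \<and> s \<le> t then k s * iter_ker n (t - s) else 0) = (if 0 \<le> s \<and> s \<le> t then k s * R (t - s) else 0)"
  proof (cases "0 \<le> s \<and> s \<le> t")
   case True
   then show ?thesis unfolding R_def using suminf_mult[OF summable_iter_ker[of "t - s"], of "k s"] by simp
  next
   case False
   show ?thesis unfolding if_not_P[OF False] by simp
  qed
 qed
 ultimately have "(\<lambda>n. iter_ker (Suc n) t) sums conv k R t"
  by (simp add: conv_def)
 moreover have "(\<lambda>n. iter_ker (Suc n) t) sums (R t - iter_ker 0 t)"
  using sums_split_initial_segment[OF summable_sums[OF summable_iter_ker[OF t]], of 1] by (simp add: R_def)
 ultimately have "conv k R t = R t - iter_ker 0 t" by (rule sums_unique2)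
 then show ?thesis by simp
qed

lemma loc_bdd_S: "loc_bdd S"
 unfolding S_def[abs_def] by (intro loc_bdd_add loc_bdd_const loc_bdd_conv loc_bdd_R)

lemma continuous_on_S: "continuous_on {0..} S"
 unfolding S_def[abs_def] by (intro continuous_intros continuous_on_conv_one loc_bdd_R)

lemma S_0: "S 0 = 1"
proof -
 have "integral {0..0} R = conv (\<lambda>_. 1) R 0" by (rule integral_unique[OF conv_one_integral[OF loc_bdd_R]])
 then have "conv (\<lambda>_. 1) R 0 = 0" by simp
 then show ?thesis by (simp add: S_def)
qed

lemma hist_add: "loc_bdd x \<Longrightarrow> loc_bdd y \<Longrightarrow> hist (\<lambda>t. x t + y t) t = hist x t + hist y t"
 by (simp add: hist_alt p.hist_add n.hist_add)

lemma hist_cmult: "hist (\<lambda>t. c * x t) t = c * hist x t"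
 by (simp add: hist_alt p.hist_cmult n.hist_cmult right_diff_distrib)

lemma hist_cong: "(\<And>s. 0 \<le> s \<Longrightarrow> s \<le> t \<Longrightarrow> x s = y s) \<Longrightarrow> x \<in> borel_measurable borel \<Longrightarrow>
  y \<in> borel_measurable borel \<Longrightarrow> hist x t = hist y t"
 unfolding hist_alt using p.hist_cong[of t x y] n.hist_cong[of t x y] by simp

text \<open>As S is a primitive of R, this is the delay equation for S.\<close>

lemma R_eq_hist_S: "0 \<le> t \<Longrightarrow> R t = hist S t"
proof -
 assume t: "0 \<le> t"
 have "hist S t = hist (\<lambda>_. 1) t + hist (conv (\<lambda>_. 1) R) t"
  unfolding S_def[abs_def] by (rule hist_add) (intro loc_bdd_const loc_bdd_conv loc_bdd_R)+
 also have "hist (\<lambda>_. 1) t = k t"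
  by (simp add: hist_alt p.hist_const_one[OF t] n.hist_const_one[OF t] k_def)
 finally show ?thesis using R_eq[OF t] hist_conv_one[OF loc_bdd_R t] by simp
qed

text \<open>Convolution with the resolvent inverts x - conv k x, by associativity and
  \<open>R_eq\<close>; this is uniqueness for the Volterra equation.\<close>

lemma volterra_solution:
 assumes x: "loc_bdd x" and t: "0 \<le> t"
 shows "x t = (x t - conv k x t) + conv R (\<lambda>s. x s - conv k x s) t"
proof -
 note lb = loc_bdd_R loc_bdd_k x loc_bdd_conv
 have "conv R (\<lambda>s. x s - conv k x s) t = conv R x t - conv R (conv k x) t"
  by (intro conv_diff_right lb)
 also have "conv R (conv k x) t = conv (conv k R) x t"
  using conv_assoc[OF loc_bdd_R loc_bdd_k x, of t] by (simp add: conv_commute)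
 also have "conv R x t - conv (conv k R) x t = conv (\<lambda>s. R s - conv k R s) x t"
  by (intro conv_diff_left[symmetric] lb)
 also have "\<dots> = conv k x t" by (rule conv_cong) (use R_eq in auto)
 finally show ?thesis by simp
qed

lemma volterra_exists:
 assumes F: "loc_bdd F" and t: "0 \<le> t"
 shows "F t + conv R F t = F t + conv k (\<lambda>s. F s + conv R F s) t"
proof -
 note lb = loc_bdd_R loc_bdd_k F loc_bdd_conv
 have "conv k (\<lambda>s. F s + conv R F s) t = conv k F t + conv k (conv R F) t"
  by (intro conv_add_right lb)
 also have "conv k (conv R F) t = conv (conv k R) F t"
  by (intro conv_assoc[symmetric] lb)
 also have "conv k F t + conv (conv k R) F t = conv (\<lambda>s. k s + conv k R s) F t"
  by (intro conv_add_left[symmetric] lb)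
 also have "\<dots> = conv R F t" by (rule conv_cong) (use R_eq in auto)
 finally show ?thesis by simp
qed

text \<open>Variation of constants: on a forcing that is a primitive, the resolvent R can be traded
  for S, since S is one plus the primitive of R.\<close>

lemma resolvent_of_primitive:
 assumes f: "loc_bdd f" and t: "0 \<le> t"
 shows "(c + conv (\<lambda>_. 1) f t) + conv R (\<lambda>s. c + conv (\<lambda>_. 1) f s) t = c * S t + conv S f t"
proof -
 note lb = loc_bdd_R f loc_bdd_conv loc_bdd_const
 have "conv R (\<lambda>s. c + conv (\<lambda>_. 1) f s) t = conv R (\<lambda>_. c) t + conv R (conv (\<lambda>_. 1) f) t"
  by (intro conv_add_right lb)
 also have "conv R (\<lambda>_. c) t = c * conv (\<lambda>_. 1) R t"
  using conv_cmult_right[of R c "\<lambda>_. 1" t] by (simp add: conv_commute)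
 also have "conv R (conv (\<lambda>_. 1) f) t = conv (conv (\<lambda>_. 1) R) f t"
  using conv_assoc[of R "\<lambda>_. 1" f t] lb by (simp add: conv_commute)
 finally have "conv R (\<lambda>s. c + conv (\<lambda>_. 1) f s) t = c * conv (\<lambda>_. 1) R t + conv (conv (\<lambda>_. 1) R) f t" .
 moreover have "conv (\<lambda>_. 1) f t + conv (conv (\<lambda>_. 1) R) f t = conv S f t"
  unfolding S_def[abs_def] by (intro conv_add_left[symmetric] lb)
 ultimately show ?thesis by (simp add: S_def algebra_simps)
qed

end

section \<open>Laplace transforms and contour shift\<close>

lemma integrable_inverse_one_plus_square: "integrable lborel (\<lambda>x::real. inverse (1 + x\<^sup>2))"
 using integrable_inverse_1_plus_square by (simp add: set_integrable_def)

lemma integrable_exp_tail: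
 assumes "0 < c"
 shows "integrable lborel (\<lambda>t::real. if 0 \<le> t then exp (- (c * t)) else 0)"
proof -
 interpret prob_space "density lborel (exponential_density c)"
  by (rule prob_space_exponential_density[OF assms])
 have "integrable (density lborel (exponential_density c)) (\<lambda>_. 1::real)" by simp
 then have "integrable lborel (\<lambda>t. exponential_density c t * 1)"
  by (subst (asm) integrable_density) (auto simp: exponential_density_nonneg[OF assms])
 then have "integrable lborel (\<lambda>t. (1 / c) * exponential_density c t)"
  by (intro integrable_mult_right) simp
 then show ?thesis
  by (rule Bochner_Integration.integrable_cong[THEN iffD1, rotated -1])
   (use assms in \<open>auto simp: exponential_density_def mult.commute\<close>)
qed

lemma
 fixes c :: complex
 assumes c: "0 < Re c"
 shows integrable_cexp_tail: "integrable lborel (\<lambda>t. if 0 \<le> t then exp (- (c * of_real t)) else 0)"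
  and integral_cexp_tail: "(CLBINT t. (if 0 \<le> t then exp (- (c * of_real t)) else 0)) = 1 / c"
proof -
 let ?f = "\<lambda>t::real. if 0 \<le> t then exp (- (c * of_real t)) else 0"
 have w: "integrable lborel (\<lambda>t::real. if 0 \<le> t then exp (- (Re c * t)) else 0)"
  by (rule integrable_exp_tail[OF c])
 show i: "integrable lborel ?f"
  by (rule Bochner_Integration.integrable_bound[OF w]) auto
 have "(\<lambda>n. CLBINT t. indicator {0..real n} t *\<^sub>R exp (- (c * of_real t))) \<longlonglongrightarrow> (CLBINT t. ?f t)"
 proof (rule integral_dominated_convergence[OF _ _ w])
  show "AE t in lborel. (\<lambda>n. indicator {0..real n} t *\<^sub>R exp (- (c * of_real t))) \<longlonglongrightarrow> ?f t"
  proof (intro always_eventually allI)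
   fix t :: real
   have "\<forall>\<^sub>F n in sequentially. ?f t = indicator {0..real n} t *\<^sub>R exp (- (c * of_real t))"
   proof (rule eventually_sequentiallyI[of "nat \<lceil>t\<rceil>"])
    fix n assume "nat \<lceil>t\<rceil> \<le> n"
    then have "t \<le> real n" by linarith
    then show "?f t = indicator {0..real n} t *\<^sub>R exp (- (c * of_real t))" by (auto simp: indicator_def)
   qed
   then show "(\<lambda>n. indicator {0..real n} t *\<^sub>R exp (- (c * of_real t))) \<longlonglongrightarrow> ?f t"
    by (rule Lim_transform_eventually[OF tendsto_const])
  qed
  show "AE t in lborel. norm (indicator {0..real n} t *\<^sub>R exp (- (c * of_real t))) \<le> (if 0 \<le> t then exp (- (Re c * t)) else 0)" for n
   by (intro always_eventually allI) (auto simp: indicator_def)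
 qed (use i in \<open>auto dest: borel_measurable_integrable\<close>)
 moreover have "(CLBINT t. indicator {0..real n} t *\<^sub>R exp (- (c * of_real t))) = - exp (- (c * of_real (real n))) / c - (- 1 / c)" for n
 proof -
  have "(CLBINT t. indicator {0..real n} t *\<^sub>R exp (- (c * of_real t))) =
    - exp (- (c * of_real (real n))) / c - (- exp (- (c * of_real 0)) / c)"
  proof (rule integral_FTC_atLeastAtMost)
   fix x :: real
   have "((\<lambda>z. - exp (- (c * z)) / c) has_field_derivative exp (- (c * of_real x))) (at (of_real x))"
    using c by (auto intro!: derivative_eq_intros)
   then show "((\<lambda>t. - exp (- (c * of_real t)) / c) has_vector_derivative exp (- (c * of_real x))) (at x within {0..real n})"
    using has_vector_derivative_real_field by blast
  qed (auto intro!: continuous_intros)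
  then show ?thesis by simp
 qed
 moreover have "(\<lambda>n. - exp (- (c * of_real (real n))) / c - (- 1 / c)) \<longlonglongrightarrow> - 0 / c - (- 1 / c)"
 proof (intro tendsto_intros)
  have "(\<lambda>n. exp (- Re c * real n)) \<longlonglongrightarrow> 0" using c by real_asymp
  then show "(\<lambda>n. exp (- (c * of_real (real n)))) \<longlonglongrightarrow> 0"
   by (intro tendsto_norm_zero_cancel[of "\<lambda>n. exp (- (c * of_real (real n)))"]) simp
 qed (use c in auto)
 ultimately show "(CLBINT t. ?f t) = 1 / c"
  by (metis (no_types, lifting) LIMSEQ_unique minus_divide_left diff_minus_eq_add add_0 minus_zero div_0 minus_minus ext)
qed

section \<open>Moving vertical lines of integration and decay in time\<close>

lemma integral_interval_tendsto:
 fixes f :: "real \<Rightarrow> complex"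
 assumes f: "integrable lborel f" and c: "continuous_on UNIV f"
 shows "(\<lambda>n. integral {- real n..real n} f) \<longlonglongrightarrow> integral\<^sup>L lborel f"
proof -
 have "(\<lambda>n. CLBINT t. indicator {-real n..real n} t *\<^sub>R f t) \<longlonglongrightarrow> integral\<^sup>L lborel f"
 proof (rule integral_dominated_convergence[where w = "\<lambda>t. norm (f t)"])
  show "AE t in lborel. (\<lambda>n. indicator {-real n..real n} t *\<^sub>R f t) \<longlonglongrightarrow> f t"
  proof (intro always_eventually allI)
   fix t :: real
   have "\<forall>\<^sub>F n in sequentially. f t = indicator {-real n..real n} t *\<^sub>R f t"
   proof (rule eventually_sequentiallyI[of "nat \<lceil>\<bar>t\<bar>\<rceil>"])
    fix n assume "nat \<lceil>\<bar>t\<bar>\<rceil> \<le> n"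
    then have "\<bar>t\<bar> \<le> real n" by linarith
    then show "f t = indicator {-real n..real n} t *\<^sub>R f t" by (auto simp: indicator_def)
   qed
   then show "(\<lambda>n. indicator {-real n..real n} t *\<^sub>R f t) \<longlonglongrightarrow> f t"
    by (rule Lim_transform_eventually[OF tendsto_const])
  qed
 qed (use f in \<open>auto dest: borel_measurable_integrable simp: indicator_def\<close>)
 moreover have "(CLBINT t. indicator {-real n..real n} t *\<^sub>R f t) = integral {- real n..real n} f" for n
 proof -
  have "set_integrable lborel {-real n..real n} f"
   unfolding set_integrable_def using f by (intro integrable_mult_indicator) auto
  from set_borel_integral_eq_integral(2)[OF this] show ?thesis
   by (simp add: set_lebesgue_integral_def)
 qed
 ultimately show ?thesis by simp
qed

text \<open>The integrand has a primitive on the convex half-plane, so the integral over a piece of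
  a vertical line is a difference of two of its values. The difference between two lines is then
  carried by two horizontal segments, which vanish in the limit by the decay in Im z. With a = b the
  lemma serves as a norm bound on one line.\<close>

lemma vertical_line_shift:
 fixes G :: "complex \<Rightarrow> complex"
 assumes hol: "G holomorphic_on {z. - \<gamma>0 < Re z}" and ab: "- \<gamma>0 < a" "a \<le> b"
  and bd: "\<And>z. a \<le> Re z \<Longrightarrow> Re z \<le> b \<Longrightarrow> norm (G z) \<le> C * inverse (1 + (Im z)\<^sup>2)"
 shows "(CLBINT t. G (Complex a t)) = (CLBINT t. G (Complex b t))"
  and "norm (CLBINT t. G (Complex a t)) \<le> C * (LBINT t. inverse (1 + t\<^sup>2))"
  and "integrable lborel (\<lambda>t. G (Complex b t))"
proof -
 let ?U = "{z. - \<gamma>0 < Re z}"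
 have conv: "convex ?U" using convex_halfspace_Re_gt[of "-\<gamma>0"] by simp
 have op: "open ?U" using open_halfspace_Re_gt[of "-\<gamma>0"] by simp
 have contG: "continuous_on ?U G" using hol by (rule holomorphic_on_imp_continuous_on)
 have line: "continuous_on UNIV (\<lambda>t. G (Complex c t))" if "- \<gamma>0 < c" for c
  by (rule continuous_on_compose2[OF contG]) (use that in \<open>auto simp: Complex_eq intro!: continuous_intros\<close>)
 have int: "integrable lborel (\<lambda>t. G (Complex c t))" if c: "a \<le> c" "c \<le> b" for c
 proof (rule Bochner_Integration.integrable_bound[OF integrable_mult_right[OF integrable_inverse_one_plus_square, of C]])
  show "(\<lambda>t. G (Complex c t)) \<in> borel_measurable lborel"
   using line[of c] c ab by (simp add: borel_measurable_continuous_onI)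
  show "AE t in lborel. norm (G (Complex c t)) \<le> norm (C * inverse (1 + t\<^sup>2))"
   using bd[of "Complex c _"] c by (intro always_eventually allI) (auto intro: order_trans[OF _ abs_ge_self])
 qed
 show "integrable lborel (\<lambda>t. G (Complex b t))" using int ab by simp
 have "norm (CLBINT t. G (Complex a t)) \<le> (LBINT t. norm (G (Complex a t)))" by (rule integral_norm_bound)
 also have "\<dots> \<le> (LBINT t. C * inverse (1 + t\<^sup>2))"
  by (rule integral_mono) (use int[of a] ab bd[of "Complex a _"] in \<open>auto intro!: integrable_inverse_one_plus_square integrable_mult_right\<close>)
 finally show "norm (CLBINT t. G (Complex a t)) \<le> C * (LBINT t. inverse (1 + t\<^sup>2))" by simp
 obtain F where F: "\<And>z. z \<in> ?U \<Longrightarrow> (F has_field_derivative G z) (at z within ?U)"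
  using holomorphic_convex_primitive'[OF conv op hol] by blast
 have F': "(F has_field_derivative G z) (at z)" if "- \<gamma>0 < Re z" for z
  using F[of z] op that by (simp add: at_within_open[of z ?U])
 have vert: "integral {- real n..real n} (\<lambda>t. G (Complex c t)) = - \<i> * (F (Complex c (real n)) - F (Complex c (- real n)))"
  if c: "- \<gamma>0 < c" for c n
 proof -
  have "((\<lambda>t. G (Complex c t)) has_integral (- \<i> * F (Complex c (real n)) - (- \<i> * F (Complex c (- real n))))) {- real n..real n}"
  proof (rule fundamental_theorem_of_calculus)
   fix x assume "x \<in> {- real n..real n}"
   have d: "((\<lambda>t. Complex c t) has_vector_derivative \<i>) (at x within {- real n..real n})"
    unfolding Complex_eq by (auto intro!: derivative_eq_intros)
   have "((F \<circ> (\<lambda>t. Complex c t)) has_vector_derivative (\<i> * G (Complex c x))) (at x within {- real n..real n})"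
    by (rule field_vector_diff_chain_within[OF d]) (use F'[of "Complex c x"] c in \<open>auto intro: has_field_derivative_at_within\<close>)
   then have "((\<lambda>t. - \<i> * (F \<circ> (\<lambda>t. Complex c t)) t) has_vector_derivative (- \<i> * (\<i> * G (Complex c x)))) (at x within {- real n..real n})"
    by (rule has_vector_derivative_mult_right)
   then show "((\<lambda>t. - \<i> * F (Complex c t)) has_vector_derivative (G (Complex c x))) (at x within {- real n..real n})"
    by (simp add: o_def mult.assoc[symmetric])
  qed simp
  then show ?thesis by (simp add: integral_unique algebra_simps)
 qed
 have hor: "norm (F (Complex b y) - F (Complex a y)) \<le> C * inverse (1 + y\<^sup>2) * (b - a)" for y
 proof -
  let ?S = "closed_segment (Complex a y) (Complex b y)"
  have S: "a \<le> Re z \<and> Re z \<le> b \<and> Im z = y" if "z \<in> ?S" for z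
   using that ab(2) by (auto simp: closed_segment_same_Im closed_segment_eq_real_ivl)
  have "norm (F (Complex b y) - F (Complex a y)) \<le> C * inverse (1 + y\<^sup>2) * norm (Complex b y - Complex a y)"
  proof (rule field_differentiable_bound[of ?S F G])
   show "norm (G z) \<le> C * inverse (1 + y\<^sup>2)" if "z \<in> ?S" for z using bd[of z] S[OF that] by simp
   show "(F has_field_derivative G z) (at z within ?S)" if "z \<in> ?S" for z
    using F'[of z] S[OF that] ab by (auto intro: has_field_derivative_at_within)
  qed auto
  also have "norm (Complex b y - Complex a y) = b - a" using ab by (simp add: cmod_def)
  finally show ?thesis .
 qed
 have "(\<lambda>n. C * inverse (1 + (real n)\<^sup>2) * (b - a) + C * inverse (1 + (real n)\<^sup>2) * (b - a)) \<longlonglongrightarrow> 0"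
  by real_asymp
 then have "(\<lambda>n. integral {- real n..real n} (\<lambda>t. G (Complex b t)) - integral {- real n..real n} (\<lambda>t. G (Complex a t))) \<longlonglongrightarrow> 0"
 proof (rule Lim_null_comparison[rotated], intro always_eventually allI)
  fix n
  have "integral {- real n..real n} (\<lambda>t. G (Complex b t)) - integral {- real n..real n} (\<lambda>t. G (Complex a t)) =
    - \<i> * ((F (Complex b (real n)) - F (Complex a (real n))) - (F (Complex b (- real n)) - F (Complex a (- real n))))"
   using ab by (simp add: vert algebra_simps)
  also have "norm \<dots> \<le> norm (F (Complex b (real n)) - F (Complex a (real n))) + norm (F (Complex b (- real n)) - F (Complex a (- real n)))"
   by (simp add: norm_mult norm_triangle_ineq4)
  also have "\<dots> \<le> C * inverse (1 + (real n)\<^sup>2) * (b - a) + C * inverse (1 + (real n)\<^sup>2) * (b - a)"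
   using hor[of "real n"] hor[of "- real n"] unfolding power2_minus by linarith
  finally show "norm (integral {- real n..real n} (\<lambda>t. G (Complex b t)) - integral {- real n..real n} (\<lambda>t. G (Complex a t)))
   \<le> C * inverse (1 + (real n)\<^sup>2) * (b - a) + C * inverse (1 + (real n)\<^sup>2) * (b - a)" .
 qed
 moreover have "(\<lambda>n. integral {- real n..real n} (\<lambda>t. G (Complex b t)) - integral {- real n..real n} (\<lambda>t. G (Complex a t)))
   \<longlonglongrightarrow> (CLBINT t. G (Complex b t)) - (CLBINT t. G (Complex a t))"
  by (intro tendsto_diff integral_interval_tendsto int line) (use ab in auto)
 ultimately have "(CLBINT t. G (Complex b t)) - (CLBINT t. G (Complex a t)) = 0"
  by (rule LIMSEQ_unique[rotated])
 then show "(CLBINT t. G (Complex a t)) = (CLBINT t. G (Complex b t))" by simp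
qed

text \<open>The weight exp(-c t) makes g integrable, and H on the line Re z = c becomes the Fourier
  transform of the weighted function. Inversion and a shift to Re z = -d leave the factor exp(-d t).
  The condition g 0 = 0 makes the extension by zero continuous, so that inversion holds pointwise
  down to t = 0.\<close>

lemma exponential_decay_from_Laplace_transform:
 fixes g :: "real \<Rightarrow> complex"
 assumes g: "continuous_on {0..} g" "g 0 = 0" and A: "\<And>t. 0 \<le> t \<Longrightarrow> norm (g t) \<le> A * exp (c1 * t)"
  and c: "c1 < c" "0 \<le> d" "d < \<gamma>0" "- d \<le> c"
  and H: "H holomorphic_on {z. - \<gamma>0 < Re z}"
  and L: "\<And>v. (CLBINT t. (if 0 \<le> t then exp (- (Complex c v * of_real t)) * g t else 0)) = H (Complex c v)"
  and bd: "\<And>z. - d \<le> Re z \<Longrightarrow> Re z \<le> c \<Longrightarrow> norm (H z) \<le> C * inverse (1 + (Im z)\<^sup>2)"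
  and t: "0 \<le> t"
 shows "norm (g t) \<le> C * (LBINT v. inverse (1 + v\<^sup>2)) * exp (- (d * t))"
proof -
 define f where "f s = (if 0 \<le> s then of_real (exp (- (c * s))) * g s else 0)" for s
 have cont: "continuous_on UNIV f"
 proof -
  have "continuous_on ({0..} \<union> {..0}) f"
   unfolding f_def by (intro continuous_on_If continuous_intros g(1)) (use g(2) in auto)
  moreover have "{0..} \<union> {..0} = (UNIV :: real set)" by auto
  ultimately show ?thesis by simp
 qed
 have fb: "norm (f s) \<le> \<bar>A\<bar> * (if 0 \<le> s then exp (- ((c - c1) * s)) else 0)" for s
 proof (cases "0 \<le> s")
  case True
  have "norm (f s) \<le> exp (- (c * s)) * (\<bar>A\<bar> * exp (c1 * s))"
   unfolding f_def using True by (auto simp: norm_mult intro!: mult_left_mono order_trans[OF A] mult_right_mono)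
  also have "\<dots> = \<bar>A\<bar> * exp (- ((c - c1) * s))" by (simp add: algebra_simps flip: exp_add)
  finally show ?thesis using True by simp
 qed (simp add: f_def)
 have fint: "integrable lborel f"
 proof (rule Bochner_Integration.integrable_bound[OF integrable_mult_right[OF integrable_exp_tail[of "c - c1"], of "\<bar>A\<bar>"]])
  show "f \<in> borel_measurable lborel" using cont by (simp add: borel_measurable_continuous_onI)
  show "AE s in lborel. norm (f s) \<le> norm (\<bar>A\<bar> * (if 0 \<le> s then exp (- ((c - c1) * s)) else 0))"
   using fb by (intro always_eventually allI) (auto intro: order_trans[OF _ abs_ge_self])
 qed (use c in simp)
 have fbd: "norm (f s) \<le> \<bar>A\<bar>" for s
 proof -
  have "\<bar>A\<bar> * (if 0 \<le> s then exp (- ((c - c1) * s)) else 0) \<le> \<bar>A\<bar> * 1"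
   using c by (intro mult_left_mono) auto
  then show ?thesis using fb[of s] by simp
 qed
 have hat: "(CLBINT y. f y * iexp (- (v * y))) = H (Complex c v)" for v
  unfolding L[symmetric]
 proof (intro Bochner_Integration.integral_cong refl)
  fix s
  have "- (Complex c v * of_real s) = of_real (- (c * s)) + \<i> * of_real (- (v * s))"
   by (simp add: complex_eq_iff)
  then have "exp (- (Complex c v * of_real s)) = of_real (exp (- (c * s))) * iexp (- (v * s))"
   by (simp only: exp_add exp_of_real)
  then show "f s * iexp (- (v * s)) = (if 0 \<le> s then exp (- (Complex c v * of_real s)) * g s else 0)"
   by (simp only: f_def mult_ac) simp
 qed
 define G where "G z = H z * exp (z * of_real t)" for z
 have Ghol: "G holomorphic_on {z. - \<gamma>0 < Re z}" unfolding G_def by (intro holomorphic_intros H)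
 have shiftH: "integrable lborel (\<lambda>v. H (Complex c v))"
  by (rule vertical_line_shift(3)[OF H _ _ bd, of "- d"]) (use c in auto)
 have "of_real (2 * pi) * f t = (CLBINT v. H (Complex c v) * iexp (v * t))"
  using Fourier_inversion[OF fint fbd, of t] cont shiftH unfolding hat
  by (simp add: continuous_on_eq_continuous_at)
 also have "\<dots> = (CLBINT v. of_real (exp (- (c * t))) * G (Complex c v))"
 proof (intro Bochner_Integration.integral_cong refl)
  fix v
  have "Complex c v * of_real t = of_real (c * t) + \<i> * of_real (v * t)" by (simp add: complex_eq_iff)
  then have "exp (Complex c v * of_real t) = of_real (exp (c * t)) * iexp (v * t)"
   by (simp only: exp_add exp_of_real)
  then show "H (Complex c v) * iexp (v * t) = of_real (exp (- (c * t))) * G (Complex c v)"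
   by (simp add: G_def exp_minus field_simps)
 qed
 also have "\<dots> = of_real (exp (- (c * t))) * (CLBINT v. G (Complex c v))" by simp
 finally have "of_real (2 * pi) * g t = (CLBINT v. G (Complex c v))"
  using t by (simp add: f_def mult.assoc)
 then have g2: "norm (CLBINT v. G (Complex c v)) = 2 * pi * norm (g t)"
  by (metis abs_of_nonneg mult_nonneg_nonneg norm_mult norm_of_real pi_ge_zero zero_le_numeral)
 have C0: "0 \<le> C"
 proof -
  have "0 \<le> C * inverse (1 + 0\<^sup>2)" using bd[of "of_real c"] c norm_ge_zero[of "H (of_real c)"] by (simp del: norm_ge_zero)
  then show ?thesis by simp
 qed
 have Gbc: "norm (G z) \<le> (C * exp (c * t)) * inverse (1 + (Im z)\<^sup>2)" if "- d \<le> Re z" "Re z \<le> c" for z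
 proof -
  have "norm (G z) \<le> C * inverse (1 + (Im z)\<^sup>2) * exp (c * t)"
   unfolding G_def norm_mult using that t by (intro mult_mono bd) (auto intro!: mult_right_mono mult_nonneg_nonneg C0)
  then show ?thesis by (simp add: mult_ac)
 qed
 \<comment> \<open>A strip of width zero: on the line Re z = -d itself the exponential has modulus
   \<open>exp (- (d * t))\<close>.\<close>
 have Gbg: "norm (G z) \<le> (C * exp (- (d * t))) * inverse (1 + (Im z)\<^sup>2)" if "- d \<le> Re z" "Re z \<le> - d" for z
 proof -
  have z: "Re z = - d" using that by simp
  have "norm (G z) \<le> C * inverse (1 + (Im z)\<^sup>2) * exp (- (d * t))"
   unfolding G_def norm_mult by (intro mult_mono bd) (use z c in \<open>auto intro!: mult_nonneg_nonneg C0\<close>)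
  then show ?thesis by (simp add: mult_ac)
 qed
 have eq: "(CLBINT v. G (Complex c v)) = (CLBINT v. G (Complex (- d) v))"
  by (rule vertical_line_shift(1)[OF Ghol _ _ Gbc, symmetric]) (use c in auto)
 have "2 * pi * norm (g t) = norm (CLBINT v. G (Complex (- d) v))"
  using g2 eq by simp
 also have "\<dots> \<le> C * exp (- (d * t)) * (LBINT v. inverse (1 + v\<^sup>2))"
  by (rule vertical_line_shift(2)[OF Ghol, where a = "- d" and b = "- d", OF _ _ Gbg]) (use c in auto)
 finally have "2 * pi * norm (g t) \<le> C * exp (- (d * t)) * (LBINT v. inverse (1 + v\<^sup>2))" .
 moreover have "1 * norm (g t) \<le> 2 * pi * norm (g t)"
  using pi_gt3 by (intro mult_right_mono) auto
 ultimately show ?thesis by (simp add: mult_ac)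
qed

text \<open>Two removable singularities are divided out one after the other; applied to
  \<open>delta\<close>, and again to the numerator that remains after two poles are
  subtracted.\<close>

lemma divide_by_two_zeros:
 fixes f :: "complex \<Rightarrow> complex"
 assumes f: "f holomorphic_on U" and U: "open U" "a \<in> U" "b \<in> U" "a \<noteq> b" and z: "f a = 0" "f b = 0"
 obtains g where "g holomorphic_on U" "\<And>z. z \<in> U \<Longrightarrow> f z = (z - a) * (z - b) * g z"
proof -
 define f1 where "f1 z = (if z = a then deriv f a else f z / (z - a))" for z
 have f1: "f1 holomorphic_on U"
  by (rule pole_theorem_open_0[OF f U(1), of a]) (use z in \<open>auto simp: f1_def\<close>)
 have f1f: "f z = (z - a) * f1 z" if "z \<in> U" for z using z by (simp add: f1_def)
 have f1b: "f1 b = 0" using U z by (simp add: f1_def)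
 define f2 where "f2 z = (if z = b then deriv f1 b else f1 z / (z - b))" for z
 have f2: "f2 holomorphic_on U"
  by (rule pole_theorem_open_0[OF f1 U(1), of b]) (use f1b in \<open>auto simp: f2_def\<close>)
 show thesis
  by (rule that[OF f2]) (use f1f f1b in \<open>auto simp: f2_def\<close>)
qed

section \<open>The characteristic function and decay of the fundamental solution\<close>

context past_measure
begin

lemma integrable_cexp: "integrable \<mu> (\<lambda>v. exp (z * of_real v) :: complex)"
proof (rule integrable_const_bound[where B = "exp (\<bar>Re z\<bar> * r)"])
 show "AE v in \<mu>. norm (exp (z * of_real v)) \<le> exp (\<bar>Re z\<bar> * r)"
  using support
 proof eventually_elim
  case (elim v)
  have "Re z * v \<le> \<bar>Re z\<bar> * \<bar>v\<bar>" by (metis abs_ge_self abs_mult)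
  also have "\<dots> \<le> \<bar>Re z\<bar> * r" using elim by (intro mult_left_mono) auto
  finally show ?case by simp
 qed
qed measurable

lemma cexp_transform_bound:
 assumes "- g \<le> Re z" "0 \<le> g"
 shows "norm (LINT v|\<mu>. exp (z * of_real v)) \<le> mass * exp (g * r)"
proof -
 have "norm (LINT v|\<mu>. exp (z * of_real v)) \<le> (LINT v|\<mu>. norm (exp (z * of_real v)))"
  by (rule integral_norm_bound)
 also have "\<dots> \<le> (LINT v|\<mu>. exp (g * r))"
 proof (rule integral_mono_AE)
  show "AE v in \<mu>. norm (exp (z * of_real v)) \<le> exp (g * r)"
   using support
  proof eventually_elim
   case (elim v)
   have "Re z * v \<le> g * (- v)" using mult_right_mono_neg[of "-g" "Re z" v] assms elim by simp
   also have "\<dots> \<le> g * r" using assms elim by (intro mult_left_mono) auto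
   finally show ?case by simp
  qed
 qed (intro integrable_norm integrable_cexp, simp)
 finally show ?thesis by simp
qed

text \<open>The support is bounded, so the exponential series may be integrated term by term and
  gives an everywhere convergent power series.\<close>

lemma cexp_transform_holomorphic: "(\<lambda>z. LINT v|\<mu>. exp (z * of_real v) :: complex) holomorphic_on UNIV"
proof -
 have "(\<lambda>z. LINT v|\<mu>. exp (z * of_real v) :: complex) holomorphic_on ball 0 p" for p
 proof (rule power_series_holomorphic)
  fix z :: complex
  have bd: "AE v in \<mu>. norm ((z * of_real v) ^ n /\<^sub>R fact n) \<le> (norm z * r) ^ n / fact n" for n
   using support
  proof eventually_elim
   case (elim v)
   then have "norm (z * of_real v) \<le> norm z * r" using mult_left_mono[of "- v" r "norm z"] by (simp add: norm_mult)
   then have "norm (z * of_real v) ^ n \<le> (norm z * r) ^ n" by (intro power_mono) auto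
   then show ?case by (simp add: norm_power divide_inverse mult.commute mult_left_mono)
  qed
  have sm: "summable (\<lambda>n. (norm z * r) ^ n / fact n)"
   using summable_exp[of "norm z * r"] by (simp add: divide_inverse mult.commute)
  have int: "integrable \<mu> (\<lambda>v. (z * of_real v) ^ n /\<^sub>R fact n)" for n
   by (rule integrable_const_bound[OF bd]) measurable
  have "(\<lambda>n. LINT v|\<mu>. (z * of_real v) ^ n /\<^sub>R fact n) sums (LINT v|\<mu>. (\<Sum>n. (z * of_real v) ^ n /\<^sub>R fact n))"
  proof (rule sums_integral[OF int])
   have "AE v in \<mu>. \<forall>n. norm ((z * of_real v) ^ n /\<^sub>R fact n) \<le> (norm z * r) ^ n / fact n"
    using bd by (simp add: AE_all_countable)
   then show "AE v in \<mu>. summable (\<lambda>n. norm ((z * of_real v) ^ n /\<^sub>R fact n))"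
    by eventually_elim (rule summable_comparison_test[OF _ sm], auto)
   show "summable (\<lambda>n. LINT v|\<mu>. norm ((z * of_real v) ^ n /\<^sub>R fact n))"
   proof (rule summable_comparison_test[OF _ summable_mult[OF sm, of mass]], intro exI[of _ 0] allI impI)
    fix n
    have "(LINT v|\<mu>. norm ((z * of_real v) ^ n /\<^sub>R fact n)) \<le> (LINT v|\<mu>. (norm z * r) ^ n / fact n)"
     by (rule integral_mono_AE[OF integrable_norm[OF int] _ bd]) simp
    then show "norm (LINT v|\<mu>. norm ((z * of_real v) ^ n /\<^sub>R fact n)) \<le> mass * ((norm z * r) ^ n / fact n)"
     by (simp add: integral_nonneg_AE)
   qed
  qed
  moreover have "(\<Sum>n. (z * of_real v) ^ n /\<^sub>R fact n) = exp (z * of_real v)" for v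
   unfolding exp_def ..
  moreover have "(LINT v|\<mu>. (z * of_real v) ^ n /\<^sub>R fact n) = (LINT v|\<mu>. (of_real v) ^ n /\<^sub>R fact n) * (z - 0) ^ n" for n
   by (subst integral_mult_left_zero[symmetric]) (auto intro!: Bochner_Integration.integral_cong simp: power_mult_distrib)
  ultimately show "(\<lambda>n. (LINT v|\<mu>. (of_real v) ^ n /\<^sub>R fact n) * (z - 0) ^ n) sums (LINT v|\<mu>. exp (z * of_real v))"
   by simp
 qed
 then have "(\<lambda>z. LINT v|\<mu>. exp (z * of_real v) :: complex) field_differentiable at z" for z
  using holomorphic_on_imp_differentiable_at[of _ "ball 0 (norm z + 1)" z] by simp
 then show ?thesis by (simp add: holomorphic_on_def field_differentiable_at_within)
qed

text \<open>A shift by v multiplies the transform by exp(z v); the extension by zero in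
  \<open>hist\<close> avoids boundary terms.\<close>

lemma laplace_hist:
 assumes x: "loc_bdd x" and A: "\<And>t. 0 \<le> t \<Longrightarrow> \<bar>x t\<bar> \<le> A * exp (a * t)" and z: "a < Re z" and a: "0 \<le> a"
 shows "(CLBINT t. (if 0 \<le> t then exp (- (z * of_real t)) * of_real (hist x t) else 0)) =
  (LINT v|\<mu>. exp (z * of_real v)) * (CLBINT t. (if 0 \<le> t then exp (- (z * of_real t)) * of_real (x t) else 0))"
  (is "?L = _ * ?X")
proof -
 note [measurable] = loc_bdd_measurable[OF x]
 have A0: "0 \<le> A" using A[of 0] by simp
 define F where "F t v = (if 0 \<le> t \<and> v \<le> 0 \<and> 0 \<le> t + v then exp (- (z * of_real t)) * of_real (x (t + v)) else 0)" for t v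
 have "?L = (CLBINT t. (LINT v|\<mu>. F t v))"
 proof (intro Bochner_Integration.integral_cong refl)
  fix t
  show "(if 0 \<le> t then exp (- (z * of_real t)) * of_real (hist x t) else 0) = (LINT v|\<mu>. F t v)"
  proof (cases "0 \<le> t")
   case True
   have "exp (- (z * of_real t)) * of_real (hist x t) =
     (LINT v|\<mu>. exp (- (z * of_real t)) * of_real (if 0 \<le> t + v then x (t + v) else 0))"
    unfolding hist_def by simp
   also have "\<dots> = (LINT v|\<mu>. F t v)"
   proof (rule integral_cong_AE)
    show "AE v in \<mu>. exp (- (z * of_real t)) * of_real (if 0 \<le> t + v then x (t + v) else 0) = F t v"
     using support by eventually_elim (use True in \<open>auto simp: F_def\<close>)
   qed (unfold F_def, measurable)
   finally show ?thesis using True by simp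
  qed (simp add: F_def)
 qed
 also have "\<dots> = (LINT v|\<mu>. (CLBINT t. F t v))"
 proof (rule pair_sigma_finite.Fubini_dominated[OF pair_lborel(2), symmetric])
  show "case_prod F \<in> borel_measurable (lborel \<Otimes>\<^sub>M \<mu>)" unfolding F_def[abs_def] by measurable
  show "integrable \<mu> (\<lambda>_. 1::real)" by simp
  show "integrable lborel (\<lambda>t::real. A * (if 0 \<le> t then exp (- ((Re z - a) * t)) else 0))"
   by (intro integrable_mult_right integrable_exp_tail) (use z in simp)
  fix t v
  show "norm (F t v) \<le> A * (if 0 \<le> t then exp (- ((Re z - a) * t)) else 0) * 1"
  proof (cases "0 \<le> t \<and> v \<le> 0 \<and> 0 \<le> t + v")
   case True
   have "\<bar>x (t + v)\<bar> \<le> A * exp (a * (t + v))" using True by (intro A) auto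
   also have "\<dots> \<le> A * exp (a * t)" using True a A0 by (auto intro!: mult_left_mono)
   finally have "norm (F t v) \<le> exp (- (Re z * t)) * (A * exp (a * t))"
    using True by (auto simp: F_def norm_mult intro!: mult_left_mono)
   also have "\<dots> = A * exp (- ((Re z - a) * t))" by (simp add: algebra_simps flip: exp_add)
   finally show ?thesis using True by simp
  qed (auto simp: F_def A0)
 qed
 also have "\<dots> = (LINT v|\<mu>. exp (z * of_real v) * ?X)"
 proof (rule integral_cong_AE)
  show "AE v in \<mu>. (CLBINT t. F t v) = exp (z * of_real v) * ?X"
   using support
  proof eventually_elim
   case (elim v)
   have "(CLBINT t. F t v) = \<bar>1\<bar> *\<^sub>R (CLBINT u. F (- v + 1 * u) v)"
    by (rule lborel_integral_real_affine) simp
   also have "\<dots> = (CLBINT u. exp (z * of_real v) * (if 0 \<le> u then exp (- (z * of_real u)) * of_real (x u) else 0))"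
    unfolding abs_one scaleR_one
    by (intro Bochner_Integration.integral_cong refl) (use elim in \<open>auto simp: F_def algebra_simps exp_diff exp_minus divide_inverse\<close>)
   also have "\<dots> = exp (z * of_real v) * ?X" by (rule integral_mult_right_zero)
   finally show ?case .
  qed
  show "(\<lambda>v. CLBINT t. F t v) \<in> borel_measurable \<mu>" unfolding F_def by measurable
 qed measurable
 also have "\<dots> = (LINT v|\<mu>. exp (z * of_real v)) * ?X" by (rule integral_mult_left_zero)
 finally show ?thesis .
qed

end

lemma integrable_laplace:
 assumes x: "loc_bdd x" and A: "\<And>t. 0 \<le> t \<Longrightarrow> \<bar>x t\<bar> \<le> A * exp (a * t)" and z: "a < Re z"
 shows "integrable lborel (\<lambda>t. (if 0 \<le> t then exp (- (z * of_real t)) * of_real (x t) else 0) :: complex)"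
proof (rule Bochner_Integration.integrable_bound[OF integrable_mult_right[OF integrable_exp_tail[of "Re z - a"], of A]])
 note [measurable] = loc_bdd_measurable[OF x]
 show "(\<lambda>t. (if 0 \<le> t then exp (- (z * of_real t)) * of_real (x t) else 0)) \<in> borel_measurable lborel" by measurable
 have "norm ((if 0 \<le> t then exp (- (z * of_real t)) * of_real (x t) else 0) :: complex) \<le>
   A * (if 0 \<le> t then exp (- ((Re z - a) * t)) else 0)" for t
 proof (cases "0 \<le> t")
  case True
  have "norm (exp (- (z * of_real t)) * of_real (x t) :: complex) \<le> exp (- (Re z * t)) * (A * exp (a * t))"
   using A[OF True] by (auto simp: norm_mult intro!: mult_left_mono)
  also have "\<dots> = A * exp (- ((Re z - a) * t))" by (simp add: algebra_simps flip: exp_add)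
  finally show ?thesis using True by simp
 qed simp
 then show "AE t in lborel. norm ((if 0 \<le> t then exp (- (z * of_real t)) * of_real (x t) else 0) :: complex) \<le>
   norm (A * (if 0 \<le> t then exp (- ((Re z - a) * t)) else 0))"
  by (intro always_eventually allI) (metis order_trans abs_ge_self real_norm_def)
qed (use z in simp)

lemma laplace_conv_one:
 assumes x: "loc_bdd x" and A: "\<And>t. 0 \<le> t \<Longrightarrow> \<bar>x t\<bar> \<le> A * exp (a * t)" and z: "a < Re z" and a: "0 \<le> a"
 shows "(CLBINT t. (if 0 \<le> t then exp (- (z * of_real t)) * of_real (conv (\<lambda>_. 1) x t) else 0)) =
  1 / z * (CLBINT t. (if 0 \<le> t then exp (- (z * of_real t)) * of_real (x t) else 0))"
  (is "?L = _ * ?X")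
proof -
 note [measurable] = loc_bdd_measurable[OF x]
 have A0: "0 \<le> A" using A[of 0] by simp
 \<comment> \<open>Half of the available decay goes to each variable: for s \<le> t the exponent -
   Re z * t + a * s equals - n * t - n * s - (n + a) * (t - s).\<close>
 define n where "n = (Re z - a) / 2"
 have n: "0 < n" using z by (simp add: n_def)
 define F where "F t s = (if 0 \<le> s \<and> s \<le> t then exp (- (z * of_real t)) * of_real (x s) else 0)" for t s
 have "?L = (CLBINT t. CLBINT s. F t s)"
 proof (intro Bochner_Integration.integral_cong refl)
  fix t
  show "(if 0 \<le> t then exp (- (z * of_real t)) * of_real (conv (\<lambda>_. 1) x t) else 0) = (CLBINT s. F t s)"
  proof (cases "0 \<le> t")
   case True
   have "exp (- (z * of_real t)) * of_real (conv (\<lambda>_. 1) x t) =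
     (CLBINT s. exp (- (z * of_real t)) * of_real (if 0 \<le> s \<and> s \<le> t then x s else 0))"
    unfolding conv_one_alt by simp
   also have "\<dots> = (CLBINT s. F t s)"
    by (intro Bochner_Integration.integral_cong refl) (auto simp: F_def)
   finally show ?thesis using True by simp
  next
   case False
   then have "F t s = 0" for s by (auto simp: F_def)
   then show ?thesis using False by simp
  qed
 qed
 also have "\<dots> = (CLBINT s. CLBINT t. F t s)"
 proof (rule lborel_pair.Fubini_dominated[symmetric])
  show "case_prod F \<in> borel_measurable (lborel \<Otimes>\<^sub>M lborel)" unfolding F_def[abs_def] by measurable
  show "integrable lborel (\<lambda>t::real. A * (if 0 \<le> t then exp (- (n * t)) else 0))"
   "integrable lborel (\<lambda>t::real. if 0 \<le> t then exp (- (n * t)) else 0)"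
   by (intro integrable_mult_right integrable_exp_tail n)+
  fix t s
  show "norm (F t s) \<le> A * (if 0 \<le> t then exp (- (n * t)) else 0) * (if 0 \<le> s then exp (- (n * s)) else 0)"
  proof (cases "0 \<le> s \<and> s \<le> t")
   case True
   have "norm (F t s) \<le> exp (- (Re z * t)) * (A * exp (a * s))"
    using True A[of s] by (auto simp: F_def norm_mult intro!: mult_left_mono)
   also have "\<dots> = A * exp (- (n * t) - n * s - (n + a) * (t - s))"
    by (simp add: n_def field_simps flip: exp_add)
   also have "\<dots> \<le> A * exp (- (n * t) - n * s)"
    using True a n A0 by (intro mult_left_mono) auto
   finally show ?thesis using True by (simp add: exp_diff exp_minus divide_inverse mult_ac)
  qed (auto simp: F_def A0)
 qed
 also have "\<dots> = (CLBINT s. 1 / z * (if 0 \<le> s then exp (- (z * of_real s)) * of_real (x s) else 0))"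
 proof (intro Bochner_Integration.integral_cong refl)
  fix s
  have "(CLBINT t. F t s) = \<bar>1\<bar> *\<^sub>R (CLBINT u. F (s + 1 * u) s)"
   by (rule lborel_integral_real_affine) simp
  also have "\<dots> = (CLBINT u. (if 0 \<le> s then exp (- (z * of_real s)) * of_real (x s) else 0) * (if 0 \<le> u then exp (- (z * of_real u)) else 0))"
   unfolding abs_one scaleR_one
   by (intro Bochner_Integration.integral_cong refl) (auto simp: F_def algebra_simps exp_diff exp_minus divide_inverse)
  also have "\<dots> = (if 0 \<le> s then exp (- (z * of_real s)) * of_real (x s) else 0) * (1 / z)"
   using z a by (subst integral_mult_right_zero) (simp only: integral_cexp_tail)
  finally show "(CLBINT t. F t s) = 1 / z * (if 0 \<le> s then exp (- (z * of_real s)) * of_real (x s) else 0)"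
   by (simp only: mult.commute)
 qed
 also have "\<dots> = 1 / z * ?X" by (rule integral_mult_right_zero)
 finally show ?thesis .
qed

section \<open>The characteristic function as reciprocal of a Laplace transform\<close>

context delay_kernel
begin

definition delta :: "complex \<Rightarrow> complex" where
 "delta z = z - lin (\<lambda>\<theta>. exp (z * of_real \<theta>))"

lemma lin_cexp_bound:
 assumes "- g \<le> Re z" "0 \<le> g"
 shows "norm (lin (\<lambda>v. exp (z * of_real v) :: complex)) \<le> K * exp (g * r)"
proof -
 have "norm (lin (\<lambda>v. exp (z * of_real v) :: complex)) \<le> p.mass * exp (g * r) + n.mass * exp (g * r)"
  unfolding lin_def
  by (rule order_trans[OF norm_triangle_ineq4 add_mono[OF p.cexp_transform_bound[OF assms] n.cexp_transform_bound[OF assms]]])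
 also have "\<dots> \<le> K * exp (g * r)" by (simp add: K_def algebra_simps)
 finally show ?thesis .
qed

lemma delta_holomorphic: "delta holomorphic_on A"
 unfolding delta_def[abs_def] lin_def
 by (intro holomorphic_intros holomorphic_on_subset[OF p.cexp_transform_holomorphic] holomorphic_on_subset[OF n.cexp_transform_holomorphic]) auto

lemma S_bound: "0 \<le> t \<Longrightarrow> \<bar>S t\<bar> \<le> 1 * exp (2 * K * t)"
proof -
 assume t: "0 \<le> t"
 have "\<bar>conv (\<lambda>_. 1) R t\<bar> = \<bar>conv R (\<lambda>_. 1) t\<bar>" by (simp add: conv_commute)
 also have "\<dots> \<le> K * exp (K * t) * t"
 proof (rule conv_bound[OF loc_bdd_R loc_bdd_const t])
  fix s assume s: "0 \<le> s" "s \<le> t"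
  have "\<bar>R s\<bar> \<le> K * exp (K * s)" by (rule R_bound[OF s(1)])
  also have "\<dots> \<le> K * exp (K * t)" using s K_pos by auto
  finally show "\<bar>R s * 1\<bar> \<le> K * exp (K * t)" by simp
 qed
 finally have "\<bar>S t\<bar> \<le> 1 + K * t * exp (K * t)" by (simp add: S_def mult_ac)
 also have "\<dots> \<le> exp (K * t) + K * t * exp (K * t)" using t K_pos by simp
 also have "\<dots> = (1 + K * t) * exp (K * t)" by (simp add: algebra_simps)
 also have "\<dots> \<le> exp (K * t) * exp (K * t)" by (intro mult_right_mono exp_ge_add_one_self) simp
 also have "\<dots> = exp (2 * K * t)" by (simp flip: exp_add)
 finally show ?thesis by simp
qed

text \<open>With T the Laplace transform at z, the relations S = 1 + conv 1 R and R = hist S give z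
  T(S) = 1 + lin(exp(z .)) T(S). Thus T(S) is the reciprocal of \<open>delta\<close> to the right of
  the growth rate 2 K.\<close>

lemma laplace_S:
 assumes z: "2 * K < Re z"
 shows "delta z * (CLBINT t. (if 0 \<le> t then exp (- (z * of_real t)) * of_real (S t) else 0)) = 1"
proof -
 let ?T = "\<lambda>x. CLBINT t. (if 0 \<le> t then exp (- (z * of_real t)) * of_real (x t) else 0)"
 have a: "0 \<le> 2 * K" and z0: "0 < Re z" "z \<noteq> 0" using K_pos z by auto
 have Rb: "\<bar>R t\<bar> \<le> K * exp (2 * K * t)" if "0 \<le> t" for t
  by (rule order_trans[OF R_bound[OF that]]) (use that K_pos in auto)
 have intS: "\<bar>conv (\<lambda>_. 1) R t\<bar> \<le> 2 * exp (2 * K * t)" if "0 \<le> t" for t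
 proof -
  have "\<bar>conv (\<lambda>_. 1) R t\<bar> \<le> \<bar>S t\<bar> + 1" by (simp add: S_def)
  also have "\<dots> \<le> exp (2 * K * t) + exp (2 * K * t)" using S_bound[OF that] that K_pos by (intro add_mono) auto
  finally show ?thesis by simp
 qed
 have "?T S = ?T (\<lambda>_. 1) + ?T (conv (\<lambda>_. 1) R)"
  by (subst Bochner_Integration.integral_add[symmetric, OF integrable_laplace[where a = 0 and A = 1] integrable_laplace[OF _ intS z]])
   (use z0 in \<open>auto intro!: Bochner_Integration.integral_cong loc_bdd_conv loc_bdd_R simp: S_def algebra_simps\<close>)
 also have "?T (\<lambda>_. 1) = 1 / z" using integral_cexp_tail[OF z0(1)] by (simp cong: if_cong)
 also have "?T (conv (\<lambda>_. 1) R) = 1 / z * ?T R"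
  by (rule laplace_conv_one[OF loc_bdd_R Rb z a])
 also have "?T R = ?T (hist S)"
  by (intro Bochner_Integration.integral_cong refl) (auto simp: R_eq_hist_S)
 also have "?T (hist S) = ?T (p.hist S) - ?T (n.hist S)"
 proof (subst Bochner_Integration.integral_diff[symmetric])
  have "\<exists>A. \<forall>t\<ge>0. \<bar>past_measure.hist \<mu> S t\<bar> \<le> A * exp (2 * K * t)" if "past_measure \<mu> r" for \<mu>
  proof -
   interpret m: past_measure \<mu> r by (rule that)
   have "\<bar>m.hist S t\<bar> \<le> m.mass * exp (2 * K * t)" if "0 \<le> t" for t
   proof (rule m.hist_bound)
    fix s assume s: "0 \<le> s" "s \<le> t"
    have "\<bar>S s\<bar> \<le> exp (2 * K * s)" using S_bound[OF s(1)] by simp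
    also have "\<dots> \<le> exp (2 * K * t)" using s K_pos by simp
    finally show "\<bar>S s\<bar> \<le> exp (2 * K * t)" .
   qed (use loc_bdd_S in \<open>auto dest: loc_bdd_measurable\<close>)
   then show ?thesis by blast
  qed
  from this[OF p.past_measure_axioms] this[OF n.past_measure_axioms]
  obtain Ap An where b: "\<And>t. 0 \<le> t \<Longrightarrow> \<bar>p.hist S t\<bar> \<le> Ap * exp (2 * K * t)" "\<And>t. 0 \<le> t \<Longrightarrow> \<bar>n.hist S t\<bar> \<le> An * exp (2 * K * t)"
   by blast
  show "integrable lborel (\<lambda>t. (if 0 \<le> t then exp (- (z * of_real t)) * of_real (p.hist S t) else 0) :: complex)"
   by (rule integrable_laplace[OF p.loc_bdd_hist[OF loc_bdd_S] b(1) z])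
  show "integrable lborel (\<lambda>t. (if 0 \<le> t then exp (- (z * of_real t)) * of_real (n.hist S t) else 0) :: complex)"
   by (rule integrable_laplace[OF n.loc_bdd_hist[OF loc_bdd_S] b(2) z])
 qed (auto intro!: Bochner_Integration.integral_cong simp: hist_alt algebra_simps)
 also have "\<dots> = lin (\<lambda>v. exp (z * of_real v)) * ?T S"
  unfolding lin_def left_diff_distrib
  by (intro arg_cong2[of _ _ _ _ minus] p.laplace_hist[OF loc_bdd_S S_bound z a] n.laplace_hist[OF loc_bdd_S S_bound z a])
 finally have "z * ?T S = z * (1 / z + 1 / z * (lin (\<lambda>v. exp (z * of_real v)) * ?T S))" by simp
 also have "\<dots> = 1 + lin (\<lambda>v. exp (z * of_real v)) * ?T S" using z0 by (simp add: field_simps)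
 finally show ?thesis by (simp add: delta_def left_diff_distrib)
qed

end

section \<open>The spectral gap and the asymptotics of the fundamental solution\<close>

text \<open>Order one at a gives a second factorisation f w = h w * (w - a) with h nonzero near a;
  comparing both as w tends to a yields h a = (a - b) * g a. The point at which f is nonzero
  excludes the zero function.\<close>

lemma simple_zero_factor_nonzero:
 fixes f g :: "complex \<Rightarrow> complex"
 assumes f: "f holomorphic_on UNIV" and g: "g holomorphic_on UNIV" and fg: "\<And>z. f z = (z - a) * (z - b) * g z"
  and z: "zorder f a = 1" and nz: "f w \<noteq> 0"
 shows "g a \<noteq> 0"
proof -
 have "\<exists>p>0. zor_poly f a holomorphic_on cball a p \<and>
   (\<forall>w\<in>cball a p. f w = zor_poly f a w * (w - a) \<and> zor_poly f a w \<noteq> 0)"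
  using zorder_exist_zero[OF f open_UNIV connected_UNIV UNIV_I, of a] z nz by auto
 then obtain p h where p: "p > 0" and h: "h holomorphic_on cball a p"
  and fh: "\<And>w. w \<in> cball a p \<Longrightarrow> f w = h w * (w - a) \<and> h w \<noteq> 0"
  by blast
 have "h \<midarrow>a\<rightarrow> h a"
  using holomorphic_on_imp_continuous_on[OF h] p
  by (metis centre_in_ball continuous_on_eq_continuous_at continuous_on_subset ball_subset_cball isContD open_ball)
 moreover have "(\<lambda>w. (w - b) * g w) \<midarrow>a\<rightarrow> (a - b) * g a"
  using holomorphic_on_imp_continuous_on[OF g]
  by (intro tendsto_intros) (simp add: continuous_on_eq_continuous_at isContD)
 then have "h \<midarrow>a\<rightarrow> (a - b) * g a"
 proof (rule Lim_transform_eventually)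
  show "\<forall>\<^sub>F w in at a. (w - b) * g w = h w"
   unfolding eventually_at
  proof (intro exI[of _ p] conjI ballI impI p)
   fix w assume w: "w \<noteq> a \<and> dist w a < p"
   then have "w \<in> cball a p" by (simp add: dist_commute)
   then have "h w * (w - a) = (w - a) * (w - b) * g w" using fh[of w] fg[of w] by metis
   then show "(w - b) * g w = h w" using w by simp
  qed
 qed
 ultimately have "h a = (a - b) * g a" by (rule LIM_unique)
 moreover have "h a \<noteq> 0" using fh[of a] p by simp
 ultimately show ?thesis by auto
qed

text \<open>A simple fraction differs from its leading term at infinity by a quantity of order
  1/|z|^2, which is integrable along vertical lines.\<close>

lemma norm_shifted_inverse_diff:
 fixes z \<beta> :: complex
 assumes "2 * norm \<beta> \<le> norm z" "z \<noteq> 0"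
 shows "norm (\<alpha> / (z - \<beta>) - \<alpha> / z) \<le> 2 * norm \<alpha> * norm \<beta> / (norm z)\<^sup>2"
proof -
 have half: "norm z / 2 \<le> norm (z - \<beta>)" using norm_triangle_ineq2[of z \<beta>] assms(1) by linarith
 have pos: "0 < norm z" using assms by simp
 then have nz: "z - \<beta> \<noteq> 0" using half by auto
 have "\<alpha> / (z - \<beta>) - \<alpha> / z = \<alpha> * \<beta> / (z * (z - \<beta>))"
  using assms(2) nz by (simp add: field_simps)
 also have "norm \<dots> = norm \<alpha> * norm \<beta> / (norm z * norm (z - \<beta>))" by (simp add: norm_mult norm_divide)
 also have "\<dots> \<le> norm \<alpha> * norm \<beta> / (norm z * (norm z / 2))"
  using half pos by (intro divide_left_mono mult_left_mono mult_pos_pos) auto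
 also have "\<dots> = 2 * norm \<alpha> * norm \<beta> / (norm z)\<^sup>2" by (simp add: power2_eq_square)
 finally show ?thesis .
qed

locale critical_delay = delay_kernel +
 fixes \<omega> :: real
 assumes \<omega>_pos: "0 < \<omega>"
  and critical_roots: "\<And>z. 0 \<le> Re z \<Longrightarrow> delta z = 0 \<longleftrightarrow> z = \<i> * of_real \<omega> \<or> z = - \<i> * of_real \<omega>"
  and simple_roots: "zorder delta (\<i> * of_real \<omega>) = 1" "zorder delta (- \<i> * of_real \<omega>) = 1"
begin

abbreviation "ia \<equiv> \<i> * complex_of_real \<omega>"
abbreviation "ib \<equiv> - \<i> * complex_of_real \<omega>"

lemma ia_neq_ib: "ia \<noteq> ib" using \<omega>_pos by (simp add: complex_eq_iff)

text \<open>A zero z of \<open>delta\<close> equals lin(exp(z .)), so the zeros with Re z \<ge> -1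
  lie in a disc of radius K exp(r). Those of the quotient D between Re z = -1 and the axis form a
  compact set without points on the axis; their largest real part is negative and gives the
  gap.\<close>

lemma delta_spectral_gap:
 obtains D \<gamma>0 where "D holomorphic_on UNIV" "\<And>z. delta z = (z - ia) * (z - ib) * D z"
  "0 < \<gamma>0" "\<gamma>0 < 1" "\<And>z. - \<gamma>0 \<le> Re z \<Longrightarrow> D z \<noteq> 0"
proof -
 have r0: "delta ia = 0" "delta ib = 0" using critical_roots[of ia] critical_roots[of ib] by auto
 from divide_by_two_zeros[OF delta_holomorphic open_UNIV UNIV_I UNIV_I ia_neq_ib r0]
 obtain D where D: "D holomorphic_on UNIV" and fac_UNIV: "\<And>z. z \<in> UNIV \<Longrightarrow> delta z = (z - ia) * (z - ib) * D z"
  by blast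
 note fac = fac_UNIV[OF UNIV_I]
 have nz: "delta 1 \<noteq> 0" using critical_roots[of 1] by (auto simp: complex_eq_iff)
 have Da: "D ia \<noteq> 0"
  by (rule simple_zero_factor_nonzero[OF delta_holomorphic D fac simple_roots(1) nz])
 have fac': "delta z = (z - ib) * (z - ia) * D z" for z using fac[of z] by (simp only: mult_ac)
 have Db: "D ib \<noteq> 0"
  by (rule simple_zero_factor_nonzero[OF delta_holomorphic D fac' simple_roots(2) nz])
 have Dpos: "D z \<noteq> 0" if "0 \<le> Re z" for z
 proof (cases "z = ia \<or> z = ib")
  case False
  then have "delta z \<noteq> 0" using critical_roots[OF that] by simp
  then show ?thesis using fac[of z] by auto
 qed (use Da Db in auto)
 define K1 where "K1 = K * exp (1 * r)"
 define Z where "Z = {z. -1 \<le> Re z \<and> Re z \<le> 0 \<and> norm z \<le> K1 \<and> D z = 0}"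
 have Dcont: "continuous_on UNIV D" by (rule holomorphic_on_imp_continuous_on[OF D])
 have "closed Z" unfolding Z_def
  by (intro closed_Collect_conj closed_Collect_le closed_Collect_eq continuous_intros Dcont)
 moreover have "bounded Z" unfolding Z_def bounded_iff by blast
 ultimately have Z: "compact Z" by (simp add: compact_eq_bounded_closed)
 have "\<exists>\<gamma>0. 0 < \<gamma>0 \<and> \<gamma>0 < 1 \<and> (\<forall>z\<in>Z. Re z < - \<gamma>0)"
 proof (cases "Z = {}")
  case True
  then show ?thesis by (intro exI[of _ "1/2"]) auto
 next
  case False
  obtain z0 where z0: "z0 \<in> Z" "\<And>z. z \<in> Z \<Longrightarrow> Re z \<le> Re z0"
   using continuous_attains_sup[OF Z False continuous_on_Re[OF continuous_on_id]] by auto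
  have "Re z0 < 0" using Dpos[of z0] z0(1) unfolding Z_def by force
  then show ?thesis
   by (intro exI[of _ "min (1/2) (- Re z0 / 2)"]) (auto dest!: z0(2))
 qed
 then obtain \<gamma>0 where \<gamma>0: "0 < \<gamma>0" "\<gamma>0 < 1" "\<And>z. z \<in> Z \<Longrightarrow> Re z < - \<gamma>0" by blast
 have "D z \<noteq> 0" if z: "- \<gamma>0 \<le> Re z" for z
 proof
  assume D0: "D z = 0"
  then have "Re z < 0" using Dpos[of z] by force
  have "delta z = 0" using fac[of z] D0 by simp
  then have "z = lin (\<lambda>v. exp (z * of_real v))" by (simp add: delta_def)
  also have "norm \<dots> \<le> K1" unfolding K1_def by (rule lin_cexp_bound) (use z \<gamma>0 in auto)
  finally have "z \<in> Z" using z \<gamma>0(2) \<open>Re z < 0\<close> D0 by (auto simp: Z_def)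
  then show False using \<gamma>0(3) z by fastforce
 qed
 then show thesis using that[OF D fac \<gamma>0(1,2)] by blast
qed

text \<open>From the transform 1 / delta the two simple poles on the axis are subtracted, and a
  third fraction h / (z + 1) that cancels the remaining 1/z at infinity. The rest H is holomorphic
  beyond the axis and of order 1/|z|^2, so \<open>exponential_decay_from_Laplace_transform\<close>
  applies. In the time domain the subtracted terms are a rotation and h exp(-t).\<close>

theorem S_decay:
 "\<exists>A B C b. 0 < b \<and> (\<forall>t\<ge>0. \<bar>S t - (A * cos (\<omega> * t) + B * sin (\<omega> * t))\<bar> \<le> C * exp (- (b * t)))"
proof -
 obtain D \<gamma>0 where D: "D holomorphic_on UNIV" and fac: "\<And>z. delta z = (z - ia) * (z - ib) * D z"
  and \<gamma>0: "0 < \<gamma>0" "\<gamma>0 < 1" and Dnz: "\<And>z. - \<gamma>0 \<le> Re z \<Longrightarrow> D z \<noteq> 0"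
  using delta_spectral_gap by blast
 define U where "U = {z. - \<gamma>0 < Re z}"
 have U: "open U" unfolding U_def using open_halfspace_Re_gt[of "-\<gamma>0"] by simp
 have abU: "ia \<in> U" "ib \<in> U" using \<gamma>0 by (auto simp: U_def)
 define E where "E z = 1 / D z" for z
 have E: "E holomorphic_on U" unfolding E_def
  by (intro holomorphic_intros holomorphic_on_subset[OF D]) (use Dnz in \<open>auto simp: U_def\<close>)
 \<comment> \<open>The residues of 1 / delta at the two critical roots; with them N vanishes at both
   roots and division leaves a holomorphic M.\<close>
 define c1 where "c1 = E ia / (ia - ib)"
 define c2 where "c2 = E ib / (ib - ia)"
 define N where "N z = E z - (c1 * (z - ib) + c2 * (z - ia))" for z
 have "N holomorphic_on U" unfolding N_def by (intro holomorphic_intros E)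
 moreover have "N ia = 0" "N ib = 0" using ia_neq_ib by (auto simp: N_def c1_def c2_def)
 ultimately obtain M where M: "M holomorphic_on U" and NM: "\<And>z. z \<in> U \<Longrightarrow> N z = (z - ia) * (z - ib) * M z"
  using divide_by_two_zeros[OF _ U abU ia_neq_ib] by blast
 \<comment> \<open>This value cancels the terms in 1/z at infinity and gives g 0 = 0 below. The
   auxiliary pole -1 lies outside U because \<gamma>0 < 1.\<close>
 define h where "h = 1 - c1 - c2"
 define H where "H z = M z - h / (z - (- 1))" for z
 have one: "z - (- 1) \<noteq> 0" if "z \<in> U" for z using that \<gamma>0 by (auto simp: U_def complex_eq_iff)
 have H: "H holomorphic_on U" unfolding H_def by (intro holomorphic_intros M one)
 have Heq: "H z = 1 / delta z - c1 / (z - ia) - c2 / (z - ib) - h / (z - (- 1))"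
  if z: "z \<in> U" "z \<noteq> ia" "z \<noteq> ib" for z
 proof -
  have nz: "z - ia \<noteq> 0" "z - ib \<noteq> 0" using z(2,3) unfolding right_minus_eq .
  have "M z = N z / ((z - ia) * (z - ib))" using NM[OF z(1)] nz by (metis nonzero_mult_div_cancel_left no_zero_divisors)
  also have "\<dots> = E z / ((z - ia) * (z - ib)) - c1 * (z - ib) / ((z - ia) * (z - ib)) - c2 * (z - ia) / ((z - ia) * (z - ib))"
   unfolding N_def by (simp only: diff_divide_distrib add_divide_distrib diff_diff_eq)
  also have "c1 * (z - ib) / ((z - ia) * (z - ib)) = c1 / (z - ia)"
   by (rule mult_divide_mult_cancel_right[OF nz(2)])
  also have "c2 * (z - ia) / ((z - ia) * (z - ib)) = c2 / (z - ib)"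
   unfolding mult.commute[of "z - ia" "z - ib"] by (rule mult_divide_mult_cancel_right[OF nz(1)])
  also have "E z / ((z - ia) * (z - ib)) = 1 / delta z"
   unfolding E_def fac by (simp add: divide_divide_eq_left mult_ac)
  finally show ?thesis by (simp only: H_def)
 qed
 \<comment> \<open>The contour Re z = -b stays strictly inside U; the line Re z = c lies to the
   right of the growth rate 2 K.\<close>
 define b where "b = \<gamma>0 / 2"
 define c where "c = 2 * K + 1"
 define K1 where "K1 = K * exp (b * r)"
 have K1: "1 \<le> K1" unfolding K1_def using mult_mono[of 1 K 1 "exp (b * r)"] K_pos p.r_pos \<gamma>0 by (auto simp: b_def)
 \<comment> \<open>Beyond the radius Y the three poles and the value lin(exp(z .)) have at most half
   the modulus of z, as \<open>norm_shifted_inverse_diff\<close> demands.\<close>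
 define Y where "Y = 2 * (K1 + \<omega> + 1)"
 define A2 where "A2 = 2 * K1 + 2 * norm c1 * \<omega> + 2 * norm c2 * \<omega> + 2 * norm h"
 have A20: "0 \<le> A2" unfolding A2_def using K1 \<omega>_pos by simp
 have far: "norm (H z) \<le> A2 / (norm z)\<^sup>2" if z: "- b \<le> Re z" "Y \<le> norm z" for z
 proof -
  have zU: "z \<in> U" using z \<gamma>0 by (auto simp: U_def b_def)
  have z0: "z \<noteq> 0" using z K1 \<omega>_pos by (auto simp: Y_def)
  have nab: "norm ia = \<omega>" "norm ib = \<omega>" using \<omega>_pos by (auto simp: norm_mult)
  have zab: "z \<noteq> ia" "z \<noteq> ib" using z K1 \<omega>_pos nab by (auto simp: Y_def)
  have q: "norm (lin (\<lambda>j. exp (z * of_real j))) \<le> K1"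
   unfolding K1_def by (rule lin_cexp_bound) (use z \<gamma>0 in \<open>auto simp: b_def\<close>)
  have "h = 1 - c1 - c2" by (rule h_def)
  then have "H z = (1 / delta z - 1 / z) - (c1 / (z - ia) - c1 / z) - (c2 / (z - ib) - c2 / z) - (h / (z - (- 1)) - h / z)"
   unfolding Heq[OF zU zab] by (simp add: diff_divide_distrib)
  also have "norm \<dots> \<le> norm (1 / delta z - 1 / z) + norm (c1 / (z - ia) - c1 / z) + norm (c2 / (z - ib) - c2 / z) + norm (h / (z - (- 1)) - h / z)"
   by (intro order_trans[OF norm_triangle_ineq4] add_mono order_refl)
  also have "\<dots> \<le> 2 * K1 / (norm z)\<^sup>2 + 2 * norm c1 * \<omega> / (norm z)\<^sup>2 + 2 * norm c2 * \<omega> / (norm z)\<^sup>2 + 2 * norm h / (norm z)\<^sup>2"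
  proof (intro add_mono)
   have "norm (1 / delta z - 1 / z) \<le> 2 * norm (1::complex) * norm (lin (\<lambda>j. exp (z * of_real j)) :: complex) / (norm z)\<^sup>2"
    unfolding delta_def by (rule norm_shifted_inverse_diff[OF _ z0]) (use q z \<omega>_pos in \<open>auto simp: Y_def\<close>)
   also have "\<dots> \<le> 2 * K1 / (norm z)\<^sup>2" using q by (intro divide_right_mono) auto
   finally show "norm (1 / delta z - 1 / z) \<le> 2 * K1 / (norm z)\<^sup>2" .
   show "norm (c1 / (z - ia) - c1 / z) \<le> 2 * norm c1 * \<omega> / (norm z)\<^sup>2"
    using norm_shifted_inverse_diff[of ia z c1] z0 z K1 nab by (simp add: Y_def)
   show "norm (c2 / (z - ib) - c2 / z) \<le> 2 * norm c2 * \<omega> / (norm z)\<^sup>2"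
    using norm_shifted_inverse_diff[of ib z c2] z0 z K1 nab by (simp add: Y_def)
   show "norm (h / (z - (- 1)) - h / z) \<le> 2 * norm h / (norm z)\<^sup>2"
    using norm_shifted_inverse_diff[of "-1" z h] z0 z K1 \<omega>_pos by (simp add: Y_def)
  qed
  also have "\<dots> = A2 / (norm z)\<^sup>2" by (simp add: A2_def add_divide_distrib)
  finally show ?thesis .
 qed
 have "compact {z. - b \<le> Re z \<and> Re z \<le> c \<and> \<bar>Im z\<bar> \<le> Y}"
 proof -
  have "{z. - b \<le> Re z \<and> Re z \<le> c \<and> \<bar>Im z\<bar> \<le> Y} = cbox (Complex (- b) (- Y)) (Complex c Y)"
   by (auto simp: in_cbox_complex_iff)
  then show ?thesis by simp
 qed
 moreover have "continuous_on {z. - b \<le> Re z \<and> Re z \<le> c \<and> \<bar>Im z\<bar> \<le> Y} H"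
  by (rule continuous_on_subset[OF holomorphic_on_imp_continuous_on[OF H]]) (use \<gamma>0 in \<open>auto simp: U_def b_def\<close>)
 ultimately have "bounded (H ` {z. - b \<le> Re z \<and> Re z \<le> c \<and> \<bar>Im z\<bar> \<le> Y})"
  by (intro compact_imp_bounded compact_continuous_image)
 then obtain B1 where B1: "\<And>z. - b \<le> Re z \<Longrightarrow> Re z \<le> c \<Longrightarrow> \<bar>Im z\<bar> \<le> Y \<Longrightarrow> norm (H z) \<le> B1"
  unfolding bounded_iff by blast
 define C where "C = max 0 B1 * (1 + Y\<^sup>2) + 2 * A2"
 have bd: "norm (H z) \<le> C * inverse (1 + (Im z)\<^sup>2)" if z: "- b \<le> Re z" "Re z \<le> c" for z
 proof -
  have pos: "0 < 1 + (Im z)\<^sup>2" by (rule add_pos_nonneg) auto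
  have "norm (H z) * (1 + (Im z)\<^sup>2) \<le> C"
  proof (cases "\<bar>Im z\<bar> \<le> Y")
   case True
   have "(Im z)\<^sup>2 \<le> Y\<^sup>2" using True by (metis abs_ge_zero power2_abs power_mono)
   then have "norm (H z) * (1 + (Im z)\<^sup>2) \<le> max 0 B1 * (1 + Y\<^sup>2)"
    using B1[OF z True] by (intro mult_mono) auto
   then show ?thesis using A20 by (simp add: C_def)
  next
   case False
   have Y1: "1 \<le> Y" using K1 \<omega>_pos by (simp add: Y_def)
   have Imz: "\<bar>Im z\<bar> \<le> norm z" by (rule abs_Im_le_cmod)
   have "1 \<le> \<bar>Im z\<bar>\<^sup>2" using False Y1 by (intro one_le_power) auto
   then have "1 + (Im z)\<^sup>2 \<le> 2 * \<bar>Im z\<bar>\<^sup>2" by simp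
   also have "\<dots> \<le> 2 * (norm z)\<^sup>2" using Imz by (intro mult_left_mono power_mono) auto
   finally have *: "1 + (Im z)\<^sup>2 \<le> 2 * (norm z)\<^sup>2" .
   have nz: "0 < (norm z)\<^sup>2" using False Imz Y1 by (intro zero_less_power) linarith
   have "norm (H z) * (1 + (Im z)\<^sup>2) \<le> A2 / (norm z)\<^sup>2 * (2 * (norm z)\<^sup>2)"
    using far[OF z(1)] False Imz * A20 nz by (intro mult_mono) auto
   also have "\<dots> = 2 * A2" using nz by simp
   finally have "norm (H z) * (1 + (Im z)\<^sup>2) \<le> 2 * A2" .
   then show ?thesis by (simp add: C_def add.commute add_increasing2)
  qed
  then have "norm (H z) \<le> C / (1 + (Im z)\<^sup>2)" using pos by (simp only: pos_le_divide_eq)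
  then show ?thesis by (simp only: divide_inverse)
 qed
 define g where "g t = of_real (S t) - c1 * exp (ia * of_real t) - c2 * exp (ib * of_real t) - h * exp (- of_real t)" for t :: real
 have gc: "continuous_on {0..} g" unfolding g_def by (intro continuous_intros continuous_on_S)
 have g0: "g 0 = 0" by (simp add: g_def S_0 h_def)
 have gA: "norm (g t) \<le> (1 + norm c1 + norm c2 + norm h) * exp (2 * K * t)" if t: "0 \<le> t" for t
 proof -
  have e1: "1 \<le> exp (2 * K * t)" using t K_pos by simp
  have "norm (g t) \<le> norm (of_real (S t) :: complex) + norm (c1 * exp (ia * of_real t)) + norm (c2 * exp (ib * of_real t)) + norm (h * exp (- of_real t))"
   unfolding g_def by (intro order_trans[OF norm_triangle_ineq4] add_mono order_refl)
  also have "\<dots> \<le> exp (2 * K * t) + norm c1 * exp (2 * K * t) + norm c2 * exp (2 * K * t) + norm h * exp (2 * K * t)"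
  proof (intro add_mono)
   show "norm (of_real (S t) :: complex) \<le> exp (2 * K * t)" using S_bound[OF t] by simp
   show "norm (c1 * exp (ia * of_real t)) \<le> norm c1 * exp (2 * K * t)"
    unfolding norm_mult using e1 by (intro mult_left_mono) auto
   show "norm (c2 * exp (ib * of_real t)) \<le> norm c2 * exp (2 * K * t)"
    unfolding norm_mult using e1 by (intro mult_left_mono) auto
   have "exp (- t) \<le> 1" using t by simp
   then have "norm (exp (- of_real t) :: complex) \<le> exp (2 * K * t)" using e1 by (simp del: exp_le_cancel_iff exp_le_one_iff one_le_exp_iff)
   then show "norm (h * exp (- of_real t)) \<le> norm h * exp (2 * K * t)"
    unfolding norm_mult by (intro mult_left_mono) auto
  qed
  finally show ?thesis by (simp add: algebra_simps)
 qed
 have L: "(CLBINT t. (if 0 \<le> t then exp (- (Complex c y * of_real t)) * g t else 0)) = H (Complex c y)" for y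
 proof -
  define z where "z = Complex c y"
  have Rez: "Re z = c" "2 * K < Re z" "0 < Re z" using K_pos by (auto simp: z_def c_def)
  have zU: "z \<in> U" "z \<noteq> ia" "z \<noteq> ib" using Rez \<gamma>0 by (auto simp: U_def)
  let ?e = "\<lambda>w. \<lambda>t::real. if 0 \<le> t then exp (- ((z - w) * of_real t)) else 0"
  let ?s = "\<lambda>t::real. (if 0 \<le> t then exp (- (z * of_real t)) * of_real (S t) else 0) :: complex"
  have ie: "integrable lborel (?e w)" "integral\<^sup>L lborel (?e w) = 1 / (z - w)" if "Re w \<le> 0" for w
   using integrable_cexp_tail[of "z - w"] integral_cexp_tail[of "z - w"] that Rez by auto
  have iea: "integrable lborel (?e ia)" "integral\<^sup>L lborel (?e ia) = 1 / (z - ia)" by (rule ie, simp)+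
  have ieb: "integrable lborel (?e ib)" "integral\<^sup>L lborel (?e ib) = 1 / (z - ib)" by (rule ie, simp)+
  have ie1: "integrable lborel (?e (- 1))" "integral\<^sup>L lborel (?e (- 1)) = 1 / (z - (- 1))" by (rule ie, simp)+
  have is1: "integrable lborel ?s" by (rule integrable_laplace[OF loc_bdd_S S_bound Rez(2)])
  have inv: "x = 1 / d" if "d * x = 1" for x d :: complex
   using that by (cases "d = 0") (auto simp: field_simps)
  have is2: "integral\<^sup>L lborel ?s = 1 / delta z"
   by (rule inv[OF laplace_S[OF Rez(2)]])
  have "(CLBINT t. (if 0 \<le> t then exp (- (z * of_real t)) * g t else 0)) =
    (CLBINT t. ?s t - c1 * ?e ia t - c2 * ?e ib t - h * ?e (- 1) t)"
  proof (intro Bochner_Integration.integral_cong refl)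
   fix t :: real
   have e: "exp (- ((z - w) * of_real t)) = exp (- (z * of_real t)) * exp (w * of_real t)" for w
    by (simp add: algebra_simps flip: exp_add)
   have e1: "exp (- ((z - (- 1)) * of_real t)) = exp (- (z * of_real t)) * exp (- of_real t)"
    using e[of "-1"] by simp
   have alg: "x * (s - c1 * p - c2 * q - h * v) = x * s - c1 * (x * p) - c2 * (x * q) - h * (x * v)" for x s p q v
    by (simp add: algebra_simps)
   show "(if 0 \<le> t then exp (- (z * of_real t)) * g t else 0) = ?s t - c1 * ?e ia t - c2 * ?e ib t - h * ?e (- 1) t"
   proof (cases "0 \<le> t")
    case True
    show ?thesis unfolding g_def e1 e[of ia] e[of ib] alg by (simp only: True if_True)
   qed simp
  qed
  also have "\<dots> = integral\<^sup>L lborel ?s - c1 * integral\<^sup>L lborel (?e ia) - c2 * integral\<^sup>L lborel (?e ib) - h * integral\<^sup>L lborel (?e (- 1))"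
   by (simp only: Bochner_Integration.integral_diff Bochner_Integration.integrable_diff
     Bochner_Integration.integrable_mult_right is1 iea(1) ieb(1) ie1(1) integral_mult_right_zero)
  also have "\<dots> = H z" unfolding Heq[OF zU] is2 iea(2) ieb(2) ie1(2) by (simp only: times_divide_eq_right mult_1_right)
  finally show ?thesis unfolding z_def .
 qed
 have decay: "norm (g t) \<le> C * (LBINT y. inverse (1 + y\<^sup>2)) * exp (- (b * t))" if "0 \<le> t" for t
 proof (rule exponential_decay_from_Laplace_transform[OF gc g0])
  show "cmod (g t) \<le> (1 + norm c1 + norm c2 + norm h) * exp (2 * K * t)" if "0 \<le> t" for t by (rule gA[OF that])
  show "2 * K < c" "0 \<le> b" "b < \<gamma>0" "- b \<le> c" using \<gamma>0 K_pos by (auto simp: b_def c_def)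
  show "H holomorphic_on {z. - \<gamma>0 < Re z}" using H by (simp only: U_def)
 qed (use L bd that in auto)
 show ?thesis
 proof (intro exI conjI allI impI)
  show "0 < b" using \<gamma>0 by (simp add: b_def)
  fix t :: real assume t: "0 \<le> t"
  have "S t - (Re (c1 + c2) * cos (\<omega> * t) + (Im c2 - Im c1) * sin (\<omega> * t)) = Re (g t) + Re h * exp (- t)"
  proof -
   have "exp (ia * of_real t) = cis (\<omega> * t)" "exp (ib * of_real t) = cis (- (\<omega> * t))"
    unfolding cis_conv_exp by (simp_all add: mult_ac)
   moreover have "exp (- of_real t :: complex) = of_real (exp (- t))" by (simp flip: exp_of_real)
   ultimately show ?thesis unfolding g_def by (simp add: algebra_simps)
  qed
  also have "\<bar>\<dots>\<bar> \<le> norm (g t) + norm h * exp (- t)"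
   by (rule order_trans[OF abs_triangle_ineq add_mono]) (auto simp: abs_mult abs_Re_le_cmod intro!: mult_right_mono)
  also have "\<dots> \<le> C * (LBINT y. inverse (1 + y\<^sup>2)) * exp (- (b * t)) + norm h * exp (- (b * t))"
   using decay[OF t] \<gamma>0 t by (intro add_mono mult_left_mono) (auto simp: b_def intro!: mult_right_mono[of "\<gamma>0 / 2" 1 t, simplified])
  also have "\<dots> = (C * (LBINT y. inverse (1 + y\<^sup>2)) + norm h) * exp (- (b * t))" by (simp add: algebra_simps)
  finally show "\<bar>S t - (Re (c1 + c2) * cos (\<omega> * t) + (Im c2 - Im c1) * sin (\<omega> * t))\<bar> \<le> (C * (LBINT y. inverse (1 + y\<^sup>2)) + norm h) * exp (- (b * t))" .
 qed
qed

end

section \<open>The semigroup and the spectral projection\<close>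

lemma past_measure_restrict:
 assumes "finite_measure \<mu>" and sets: "sets \<mu> = sets borel" and r: "0 < (r::real)"
 shows "past_measure (density \<mu> (indicator {-r..0})) r"
proof -
 interpret \<mu>: finite_measure \<mu> by fact
 have [measurable_cong]: "sets \<mu> = sets borel" by (rule sets)
 have e: "emeasure (density \<mu> (indicator {-r..0})) A = emeasure \<mu> ({-r..0} \<inter> A)" if "A \<in> sets borel" for A
  using that by (subst emeasure_density) (auto simp: sets simp flip: indicator_inter_arith)
 show ?thesis
 proof (intro past_measure.intro finite_measureI past_measure_axioms.intro)
  show "emeasure (density \<mu> (indicator {-r..0})) (space (density \<mu> (indicator {-r..0}))) \<noteq> \<infinity>"
   using e[of UNIV] sets_eq_imp_space_eq[OF sets] \<mu>.emeasure_finite by simp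
  show "0 < r" by (rule r)
  show "sets (density \<mu> (indicator {-r..0})) = sets borel" by (simp add: sets)
  show "AE v in density \<mu> (indicator {-r..0}). -r \<le> v \<and> v \<le> 0"
   by (subst AE_density) (auto simp: indicator_def)
 qed
qed

lemma integral_restrict_density:
 fixes f :: "real \<Rightarrow> real"
 assumes sets: "sets \<mu> = sets borel" and m: "f' \<in> borel_measurable borel"
  and eq: "\<And>v. v \<in> {-r..0} \<Longrightarrow> f v = f' v"
 shows "(LINT v:{-r..0}|\<mu>. f v) = (LINT v|density \<mu> (indicator {-r..0}). f' v)"
proof -
 have [measurable_cong]: "sets \<mu> = sets borel" by (rule sets)
 note m[measurable]
 have d: "density \<mu> (indicator {-r..0}) = density \<mu> (\<lambda>x. ennreal (indicator {-r..0} x))"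
  by (simp add: ennreal_indicator)
 have "(LINT v|density \<mu> (indicator {-r..0}). f' v) = (LINT v|\<mu>. indicator {-r..0} v *\<^sub>R f' v)"
  unfolding d by (rule integral_density) auto
 also have "\<dots> = (LINT v:{-r..0}|\<mu>. f v)"
  unfolding set_lebesgue_integral_def
  by (rule Bochner_Integration.integral_cong) (use eq in \<open>auto simp: indicator_def\<close>)
 finally show ?thesis ..
qed

text \<open>\<open>L_ext_lin\<close> lets a function known on [-r,0] be replaced by any Borel
  function on the line that agrees with it there, the form in which \<open>lin\<close> can be
  computed.\<close>

locale delay_model = critical_delay +
 fixes L :: "(real \<Rightarrow> real) \<Rightarrow> real"
 assumes L_ext_lin: "\<And>\<phi> \<phi>'. \<phi>' \<in> borel_measurable borel \<Longrightarrow> (\<And>\<theta>. \<theta> \<in> {-r..0} \<Longrightarrow> \<phi> \<theta> = \<phi>' \<theta>) \<Longrightarrow> L_ext r L \<phi> = lin \<phi>'"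
  and L_cont: "\<And>\<phi>. continuous_on {-r..0} \<phi> \<Longrightarrow> L \<phi> = L_ext r L \<phi>"

lemma (in delay_kernel) Re_Im_lin_cexp:
 "Re (lin (\<lambda>v. exp (z * of_real v))) = lin (\<lambda>v. Re (exp (z * of_real v)))"
 "Im (lin (\<lambda>v. exp (z * of_real v))) = lin (\<lambda>v. Im (exp (z * of_real v)))"
 unfolding lin_def using p.integrable_cexp[of z] n.integrable_cexp[of z] by simp_all

text \<open>The measures are the restrictions to [-r,0] of the very pair that \<open>SOME\<close>
  selects in \<open>L_ext\<close>; \<open>riesz_pair_exists\<close> guarantees that this pair
  represents L.\<close>

theorem delay_model_exists:
 assumes r: "0 < r" and L: "bounded_linear_on_C r L" and crit: "critical_spectrum L \<omega>"
 shows "\<exists>\<mu>p \<mu>n. delay_model \<mu>p \<mu>n r \<omega> L"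
proof -
 obtain \<mu>p \<mu>n where some: "(SOME \<mu>. riesz_pair r L \<mu>) = (\<mu>p, \<mu>n)" by (cases "SOME \<mu>. riesz_pair r L \<mu>")
 have "riesz_pair r L (\<mu>p, \<mu>n)"
  using someI_ex[OF riesz_pair_exists[OF r L]] unfolding some .
 then have fin: "finite_measure \<mu>p" "finite_measure \<mu>n" and sets: "sets \<mu>p = sets borel" "sets \<mu>n = sets borel"
  and rep: "\<And>f. continuous_on {-r..0} f \<Longrightarrow> L f = (LINT v:{-r..0}|\<mu>p. f v) - (LINT v:{-r..0}|\<mu>n. f v)"
  unfolding riesz_pair_def by auto
 define P where "P = density \<mu>p (indicator {-r..0})"
 define N where "N = density \<mu>n (indicator {-r..0})"
 interpret delay_kernel P N r
  unfolding delay_kernel_def P_def N_def using past_measure_restrict[OF fin(1) sets(1) r] past_measure_restrict[OF fin(2) sets(2) r] by simp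
 have Lext: "L_ext r L f = lin f'" if "f' \<in> borel_measurable borel" "\<And>v. v \<in> {-r..0} \<Longrightarrow> f v = f' v" for f f'
  unfolding L_ext_def some lin_def
  unfolding P_def N_def using integral_restrict_density[where r = r, OF sets(1) that] integral_restrict_density[where r = r, OF sets(2) that] by simp
 have cont: "L f = L_ext r L f" if "continuous_on {-r..0} f" for f
  unfolding L_ext_def some using rep[OF that] by simp
 have char: "char_fun L z = delta z" for z
 proof -
  have c: "continuous_on UNIV (\<lambda>v. Re (exp (z * of_real v)))" "continuous_on UNIV (\<lambda>v. Im (exp (z * of_real v)))"
   by (intro continuous_intros)+
  have "L (\<lambda>v. Re (exp (z * of_real v))) = lin (\<lambda>v. Re (exp (z * of_real v)))"
   using cont[OF continuous_on_subset[OF c(1)]] Lext[of "\<lambda>v. Re (exp (z * of_real v))"] borel_measurable_continuous_onI[OF c(1)] by auto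
  moreover have "L (\<lambda>v. Im (exp (z * of_real v))) = lin (\<lambda>v. Im (exp (z * of_real v)))"
   using cont[OF continuous_on_subset[OF c(2)]] Lext[of "\<lambda>v. Im (exp (z * of_real v))"] borel_measurable_continuous_onI[OF c(2)] by auto
  ultimately show ?thesis unfolding char_fun_def delta_def by (simp add: complex_eq_iff Re_Im_lin_cexp)
 qed
 then have char': "char_fun L = delta" by (rule ext)
 have "delay_model P N r \<omega> L"
 proof (unfold_locales)
  show "0 < \<omega>" "zorder delta (\<i> * of_real \<omega>) = 1" "zorder delta (- \<i> * of_real \<omega>) = 1"
   using crit unfolding critical_spectrum_def char' by auto
  fix z assume z: "0 \<le> Re z"
  have ax: "{z. delta z = 0 \<and> Re z = 0} = {\<i> * of_real \<omega>, - \<i> * of_real \<omega>}" "delta z = 0 \<longrightarrow> Re z \<noteq> 0 \<longrightarrow> Re z < 0"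
   using crit unfolding critical_spectrum_def char' by auto
  show "delta z = 0 \<longleftrightarrow> z = \<i> * of_real \<omega> \<or> z = - \<i> * of_real \<omega>"
  proof
   assume d: "delta z = 0"
   then have "Re z = 0" using ax(2) z by force
   then have "z \<in> {z. delta z = 0 \<and> Re z = 0}" using d by simp
   then show "z = \<i> * of_real \<omega> \<or> z = - \<i> * of_real \<omega>" unfolding ax(1) by simp
  next
   assume "z = \<i> * of_real \<omega> \<or> z = - \<i> * of_real \<omega>"
   then have "z \<in> {z. delta z = 0 \<and> Re z = 0}" unfolding ax(1) by simp
   then show "delta z = 0" by simp
  qed
 qed (use Lext cont in auto)
 then show ?thesis by blast
qed

context delay_model
begin

text \<open>Real and imaginary part of \<open>delta ia = 0\<close>.\<close>

lemma lin_cos_sin: "lin (\<lambda>v. cos (\<omega> * v)) = 0" "lin (\<lambda>v. sin (\<omega> * v)) = \<omega>"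
proof -
 have "delta ia = 0" using critical_roots[of ia] by simp
 then have e: "lin (\<lambda>v. exp (ia * of_real v)) = ia" by (simp add: delta_def)
 have c: "exp (ia * of_real v) = cis (\<omega> * v)" for v by (simp add: cis_conv_exp mult_ac)
 show "lin (\<lambda>v. cos (\<omega> * v)) = 0" using Re_Im_lin_cexp(1)[of ia] unfolding e by (simp add: c)
 show "lin (\<lambda>v. sin (\<omega> * v)) = \<omega>" using Re_Im_lin_cexp(2)[of ia] unfolding e by (simp add: c)
qed

lemma lin_add:
 fixes f g :: "real \<Rightarrow> real"
 assumes "f \<in> borel_measurable borel" "\<And>v. \<bar>f v\<bar> \<le> B" "g \<in> borel_measurable borel" "\<And>v. \<bar>g v\<bar> \<le> C"
 shows "lin (\<lambda>v. f v + g v) = lin f + lin g"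
proof -
 have "integrable \<mu>p f" "integrable \<mu>n f"
  using assms by (auto intro!: p.integrable_const_bound[where B = B] n.integrable_const_bound[where B = B])
 moreover have "integrable \<mu>p g" "integrable \<mu>n g"
  using assms by (auto intro!: p.integrable_const_bound[where B = C] n.integrable_const_bound[where B = C])
 ultimately show ?thesis by (simp add: lin_def)
qed

lemma lin_cmult: "lin (\<lambda>v. c * f v) = c * lin f" for c :: real
 by (simp add: lin_def right_diff_distrib)

lemma Phi_measurable: "Phi w v \<in> borel_measurable borel"
 unfolding Phi_def by measurable

lemma Phi_bound: "\<bar>Phi w v y\<bar> \<le> \<bar>v $ 1\<bar> + \<bar>v $ 2\<bar>"
proof -
 have "\<bar>v $ 1 * cos (w * y)\<bar> + \<bar>v $ 2 * sin (w * y)\<bar> \<le> \<bar>v $ 1\<bar> * 1 + \<bar>v $ 2\<bar> * 1"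
  unfolding abs_mult by (intro add_mono mult_left_mono) auto
 then show ?thesis unfolding Phi_def by linarith
qed

text \<open>The right-hand side is the derivative of \<open>Phi \<omega> v\<close> at s: rotations
  solve the linear delay equation.\<close>

lemma lin_Phi: "lin (\<lambda>y. Phi \<omega> v (s + y)) = \<omega> * (v $ 2 * cos (\<omega> * s) - v $ 1 * sin (\<omega> * s))"
proof -
 define a where "a = v $ 1 * cos (\<omega> * s) + v $ 2 * sin (\<omega> * s)"
 define b where "b = v $ 2 * cos (\<omega> * s) - v $ 1 * sin (\<omega> * s)"
 have "Phi \<omega> v (s + y) = a * cos (\<omega> * y) + b * sin (\<omega> * y)" for y
  unfolding Phi_def a_def b_def distrib_left cos_add sin_add by (simp add: algebra_simps)
 then have "lin (\<lambda>y. Phi \<omega> v (s + y)) = lin (\<lambda>y. a * cos (\<omega> * y) + b * sin (\<omega> * y))" by simp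
 also have "\<dots> = lin (\<lambda>y. a * cos (\<omega> * y)) + lin (\<lambda>y. b * sin (\<omega> * y))"
  by (rule lin_add[where B = "\<bar>a\<bar>" and C = "\<bar>b\<bar>"]) (auto simp: abs_mult mult_left_le)
 also have "\<dots> = \<omega> * b" by (simp add: lin_cmult lin_cos_sin)
 finally show ?thesis by (simp add: b_def)
qed

section \<open>The explicit solution of the linear equation and its uniqueness\<close>

definition init :: "(real \<Rightarrow> real) \<Rightarrow> real \<Rightarrow> real" where
 "init \<phi> \<theta> = indicator {-r..0} \<theta> * \<phi> \<theta>"

text \<open>The part of the delay term that sees the initial segment, complementary to
  \<open>hist\<close>; for bounded Borel data it vanishes from time r on.\<close>

definition forcing :: "(real \<Rightarrow> real) \<Rightarrow> real \<Rightarrow> real" where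
 "forcing \<phi> s = lin (\<lambda>\<theta>. if s + \<theta> < 0 then init \<phi> (s + \<theta>) else 0)"

text \<open>Variation of constants for the linear equation. The semigroup \<open>T_hat\<close> picks
  some solution; uniqueness will identify it with this explicit one.\<close>

definition sol :: "(real \<Rightarrow> real) \<Rightarrow> real \<Rightarrow> real" where
 "sol \<phi> t = (if t < 0 then init \<phi> t else \<phi> 0 * S t + conv S (forcing \<phi>) t)"

lemma C_hat_init:
 assumes "f \<in> C_hat r"
 obtains B where "0 \<le> B" "init f \<in> borel_measurable borel" "\<And>v. \<bar>init f v\<bar> \<le> B"
proof -
 obtain B where B: "\<forall>x\<in>{-r..0}. \<bar>f x\<bar> \<le> B" using assms unfolding C_hat_def bounded_iff by auto
 show thesis
 proof (rule that[of "max 0 B"])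
  show "init f \<in> borel_measurable borel" using assms unfolding C_hat_def set_borel_measurable_def init_def[abs_def] by simp
  show "\<bar>init f v\<bar> \<le> max 0 B" for v using B by (auto simp: init_def indicator_def le_max_iff_disj)
 qed simp
qed

lemma forcing_measurable:
 assumes [measurable]: "init f \<in> borel_measurable borel"
 shows "forcing f \<in> borel_measurable borel"
 unfolding forcing_def[abs_def] lin_def by measurable

lemma forcing_bound:
 assumes [measurable]: "init f \<in> borel_measurable borel" and B: "\<And>v. \<bar>init f v\<bar> \<le> B"
 shows "\<bar>forcing f s\<bar> \<le> K * B" "r \<le> s \<Longrightarrow> forcing f s = 0"
proof -
 have B0: "0 \<le> B" using B[of 0] by linarith
 let ?h = "\<lambda>v. if s + v < 0 then init f (s + v) else 0"
 have h: "\<bar>?h v\<bar> \<le> B" for v using B B0 by auto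
 have b: "\<bar>integral\<^sup>L \<mu> ?h\<bar> \<le> measure \<mu> UNIV * B" if "past_measure \<mu> r" for \<mu>
 proof -
  interpret m: past_measure \<mu> r by (rule that)
  have "norm (integral\<^sup>L \<mu> ?h) \<le> (LINT v|\<mu>. norm (?h v))" by (rule integral_norm_bound)
  also have "\<dots> \<le> (LINT v|\<mu>. B)"
   by (rule integral_mono) (use h in \<open>auto intro!: m.integrable_const_bound[where B = B]\<close>)
  finally show ?thesis by simp
 qed
 have "\<bar>forcing f s\<bar> \<le> \<bar>integral\<^sup>L \<mu>p ?h\<bar> + \<bar>integral\<^sup>L \<mu>n ?h\<bar>" unfolding forcing_def lin_def by linarith
 also have "\<dots> \<le> measure \<mu>p UNIV * B + measure \<mu>n UNIV * B"
  by (intro add_mono b p.past_measure_axioms n.past_measure_axioms)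
 also have "\<dots> \<le> K * B" using B0 by (simp add: K_def algebra_simps)
 finally show "\<bar>forcing f s\<bar> \<le> K * B" .
 assume rs: "r \<le> s"
 have "integral\<^sup>L \<mu> ?h = 0" if "past_measure \<mu> r" for \<mu>
 proof -
  interpret m: past_measure \<mu> r by (rule that)
  have "AE v in \<mu>. ?h v = 0" using m.support by eventually_elim (use rs in auto)
  then show ?thesis by (rule integral_eq_zero_AE)
 qed
 from this[OF p.past_measure_axioms] this[OF n.past_measure_axioms]
 show "forcing f s = 0" by (simp add: forcing_def lin_def)
qed

lemma loc_bdd_forcing: "f \<in> C_hat r \<Longrightarrow> loc_bdd (forcing f)"
proof -
 assume "f \<in> C_hat r"
 then obtain B where B: "0 \<le> B" "init f \<in> borel_measurable borel" "\<And>v. \<bar>init f v\<bar> \<le> B" using C_hat_init by blast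
 show ?thesis unfolding loc_bdd_def using forcing_measurable[OF B(2)] forcing_bound(1)[OF B(2,3)] by blast
qed

lemma lin_past_split:
 assumes phi: "f \<in> C_hat r" and x: "loc_bdd x" and s: "0 \<le> s"
  and y: "\<And>v. -r \<le> v \<Longrightarrow> v < 0 \<Longrightarrow> y v = f v" "\<And>t. 0 \<le> t \<Longrightarrow> y t = x t"
 shows "L_ext r L (\<lambda>v. y (s + v)) = hist x s + forcing f s"
proof -
 obtain B where B: "0 \<le> B" and [measurable]: "init f \<in> borel_measurable borel" and B': "\<And>v. \<bar>init f v\<bar> \<le> B"
  using C_hat_init[OF phi] by blast
 note [measurable] = loc_bdd_measurable[OF x]
 obtain C where C: "0 \<le> C" "\<And>u. 0 \<le> u \<Longrightarrow> u \<le> s \<Longrightarrow> \<bar>x u\<bar> \<le> C" using loc_bdd_obtain[OF x, of s] by blast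
 \<comment> \<open>The cut at v \<le> 0 changes nothing on the support and keeps the function
   bounded on the whole line, as \<open>lin_add\<close> requires.\<close>
 let ?f = "\<lambda>v. if 0 \<le> s + v \<and> v \<le> 0 then x (s + v) else 0"
 let ?g = "\<lambda>v. if s + v < 0 then init f (s + v) else 0"
 have "L_ext r L (\<lambda>v. y (s + v)) = lin (\<lambda>v. ?f v + ?g v)"
 proof (rule L_ext_lin)
  fix v assume th: "v \<in> {-r..0}"
  show "y (s + v) = ?f v + ?g v"
   using th s y(1)[of "s + v"] y(2)[of "s + v"] by (auto simp: init_def)
 qed measurable
 also have "\<dots> = lin ?f + lin ?g"
  by (rule lin_add[where B = C and C = B]) (use B B' C in auto)
 also have "lin ?f = hist x s"
  unfolding hist_def lin_def
 proof (intro arg_cong2[of _ _ _ _ minus] integral_cong_AE)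
  show "AE v in \<mu>p. ?f v = (if 0 \<le> s + v then x (s + v) else 0)" using p.support by eventually_elim auto
  show "AE v in \<mu>n. ?f v = (if 0 \<le> s + v then x (s + v) else 0)" using n.support by eventually_elim auto
 qed measurable
 finally show ?thesis by (simp add: forcing_def)
qed

lemma set_integral_interval:
 assumes g: "loc_bdd g" and eq: "\<And>s. 0 \<le> s \<Longrightarrow> h s = g s"
 shows "set_integrable lborel {0..t} h" "(LINT s:{0..t}|lborel. h s) = conv (\<lambda>_. 1) g t"
proof -
 have e: "(\<lambda>s. indicator {0..t} s *\<^sub>R h s) = (\<lambda>s. if 0 \<le> s \<and> s \<le> t then g s else 0)"
  using eq by (auto simp: indicator_def)
 show "set_integrable lborel {0..t} h" unfolding set_integrable_def e
  using conv_integrable[OF g loc_bdd_const[of 1], of t] by (simp cong: if_cong)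
 show "(LINT s:{0..t}|lborel. h s) = conv (\<lambda>_. 1) g t"
  unfolding set_lebesgue_integral_def e conv_one_alt ..
qed

lemma sol_is_delay_sol:
 assumes phi: "h \<in> C_hat r"
 shows "is_delay_sol r L h (sol h)"
proof -
 note f = loc_bdd_forcing[OF phi]
 define x where "x t = h 0 * S t + conv S (forcing h) t" for t
 have x: "loc_bdd x" unfolding x_def[abs_def] by (intro loc_bdd_add loc_bdd_cmult loc_bdd_conv loc_bdd_S f)
 define F where "F t = h 0 + conv (\<lambda>_. 1) (forcing h) t" for t
 have F: "loc_bdd F" unfolding F_def[abs_def] by (intro loc_bdd_add loc_bdd_conv loc_bdd_const f)
 have xF: "x t = F t + conv R F t" if "0 \<le> t" for t
  unfolding x_def F_def[abs_def] by (rule resolvent_of_primitive[OF f that, symmetric])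
 have xk: "x t = F t + conv k x t" if t: "0 \<le> t" for t
 proof -
  have "conv k (\<lambda>s. F s + conv R F s) t = conv k x t" by (rule conv_cong) (use xF in auto)
  then show ?thesis using volterra_exists[OF F t] xF[OF t] by simp
 qed
 have x0: "x 0 = h 0"
 proof -
  have "\<bar>conv S (forcing h) 0\<bar> \<le> \<bar>S 0 * forcing h 0\<bar> * 0" by (rule conv_bound[OF loc_bdd_S f]) auto
  then show ?thesis by (simp add: x_def S_0)
 qed
 have L: "L_ext r L (\<lambda>v. sol h (s + v)) = hist x s + forcing h s" if "0 \<le> s" for s
  by (rule lin_past_split[OF phi x that]) (auto simp: sol_def init_def x_def)
 have g: "loc_bdd (\<lambda>s. hist x s + forcing h s)" by (intro loc_bdd_add loc_bdd_hist x f)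
 note I = set_integral_interval[OF g L]
 show ?thesis
  unfolding is_delay_sol_def
 proof (intro conjI ballI allI impI)
  fix v assume "v \<in> {-r..0}"
  then show "sol h v = h v" using x0 by (cases "v = 0") (auto simp: sol_def init_def x_def)
 next
  fix t :: real assume t: "0 \<le> t"
  show "set_integrable lborel {0..t} (\<lambda>s. L_ext r L (\<lambda>v. sol h (s + v)))" by (rule I)
  have "(LINT s:{0..t}|lborel. L_ext r L (\<lambda>v. sol h (s + v))) = conv (\<lambda>_. 1) (hist x) t + conv (\<lambda>_. 1) (forcing h) t"
   by (rule trans[OF I(2) conv_add_right[OF loc_bdd_const loc_bdd_hist[OF x] f]])
  also have "\<dots> = conv k x t + conv (\<lambda>_. 1) (forcing h) t" by (simp add: conv_one_hist[OF x t])
  finally show "sol h t = h 0 + (LINT s:{0..t}|lborel. L_ext r L (\<lambda>v. sol h (s + v)))"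
   using xk[OF t] t by (simp add: sol_def x_def F_def)
 qed
qed

lemma delay_sol_unique:
 assumes phi: "h \<in> C_hat r" and y: "is_delay_sol r L h y" and t: "- r \<le> t"
 shows "y t = sol h t"
proof (cases "t < 0")
 case True
 then show ?thesis using y t unfolding is_delay_sol_def by (auto simp: sol_def init_def)
next
 case False
 then have t0: "0 \<le> t" by simp
 note f = loc_bdd_forcing[OF phi]
 define g where "g s = L_ext r L (\<lambda>v. y (s + v))" for s
 have int: "set_integrable lborel {0..t} g" and yt: "y t = h 0 + (LINT s:{0..t}|lborel. g s)" if "0 \<le> t" for t
  using y that unfolding is_delay_sol_def g_def by auto
 \<comment> \<open>Nothing is known of y to the left of -r; freezing its value at 0 gives a function
   continuous on the line, hence locally bounded.\<close>
 define x where "x t = (if 0 \<le> t then y t else y 0)" for t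
 have "continuous_on {0..T} y" for T
 proof (cases "0 \<le> T")
  case True
  have "continuous_on {0..T} (\<lambda>u. h 0 + integral {0..u} g)"
   by (intro continuous_intros indefinite_integral_continuous_1 set_borel_integral_eq_integral(1)[OF int[OF True]])
  moreover have "h 0 + integral {0..u} g = y u" if "u \<in> {0..T}" for u
   using yt[of u] set_borel_integral_eq_integral(2)[OF int[of u]] that by simp
  ultimately show ?thesis by (rule continuous_on_eq)
 qed simp
 then have ycont: "continuous_on {0..} y" by (rule continuous_on_atLeast_if_Icc)
 have "continuous_on ({0..} \<union> {..0}) x"
  unfolding x_def by (intro continuous_on_If ycont continuous_intros) auto
 moreover have "{0..} \<union> {..0} = (UNIV :: real set)" by auto
 ultimately have x: "loc_bdd x" by (intro loc_bdd_continuous) simp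
 have L: "g s = hist x s + forcing h s" if "0 \<le> s" for s
  unfolding g_def by (rule lin_past_split[OF phi x that]) (use y in \<open>auto simp: is_delay_sol_def x_def\<close>)
 have gl: "loc_bdd (\<lambda>s. hist x s + forcing h s)" by (intro loc_bdd_add loc_bdd_hist x f)
 define F where "F t = h 0 + conv (\<lambda>_. 1) (forcing h) t" for t
 have xk: "x t - conv k x t = F t" if t: "0 \<le> t" for t
 proof -
  have "(LINT s:{0..t}|lborel. g s) = conv (\<lambda>_. 1) (hist x) t + conv (\<lambda>_. 1) (forcing h) t"
   by (rule trans[OF set_integral_interval(2)[OF gl L] conv_add_right[OF loc_bdd_const loc_bdd_hist[OF x] f]])
  also have "\<dots> = conv k x t + conv (\<lambda>_. 1) (forcing h) t" by (simp add: conv_one_hist[OF x t])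
  finally show ?thesis using yt[OF t] t by (simp add: x_def F_def)
 qed
 have "x t = F t + conv R (\<lambda>s. x s - conv k x s) t" using volterra_solution[OF x t0] xk[OF t0] by simp
 also have "conv R (\<lambda>s. x s - conv k x s) t = conv R F t" by (rule conv_cong) (use xk in auto)
 also have "F t + conv R F t = h 0 * S t + conv S (forcing h) t"
  unfolding F_def[abs_def] by (rule resolvent_of_primitive[OF f t0])
 finally show ?thesis using t0 by (simp add: x_def sol_def)
qed

text \<open>Uniqueness identifies the solution chosen by \<open>SOME\<close> with the explicit
  one.\<close>

lemma T_hat_eq:
 assumes phi: "f \<in> C_hat r" and t: "0 \<le> t" "v \<in> {-r..0}"
 shows "T_hat r L t f v = sol f (t + v)"
 unfolding T_hat_def
 by (rule delay_sol_unique[OF phi]) (use someI[of "is_delay_sol r L f", OF sol_is_delay_sol[OF phi]] t in auto)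

lemma C_hat_Phi: "Phi w v \<in> C_hat r"
proof -
 have "\<forall>x\<in>{-r..0}. \<bar>Phi w v x\<bar> \<le> \<bar>v $ 1\<bar> + \<bar>v $ 2\<bar>" using Phi_bound by blast
 then show ?thesis
  unfolding C_hat_def set_borel_measurable_def bounded_iff using Phi_measurable by auto
qed

lemma C_hat_diff:
 assumes "f \<in> C_hat r" "\<psi> \<in> C_hat r"
 shows "(\<lambda>v. f v - \<psi> v) \<in> C_hat r"
proof -
 have [measurable]: "set_borel_measurable borel {-r..0} f" "set_borel_measurable borel {-r..0} \<psi>"
  using assms by (auto simp: C_hat_def)
 have "set_borel_measurable borel {-r..0} (\<lambda>v. f v - \<psi> v)"
  using assms unfolding C_hat_def set_borel_measurable_def by (auto simp: right_diff_distrib intro!: borel_measurable_diff)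
 moreover obtain B C where "\<forall>x\<in>{-r..0}. \<bar>f x\<bar> \<le> B" "\<forall>x\<in>{-r..0}. \<bar>\<psi> x\<bar> \<le> C"
  using assms unfolding C_hat_def bounded_iff by auto
 then have "\<forall>x\<in>{-r..0}. \<bar>f x - \<psi> x\<bar> \<le> B + C" by (auto intro!: order_trans[OF abs_triangle_ineq4] add_mono)
 ultimately show ?thesis unfolding C_hat_def bounded_iff by auto
qed

text \<open>Subtracting a rotation from a solution gives again a solution, with the rotation
  subtracted from the initial function; uniqueness does the rest.\<close>

lemma sol_diff_Phi:
 assumes phi: "g \<in> C_hat r" and t: "- r \<le> t"
 shows "sol (\<lambda>y. g y - Phi \<omega> v y) t = sol g t - Phi \<omega> v t"
proof (rule delay_sol_unique[OF C_hat_diff[OF phi C_hat_Phi] _ t, symmetric])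
 have s: "is_delay_sol r L g (sol g)" by (rule sol_is_delay_sol[OF phi])
 let ?p = "\<lambda>s. \<omega> * (v $ 2 * cos (\<omega> * s) - v $ 1 * sin (\<omega> * s))"
 note f = loc_bdd_forcing[OF phi]
 define x where "x t = g 0 * S t + conv S (forcing g) t" for t
 have x: "loc_bdd x" unfolding x_def[abs_def] by (intro loc_bdd_add loc_bdd_cmult loc_bdd_conv loc_bdd_S f)
 have sm: "sol g \<in> borel_measurable borel"
 proof -
  obtain B where [measurable]: "init g \<in> borel_measurable borel" using C_hat_init[OF phi] by blast
  note [measurable] = loc_bdd_measurable[OF x]
  have "sol g = (\<lambda>t. if t < 0 then init g t else x t)" by (rule ext) (auto simp: sol_def x_def)
  then show ?thesis by simp
 qed
 note [measurable] = sm Phi_measurable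
 have L: "L_ext r L (\<lambda>y. sol g (s + y) - Phi \<omega> v (s + y)) = L_ext r L (\<lambda>y. sol g (s + y)) - ?p s" if "0 \<le> s" for s
 proof -
  obtain B where B: "0 \<le> B" and [measurable]: "init g \<in> borel_measurable borel" and B': "\<And>y. \<bar>init g y\<bar> \<le> B"
   using C_hat_init[OF phi] by blast
  obtain C where C: "0 \<le> C" "\<And>u. 0 \<le> u \<Longrightarrow> u \<le> s \<Longrightarrow> \<bar>x u\<bar> \<le> C" using loc_bdd_obtain[OF x, of s] by blast
  let ?y = "\<lambda>y. if y \<le> 0 then sol g (s + y) else 0"
  have yb: "\<bar>?y y\<bar> \<le> max B C" for y 
   using B' C B by (auto simp: sol_def x_def[symmetric] le_max_iff_disj)
  have "L_ext r L (\<lambda>y. sol g (s + y) - Phi \<omega> v (s + y)) = lin (\<lambda>y. ?y y + (-1) * Phi \<omega> v (s + y))"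
   by (rule L_ext_lin) auto
  also have "\<dots> = lin ?y + lin (\<lambda>y. (-1) * Phi \<omega> v (s + y))"
   by (rule lin_add[OF _ yb, where C = "\<bar>v $ 1\<bar> + \<bar>v $ 2\<bar>"]) (use Phi_bound in auto)
  also have "lin ?y = L_ext r L (\<lambda>y. sol g (s + y))"
   by (rule L_ext_lin[symmetric]) auto
  finally show ?thesis unfolding lin_cmult lin_Phi by simp
 qed
 have pint: "((\<lambda>s. ?p s) has_integral (Phi \<omega> v t - Phi \<omega> v 0)) {0..t}" if "0 \<le> t" for t
  by (rule fundamental_theorem_of_calculus[OF that])
   (auto simp: Phi_def has_real_derivative_iff_has_vector_derivative[symmetric] algebra_simps intro!: derivative_eq_intros)
 have ps: "set_integrable lborel {0..t} ?p" for t
  by (rule borel_integrable_atLeastAtMost') (intro continuous_intros)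
 show "is_delay_sol r L (\<lambda>y. g y - Phi \<omega> v y) (\<lambda>t. sol g t - Phi \<omega> v t)"
  unfolding is_delay_sol_def
 proof (intro conjI ballI allI impI)
  fix y assume "y \<in> {-r..0}"
  then show "sol g y - Phi \<omega> v y = g y - Phi \<omega> v y" using s by (simp add: is_delay_sol_def)
 next
  fix t :: real assume t: "0 \<le> t"
  have si: "set_integrable lborel {0..t} (\<lambda>s. L_ext r L (\<lambda>y. sol g (s + y)))"
   and se: "sol g t = g 0 + (LINT s:{0..t}|lborel. L_ext r L (\<lambda>y. sol g (s + y)))"
   using s t unfolding is_delay_sol_def by auto
  have d: "set_integrable lborel {0..t} (\<lambda>s. L_ext r L (\<lambda>y. sol g (s + y)) - ?p s)"
   "(LINT s:{0..t}|lborel. L_ext r L (\<lambda>y. sol g (s + y)) - ?p s) =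
    (LINT s:{0..t}|lborel. L_ext r L (\<lambda>y. sol g (s + y))) - (LINT s:{0..t}|lborel. ?p s)"
   using set_integral_diff[OF si ps] by auto
  have c: "set_integrable lborel {0..t} (\<lambda>s. L_ext r L (\<lambda>y. sol g (s + y) - Phi \<omega> v (s + y))) \<longleftrightarrow>
    set_integrable lborel {0..t} (\<lambda>s. L_ext r L (\<lambda>y. sol g (s + y)) - ?p s)"
   "(LINT s:{0..t}|lborel. L_ext r L (\<lambda>y. sol g (s + y) - Phi \<omega> v (s + y))) =
    (LINT s:{0..t}|lborel. L_ext r L (\<lambda>y. sol g (s + y)) - ?p s)"
   by (rule set_integrable_cong set_lebesgue_integral_cong; use L in auto)+
  show "set_integrable lborel {0..t} (\<lambda>s. L_ext r L (\<lambda>y. sol g (s + y) - Phi \<omega> v (s + y)))"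
   using c(1) d(1) by simp
  have "(LINT s:{0..t}|lborel. ?p s) = Phi \<omega> v t - Phi \<omega> v 0"
   by (rule trans[OF set_borel_integral_eq_integral(2)[OF ps] integral_unique[OF pint[OF t]]])
  then show "sol g t - Phi \<omega> v t = g 0 - Phi \<omega> v 0 + (LINT s:{0..t}|lborel. L_ext r L (\<lambda>y. sol g (s + y) - Phi \<omega> v (s + y)))"
   using c(2) d(2) se by simp
 qed
qed

end

section \<open>Rotations, decaying remainders and the spectral projection\<close>

lemma Phi_diff: "Phi w v t - Phi w u t = Phi w (v - u) t"
 by (simp add: Phi_def algebra_simps)

text \<open>Sampling once per period at the phases 0 and pi / 2 reads off the two coordinates as
  limits of constant sequences.\<close>

lemma Phi_eq_0_if_tendsto:
 assumes w: "0 < w" and lim: "(Phi w v \<longlongrightarrow> 0) at_top"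
 shows "v = 0"
proof -
 have l: "filterlim (\<lambda>n. (2 * pi * real n + c) / w) at_top sequentially" for c
  using w by real_asymp
 have "(\<lambda>n. Phi w v ((2 * pi * real n + 0) / w)) \<longlonglongrightarrow> 0" by (rule filterlim_compose[OF lim l])
 moreover have "Phi w v ((2 * pi * real n + 0) / w) = v $ 1" for n
  using w by (simp add: Phi_def mult.assoc[symmetric] cos_int_2pin[of "int n", simplified] sin_int_2pin[of "int n", simplified] mult.commute[of pi])
 ultimately have v1: "v $ 1 = 0" by (simp add: LIMSEQ_const_iff)
 have "(\<lambda>n. Phi w v ((2 * pi * real n + pi / 2) / w)) \<longlonglongrightarrow> 0" by (rule filterlim_compose[OF lim l])
 moreover have "Phi w v ((2 * pi * real n + pi / 2) / w) = v $ 2" for n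
 proof -
  have "sin (2 * pi * real n + pi / 2) = 1" "cos (2 * pi * real n + pi / 2) = 0"
   using sin_int_2pin[of "int n"] cos_int_2pin[of "int n"] by (simp_all add: sin_add cos_add mult_ac)
  then show ?thesis using w by (simp add: Phi_def)
 qed
 ultimately have v2: "v $ 2 = 0" by (simp add: LIMSEQ_const_iff)
 show ?thesis using v1 v2 by (simp add: vec_eq_iff forall_2)
qed

lemma conv_one_stationary:
 assumes "\<And>s. r \<le> s \<Longrightarrow> g s = 0" "r \<le> t" "0 \<le> r"
 shows "conv (\<lambda>_. 1) g t = conv (\<lambda>_. 1) g r"
 unfolding conv_one_alt
 by (rule Bochner_Integration.integral_cong) (use assms in force)+

context delay_model
begin

text \<open>S is split into a rotation and a decaying part. The forcing lives on [0,r], so after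
  time r its convolution with the rotation is a rotation again, by the addition theorems, and its
  convolution with the decaying part keeps the decay rate. Times before r only cost a factor exp(c
  r). The rate c is common to all initial functions.\<close>

theorem spectral_decomposition:
 "\<exists>c>0. \<forall>q\<in>C_hat r. \<exists>v C. 0 \<le> C \<and> (\<forall>t\<ge>-r. \<bar>sol q t - Phi \<omega> v t\<bar> \<le> C * exp (- (c * t)))"
proof -
 obtain A B C c where c: "0 < c" and dec: "\<And>t. 0 \<le> t \<Longrightarrow> \<bar>S t - (A * cos (\<omega> * t) + B * sin (\<omega> * t))\<bar> \<le> C * exp (- (c * t))"
  using S_decay by blast
 have C0: "0 \<le> C" using order_trans[OF abs_ge_zero dec[of 0]] by simp
 define P where "P t = A * cos (\<omega> * t) + B * sin (\<omega> * t)" for t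
 define sQ where "sQ t = S t - P t" for t
 have P: "loc_bdd P" unfolding P_def by (intro loc_bdd_continuous continuous_intros)
 have sQ: "loc_bdd sQ" unfolding sQ_def[abs_def] by (intro loc_bdd_diff loc_bdd_S P)
 show ?thesis
 proof (intro exI[of _ c] conjI ballI c)
  fix q assume phi: "q \<in> C_hat r"
  define f where "f = forcing q"
  have f: "loc_bdd f" unfolding f_def by (rule loc_bdd_forcing[OF phi])
  obtain Bi where Bi: "0 \<le> Bi" "init q \<in> borel_measurable borel" "\<And>y. \<bar>init q y\<bar> \<le> Bi" using C_hat_init[OF phi] by blast
  have fb: "\<bar>f s\<bar> \<le> K * Bi" "r \<le> s \<Longrightarrow> f s = 0" for s
   unfolding f_def using forcing_bound[OF Bi(2,3)] by auto
  define g1 where "g1 s = f s * (A * cos (\<omega> * s) - B * sin (\<omega> * s))" for s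
  define g2 where "g2 s = f s * (A * sin (\<omega> * s) + B * cos (\<omega> * s))" for s
  have fh: "loc_bdd (\<lambda>s. f s * h s)" if "continuous_on UNIV h" for h
  proof -
   have h: "loc_bdd h" by (rule loc_bdd_continuous[OF that])
   note [measurable] = loc_bdd_measurable[OF f] loc_bdd_measurable[OF h]
   have "\<exists>B. \<forall>t\<in>{0..T}. \<bar>f t * h t\<bar> \<le> B" for T
   proof -
    obtain D where "0 \<le> D" "\<And>s. 0 \<le> s \<Longrightarrow> s \<le> T \<Longrightarrow> \<bar>h s\<bar> \<le> D" using loc_bdd_obtain[OF h, of T] by blast
    then show ?thesis
     by (intro exI[of _ "(K * Bi) * D"]) (use fb K_pos Bi in \<open>auto simp: abs_mult intro!: mult_mono\<close>)
   qed
   then show ?thesis by (simp add: loc_bdd_def)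
  qed
  have g: "loc_bdd g1" "loc_bdd g2" unfolding g1_def[abs_def] g2_def[abs_def] by (intro fh continuous_intros)+
  \<comment> \<open>The coordinates contain the integrals of g1 and g2 up to r, after which both
    integrands vanish.\<close>
  define v :: "real^2" where "v = vector [q 0 * A + conv (\<lambda>_. 1) g1 r, q 0 * B + conv (\<lambda>_. 1) g2 r]"
  have convP: "conv P f t = cos (\<omega> * t) * conv (\<lambda>_. 1) g1 t + sin (\<omega> * t) * conv (\<lambda>_. 1) g2 t" for t
  proof -
   have "conv P f t = (LBINT s. if 0 \<le> s \<and> s \<le> t then f s * P (t - s) else 0)"
    unfolding conv_commute[of P] conv_def ..
   also have "\<dots> = (LBINT s. cos (\<omega> * t) * (if 0 \<le> s \<and> s \<le> t then g1 s else 0) + sin (\<omega> * t) * (if 0 \<le> s \<and> s \<le> t then g2 s else 0))"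
    by (intro Bochner_Integration.integral_cong refl)
     (simp add: P_def g1_def g2_def right_diff_distrib cos_diff sin_diff algebra_simps)
   also have "\<dots> = cos (\<omega> * t) * (LBINT s. if 0 \<le> s \<and> s \<le> t then g1 s else 0) + sin (\<omega> * t) * (LBINT s. if 0 \<le> s \<and> s \<le> t then g2 s else 0)"
    using conv_integrable[OF g(1) loc_bdd_const[of 1], of t] conv_integrable[OF g(2) loc_bdd_const[of 1], of t]
    by (subst Bochner_Integration.integral_add) (auto simp: cong: if_cong)
   finally show ?thesis by (simp only: conv_one_alt)
  qed
  have main: "sol q t - Phi \<omega> v t = q 0 * sQ t + conv f sQ t" if t: "r \<le> t" for t
  proof -
   have t0: "0 \<le> t" using t p.r_pos by simp
   have "S = (\<lambda>t. P t + sQ t)" by (simp add: sQ_def[abs_def])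
   then have "conv S f t = conv P f t + conv sQ f t" using conv_add_left[OF f P sQ] by simp
   moreover have "conv (\<lambda>_. 1) g1 t = conv (\<lambda>_. 1) g1 r" "conv (\<lambda>_. 1) g2 t = conv (\<lambda>_. 1) g2 r"
    by (rule conv_one_stationary; use t fb(2) p.r_pos in \<open>auto simp: g1_def g2_def\<close>)+
   ultimately show ?thesis
    using t0 by (simp add: sol_def f_def[symmetric] convP Phi_def v_def P_def sQ_def conv_commute[of sQ] algebra_simps)
  qed
  have late: "\<bar>sol q t - Phi \<omega> v t\<bar> \<le> (\<bar>q 0\<bar> * C + K * Bi * (C * exp (c * r)) * r) * exp (- (c * t))" if t: "r \<le> t" for t
  proof -
   have t0: "0 \<le> t" using t p.r_pos by simp
   have m: "f \<in> borel_measurable borel" "sQ \<in> borel_measurable borel" using f sQ by (auto dest: loc_bdd_measurable)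
   note [measurable] = m
   have "conv f sQ t = (LBINT s. if 0 \<le> s \<and> s \<le> r then f s * sQ (t - s) else 0)"
    unfolding conv_def
    by (intro Bochner_Integration.integral_cong refl) (use fb(2) t in force)
   also have "\<bar>\<dots>\<bar> \<le> K * Bi * (C * exp (- (c * (t - r)))) * (r - 0)"
   proof (rule integral_if_le)
    fix s assume s: "0 \<le> s" "s \<le> r"
    have "\<bar>sQ (t - s)\<bar> \<le> C * exp (- (c * (t - s)))" unfolding sQ_def P_def by (rule dec) (use s t in auto)
    also have "\<dots> \<le> C * exp (- (c * (t - r)))" using s c C0 by (intro mult_left_mono) auto
    finally show "\<bar>f s * sQ (t - s)\<bar> \<le> K * Bi * (C * exp (- (c * (t - r))))"
     unfolding abs_mult using fb(1) K_pos Bi by (intro mult_mono) auto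
   qed (use p.r_pos in auto)
   also have "\<dots> = K * Bi * (C * exp (c * r)) * r * exp (- (c * t))"
    by (simp add: right_diff_distrib exp_diff exp_minus divide_inverse)
   finally have 1: "\<bar>conv f sQ t\<bar> \<le> K * Bi * (C * exp (c * r)) * r * exp (- (c * t))" .
   have "\<bar>q 0 * sQ t\<bar> \<le> \<bar>q 0\<bar> * (C * exp (- (c * t)))"
    unfolding abs_mult sQ_def P_def by (intro mult_left_mono dec t0) simp
   then show ?thesis using 1 unfolding main[OF t] by (simp add: algebra_simps)
  qed
  define x where "x t = q 0 * S t + conv S f t" for t
  have x: "loc_bdd x" unfolding x_def[abs_def] by (intro loc_bdd_add loc_bdd_cmult loc_bdd_conv loc_bdd_S f)
  obtain D where D: "0 \<le> D" "\<And>s. 0 \<le> s \<Longrightarrow> s \<le> r \<Longrightarrow> \<bar>x s\<bar> \<le> D" using loc_bdd_obtain[OF x, of r] by blast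
  define D1 where "D1 = Bi + D + \<bar>v $ 1\<bar> + \<bar>v $ 2\<bar>"
  have D10: "0 \<le> D1" using Bi D by (simp add: D1_def)
  have early: "\<bar>sol q t - Phi \<omega> v t\<bar> \<le> D1 * exp (c * r) * exp (- (c * t))" if t: "t \<le> r" for t
  proof -
   have "\<bar>sol q t\<bar> \<le> Bi + D"
   proof (cases "t < 0")
    case True
    then show ?thesis using Bi(3)[of t] D(1) by (simp add: sol_def)
   next
    case False
    then show ?thesis using D(2)[of t] t Bi(1) by (simp add: sol_def x_def f_def)
   qed
   then have "\<bar>sol q t - Phi \<omega> v t\<bar> \<le> D1 * 1" using Phi_bound[of \<omega> v t] by (simp add: D1_def)
   also have "\<dots> \<le> D1 * exp (c * (r - t))" using D10 t c by (intro mult_left_mono) auto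
   finally show ?thesis by (simp add: right_diff_distrib exp_diff exp_minus divide_inverse mult.assoc)
  qed
  define C' where "C' = max (\<bar>q 0\<bar> * C + K * Bi * (C * exp (c * r)) * r) (D1 * exp (c * r))"
  show "\<exists>v C. 0 \<le> C \<and> (\<forall>t\<ge>-r. \<bar>sol q t - Phi \<omega> v t\<bar> \<le> C * exp (- (c * t)))"
  proof (intro exI[of _ v] exI[of _ C'] conjI allI impI)
   show "0 \<le> C'" using D10 by (simp add: C'_def le_max_iff_disj)
   fix t
   show "\<bar>sol q t - Phi \<omega> v t\<bar> \<le> C' * exp (- (c * t))"
   proof (cases "r \<le> t")
    case True
    show ?thesis by (rule order_trans[OF late[OF True] mult_right_mono]) (auto simp: C'_def)
   next
    case False
    then have "t \<le> r" by simp
    show ?thesis by (rule order_trans[OF early[OF \<open>t \<le> r\<close>] mult_right_mono]) (auto simp: C'_def)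
   qed
  qed
 qed
qed

text \<open>A rotation that tends to zero vanishes, so at most one rotation can be subtracted from f
  to reach \<open>Q_hat\<close>; the decomposition supplies it. This is existence and uniqueness of
  the projection at once.\<close>

lemma Q_hat_iff:
 assumes phi: "f \<in> C_hat r" and g: "0 < g"
  and C: "\<And>t. - r \<le> t \<Longrightarrow> \<bar>sol f t - Phi \<omega> v t\<bar> \<le> C * exp (- (g * t))"
 shows "(\<lambda>y. f y - Phi \<omega> u y) \<in> Q_hat r L \<longleftrightarrow> u = v"
proof -
 let ?\<psi> = "\<lambda>y. f y - Phi \<omega> u y"
 have psi: "?\<psi> \<in> C_hat r" by (rule C_hat_diff[OF phi C_hat_Phi])
 have C0: "0 \<le> C"
 proof -
  have "0 \<le> C * exp (- (g * 0))" using C[of 0] p.r_pos by (meson abs_ge_zero order_trans less_imp_le neg_le_0_iff_le)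
  then show ?thesis by simp
 qed
 have T: "sup_on r (T_hat r L t ?\<psi>) = (SUP y\<in>{-r..0}. \<bar>sol f (t + y) - Phi \<omega> u (t + y)\<bar>)" if "0 \<le> t" for t
  unfolding sup_on_def by (intro SUP_cong refl) (use T_hat_eq[OF psi that] sol_diff_Phi[OF phi] that in auto)
 have dec: "\<bar>sol f (t + y) - Phi \<omega> v (t + y)\<bar> \<le> C * exp (g * r) * exp (- (g * t))" if "y \<in> {-r..0}" "0 \<le> t" for t y
 proof -
  have "\<bar>sol f (t + y) - Phi \<omega> v (t + y)\<bar> \<le> C * exp (- (g * (t + y)))" by (rule C) (use that in auto)
  also have "\<dots> \<le> C * exp (g * r - g * t)"
   using that g C0 mult_left_mono[of "- y" r g] by (intro mult_left_mono) (auto simp: algebra_simps)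
  finally show ?thesis by (simp add: exp_diff exp_minus divide_inverse)
 qed
 have lim0: "((\<lambda>t. C * exp (g * r) * exp (- (g * t))) \<longlongrightarrow> 0) at_top" using g by real_asymp
 show ?thesis
 proof
  assume uv: "u = v"
  have "((\<lambda>t. sup_on r (T_hat r L t ?\<psi>)) \<longlongrightarrow> 0) at_top"
  proof (rule Lim_null_comparison[OF _ lim0], rule eventually_mono[OF eventually_ge_at_top[of 0]])
   fix t :: real assume t: "0 \<le> t"
   have bdd: "bdd_above ((\<lambda>y. \<bar>sol f (t + y) - Phi \<omega> v (t + y)\<bar>) ` {-r..0})"
    by (rule bdd_aboveI2[OF dec[OF _ t]])
   have "(SUP y\<in>{-r..0}. \<bar>sol f (t + y) - Phi \<omega> v (t + y)\<bar>) \<le> C * exp (g * r) * exp (- (g * t))"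
    by (rule cSUP_least[OF _ dec[OF _ t]]) (use p.r_pos in auto)
   moreover have "0 \<le> (SUP y\<in>{-r..0}. \<bar>sol f (t + y) - Phi \<omega> v (t + y)\<bar>)"
    by (rule cSUP_upper2[OF bdd, of 0]) (use p.r_pos in auto)
   ultimately show "norm (sup_on r (T_hat r L t ?\<psi>)) \<le> C * exp (g * r) * exp (- (g * t))"
    using T[OF t] uv by simp
  qed
  then show "?\<psi> \<in> Q_hat r L" using psi by (simp add: Q_hat_def)
 next
  assume "?\<psi> \<in> Q_hat r L"
  then have lim: "((\<lambda>t. sup_on r (T_hat r L t ?\<psi>)) \<longlongrightarrow> 0) at_top" by (simp add: Q_hat_def)
  have "((\<lambda>t. sol f t - Phi \<omega> u t) \<longlongrightarrow> 0) at_top"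
  proof (rule Lim_null_comparison[OF _ lim], rule eventually_mono[OF eventually_ge_at_top[of 0]])
   fix t :: real assume t: "0 \<le> t"
   \<comment> \<open>A bound at the fixed time t: only for bounded sets does the supremum dominate
     the single values.\<close>
   define E where "E = C * exp (g * r) * exp (- (g * t)) + (\<bar>(v - u) $ 1\<bar> + \<bar>(v - u) $ 2\<bar>)"
   have bdd: "bdd_above ((\<lambda>y. \<bar>sol f (t + y) - Phi \<omega> u (t + y)\<bar>) ` {-r..0})"
   proof (rule bdd_aboveI2[where M = E])
    fix y assume th: "y \<in> {-r..0}"
    show "\<bar>sol f (t + y) - Phi \<omega> u (t + y)\<bar> \<le> E"
     using dec[OF th t] Phi_bound[of \<omega> "v - u" "t + y"] unfolding Phi_diff[symmetric] E_def by linarith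
   qed
   have "\<bar>sol f (t + 0) - Phi \<omega> u (t + 0)\<bar> \<le> (SUP y\<in>{-r..0}. \<bar>sol f (t + y) - Phi \<omega> u (t + y)\<bar>)"
    by (rule cSUP_upper[OF _ bdd]) (use p.r_pos in auto)
   then show "norm (sol f t - Phi \<omega> u t) \<le> sup_on r (T_hat r L t ?\<psi>)" using T[OF t] by simp
  qed
  moreover have "((\<lambda>t. sol f t - Phi \<omega> v t) \<longlongrightarrow> 0) at_top"
  proof (rule Lim_null_comparison[OF _ lim0], rule eventually_mono[OF eventually_ge_at_top[of 0]])
   fix t :: real assume "0 \<le> t"
   then show "norm (sol f t - Phi \<omega> v t) \<le> C * exp (g * r) * exp (- (g * t))" using dec[of 0 t] p.r_pos by simp
  qed
  ultimately have "((\<lambda>t. (sol f t - Phi \<omega> v t) - (sol f t - Phi \<omega> u t)) \<longlongrightarrow> 0 - 0) at_top" by (intro tendsto_diff)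
  then have "(Phi \<omega> (u - v) \<longlongrightarrow> 0) at_top" unfolding Phi_diff[symmetric, abs_def] by simp
  then have "u - v = 0" by (rule Phi_eq_0_if_tendsto[OF \<omega>_pos])
  then show "u = v" by simp
 qed
qed

lemma Phi_inj: "Phi \<omega> u = Phi \<omega> v \<Longrightarrow> u = v"
proof -
 assume e: "Phi \<omega> u = Phi \<omega> v"
 have "Phi \<omega> u 0 = Phi \<omega> v 0" "Phi \<omega> u (pi / 2 / \<omega>) = Phi \<omega> v (pi / 2 / \<omega>)" by (simp_all add: e)
 then show ?thesis using \<omega>_pos by (simp add: Phi_def vec_eq_iff forall_2)
qed

text \<open>Evaluates both \<open>THE\<close> operators: \<open>pi_hat\<close> and
  \<open>pi_coord\<close> return the rotation of the spectral decomposition.\<close>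

theorem projection_decay:
 "\<exists>g>0. \<forall>f\<in>C_hat r. pi_hat r L \<omega> f = Phi \<omega> (pi_coord r L \<omega> f) \<and>
   (\<exists>C\<ge>0. \<forall>t\<ge>-r. \<bar>sol f t - Phi \<omega> (pi_coord r L \<omega> f) t\<bar> \<le> C * exp (- (g * t)))"
proof -
 obtain g where g: "0 < g" and dec: "\<And>f. f \<in> C_hat r \<Longrightarrow>
   \<exists>v C. 0 \<le> C \<and> (\<forall>t\<ge>-r. \<bar>sol f t - Phi \<omega> v t\<bar> \<le> C * exp (- (g * t)))"
  using spectral_decomposition by blast
 show ?thesis
 proof (rule exI[of _ g], intro conjI ballI g)
  fix f assume phi: "f \<in> C_hat r"
  obtain v C where C0: "0 \<le> C" and C: "\<And>t. - r \<le> t \<Longrightarrow> \<bar>sol f t - Phi \<omega> v t\<bar> \<le> C * exp (- (g * t))"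
   using dec[OF phi] by blast
  note Q = Q_hat_iff[OF phi g C]
  have ph: "pi_hat r L \<omega> f = Phi \<omega> v"
   unfolding pi_hat_def
  proof (rule the_equality)
   show "Phi \<omega> v \<in> P_space \<omega> \<and> (\<lambda>y. f y - Phi \<omega> v y) \<in> Q_hat r L" using Q[of v] by (simp add: P_space_def)
   fix p assume p: "p \<in> P_space \<omega> \<and> (\<lambda>y. f y - p y) \<in> Q_hat r L"
   then obtain u where u: "p = Phi \<omega> u" by (auto simp: P_space_def)
   show "p = Phi \<omega> v" using p Q[of u] unfolding u by simp
  qed
  have pc: "pi_coord r L \<omega> f = v"
   unfolding pi_coord_def ph by (rule the_equality) (auto dest: Phi_inj)
  show "pi_hat r L \<omega> f = Phi \<omega> (pi_coord r L \<omega> f)" unfolding ph pc ..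
  show "\<exists>C\<ge>0. \<forall>t\<ge>-r. \<bar>sol f t - Phi \<omega> (pi_coord r L \<omega> f) t\<bar> \<le> C * exp (- (g * t))"
   unfolding pc using C0 C by blast
 qed
qed

lemma C_hat_indicator: "indicator {0} \<in> C_hat r"
 unfolding C_hat_def set_borel_measurable_def bounded_iff
 by (auto intro!: exI[of _ 1] borel_measurable_times borel_measurable_indicator simp: indicator_def)

text \<open>With an initial value concentrated at 0 the forcing vanishes; hence
  \<open>Psi_tilde\<close>, the projection of this indicator, gives the rotation part of S.\<close>

lemma sol_indicator: "0 \<le> t \<Longrightarrow> sol (indicator {0}) t = S t"
proof -
 assume t: "0 \<le> t"
 have "forcing (indicator {0}) s = 0" for s
 proof -
  have "(\<lambda>v. if s + v < 0 then init (indicator {0}) (s + v) else 0) = (\<lambda>_. 0)" by (auto simp: init_def)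
  then show ?thesis by (simp add: forcing_def lin_def)
 qed
 then have "forcing (indicator {0}) = (\<lambda>_. 0)" by (rule ext)
 then have "conv S (forcing (indicator {0})) t = 0" by (simp add: conv_def cong: if_cong)
 then show ?thesis using t by (simp add: sol_def)
qed

lemma C_hat_continuous: "continuous_on {-r..0} \<xi> \<Longrightarrow> \<xi> \<in> C_hat r"
proof -
 assume c: "continuous_on {-r..0} \<xi>"
 have "bounded (\<xi> ` {-r..0})" by (rule compact_imp_bounded[OF compact_continuous_image[OF c compact_Icc]])
 moreover have "set_borel_measurable borel {-r..0} \<xi>"
  unfolding set_borel_measurable_def by (rule borel_measurable_continuous_on_indicator[OF _ c]) simp
 ultimately show ?thesis by (simp add: C_hat_def)
qed

text \<open>The deterministic term of the statement becomes the linear solution from \<xi> less its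
  rotation part.\<close>

lemma Y_frak_eq:
 assumes xi: "continuous_on {-r..0} \<xi>" and s: "0 \<le> s"
 shows "Y_frak r L \<omega> \<xi> \<epsilon> s 0 = sol \<xi> (s / \<epsilon>\<^sup>2) - Phi \<omega> (z_init r L \<omega> \<xi>) (s / \<epsilon>\<^sup>2)"
proof -
 have phi: "\<xi> \<in> C_hat r" by (rule C_hat_continuous[OF xi])
 have "pi_hat r L \<omega> \<xi> = Phi \<omega> (pi_coord r L \<omega> \<xi>)" using projection_decay phi by blast
 then have y: "y_init r L \<omega> \<xi> = (\<lambda>v. \<xi> v - Phi \<omega> (z_init r L \<omega> \<xi>) v)" by (simp add: y_init_def z_init_def)
 have "T_hat r L (s / \<epsilon>\<^sup>2) (y_init r L \<omega> \<xi>) 0 = sol (y_init r L \<omega> \<xi>) (s / \<epsilon>\<^sup>2 + 0)"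
  unfolding y by (rule T_hat_eq[OF C_hat_diff[OF phi C_hat_Phi]]) (use s p.r_pos in auto)
 also have "\<dots> = sol \<xi> (s / \<epsilon>\<^sup>2) - Phi \<omega> (z_init r L \<omega> \<xi>) (s / \<epsilon>\<^sup>2)"
  unfolding y add_0_right
 proof (rule sol_diff_Phi[OF phi])
  have "0 \<le> s / \<epsilon>\<^sup>2" using s by simp
  then show "- r \<le> s / \<epsilon>\<^sup>2" using p.r_pos by linarith
 qed
 finally show ?thesis by (simp add: Y_frak_def)
qed

end

section \<open>A quantitative Kolmogorov continuity criterion\<close>

text \<open>The factor by which an increment of Hoelder exponent 1/8 shrinks when the step is
  halved.\<close>

definition hoelder_ratio :: real where "hoelder_ratio = 2 powr (- 1 / 8)"

text \<open>A geometric series on either side, one step between them, and a factor 2 from rounding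
  the distance to a dyadic level.\<close>

definition hoelder_const :: real where
 "hoelder_const = 2 * (1 + 2 * (1 / (1 - hoelder_ratio)))"

lemma hoelder_ratio: "0 < hoelder_ratio" "hoelder_ratio < 1" "hoelder_ratio ^ 8 = 1 / 2"
proof -
 show "0 < hoelder_ratio" "hoelder_ratio < 1"
  unfolding hoelder_ratio_def by (auto simp: powr_less_one)
 have "hoelder_ratio ^ 8 = 2 powr (- 1 / 8 * 8)"
  unfolding hoelder_ratio_def by (subst powr_power) auto
 then show "hoelder_ratio ^ 8 = 1 / 2" by (simp add: powr_minus_divide)
qed

lemma hoelder_const_pos: "0 < hoelder_const"
 using hoelder_ratio unfolding hoelder_const_def by (simp add: add_pos_nonneg)

lemma floor_double: "\<lfloor>2 * (x::real)\<rfloor> = 2 * \<lfloor>x\<rfloor> \<or> \<lfloor>2 * x\<rfloor> = 2 * \<lfloor>x\<rfloor> + 1"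
 by linarith

text \<open>With 2^-n comparable to y - x, the chain runs from x through its dyadic floors down to
  level n, across at most one step of that level, and up to y. Consecutive floors of a point differ
  by at most one dyadic step, so the increments are dominated by geometric series; continuity passes
  from the floors to x and y.\<close>

lemma dyadic_chaining:
 fixes g :: "real \<Rightarrow> real"
 assumes cont: "continuous_on {0..1} g" and N: "0 \<le> N"
  and inc: "\<And>n k. k < (2::nat) ^ n \<Longrightarrow> \<bar>g ((real k + 1) / 2 ^ n) - g (real k / 2 ^ n)\<bar> \<le> N * hoelder_ratio ^ n"
  and xy: "0 \<le> x" "x \<le> y" "y \<le> 1"
 shows "\<bar>g y - g x\<bar> \<le> N * hoelder_const * (y - x) powr (1 / 8)"
proof (cases "x = y")
 case True
 then show ?thesis by simp
next
 case False
 define p where "p = hoelder_ratio"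
 have p: "0 < p" "p < 1" using hoelder_ratio by (auto simp: p_def)
 define a where "a n x = \<lfloor>2 ^ n * x\<rfloor>" for n :: nat and x :: real
 define fl where "fl n x = real_of_int (a n x) / 2 ^ n" for n x
 have a01: "0 \<le> a n x" "a n x \<le> 2 ^ n" if "0 \<le> x" "x \<le> 1" for n x
 proof -
  show "0 \<le> a n x" using that by (simp add: a_def)
  have "2 ^ n * x \<le> 2 ^ n * 1" using that by (intro mult_left_mono) auto
  then have "a n x \<le> \<lfloor>2 ^ n :: real\<rfloor>" unfolding a_def by (intro floor_mono) simp
  then show "a n x \<le> 2 ^ n" by (metis floor_numeral_power)
 qed
 have step: "\<bar>g (real_of_int (j + 1) / 2 ^ n) - g (real_of_int j / 2 ^ n)\<bar> \<le> N * p ^ n" if "0 \<le> j" "j + 1 \<le> 2 ^ n" for j n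
 proof -
  have "nat j < 2 ^ n" using that by (simp add: nat_less_iff)
  from inc[OF this] show ?thesis using that by (simp add: p_def)
 qed
 have flx: "fl n x \<in> {0..1}" if "0 \<le> x" "x \<le> 1" for n x
 proof -
  have "real_of_int (a n x) \<le> 2 ^ n" using a01(2)[OF that, of n] by (metis of_int_le_iff of_int_numeral of_int_power)
  then show ?thesis using a01(1)[OF that, of n] by (simp add: fl_def)
 qed
 have fl_lim: "(\<lambda>n. fl n x) \<longlonglongrightarrow> x" for x
 proof -
  have "(\<lambda>n. (1/2) ^ n :: real) \<longlonglongrightarrow> 0" by (intro LIMSEQ_realpow_zero) auto
  moreover have "norm (fl n x - x) \<le> (1/2) ^ n" for n
  proof -
   have "\<bar>real_of_int (a n x) - 2 ^ n * x\<bar> \<le> 1" unfolding a_def by linarith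
   then have "\<bar>(real_of_int (a n x) - 2 ^ n * x) / 2 ^ n\<bar> \<le> 1 / 2 ^ n"
    unfolding abs_divide by (intro divide_mono) auto
   moreover have "(real_of_int (a n x) - 2 ^ n * x) / 2 ^ n = fl n x - x" by (simp add: fl_def diff_divide_distrib)
   ultimately show ?thesis by (simp add: power_one_over)
  qed
  ultimately have "(\<lambda>n. fl n x - x) \<longlonglongrightarrow> 0" by (rule Lim_null_comparison[OF always_eventually[OF allI], rotated])
  then show ?thesis by (simp add: LIM_zero_iff)
 qed
 have chain1: "\<bar>g (fl (Suc n) x) - g (fl n x)\<bar> \<le> N * p ^ Suc n" if x: "0 \<le> x" "x \<le> 1" for n x
 proof -
  have dbl: "a (Suc n) x = 2 * a n x \<or> a (Suc n) x = 2 * a n x + 1"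
   unfolding a_def using floor_double[of "2 ^ n * x"] by (simp add: mult.assoc)
  have fe: "fl n x = real_of_int (2 * a n x) / 2 ^ Suc n" by (simp add: fl_def)
  from dbl show ?thesis
  proof
   assume "a (Suc n) x = 2 * a n x"
   then have "fl (Suc n) x = fl n x" unfolding fe by (simp add: fl_def)
   then show ?thesis using N p by simp
  next
   assume e: "a (Suc n) x = 2 * a n x + 1"
   show ?thesis
    unfolding fe unfolding fl_def e
    by (rule step) (use a01[OF x, of n] a01(2)[OF x, of "Suc n"] e in auto)
  qed
 qed
 define h where "h = 1 / (1 - p)"
 have h: "0 < h" "1 + p * h = h" using p by (auto simp: h_def field_simps)
 have chainj: "\<bar>g (fl (n + j) x) - g (fl n x)\<bar> \<le> N * h * p ^ n * (1 - p ^ j)" if x: "0 \<le> x" "x \<le> 1" for n j x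
 proof (induction j)
  case (Suc j)
  have "\<bar>g (fl (n + Suc j) x) - g (fl n x)\<bar> \<le> \<bar>g (fl (Suc (n + j)) x) - g (fl (n + j) x)\<bar> + \<bar>g (fl (n + j) x) - g (fl n x)\<bar>"
   by simp
  also have "\<dots> \<le> N * p ^ Suc (n + j) + N * h * p ^ n * (1 - p ^ j)"
   by (intro add_mono chain1 x Suc.IH)
  also have "p ^ Suc (n + j) \<le> h * p ^ n * (p ^ j * (1 - p))"
   using p by (simp add: h_def power_add mult_le_cancel_right1)
  then have "N * p ^ Suc (n + j) + N * h * p ^ n * (1 - p ^ j) \<le> N * (h * p ^ n * (p ^ j * (1 - p))) + N * h * p ^ n * (1 - p ^ j)"
   using N by (intro add_right_mono mult_left_mono) auto
  also have "\<dots> = N * h * p ^ n * (1 - p ^ Suc j)" by (simp add: algebra_simps)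
  finally show ?case .
 qed simp
 have chain: "\<bar>g x - g (fl n x)\<bar> \<le> N * h * p ^ n" if x: "0 \<le> x" "x \<le> 1" for n x
 proof -
  have "(\<lambda>j. g (fl (n + j) x)) \<longlonglongrightarrow> g x"
  proof (rule continuous_on_tendsto_compose[OF cont])
   show "(\<lambda>j. fl (n + j) x) \<longlonglongrightarrow> x" using LIMSEQ_ignore_initial_segment[OF fl_lim, of n] by (simp add: add.commute)
  qed (use x flx[OF x] in auto)
  then have "(\<lambda>j. \<bar>g (fl (n + j) x) - g (fl n x)\<bar>) \<longlonglongrightarrow> \<bar>g x - g (fl n x)\<bar>" by (intro tendsto_intros)
  moreover have "\<bar>g (fl (n + j) x) - g (fl n x)\<bar> \<le> N * h * p ^ n" for j
  proof -
   have "N * h * p ^ n * (1 - p ^ j) \<le> N * h * p ^ n * 1" using p N h by (intro mult_left_mono) auto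
   then show ?thesis using chainj[OF x, of n j] by simp
  qed
  ultimately show ?thesis by (intro LIMSEQ_le_const2) auto
 qed
 define d where "d = y - x"
 have d: "0 < d" "d \<le> 1" using xy False by (auto simp: d_def)
 \<comment> \<open>The least level whose step is below d; the level n just before it satisfies d
   \<le> 2^-n < 2 d.\<close>
 define m where "m = (LEAST m. (1/2::real) ^ m < d)"
 have ex: "\<exists>m. (1/2::real) ^ m < d" by (rule real_arch_pow_inv) (use d in auto)
 have m: "(1/2) ^ m < d" unfolding m_def by (rule LeastI_ex[OF ex])
 have "m \<noteq> 0" using m d by (cases m) auto
 then obtain n where n: "m = Suc n" using not0_implies_Suc by blast
 have dn: "d \<le> (1/2) ^ n" using not_less_Least[of n "\<lambda>m. (1/2::real) ^ m < d"] n unfolding m_def by simp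
 have x01: "0 \<le> x" "x \<le> 1" and y01: "0 \<le> y" "y \<le> 1" using xy by auto
 have mid: "\<bar>g (fl n y) - g (fl n x)\<bar> \<le> N * p ^ n"
 proof -
  have "2 ^ n * y - 2 ^ n * x \<le> 1"
   using mult_left_mono[OF dn, of "2 ^ n"] by (simp add: d_def right_diff_distrib flip: power_mult_distrib)
  then have "a n y \<le> a n x + 1" unfolding a_def by linarith
  moreover have "a n x \<le> a n y" unfolding a_def using xy by (intro floor_mono mult_left_mono) auto
  ultimately have "a n y = a n x \<or> a n y = a n x + 1" by linarith
  then show ?thesis
  proof
   assume "a n y = a n x + 1"
   then show ?thesis
    using step[of "a n x" n] a01[OF x01, of n] a01(2)[OF y01, of n] unfolding fl_def by simp
  qed (use N p in \<open>simp add: fl_def\<close>)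
 qed
 have "\<bar>g y - g x\<bar> \<le> \<bar>g y - g (fl n y)\<bar> + \<bar>g (fl n y) - g (fl n x)\<bar> + \<bar>g x - g (fl n x)\<bar>" by linarith
 also have "\<dots> \<le> N * h * p ^ n + N * p ^ n + N * h * p ^ n"
  by (intro add_mono chain mid x01 y01)
 also have "\<dots> = N * (1 + 2 * h) * p ^ n" by (simp add: algebra_simps)
 also have "p ^ n \<le> 2 * d powr (1 / 8)"
 proof -
  have "p ^ n = (2 powr (- 1 / 8)) powr real n" unfolding p_def hoelder_ratio_def by (simp add: powr_realpow)
  also have "\<dots> = (2 powr (- real n)) powr (1 / 8)" by (simp add: powr_powr mult.commute)
  also have "2 powr (- real n) = 2 * (1/2) ^ m"
   unfolding n by (simp add: powr_minus powr_realpow power_one_over inverse_eq_divide)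
  also have "(2 * (1/2) ^ m) powr (1 / 8) \<le> (2 * d) powr (1 / 8)" using m by (intro powr_mono2) auto
  also have "\<dots> = 2 powr (1 / 8) * d powr (1 / 8)" using d by (simp add: powr_mult)
  also have "\<dots> \<le> 2 powr 1 * d powr (1 / 8)" by (intro mult_right_mono powr_mono) auto
  finally show ?thesis by simp
 qed
 then have "N * (1 + 2 * h) * p ^ n \<le> N * (1 + 2 * h) * (2 * d powr (1 / 8))"
  using N h by (intro mult_left_mono) auto
 also have "\<dots> = N * hoelder_const * (y - x) powr (1 / 8)"
  by (simp add: hoelder_const_def h_def p_def d_def mult_ac)
 finally show ?thesis .
qed

text \<open>The fourth power comes from passing to the unit interval and dividing N by
  \<open>hoelder_const\<close>; 4 bounds the sum of the geometric series with ratio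
  2^(-1/2).\<close>

definition kolmogorov_const :: "real \<Rightarrow> real \<Rightarrow> real" where
 "kolmogorov_const C T = 4 * C * T\<^sup>2 * (hoelder_const / T powr (1 / 8)) ^ 4"

text \<open>Markov's inequality for the fourth moment bounds each of the 2^n increments at level n;
  since 1/8 is below 1/4, the union over a level still decays geometrically. Off the union of all
  these events every continuous path satisfies the hypothesis of
  \<open>dyadic_chaining\<close>.\<close>

lemma (in prob_space) kolmogorov_tightness:
 fixes Y :: "real \<Rightarrow> 'a \<Rightarrow> real"
 assumes T: "0 < T" and C: "0 \<le> C" and N: "0 < N"
  and meas: "\<And>t. t \<in> {0..T} \<Longrightarrow> Y t \<in> borel_measurable M"
  and cont: "AE y in M. continuous_on {0..T} (\<lambda>t. Y t y)"
  and mom: "\<And>s t. 0 \<le> s \<Longrightarrow> s \<le> t \<Longrightarrow> t \<le> T \<Longrightarrow>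
    (\<integral>\<^sup>+ y. ennreal ((Y t y - Y s y) ^ 4) \<partial>M) \<le> ennreal (C * (t - s)\<^sup>2)"
 shows "\<exists>B\<in>sets M. measure M B \<le> kolmogorov_const C T / N ^ 4 \<and>
  (AE y in M. y \<notin> B \<longrightarrow> (\<forall>s\<in>{0..T}. \<forall>t\<in>{0..T}. \<bar>Y t y - Y s y\<bar> \<le> N * \<bar>t - s\<bar> powr (1 / 8)))"
proof -
 define d where "d = hoelder_ratio"
 have d: "0 < d" "d < 1" "d ^ 8 = 1 / 2" using hoelder_ratio by (auto simp: d_def)
 define N1 where "N1 = N * T powr (1 / 8) / hoelder_const"
 have N1: "0 < N1" using N T hoelder_const_pos by (simp add: N1_def)
 define p where "p n k = real k * T / 2 ^ n" for n k :: nat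
 have p: "p n k \<in> {0..T}" if "k \<le> 2 ^ n" for n k
 proof -
  have "real k \<le> 2 ^ n" using that by (metis of_nat_le_iff of_nat_numeral of_nat_power)
  then show ?thesis using T by (simp add: p_def divide_le_eq mult.commute)
 qed
 have pd: "p n (Suc k) - p n k = T / 2 ^ n" for n k by (simp add: p_def field_simps)
 define A where "A n k = {y\<in>space M. N1 * d ^ n < \<bar>Y (p n (Suc k)) y - Y (p n k) y\<bar>}" for n k
 have A: "A n k \<in> sets M" if "k < 2 ^ n" for n k
 proof -
  have [measurable]: "Y (p n (Suc k)) \<in> borel_measurable M" "Y (p n k) \<in> borel_measurable M"
   using that by (auto intro!: meas p)
  show ?thesis unfolding A_def by measurable
 qed
 \<comment> \<open>q is 2^(-1/2). At level n the threshold costs 1 / q^n and the squared length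
   gains 4^(-n), so each event has weight (q / 2)^n and the whole level q^n.\<close>
 define q where "q = d ^ 4"
 have q2: "q * q = 1 / 2" using d(3) by (simp add: q_def flip: power_add)
 have q0: "0 < q" using d by (simp add: q_def)
 have q34: "q \<le> 3 / 4"
 proof (rule ccontr)
  assume "\<not> q \<le> 3 / 4"
  then have "3 / 4 * (3 / 4) < q * q" by (intro mult_strict_mono) auto
  then show False using q2 by simp
 qed
 have EA: "emeasure M (A n k) \<le> ennreal (C * T\<^sup>2 / N1 ^ 4 * (q / 2) ^ n)" if k: "k < 2 ^ n" for n k
 proof -
  have [measurable]: "Y (p n (Suc k)) \<in> borel_measurable M" "Y (p n k) \<in> borel_measurable M"
   using k by (auto intro!: meas p)
  define c where "c = (N1 * d ^ n) ^ 4"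
  have c: "0 < c" using N1 d by (simp add: c_def)
  have "emeasure M (A n k) = (\<integral>\<^sup>+ y. indicator (A n k) y \<partial>M)" using A[OF k] by simp
  also have "\<dots> \<le> (\<integral>\<^sup>+ y. ennreal (1 / c) * ennreal ((Y (p n (Suc k)) y - Y (p n k) y) ^ 4) \<partial>M)"
  proof (rule nn_integral_mono)
   fix y
   show "indicator (A n k) y \<le> ennreal (1 / c) * ennreal ((Y (p n (Suc k)) y - Y (p n k) y) ^ 4)"
   proof (cases "y \<in> A n k")
    case True
    then have "c \<le> \<bar>Y (p n (Suc k)) y - Y (p n k) y\<bar> ^ 4"
     unfolding A_def c_def using N1 d by (intro power_mono) auto
    then have "1 \<le> 1 / c * (Y (p n (Suc k)) y - Y (p n k) y) ^ 4"
     using c by (simp add: power_even_abs divide_simps)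
    then show ?thesis using True c by (simp flip: ennreal_mult' ennreal_1)
   qed simp
  qed
  also have "\<dots> = ennreal (1 / c) * (\<integral>\<^sup>+ y. ennreal ((Y (p n (Suc k)) y - Y (p n k) y) ^ 4) \<partial>M)"
   by (rule nn_integral_cmult) measurable
  also have "\<dots> \<le> ennreal (1 / c) * ennreal (C * (p n (Suc k) - p n k)\<^sup>2)"
  proof (intro mult_left_mono mom)
   show "0 \<le> p n k" "p n (Suc k) \<le> T" using p[of k n] p[of "Suc k" n] k by auto
   have "0 \<le> T / 2 ^ n" using T by simp
   then show "p n k \<le> p n (Suc k)" using pd[of n k] by linarith
  qed simp
  also have "\<dots> = ennreal (1 / c * (C * (T / 2 ^ n)\<^sup>2))" unfolding pd by (rule ennreal_mult'[symmetric]) (use c in simp)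
  also have "1 / c * (C * (T / 2 ^ n)\<^sup>2) = C * T\<^sup>2 / N1 ^ 4 * (q / 2) ^ n"
  proof -
   have c': "c = N1 ^ 4 * q ^ n" by (simp add: c_def q_def power_mult_distrib power_mult[symmetric] mult.commute)
   have iq: "1 / q ^ n = (2 * q) ^ n"
   proof -
    have "q ^ n * (2 * q) ^ n = (q * (2 * q)) ^ n" by (rule power_mult_distrib[symmetric])
    also have "q * (2 * q) = 1" using q2 by simp
    finally show ?thesis using q0 by (simp add: field_simps)
   qed
   have e2: "(2 * q) ^ n * (1 / (2 ^ n)\<^sup>2) = (q / 2) ^ n"
    by (simp add: power_mult_distrib power_divide power2_eq_square)
   have "1 / c * (C * (T / 2 ^ n)\<^sup>2) = C * T\<^sup>2 / N1 ^ 4 * ((1 / q ^ n) * (1 / (2 ^ n)\<^sup>2))"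
    unfolding c' power_divide by simp
   then show ?thesis by (simp only: iq e2)
  qed
  finally show ?thesis .
 qed
 define Bn where "Bn n = (\<Union>k<2 ^ n. A n k)" for n :: nat
 define B where "B = (\<Union>n. Bn n)"
 have Bn: "Bn n \<in> sets M" for n unfolding Bn_def using A by auto
 have B: "B \<in> sets M" unfolding B_def using Bn by auto
 have EBn: "emeasure M (Bn n) \<le> ennreal (C * T\<^sup>2 / N1 ^ 4 * q ^ n)" for n
 proof -
  have "emeasure M (Bn n) \<le> (\<Sum>k<2 ^ n. emeasure M (A n k))"
   unfolding Bn_def by (rule emeasure_subadditive_finite) (use A in auto)
  also have "\<dots> \<le> (\<Sum>k<(2::nat) ^ n. ennreal (C * T\<^sup>2 / N1 ^ 4 * (q / 2) ^ n))"
   by (intro sum_mono EA) auto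
  also have "\<dots> = ennreal (\<Sum>k<(2::nat) ^ n. C * T\<^sup>2 / N1 ^ 4 * (q / 2) ^ n)"
   by (rule sum_ennreal) (use C N1 q0 in auto)
  also have "(\<Sum>k<(2::nat) ^ n. C * T\<^sup>2 / N1 ^ 4 * (q / 2) ^ n) = C * T\<^sup>2 / N1 ^ 4 * q ^ n"
   by (simp add: power_divide)
  finally show ?thesis .
 qed
 have "emeasure M B \<le> (\<Sum>n. emeasure M (Bn n))"
  unfolding B_def by (rule emeasure_subadditive_countably) (use Bn in auto)
 also have "\<dots> \<le> (\<Sum>n. ennreal (C * T\<^sup>2 / N1 ^ 4 * q ^ n))" by (intro suminf_le EBn) auto
 also have "\<dots> = ennreal (\<Sum>n. C * T\<^sup>2 / N1 ^ 4 * q ^ n)"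
  by (rule suminf_ennreal2) (use C N1 q0 q34 in \<open>auto intro!: summable_mult summable_geometric\<close>)
 also have "(\<Sum>n. C * T\<^sup>2 / N1 ^ 4 * q ^ n) = C * T\<^sup>2 / N1 ^ 4 * (1 / (1 - q))"
  using q0 q34 by (subst suminf_mult) (auto intro!: summable_geometric simp: suminf_geometric)
 also have "\<dots> \<le> C * T\<^sup>2 / N1 ^ 4 * 4"
  using q34 C N1 by (intro mult_left_mono) (auto simp: divide_le_eq)
 also have "\<dots> = kolmogorov_const C T / N ^ 4"
  by (simp add: N1_def kolmogorov_const_def power_divide power_mult_distrib mult_ac)
 finally have "emeasure M B \<le> ennreal (kolmogorov_const C T / N ^ 4)" by (simp add: ennreal_leI)
 moreover have "0 \<le> kolmogorov_const C T / N ^ 4"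
  using C hoelder_const_pos N by (simp add: kolmogorov_const_def)
 ultimately have mB: "measure M B \<le> kolmogorov_const C T / N ^ 4"
  by (simp add: emeasure_eq_measure)
 have "AE y in M. y \<notin> B \<longrightarrow> (\<forall>s\<in>{0..T}. \<forall>t\<in>{0..T}. \<bar>Y t y - Y s y\<bar> \<le> N * \<bar>t - s\<bar> powr (1 / 8))"
  using cont AE_space
 proof eventually_elim
  case (elim y)
  show ?case
  proof (intro impI ballI)
   fix s t assume nB: "y \<notin> B" and st: "s \<in> {0..T}" "t \<in> {0..T}"
   define g where "g x = Y (T * x) y" for x
   have gc: "continuous_on {0..1} g" unfolding g_def
    by (rule continuous_on_compose2[OF elim(1)]) (use T in \<open>auto intro!: continuous_intros simp: mult_left_le\<close>)
   have inc: "\<bar>g ((real k + 1) / 2 ^ n) - g (real k / 2 ^ n)\<bar> \<le> N1 * hoelder_ratio ^ n" if "k < 2 ^ n" for n k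
   proof -
    have "y \<notin> A n k" using nB that by (auto simp: B_def Bn_def)
    then show ?thesis using elim(2) by (auto simp: A_def g_def p_def d_def mult.commute add.commute)
   qed
   have main: "\<bar>Y t y - Y s y\<bar> \<le> N * \<bar>t - s\<bar> powr (1 / 8)" if "0 \<le> s" "s \<le> t" "t \<le> T" for s t
   proof -
    have "\<bar>g (t / T) - g (s / T)\<bar> \<le> N1 * hoelder_const * (t / T - s / T) powr (1 / 8)"
     by (rule dyadic_chaining[OF gc _ inc]) (use N1 that T in \<open>auto simp: divide_right_mono\<close>)
    also have "(t / T - s / T) powr (1 / 8) = (t - s) powr (1 / 8) / T powr (1 / 8)"
     using that T by (simp add: powr_divide flip: diff_divide_distrib)
    also have "N1 * hoelder_const * ((t - s) powr (1 / 8) / T powr (1 / 8)) = N * (t - s) powr (1 / 8)"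
     using hoelder_const_pos T by (simp add: N1_def)
    finally show ?thesis using T that by (simp add: g_def)
   qed
   show "\<bar>Y t y - Y s y\<bar> \<le> N * \<bar>t - s\<bar> powr (1 / 8)"
    using main[of s t] main[of t s] st by (cases "s \<le> t") (auto simp: abs_minus_commute)
  qed
 qed
 then show ?thesis using B mB by blast
qed

section \<open>Wiener integrals of smooth deterministic functions\<close>

lemma measure_lborel_Ioc_max: "measure lborel {x<..y::real} = max 0 (y - x)"
 by (cases "x \<le> y") auto

section \<open>Covariances of increments and the isometry for step functions\<close>

locale wiener = prob_space M for M :: "'w measure" +
 fixes W :: "real \<Rightarrow> 'w \<Rightarrow> real"
 assumes wiener: "wiener_process M W"
begin

lemma W_measurable[measurable]: "0 \<le> t \<Longrightarrow> W t \<in> borel_measurable M"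
 using wiener unfolding wiener_process_def by blast

lemma W_0: "AE y in M. W 0 y = 0"
 using wiener unfolding wiener_process_def by blast

lemma W_continuous: "AE y in M. continuous_on {0..} (\<lambda>t. W t y)"
 using wiener unfolding wiener_process_def by blast

lemma W_increment_normal: "0 \<le> s \<Longrightarrow> s < t \<Longrightarrow> distributed M lborel (\<lambda>y. W t y - W s y) (normal_density 0 (sqrt (t - s)))"
 using wiener unfolding wiener_process_def by blast

lemma W_increments_indep:
 "0 \<le> ts 0 \<Longrightarrow> (\<And>i. i < n \<Longrightarrow> ts i < ts (Suc i)) \<Longrightarrow>
  indep_vars (\<lambda>_. borel) (\<lambda>i y. W (ts (Suc i)) y - W (ts i) y) {..<n}"
 using wiener unfolding wiener_process_def by blast

lemma normal_even_moment:
 assumes X: "distributed M lborel X (normal_density 0 \<sigma>)" and \<sigma>: "0 < \<sigma>"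
 shows "integrable M (\<lambda>y. X y ^ (2 * k))" "expectation (\<lambda>y. X y ^ (2 * k)) = fact (2 * k) / ((2 / \<sigma>\<^sup>2) ^ k * fact k)"
proof -
 have h: "has_bochner_integral lborel (\<lambda>x. normal_density 0 \<sigma> x * (x - 0) ^ (2 * k)) (fact (2 * k) / ((2 / \<sigma>\<^sup>2) ^ k * fact k))"
  by (rule normal_moment_even[OF \<sigma>])
 then have i: "integrable lborel (\<lambda>x. normal_density 0 \<sigma> x * x ^ (2 * k))" by (simp add: has_bochner_integral_iff)
 show "integrable M (\<lambda>y. X y ^ (2 * k))"
  using distributed_integrable[OF X, of "\<lambda>x. x ^ (2 * k)"] i by simp
 show "expectation (\<lambda>y. X y ^ (2 * k)) = fact (2 * k) / ((2 / \<sigma>\<^sup>2) ^ k * fact k)"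
  using distributed_integral[OF X, of "\<lambda>x. x ^ (2 * k)"] h by (simp add: has_bochner_integral_iff)
qed

lemma W_increment_moments:
 assumes "0 \<le> s" "s \<le> t"
 shows "integrable M (\<lambda>y. (W t y - W s y)\<^sup>2)" "expectation (\<lambda>y. (W t y - W s y)\<^sup>2) = t - s"
  "expectation (\<lambda>y. W t y - W s y) = 0" "integrable M (\<lambda>y. W t y - W s y)"
proof -
 have *: "integrable M (\<lambda>y. (W t y - W s y)\<^sup>2) \<and> expectation (\<lambda>y. (W t y - W s y)\<^sup>2) = t - s \<and>
  expectation (\<lambda>y. W t y - W s y) = 0 \<and> integrable M (\<lambda>y. W t y - W s y)"
 proof (cases "s = t")
  case False
  then have st: "s < t" using assms by simp
  have \<sigma>: "0 < sqrt (t - s)" using st by simp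
  note X = W_increment_normal[OF assms(1) st]
  have "integrable M (\<lambda>y. W t y - W s y)"
  proof (rule Bochner_Integration.integrable_bound[OF Bochner_Integration.integrable_add[OF integrable_const[of 1] normal_even_moment(1)[OF X \<sigma>, of 1]]])
   have "\<bar>x\<bar> \<le> \<bar>1 + x ^ 2\<bar>" for x :: real
   proof -
    have "0 \<le> (\<bar>x\<bar> - 1)\<^sup>2" by simp
    then have "2 * \<bar>x\<bar> \<le> 1 + x\<^sup>2" by (simp add: power2_diff)
    then show ?thesis by linarith
   qed
   then show "AE y in M. norm (W t y - W s y) \<le> norm (1 + (W t y - W s y) ^ (2 * 1))" by simp
  qed (use assms in simp)
  moreover have "expectation (\<lambda>y. W t y - W s y) = 0"
   using normal_distributed_expectation[OF \<sigma> X] by simp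
  ultimately show ?thesis using normal_even_moment[OF X \<sigma>, of 1] st by (simp add: fact_numeral)
 qed simp
 then show "integrable M (\<lambda>y. (W t y - W s y)\<^sup>2)" "expectation (\<lambda>y. (W t y - W s y)\<^sup>2) = t - s"
  "expectation (\<lambda>y. W t y - W s y) = 0" "integrable M (\<lambda>y. W t y - W s y)" by auto
qed

lemma W_covariance_le:
 assumes s: "0 \<le> s" "s \<le> t"
 shows "integrable M (\<lambda>y. W s y * W t y)" "expectation (\<lambda>y. W s y * W t y) = s"
proof -
 have t: "0 \<le> t" using s by simp
 have [measurable]: "W 0 \<in> borel_measurable M" "W s \<in> borel_measurable M" "W t \<in> borel_measurable M" using s t by simp_all
 note m0 = W_increment_moments[of 0 s, OF order_refl s(1)] and m1 = W_increment_moments[OF s]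
 have prod: "integrable M (\<lambda>y. (W s y - W 0 y) * (W t y - W s y)) \<and>
   expectation (\<lambda>y. (W s y - W 0 y) * (W t y - W s y)) = 0"
 \<comment> \<open>Independence is available for strictly increasing times; in the remaining cases
   one factor is zero.\<close>
 proof (cases "s = 0 \<or> s = t")
  case False
  then have st: "0 < s" "s < t" using s by auto
  define ts where "ts i = (if i = 0 then 0 else if i = 1 then s else t)" for i :: nat
  have ind: "indep_vars (\<lambda>_. borel) (\<lambda>i y. W (ts (Suc i)) y - W (ts i) y) {..<2}"
   by (rule W_increments_indep) (use st in \<open>auto simp: ts_def less_2_cases_iff\<close>)
  have int: "integrable M (\<lambda>y. W (ts (Suc i)) y - W (ts i) y)" if "i \<in> {..<2}" for i
   using that m0(4) m1(4) by (auto simp: ts_def less_2_cases_iff)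
  have p: "(\<Prod>i\<in>{..<2::nat}. W (ts (Suc i)) y - W (ts i) y) = (W s y - W 0 y) * (W t y - W s y)" for y
   by (simp add: numeral_2_eq_2 ts_def)
  have "integrable M (\<lambda>y. \<Prod>i\<in>{..<2::nat}. W (ts (Suc i)) y - W (ts i) y)"
   by (rule indep_vars_integrable[OF _ ind int]) simp_all
  moreover have "expectation (\<lambda>y. \<Prod>i\<in>{..<2::nat}. W (ts (Suc i)) y - W (ts i) y) = (\<Prod>i\<in>{..<2::nat}. expectation (\<lambda>y. W (ts (Suc i)) y - W (ts i) y))"
   by (rule indep_vars_lebesgue_integral[OF _ ind int]) simp_all
  moreover have "\<dots> = 0" using m0(3) by (simp add: numeral_2_eq_2 ts_def)
  ultimately show ?thesis unfolding p by simp
 qed auto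
 have e: "AE y in M. W s y * W t y = (W s y - W 0 y) * (W t y - W s y) + (W s y - W 0 y)\<^sup>2"
  using W_0 by eventually_elim (simp add: power2_eq_square algebra_simps)
 have "integrable M (\<lambda>y. (W s y - W 0 y) * (W t y - W s y) + (W s y - W 0 y)\<^sup>2)" using prod m0(1) by simp
 then show "integrable M (\<lambda>y. W s y * W t y)"
  by (subst integrable_cong_AE[OF _ _ e]) auto
 have "expectation (\<lambda>y. W s y * W t y) = expectation (\<lambda>y. (W s y - W 0 y) * (W t y - W s y) + (W s y - W 0 y)\<^sup>2)"
  by (rule integral_cong_AE[OF _ _ e]) auto
 also have "\<dots> = s" using prod m0(1,2) by simp
 finally show "expectation (\<lambda>y. W s y * W t y) = s" .
qed

lemma W_covariance:
 assumes "0 \<le> s" "0 \<le> t"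
 shows "integrable M (\<lambda>y. W s y * W t y)" "expectation (\<lambda>y. W s y * W t y) = min s t"
 using W_covariance_le[of s t] W_covariance_le[of t s] assms
 by (cases "s \<le> t"; simp add: mult.commute)+

text \<open>By bilinearity and the covariance min s t, the expectation is the length of the overlap
  of the two intervals.\<close>

lemma W_increment_covariance:
 assumes ab: "0 \<le> a" "a \<le> b" and cd: "0 \<le> c" "c \<le> d"
 shows "integrable M (\<lambda>y. (W b y - W a y) * (W d y - W c y))"
  "expectation (\<lambda>y. (W b y - W a y) * (W d y - W c y)) = (LBINT s. indicator {a<..b} s * indicator {c<..d} s)"
proof -
 have pos: "0 \<le> b" "0 \<le> d" using ab cd by auto
 have e: "(\<lambda>y. (W b y - W a y) * (W d y - W c y)) = (\<lambda>y. W b y * W d y - W b y * W c y - W a y * W d y + W a y * W c y)"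
  by (auto simp: algebra_simps)
 show "integrable M (\<lambda>y. (W b y - W a y) * (W d y - W c y))"
  unfolding e by (intro Bochner_Integration.integrable_add Bochner_Integration.integrable_diff W_covariance pos ab cd)
 have "expectation (\<lambda>y. (W b y - W a y) * (W d y - W c y)) = min b d - min b c - min a d + min a c"
  unfolding e using ab cd pos
  by (subst Bochner_Integration.integral_add Bochner_Integration.integral_diff;
    (intro Bochner_Integration.integrable_add Bochner_Integration.integrable_diff W_covariance pos ab cd)?)+
   (simp add: W_covariance)
 also have "\<dots> = max 0 (min b d - max a c)" using ab cd by (auto simp: min_def max_def)
 also have "\<dots> = (LBINT s. indicator {a<..b} s * indicator {c<..d} s)"
 proof -
  have "(\<lambda>s. indicator {a<..b} s * indicator {c<..d} s :: real) = indicator {max a c<..min b d}"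
   by (auto simp: indicator_def fun_eq_iff)
  moreover have "measure lborel {max a c<..min b d} = max 0 (min b d - max a c)"
   by (rule measure_lborel_Ioc_max)
  ultimately show ?thesis by simp
 qed
 finally show "expectation (\<lambda>y. (W b y - W a y) * (W d y - W c y)) = (LBINT s. indicator {a<..b} s * indicator {c<..d} s)" .
qed

lemma step_on_mono:
 assumes "step_on t (n, ts, c)" "i < n"
 shows "0 \<le> ts i" "ts i \<le> ts (Suc i)" "ts (Suc i) \<le> t"
proof -
 have inc: "ts j \<le> ts (Suc j)" if "j < n" for j using assms that by (auto simp: step_on_def)
 have "ts 0 \<le> ts j" if "j \<le> n" for j
  using that by (induction j) (auto intro: order_trans[OF _ inc])
 then show "0 \<le> ts i" using assms by (auto simp: step_on_def intro: order_trans)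
 show "ts i \<le> ts (Suc i)" by (rule inc[OF assms(2)])
 have "ts j \<le> ts n" if "j \<le> n" for j
  using that by (induction rule: inc_induct) (auto intro: order_trans[OF inc])
 from this[of "Suc i"] show "ts (Suc i) \<le> t" using assms by (auto simp: step_on_def)
qed

lemma step_integral_measurable:
 assumes "step_on t F"
 shows "step_integral W F \<in> borel_measurable M"
proof -
 obtain n ts c where F: "F = (n, ts, c)" by (cases F)
 have [measurable]: "W (ts i) \<in> borel_measurable M" "W (ts (Suc i)) \<in> borel_measurable M" if "i < n" for i
  using step_on_mono[OF assms[unfolded F] that] by (auto intro!: W_measurable)
 show ?thesis unfolding F step_integral_def by (auto intro!: borel_measurable_sum)
qed

lemma step_fun_measurable: "step_fun F \<in> borel_measurable borel"
proof -
 obtain n ts c where F: "F = (n, ts, c)" by (cases F)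
 show ?thesis unfolding F step_fun_def prod.case
  by (intro borel_measurable_sum borel_measurable_times borel_measurable_const borel_measurable_indicator) auto
qed

text \<open>A bilinear expansion with the overlap formula; it treats two different partitions
  directly, pair by pair.\<close>

lemma step_inner_product:
 assumes F: "step_on t F" and G: "step_on t G"
 shows "integrable M (\<lambda>y. step_integral W F y * step_integral W G y)"
  "integrable lborel (\<lambda>s. step_fun F s * step_fun G s)"
  "expectation (\<lambda>y. step_integral W F y * step_integral W G y) = (LBINT s. step_fun F s * step_fun G s)"
proof -
 obtain n ts c where F': "F = (n, ts, c)" by (cases F)
 obtain m us d where G': "G = (m, us, d)" by (cases G)
 note f = step_on_mono[OF F[unfolded F']] and g = step_on_mono[OF G[unfolded G']]
 have eS: "step_integral W F y * step_integral W G y = (\<Sum>i<n. \<Sum>j<m. c i * d j * ((W (ts (Suc i)) y - W (ts i) y) * (W (us (Suc j)) y - W (us j) y)))" for y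
  unfolding F' G' step_integral_def by (simp add: sum_product mult_ac)
 have eF: "step_fun F s * step_fun G s = (\<Sum>i<n. \<Sum>j<m. c i * d j * (indicator {ts i<..ts (Suc i)} s * indicator {us j<..us (Suc j)} s))" for s
  unfolding F' G' step_fun_def prod.case sum_product by (intro sum.cong refl) (simp only: mult_ac)
 have iW: "integrable M (\<lambda>y. c i * d j * ((W (ts (Suc i)) y - W (ts i) y) * (W (us (Suc j)) y - W (us j) y)))"
  if "i \<in> {..<n}" "j \<in> {..<m}" for i j
  by (intro integrable_mult_right W_increment_covariance) (use f g that in auto)
 have il: "integrable lborel (\<lambda>s. c i * d j * (indicator {ts i<..ts (Suc i)} s * indicator {us j<..us (Suc j)} s))" if "i \<in> {..<n}" for i j
 proof (intro integrable_mult_right)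
  have "(\<lambda>s. indicator {ts i<..ts (Suc i)} s * indicator {us j<..us (Suc j)} s :: real) = indicator ({ts i<..ts (Suc i)} \<inter> {us j<..us (Suc j)})"
   by (rule ext) (rule indicator_inter_arith[symmetric])
  moreover have "emeasure lborel ({ts i<..ts (Suc i)} \<inter> {us j<..us (Suc j)}) \<le> emeasure lborel {ts i<..ts (Suc i)}"
   by (rule emeasure_mono) auto
  then have "emeasure lborel ({ts i<..ts (Suc i)} \<inter> {us j<..us (Suc j)}) < \<infinity>" using f(2) that by (auto simp: le_less_trans)
  ultimately show "integrable lborel (\<lambda>s. indicator {ts i<..ts (Suc i)} s * indicator {us j<..us (Suc j)} s :: real)" by simp
 qed
 show "integrable M (\<lambda>y. step_integral W F y * step_integral W G y)"
  unfolding eS by (intro Bochner_Integration.integrable_sum iW)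
 show "integrable lborel (\<lambda>s. step_fun F s * step_fun G s)"
  unfolding eF by (intro Bochner_Integration.integrable_sum il)
 have "expectation (\<lambda>y. step_integral W F y * step_integral W G y) = (\<Sum>i<n. \<Sum>j<m. expectation (\<lambda>y. c i * d j * ((W (ts (Suc i)) y - W (ts i) y) * (W (us (Suc j)) y - W (us j) y))))"
  unfolding eS
  by (subst Bochner_Integration.integral_sum, intro Bochner_Integration.integrable_sum iW, simp, simp, intro sum.cong refl, rule Bochner_Integration.integral_sum, rule iW)
 also have "\<dots> = (\<Sum>i<n. \<Sum>j<m. (LBINT s. c i * d j * (indicator {ts i<..ts (Suc i)} s * indicator {us j<..us (Suc j)} s)))"
  using f g by (intro sum.cong refl) (simp add: W_increment_covariance)
 also have "\<dots> = (LBINT s. step_fun F s * step_fun G s)"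
  unfolding eF
  by (subst Bochner_Integration.integral_sum, intro Bochner_Integration.integrable_sum il, simp, intro sum.cong refl, rule Bochner_Integration.integral_sum[symmetric], rule il, simp)
 finally show "expectation (\<lambda>y. step_integral W F y * step_integral W G y) = (LBINT s. step_fun F s * step_fun G s)" .
qed

lemma step_fun_support:
 assumes "step_on t F" "s \<notin> {0..t}"
 shows "step_fun F s = 0"
proof -
 obtain n ts c where F: "F = (n, ts, c)" by (cases F)
 show ?thesis
  unfolding F step_fun_def prod.case
 proof (rule sum.neutral, rule ballI)
  fix i assume "i \<in> {..<n}"
  then show "c i * indicator {ts i<..ts (Suc i)} s = 0"
   using step_on_mono[OF assms(1)[unfolded F], of i] assms(2) by (auto simp: indicator_def)
 qed
qed

lemma step_isometry:
 assumes F: "step_on t F" and G: "step_on t G"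
 shows "(\<integral>\<^sup>+ z. ennreal ((step_integral W F z - step_integral W G z)\<^sup>2) \<partial>M) =
  (\<integral>\<^sup>+ s\<in>{0..t}. ennreal ((step_fun F s - step_fun G s)\<^sup>2) \<partial>lborel)"
proof -
 have e: "(x - y)\<^sup>2 = x * x - 2 * (x * y) + y * y" for x y :: real by (simp add: power2_eq_square algebra_simps)
 note FF = step_inner_product[OF F F] and FG = step_inner_product[OF F G] and GG = step_inner_product[OF G G]
 have i1: "integrable M (\<lambda>z. (step_integral W F z - step_integral W G z)\<^sup>2)"
  unfolding e by (intro Bochner_Integration.integrable_add Bochner_Integration.integrable_diff integrable_mult_right FF FG GG)
 have i2: "integrable lborel (\<lambda>s. (step_fun F s - step_fun G s)\<^sup>2)"
  unfolding e by (intro Bochner_Integration.integrable_add Bochner_Integration.integrable_diff integrable_mult_right FF FG GG)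
 have "(\<integral>\<^sup>+ z. ennreal ((step_integral W F z - step_integral W G z)\<^sup>2) \<partial>M) = ennreal (expectation (\<lambda>z. (step_integral W F z - step_integral W G z)\<^sup>2))"
  by (rule nn_integral_eq_integral[OF i1]) simp
 also have "expectation (\<lambda>z. (step_integral W F z - step_integral W G z)\<^sup>2) = (LBINT s. (step_fun F s - step_fun G s)\<^sup>2)"
  unfolding e using FF FG GG by simp
 also have "ennreal \<dots> = (\<integral>\<^sup>+ s. ennreal ((step_fun F s - step_fun G s)\<^sup>2) \<partial>lborel)"
  by (rule nn_integral_eq_integral[OF i2, symmetric]) simp
 also have "\<dots> = (\<integral>\<^sup>+ s\<in>{0..t}. ennreal ((step_fun F s - step_fun G s)\<^sup>2) \<partial>lborel)"
  by (intro nn_integral_cong) (use step_fun_support[OF F] step_fun_support[OF G] in \<open>auto simp: indicator_def\<close>)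
 finally show ?thesis .
qed

end

section \<open>Riemann sums along equidistant partitions\<close>

definition equi_part :: "nat \<Rightarrow> real \<Rightarrow> real \<Rightarrow> nat \<Rightarrow> real" where
 "equi_part n a b i = a + (b - a) * real i / real (Suc n)"

definition riemann_step :: "(real \<Rightarrow> real) \<Rightarrow> nat \<Rightarrow> real \<Rightarrow> real \<Rightarrow> step" where
 "riemann_step f n a b = (Suc n, equi_part n a b, \<lambda>i. f (equi_part n a b i))"

lemma equi_part:
 assumes "a \<le> b"
 shows "equi_part n a b 0 = a" "equi_part n a b (Suc n) = b" "equi_part n a b i \<le> equi_part n a b (Suc i)"
  "equi_part n a b (Suc i) - equi_part n a b i = (b - a) / real (Suc n)"
  "i \<le> Suc n \<Longrightarrow> equi_part n a b i \<in> {a..b}"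
proof -
 show "equi_part n a b 0 = a" "equi_part n a b (Suc n) = b" by (simp_all add: equi_part_def del: of_nat_Suc)
 show d: "equi_part n a b (Suc i) - equi_part n a b i = (b - a) / real (Suc n)"
  by (simp add: equi_part_def diff_divide_distrib[symmetric] right_diff_distrib[symmetric])
 then show "equi_part n a b i \<le> equi_part n a b (Suc i)"
  using assms by (smt (verit) divide_nonneg_nonneg of_nat_0_le_iff)
 show "equi_part n a b i \<in> {a..b}" if "i \<le> Suc n"
 proof -
  have "real i / real (Suc n) \<le> 1" using that by (simp del: of_nat_Suc)
  then have "(b - a) * (real i / real (Suc n)) \<le> (b - a) * 1" using assms by (intro mult_left_mono) auto
  then show ?thesis using assms by (simp add: equi_part_def)
 qed
qed

lemma sum_integral_equi_part:
 fixes g :: "real \<Rightarrow> real"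
 assumes ab: "a \<le> b" and g: "continuous_on {a..b} g"
 shows "(\<Sum>i<Suc n. integral {equi_part n a b i..equi_part n a b (Suc i)} g) = integral {a..b} g"
proof -
 have "(\<Sum>i<k. integral {equi_part n a b i..equi_part n a b (Suc i)} g) = integral {a..equi_part n a b k} g" if "k \<le> Suc n" for k
  using that
 proof (induction k)
  case 0
  then show ?case by (simp add: equi_part(1)[OF ab])
 next
  case (Suc k)
  have "integral {a..equi_part n a b k} g + integral {equi_part n a b k..equi_part n a b (Suc k)} g = integral {a..equi_part n a b (Suc k)} g"
  proof (rule Henstock_Kurzweil_Integration.integral_combine)
   have m: "equi_part n a b k \<in> {a..b}" "equi_part n a b (Suc k) \<in> {a..b}"
    using Suc.prems by (auto intro!: equi_part(5)[OF ab] simp del: atLeastAtMost_iff)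
   then show "a \<le> equi_part n a b k" by simp
   show "equi_part n a b k \<le> equi_part n a b (Suc k)" by (rule equi_part(3)[OF ab])
   show "g integrable_on {a..equi_part n a b (Suc k)}"
    using m by (intro integrable_continuous_real continuous_on_subset[OF g]) auto
  qed
  then show ?case using Suc by simp
 qed
 from this[of "Suc n"] show ?thesis by (simp only: equi_part(2)[OF ab] order_refl)
qed

text \<open>Summation by parts moves the increments from w to the differentiable f; the resulting
  sums converge to the integral of f' w by uniform continuity of w. Only continuity of w enters, so
  that Brownian paths are covered.\<close>

lemma riemann_stieltjes_by_parts:
 fixes f f' w :: "real \<Rightarrow> real"
 assumes ab: "a \<le> b" and f: "\<And>t. (f has_real_derivative f' t) (at t)" and f': "continuous_on UNIV f'"
  and w: "continuous_on {a..b} w"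
 shows "(\<lambda>n. \<Sum>i<Suc n. f (equi_part n a b i) * (w (equi_part n a b (Suc i)) - w (equi_part n a b i)))
   \<longlonglongrightarrow> f b * w b - f a * w a - integral {a..b} (\<lambda>s. f' s * w s)"
proof (rule LIMSEQ_I)
 fix e :: real assume e: "0 < e"
 have "\<exists>B. \<forall>x\<in>{a..b}. \<bar>f' x\<bar> \<le> B"
  using compact_imp_bounded[OF compact_continuous_image[OF continuous_on_subset[OF f' subset_UNIV] compact_Icc], of a b]
  by (simp add: bounded_iff)
 then obtain B where B: "\<And>x. x \<in> {a..b} \<Longrightarrow> \<bar>f' x\<bar> \<le> B" by blast
 have B0: "0 \<le> B" using B[of a] ab by force
 define e' where "e' = e / (B * (b - a) + 1)"
 have den: "0 < B * (b - a) + 1" using B0 ab by (simp add: add_nonneg_pos)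
 have e': "0 < e'" using e den by (simp add: e'_def)
 have e'e: "B * e' * (b - a) < e"
 proof -
  have "B * e' * (b - a) < (B * (b - a) + 1) * e'" using e' by (simp add: algebra_simps)
  also have "\<dots> = e" using den by (simp add: e'_def)
  finally show ?thesis .
 qed
 have "uniformly_continuous_on {a..b} w" by (rule compact_uniformly_continuous[OF w compact_Icc])
 then have "\<exists>d>0. \<forall>x\<in>{a..b}. \<forall>y\<in>{a..b}. dist y x < d \<longrightarrow> dist (w y) (w x) < e'"
  using e' unfolding uniformly_continuous_on_def by simp
 then obtain d where d: "d > 0" and du: "\<And>x y. x \<in> {a..b} \<Longrightarrow> y \<in> {a..b} \<Longrightarrow> \<bar>y - x\<bar> < d \<Longrightarrow> \<bar>w y - w x\<bar> < e'"
  unfolding dist_real_def by metis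
 obtain N where N: "(b - a) / d < real N" using reals_Archimedean2 by blast
 show "\<exists>no. \<forall>n\<ge>no. norm ((\<Sum>i<Suc n. f (equi_part n a b i) * (w (equi_part n a b (Suc i)) - w (equi_part n a b i))) -
   (f b * w b - f a * w a - integral {a..b} (\<lambda>s. f' s * w s))) < e"
 proof (intro exI[of _ N] allI impI)
  fix n assume n: "N \<le> n"
  define t where "t = equi_part n a b"
  note t = equi_part(1-4)[OF ab, of n, folded t_def]
  have t5: "t i \<in> {a..b}" if "i \<le> Suc n" for i using equi_part(5)[OF ab that] by (simp only: t_def)
  have mesh: "(b - a) / real (Suc n) < d"
  proof -
   have "(b - a) / d < real (Suc n)" using N n by simp
   then show ?thesis using d by (simp add: field_simps)
  qed
  have tin: "t i \<in> {a..b}" "t (Suc i) \<in> {a..b}" if "i \<in> {..<Suc n}" for i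
   using t5[of i] t5[of "Suc i"] that by auto
  have tel: "(\<Sum>i<Suc n. f (t (Suc i)) * w (t (Suc i)) - f (t i) * w (t i)) = f b * w b - f a * w a"
   using sum_lessThan_telescope[of "\<lambda>i. f (t i) * w (t i)" "Suc n"] t(1,2) by simp
  have fw: "continuous_on {a..b} (\<lambda>s. f' s * w s)" by (intro continuous_intros w continuous_on_subset[OF f']) auto
  have piece: "(w (t (Suc i)) * (f (t (Suc i)) - f (t i))) - integral {t i..t (Suc i)} (\<lambda>s. f' s * w s) =
    integral {t i..t (Suc i)} (\<lambda>s. f' s * (w (t (Suc i)) - w s))" if i: "i \<in> {..<Suc n}" for i
  proof -
   have sub: "{t i..t (Suc i)} \<subseteq> {a..b}" using tin[OF i] by auto
   have I: "(f' has_integral (f (t (Suc i)) - f (t i))) {t i..t (Suc i)}"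
    by (rule fundamental_theorem_of_calculus[OF t(3)])
     (use f in \<open>auto simp: has_real_derivative_iff_has_vector_derivative[symmetric] intro: DERIV_subset\<close>)
   have "((\<lambda>s. f' s * w (t (Suc i)) - f' s * w s) has_integral ((f (t (Suc i)) - f (t i)) * w (t (Suc i)) - integral {t i..t (Suc i)} (\<lambda>s. f' s * w s))) {t i..t (Suc i)}"
    by (intro has_integral_diff has_integral_mult_left I integrable_integral integrable_continuous_real continuous_on_subset[OF fw sub])
   then have "integral {t i..t (Suc i)} (\<lambda>s. f' s * w (t (Suc i)) - f' s * w s) = (f (t (Suc i)) - f (t i)) * w (t (Suc i)) - integral {t i..t (Suc i)} (\<lambda>s. f' s * w s)"
    by (rule integral_unique)
   then show ?thesis by (simp add: right_diff_distrib mult.commute)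
  qed
  have pb: "\<bar>integral {t i..t (Suc i)} (\<lambda>s. f' s * (w (t (Suc i)) - w s))\<bar> \<le> B * e' * ((b - a) / real (Suc n))" if i: "i \<in> {..<Suc n}" for i
  proof -
   have sub: "{t i..t (Suc i)} \<subseteq> {a..b}" using tin[OF i] by auto
   have "norm (integral {t i..t (Suc i)} (\<lambda>s. f' s * (w (t (Suc i)) - w s))) \<le> B * e' * (t (Suc i) - t i)"
   proof (rule integral_bound[OF t(3)])
    show "continuous_on {t i..t (Suc i)} (\<lambda>s. f' s * (w (t (Suc i)) - w s))"
     by (intro continuous_intros continuous_on_subset[OF w sub] continuous_on_subset[OF f']) auto
    fix s assume s: "s \<in> {t i..t (Suc i)}"
    have "\<bar>t (Suc i) - s\<bar> < d" using s mesh t(4)[of i] by auto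
    then have "\<bar>w (t (Suc i)) - w s\<bar> < e'" using s sub tin[OF i] by (intro du) auto
    moreover have "\<bar>f' s\<bar> \<le> B" using s sub by (intro B) auto
    ultimately show "norm (f' s * (w (t (Suc i)) - w s)) \<le> B * e'"
     unfolding real_norm_def abs_mult using B0 by (intro mult_mono) auto
   qed
   then show ?thesis by (simp only: t(4) real_norm_def)
  qed
  have "(\<Sum>i<Suc n. f (t i) * (w (t (Suc i)) - w (t i))) = (\<Sum>i<Suc n. (f (t (Suc i)) * w (t (Suc i)) - f (t i) * w (t i)) - w (t (Suc i)) * (f (t (Suc i)) - f (t i)))"
   by (intro sum.cong refl) (simp add: algebra_simps)
  also have "\<dots> = (f b * w b - f a * w a) - (\<Sum>i<Suc n. w (t (Suc i)) * (f (t (Suc i)) - f (t i)))"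
   by (subst sum_subtractf) (simp only: tel)
  finally have "(\<Sum>i<Suc n. f (t i) * (w (t (Suc i)) - w (t i))) - (f b * w b - f a * w a - integral {a..b} (\<lambda>s. f' s * w s)) =
    - (\<Sum>i<Suc n. (w (t (Suc i)) * (f (t (Suc i)) - f (t i))) - integral {t i..t (Suc i)} (\<lambda>s. f' s * w s))"
   using sum_integral_equi_part[OF ab fw, of n, folded t_def] unfolding sum_subtractf by simp
  also have "\<dots> = - (\<Sum>i<Suc n. integral {t i..t (Suc i)} (\<lambda>s. f' s * (w (t (Suc i)) - w s)))"
   by (intro arg_cong[of _ _ uminus] sum.cong refl piece)
  also have "norm \<dots> \<le> (\<Sum>i<Suc n. B * e' * ((b - a) / real (Suc n)))"
   unfolding norm_minus_cancel by (rule order_trans[OF norm_sum sum_mono]) (use pb in simp)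
  also have "\<dots> = B * e' * (b - a)" by (simp del: of_nat_Suc)
  also have "\<dots> < e" by (rule e'e)
  finally show "norm ((\<Sum>i<Suc n. f (equi_part n a b i) * (w (equi_part n a b (Suc i)) - w (equi_part n a b i))) -
   (f b * w b - f a * w a - integral {a..b} (\<lambda>s. f' s * w s))) < e" unfolding t_def .
 qed
qed

lemma riemann_step_on: "0 \<le> a \<Longrightarrow> a \<le> b \<Longrightarrow> b \<le> t \<Longrightarrow> step_on t (riemann_step f n a b)"
 unfolding step_on_def riemann_step_def by (simp add: equi_part)

lemma riemann_step_fun:
 assumes ab: "a < b" and s: "s \<in> {a<..b}"
 shows "\<exists>x\<in>{a..b}. \<bar>x - s\<bar> \<le> (b - a) / real (Suc n) \<and> step_fun (riemann_step f n a b) s = f x"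
proof -
 define t where "t = equi_part n a b"
 note t = equi_part(1-4)[OF less_imp_le[OF ab], of n, folded t_def]
 have t5: "t i \<in> {a..b}" if "i \<le> Suc n" for i using equi_part(5)[OF less_imp_le[OF ab] that] by (simp only: t_def)
 have mono: "t i \<le> t j" if "i \<le> j" for i j using that by (rule lift_Suc_mono_le[of t, OF t(3)])
 define k where "k = (LEAST k. s \<le> t k)"
 have sk: "s \<le> t k" unfolding k_def by (rule LeastI[of _ "Suc n"]) (use s t(2) in auto)
 have kn: "k \<le> Suc n" unfolding k_def by (rule Least_le) (use s t(2) in auto)
 have "k \<noteq> 0" using sk s t(1) by (cases k) auto
 then obtain j where j: "k = Suc j" using not0_implies_Suc by blast
 have tj: "t j < s" using not_less_Least[of j "\<lambda>k. s \<le> t k"] j unfolding k_def by simp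
 have "step_fun (riemann_step f n a b) s = (\<Sum>i<Suc n. f (t i) * indicator {t i<..t (Suc i)} s)"
  unfolding step_fun_def riemann_step_def t_def prod.case ..
 also have "\<dots> = (\<Sum>i<Suc n. if i = j then f (t j) else 0)"
 proof (rule sum.cong[OF refl])
  fix i assume "i \<in> {..<Suc n}"
  have "s \<in> {t i<..t (Suc i)} \<longleftrightarrow> i = j"
  proof
   assume m: "s \<in> {t i<..t (Suc i)}"
   show "i = j"
   proof (rule ccontr)
    assume "i \<noteq> j"
    then consider "Suc i \<le> j" | "Suc j \<le> i" by linarith
    then show False
    proof cases
     case 1
     then show ?thesis using mono[OF 1] tj m by auto
    next
     case 2
     then show ?thesis using mono[OF 2] sk j m by auto
    qed
   qed
  qed (use tj sk j in auto)
  then show "f (t i) * indicator {t i<..t (Suc i)} s = (if i = j then f (t j) else 0)"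
   by (auto simp: indicator_def)
 qed
 also have "\<dots> = f (t j)" using j kn by simp
 finally have "step_fun (riemann_step f n a b) s = f (t j)" .
 moreover have "t j \<in> {a..b}" using t5[of j] j kn by simp
 moreover have "\<bar>t j - s\<bar> \<le> (b - a) / real (Suc n)" using t(4)[of j] tj sk j by simp
 ultimately show ?thesis by blast
qed

lemma tendsto_0_ennrealI:
 fixes f :: "nat \<Rightarrow> ennreal"
 assumes "\<And>e. 0 < e \<Longrightarrow> \<exists>N. \<forall>n\<ge>N. f n \<le> ennreal e"
 shows "f \<longlonglongrightarrow> 0"
proof (rule order_tendstoI)
 fix a :: ennreal assume "0 < a"
 then obtain b where b: "0 < b" "b < a" using dense by blast
 then have bt: "b < top" by (metis less_trans not_less_iff_gr_or_eq top.not_eq_extremum)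
 then have e: "0 < enn2real b" "ennreal (enn2real b) = b" using b by (auto simp: enn2real_positive_iff)
 from assms[OF e(1)] obtain N where "\<forall>n\<ge>N. f n \<le> b" unfolding e(2) by blast
 then show "\<forall>\<^sub>F n in sequentially. f n < a" using b(2) by (auto simp: eventually_sequentially intro: le_less_trans)
qed simp

section \<open>Path integrals, their fourth moments and identification of Wiener integrals\<close>

context wiener
begin

text \<open>The integral of f against dW after integration by parts, which makes sense along every
  continuous path.\<close>

definition paths_integral :: "(real \<Rightarrow> real) \<Rightarrow> (real \<Rightarrow> real) \<Rightarrow> real \<Rightarrow> 'w \<Rightarrow> real" where
 "paths_integral f f' t \<omega> = f t * W t \<omega> - integral {0..t} (\<lambda>s. f' s * W s \<omega>)"

text \<open>A limit of Riemann sums, hence measurable at every t; it equals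
  \<open>paths_integral\<close> almost surely, for all times simultaneously.\<close>

definition wiener_int :: "(real \<Rightarrow> real) \<Rightarrow> real \<Rightarrow> 'w \<Rightarrow> real" where
 "wiener_int f t \<omega> = lim (\<lambda>n. step_integral W (riemann_step f n 0 t) \<omega>)"

lemma step_integral_tendsto:
 assumes f: "\<And>t. (f has_real_derivative f' t) (at t)" and f': "continuous_on UNIV f'"
  and w: "continuous_on {0..} (\<lambda>t. W t y)" and ab: "0 \<le> a" "a \<le> b"
 shows "(\<lambda>n. step_integral W (riemann_step f n a b) y) \<longlonglongrightarrow> paths_integral f f' b y - paths_integral f f' a y"
proof -
 have wab: "continuous_on {a..b} (\<lambda>t. W t y)" "continuous_on {0..b} (\<lambda>t. W t y)"
  by (rule continuous_on_subset[OF w]; use ab in auto)+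
 have fw: "continuous_on {0..b} (\<lambda>s. f' s * W s y)" by (intro continuous_intros wab continuous_on_subset[OF f']) auto
 have "integral {0..a} (\<lambda>s. f' s * W s y) + integral {a..b} (\<lambda>s. f' s * W s y) = integral {0..b} (\<lambda>s. f' s * W s y)"
  by (rule Henstock_Kurzweil_Integration.integral_combine[OF ab integrable_continuous_real[OF fw]])
 then have "f b * W b y - f a * W a y - integral {a..b} (\<lambda>s. f' s * W s y) = paths_integral f f' b y - paths_integral f f' a y"
  unfolding paths_integral_def by simp
 moreover have "step_integral W (riemann_step f n a b) y = (\<Sum>i<Suc n. f (equi_part n a b i) * (W (equi_part n a b (Suc i)) y - W (equi_part n a b i) y))" for n
  unfolding step_integral_def riemann_step_def by simp
 ultimately show ?thesis using riemann_stieltjes_by_parts[OF ab(2) f f' wab(1)] by simp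
qed

lemma wiener_int_eq_paths_integral:
 assumes f: "\<And>t. (f has_real_derivative f' t) (at t)" and f': "continuous_on UNIV f'"
 shows "AE y in M. \<forall>t\<ge>0. wiener_int f t y = paths_integral f f' t y"
 using W_continuous W_0
proof eventually_elim
 case (elim y)
 have "paths_integral f f' 0 y = 0" using elim by (simp add: paths_integral_def)
 then show ?case
  unfolding wiener_int_def using step_integral_tendsto[OF f f' elim(1), of 0] by (auto intro!: limI)
qed

lemma wiener_int_measurable:
 "0 \<le> t \<Longrightarrow> wiener_int f t \<in> borel_measurable M"
 unfolding wiener_int_def[abs_def]
 by (intro borel_measurable_lim_metric step_integral_measurable riemann_step_on) auto

text \<open>A Riemann sum is a sum of independent centred normal variables of total variance at most
  F^2 (b - a); its fourth moment is three times the squared variance.\<close>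

lemma step_fourth_moment:
 assumes ab: "0 \<le> a" "a < b" and F: "\<And>x. x \<in> {a..b} \<Longrightarrow> \<bar>f x\<bar> \<le> F"
 shows "(\<integral>\<^sup>+ y. ennreal (step_integral W (riemann_step f n a b) y ^ 4) \<partial>M) \<le> ennreal (3 * F ^ 4 * (b - a)\<^sup>2)"
proof -
 define t where "t = equi_part n a b"
 note t = equi_part(1-4)[OF less_imp_le[OF ab(2)], of n, folded t_def]
 have t5: "t i \<in> {a..b}" if "i \<le> Suc n" for i using equi_part(5)[OF less_imp_le[OF ab(2)] that] by (simp only: t_def)
 have \<Delta>: "t (Suc i) - t i = (b - a) / real (Suc n)" "0 < (b - a) / real (Suc n)" for i using t(4) ab by auto
 have F0: "0 \<le> F" using F[of a] ab by force
 \<comment> \<open>Indices with vanishing coefficient are dropped, since a degenerate normal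
   variable has no density.\<close>
 define I where "I = {i. i < Suc n \<and> f (t i) \<noteq> 0}"
 have fin: "finite I" unfolding I_def by simp
 define X where "X i y = 0 + f (t i) * (W (t (Suc i)) y - W (t i) y)" for i y
 have SI: "step_integral W (riemann_step f n a b) y = (\<Sum>i\<in>I. X i y)" for y
 proof -
  have "(\<Sum>i\<in>I. X i y) = (\<Sum>i<Suc n. X i y)"
   by (rule sum.mono_neutral_left) (auto simp: I_def X_def)
  then show ?thesis unfolding step_integral_def riemann_step_def t_def[symmetric] by (simp add: X_def)
 qed
 show ?thesis
 proof (cases "I = {}")
  case True
  then show ?thesis unfolding SI by simp
 next
  case False
  have ind0: "indep_vars (\<lambda>_. borel) (\<lambda>i y. W (t (Suc i)) y - W (t i) y) {..<Suc n}"
  proof (rule W_increments_indep)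
   show "0 \<le> t 0" using t(1) ab by simp
   show "t i < t (Suc i)" for i using \<Delta>(1)[of i] \<Delta>(2) by linarith
  qed
  have ind: "indep_vars (\<lambda>_. borel) X I"
  proof -
   have "indep_vars (\<lambda>_. borel) (\<lambda>i y. W (t (Suc i)) y - W (t i) y) I"
    by (rule indep_vars_subset[OF ind0]) (auto simp: I_def)
   then have "indep_vars (\<lambda>_. borel) (\<lambda>i y. (\<lambda>x. 0 + f (t i) * x) (W (t (Suc i)) y - W (t i) y)) I"
    by (rule indep_vars_compose2) simp
   then show ?thesis unfolding X_def[abs_def] .
  qed
  define \<sigma> where "\<sigma> i = \<bar>f (t i)\<bar> * sqrt ((b - a) / real (Suc n))" for i
  have \<sigma>: "0 < \<sigma> i" if "i \<in> I" for i using that \<Delta> by (auto simp: I_def \<sigma>_def)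
  have norm: "distributed M lborel (X i) (normal_density 0 (\<sigma> i))" if i: "i \<in> I" for i
  proof -
   have "0 \<le> t i" using t5[of i] i ab by (auto simp: I_def)
   have lt: "t i < t (Suc i)" using \<Delta>(1)[of i] \<Delta>(2) by linarith
   have "distributed M lborel (X i) (normal_density (0 + f (t i) * 0) (\<bar>f (t i)\<bar> * sqrt (t (Suc i) - t i)))"
    unfolding X_def by (rule normal_density_affine[OF W_increment_normal[OF \<open>0 \<le> t i\<close> lt]]) (use i lt in \<open>auto simp: I_def\<close>)
   then show ?thesis by (simp only: \<sigma>_def \<Delta>(1)) simp
  qed
  define s where "s = sqrt (\<Sum>i\<in>I. (\<sigma> i)\<^sup>2)"
  have spos: "0 < (\<Sum>i\<in>I. (\<sigma> i)\<^sup>2)" by (intro sum_pos fin False zero_less_power \<sigma>)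
  have D: "distributed M lborel (\<lambda>y. \<Sum>i\<in>I. X i y) (normal_density 0 s)"
   using sum_indep_normal[OF fin False ind \<sigma> norm] by (simp add: s_def)
  have s0: "0 < s" using spos by (simp add: s_def)
  have s2: "s\<^sup>2 \<le> F\<^sup>2 * (b - a)"
  proof -
   have "s\<^sup>2 = (\<Sum>i\<in>I. (\<sigma> i)\<^sup>2)" using spos by (simp add: s_def)
   also have "\<dots> \<le> (\<Sum>i\<in>I. F\<^sup>2 * ((b - a) / real (Suc n)))"
   proof (rule sum_mono)
    fix i assume i: "i \<in> I"
    have "\<bar>f (t i)\<bar> \<le> F" using i t5[of i] by (intro F) (auto simp: I_def)
    then have "(\<bar>f (t i)\<bar>)\<^sup>2 \<le> F\<^sup>2" by (intro power_mono) auto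
    then show "(\<sigma> i)\<^sup>2 \<le> F\<^sup>2 * ((b - a) / real (Suc n))"
     unfolding \<sigma>_def power_mult_distrib using \<Delta>(2) by (intro mult_mono) auto
   qed
   also have "\<dots> \<le> (\<Sum>i<Suc n. F\<^sup>2 * ((b - a) / real (Suc n)))"
    by (rule sum_mono2) (use \<Delta>(2) ab in \<open>auto simp: I_def\<close>)
   also have "\<dots> = F\<^sup>2 * (b - a)" by (simp del: of_nat_Suc)
   finally show ?thesis .
  qed
  have m: "integrable M (\<lambda>y. (\<Sum>i\<in>I. X i y) ^ 4)" "expectation (\<lambda>y. (\<Sum>i\<in>I. X i y) ^ 4) = 3 * (s\<^sup>2)\<^sup>2"
   using normal_even_moment[OF D s0, of 2] s0 by (simp_all add: fact_numeral power_divide field_simps)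
  have "(\<integral>\<^sup>+ y. ennreal ((\<Sum>i\<in>I. X i y) ^ 4) \<partial>M) = ennreal (3 * (s\<^sup>2)\<^sup>2)"
   using nn_integral_eq_integral[OF m(1)] m(2) by simp
  also have "\<dots> \<le> ennreal (3 * F ^ 4 * (b - a)\<^sup>2)"
  proof (rule ennreal_leI)
   have "(s\<^sup>2)\<^sup>2 \<le> (F\<^sup>2 * (b - a))\<^sup>2" using s2 by (intro power_mono) auto
   also have "\<dots> = F ^ 4 * (b - a)\<^sup>2" by (simp add: power_mult_distrib flip: power_mult)
   finally show "3 * (s\<^sup>2)\<^sup>2 \<le> 3 * F ^ 4 * (b - a)\<^sup>2" by simp
  qed
  finally show ?thesis unfolding SI .
 qed
qed

text \<open>Fatou's lemma carries the bound from the Riemann sums to their limit.\<close>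

lemma wiener_int_fourth_moment:
 assumes f: "\<And>t. (f has_real_derivative f' t) (at t)" and f': "continuous_on UNIV f'"
  and F: "\<And>x. \<bar>f x\<bar> \<le> F" and st: "0 \<le> s" "s \<le> t"
 shows "(\<integral>\<^sup>+ y. ennreal ((wiener_int f t y - wiener_int f s y) ^ 4) \<partial>M) \<le> ennreal (3 * F ^ 4 * (t - s)\<^sup>2)"
proof (cases "s = t")
 case False
 then have lt: "s < t" using st by simp
 let ?u = "\<lambda>n y. ennreal (step_integral W (riemann_step f n s t) y ^ 4)"
 have "AE y in M. ennreal ((wiener_int f t y - wiener_int f s y) ^ 4) = liminf (\<lambda>n. ?u n y)"
  using W_continuous wiener_int_eq_paths_integral[OF f f']
 proof eventually_elim
  case (elim y)
  have "(\<lambda>n. ?u n y) \<longlonglongrightarrow> ennreal ((paths_integral f f' t y - paths_integral f f' s y) ^ 4)"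
   by (intro tendsto_ennrealI tendsto_power step_integral_tendsto[OF f f' elim(1) st])
  then have "liminf (\<lambda>n. ?u n y) = ennreal ((paths_integral f f' t y - paths_integral f f' s y) ^ 4)"
   by (rule lim_imp_Liminf[OF sequentially_bot])
  then show ?case using elim(2) st by simp
 qed
 then have "(\<integral>\<^sup>+ y. ennreal ((wiener_int f t y - wiener_int f s y) ^ 4) \<partial>M) = (\<integral>\<^sup>+ y. liminf (\<lambda>n. ?u n y) \<partial>M)"
  by (rule nn_integral_cong_AE)
 also have "\<dots> \<le> liminf (\<lambda>n. \<integral>\<^sup>+ y. ?u n y \<partial>M)"
 proof (rule nn_integral_liminf)
  fix n
  have [measurable]: "step_integral W (riemann_step f n s t) \<in> borel_measurable M"
   by (rule step_integral_measurable[OF riemann_step_on[OF st order_refl]])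
  show "?u n \<in> borel_measurable M" by measurable
 qed
 also have "\<dots> \<le> liminf (\<lambda>n. ennreal (3 * F ^ 4 * (t - s)\<^sup>2))"
  by (intro Liminf_mono always_eventually allI step_fourth_moment st(1) lt F)
 also have "\<dots> = ennreal (3 * F ^ 4 * (t - s)\<^sup>2)" by (simp add: Liminf_const)
 finally show ?thesis .
qed simp

lemma ennreal_square_triangle: "ennreal ((x - y)\<^sup>2) \<le> 2 * ennreal ((x - z)\<^sup>2) + 2 * ennreal ((z - y)\<^sup>2)"
proof -
 have "(x - y)\<^sup>2 \<le> 2 * (x - z)\<^sup>2 + 2 * (z - y)\<^sup>2"
 proof -
  have "0 \<le> ((x - z) - (z - y))\<^sup>2" by simp
  also have "\<dots> = 2 * (x - z)\<^sup>2 + 2 * (z - y)\<^sup>2 - (x - y)\<^sup>2" by (simp add: power2_eq_square algebra_simps)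
  finally show ?thesis by simp
 qed
 then have "ennreal ((x - y)\<^sup>2) \<le> ennreal (2 * (x - z)\<^sup>2 + 2 * (z - y)\<^sup>2)" by (rule ennreal_leI)
 then show ?thesis by (simp add: ennreal_plus ennreal_mult)
qed

lemma riemann_step_L2:
 assumes f: "continuous_on UNIV f" and t: "0 < t"
 shows "(\<lambda>n. \<integral>\<^sup>+ s\<in>{0..t}. ennreal ((f s - step_fun (riemann_step f n 0 t) s)\<^sup>2) \<partial>lborel) \<longlonglongrightarrow> 0"
proof (rule tendsto_0_ennrealI)
 fix e :: real assume e: "0 < e"
 define e' where "e' = sqrt (e / t)"
 have e': "0 < e'" "e'\<^sup>2 * t = e" using e t by (auto simp: e'_def)
 have "uniformly_continuous_on {0..t} f"
  by (rule compact_uniformly_continuous[OF continuous_on_subset[OF f] compact_Icc]) simp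
 then have "\<exists>d>0. \<forall>x\<in>{0..t}. \<forall>y\<in>{0..t}. dist y x < d \<longrightarrow> dist (f y) (f x) < e'"
  using e' unfolding uniformly_continuous_on_def by simp
 then obtain d where d: "d > 0" and du: "\<And>x y. x \<in> {0..t} \<Longrightarrow> y \<in> {0..t} \<Longrightarrow> \<bar>y - x\<bar> < d \<Longrightarrow> \<bar>f y - f x\<bar> < e'"
  unfolding dist_real_def by metis
 obtain N where N: "t / d < real N" using reals_Archimedean2 by blast
 show "\<exists>N. \<forall>n\<ge>N. (\<integral>\<^sup>+ s\<in>{0..t}. ennreal ((f s - step_fun (riemann_step f n 0 t) s)\<^sup>2) \<partial>lborel) \<le> ennreal e"
 proof (intro exI[of _ N] allI impI)
  fix n assume n: "N \<le> n"
  have mesh: "t / real (Suc n) < d"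
  proof -
   have "t / d < real (Suc n)" using N n by simp
   then show ?thesis using d by (simp add: field_simps)
  qed
  have "AE s in lborel. ennreal ((f s - step_fun (riemann_step f n 0 t) s)\<^sup>2) * indicator {0..t} s \<le> ennreal (e'\<^sup>2) * indicator {0..t} s"
   using AE_lborel_singleton[of 0]
  proof eventually_elim
   case (elim s)
   show ?case
   proof (cases "s \<in> {0..t}")
    case True
    then have "s \<in> {0<..t}" using elim by auto
    from riemann_step_fun[OF t this, of n f] obtain x where x: "x \<in> {0..t}" "\<bar>x - s\<bar> \<le> t / real (Suc n)"
     and fx: "step_fun (riemann_step f n 0 t) s = f x" by auto
    have "\<bar>f x - f s\<bar> < e'" using x mesh True by (intro du) auto
    then have "\<bar>f s - f x\<bar>\<^sup>2 \<le> e'\<^sup>2" by (intro power_mono) auto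
    then show ?thesis using True by (simp add: fx ennreal_leI)
   qed simp
  qed
  then have "(\<integral>\<^sup>+ s\<in>{0..t}. ennreal ((f s - step_fun (riemann_step f n 0 t) s)\<^sup>2) \<partial>lborel) \<le> (\<integral>\<^sup>+ s. ennreal (e'\<^sup>2) * indicator {0..t} s \<partial>lborel)"
   by (rule nn_integral_mono_AE)
  also have "\<dots> = ennreal e" using t e' by (simp add: nn_integral_cmult_indicator flip: ennreal_mult')
  finally show "(\<integral>\<^sup>+ s\<in>{0..t}. ennreal ((f s - step_fun (riemann_step f n 0 t) s)\<^sup>2) \<partial>lborel) \<le> ennreal e" .
 qed
qed

text \<open>The step functions of the definition and the Riemann steps of f both converge to f in
  mean square, and the isometry transfers this to their integrals. Fatou's lemma along the Riemann
  steps leaves a bound that vanishes as k grows.\<close>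

theorem has_wiener_integral_unique:
 assumes f: "\<And>t. (f has_real_derivative f' t) (at t)" and f': "continuous_on UNIV f'" and t: "0 < t"
  and Y: "has_wiener_integral M W t f Y"
 shows "AE y in M. Y y = wiener_int f t y"
proof -
 have fc: "continuous_on UNIV f" using DERIV_isCont[OF f] by (simp add: continuous_on_eq_continuous_at)
 have fm[measurable]: "f \<in> borel_measurable borel" by (rule borel_measurable_continuous_onI[OF fc])
 note [measurable] = step_fun_measurable
 obtain F where Ym[measurable]: "Y \<in> borel_measurable M" and F: "\<And>k. step_on t (F k)"
  and Ff: "(\<lambda>k. \<integral>\<^sup>+ s\<in>{0..t}. ennreal ((step_fun (F k) s - f s)\<^sup>2) \<partial>lborel) \<longlonglongrightarrow> 0"
  and FY: "(\<lambda>k. \<integral>\<^sup>+ y. ennreal ((step_integral W (F k) y - Y y)\<^sup>2) \<partial>M) \<longlonglongrightarrow> 0"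
  using Y unfolding has_wiener_integral_def by blast
 define G where "G n = riemann_step f n 0 t" for n
 have G: "step_on t (G n)" for n unfolding G_def using t by (intro riemann_step_on) auto
 note [measurable] = step_integral_measurable[OF F] step_integral_measurable[OF G] wiener_int_measurable[OF less_imp_le[OF t]]
 let ?J = "wiener_int f t"
 define d where "d k = (\<integral>\<^sup>+ s\<in>{0..t}. ennreal ((step_fun (F k) s - f s)\<^sup>2) \<partial>lborel)" for k
 define g where "g n = (\<integral>\<^sup>+ s\<in>{0..t}. ennreal ((f s - step_fun (G n) s)\<^sup>2) \<partial>lborel)" for n
 have g0: "g \<longlonglongrightarrow> 0" unfolding g_def[abs_def] G_def by (rule riemann_step_L2[OF fc t])
 have FG: "(\<integral>\<^sup>+ y. ennreal ((step_integral W (F k) y - step_integral W (G n) y)\<^sup>2) \<partial>M) \<le> 2 * d k + 2 * g n" for k n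
 proof -
  have "(\<integral>\<^sup>+ y. ennreal ((step_integral W (F k) y - step_integral W (G n) y)\<^sup>2) \<partial>M) =
    (\<integral>\<^sup>+ s\<in>{0..t}. ennreal ((step_fun (F k) s - step_fun (G n) s)\<^sup>2) \<partial>lborel)"
   by (rule step_isometry[OF F G])
  also have "\<dots> \<le> (\<integral>\<^sup>+ s. 2 * (ennreal ((step_fun (F k) s - f s)\<^sup>2) * indicator {0..t} s) + 2 * (ennreal ((f s - step_fun (G n) s)\<^sup>2) * indicator {0..t} s) \<partial>lborel)"
   by (intro nn_integral_mono) (auto simp: indicator_def ennreal_square_triangle)
  also have "\<dots> = 2 * d k + 2 * g n"
   unfolding d_def g_def by (simp add: nn_integral_add nn_integral_cmult)
  finally show ?thesis .
 qed
 have FJ: "(\<integral>\<^sup>+ y. ennreal ((step_integral W (F k) y - ?J y)\<^sup>2) \<partial>M) \<le> 2 * d k" for k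
 proof -
  let ?u = "\<lambda>n y. ennreal ((step_integral W (F k) y - step_integral W (G n) y)\<^sup>2)"
  have "AE y in M. ennreal ((step_integral W (F k) y - ?J y)\<^sup>2) = liminf (\<lambda>n. ?u n y)"
   using W_continuous W_0 wiener_int_eq_paths_integral[OF f f']
  proof eventually_elim
   case (elim y)
   have "paths_integral f f' 0 y = 0" using elim by (simp add: paths_integral_def)
   then have "(\<lambda>n. step_integral W (G n) y) \<longlonglongrightarrow> ?J y"
    using step_integral_tendsto[OF f f' elim(1) order_refl less_imp_le[OF t]] elim(3) t by (simp add: G_def)
   then have "(\<lambda>n. ?u n y) \<longlonglongrightarrow> ennreal ((step_integral W (F k) y - ?J y)\<^sup>2)"
    by (intro tendsto_ennrealI tendsto_intros)
   then show ?case by (rule lim_imp_Liminf[OF sequentially_bot, symmetric])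
  qed
  then have "(\<integral>\<^sup>+ y. ennreal ((step_integral W (F k) y - ?J y)\<^sup>2) \<partial>M) = (\<integral>\<^sup>+ y. liminf (\<lambda>n. ?u n y) \<partial>M)"
   by (rule nn_integral_cong_AE)
  also have "\<dots> \<le> liminf (\<lambda>n. \<integral>\<^sup>+ y. ?u n y \<partial>M)" by (rule nn_integral_liminf) measurable
  also have "\<dots> \<le> liminf (\<lambda>n. 2 * d k + 2 * g n)"
   by (intro Liminf_mono always_eventually allI FG)
  also have "\<dots> = 2 * d k"
  proof (rule lim_imp_Liminf[OF sequentially_bot])
   have "(\<lambda>n. 2 * d k + 2 * g n) \<longlonglongrightarrow> 2 * d k + 2 * 0"
    by (intro tendsto_add tendsto_const ennreal_tendsto_cmult g0) auto
   then show "(\<lambda>n. 2 * d k + 2 * g n) \<longlonglongrightarrow> 2 * d k" by simp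
  qed
  finally show ?thesis .
 qed
 have YJ: "(\<integral>\<^sup>+ y. ennreal ((Y y - ?J y)\<^sup>2) \<partial>M) \<le> 2 * (\<integral>\<^sup>+ y. ennreal ((step_integral W (F k) y - Y y)\<^sup>2) \<partial>M) + 2 * (2 * d k)" for k
 proof -
  have "(\<integral>\<^sup>+ y. ennreal ((Y y - ?J y)\<^sup>2) \<partial>M) \<le> (\<integral>\<^sup>+ y. 2 * ennreal ((step_integral W (F k) y - Y y)\<^sup>2) + 2 * ennreal ((step_integral W (F k) y - ?J y)\<^sup>2) \<partial>M)"
  proof (rule nn_integral_mono)
   fix y
   show "ennreal ((Y y - ?J y)\<^sup>2) \<le> 2 * ennreal ((step_integral W (F k) y - Y y)\<^sup>2) + 2 * ennreal ((step_integral W (F k) y - ?J y)\<^sup>2)"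
    using ennreal_square_triangle[of "Y y" "?J y" "step_integral W (F k) y"] by (simp only: power2_commute[of "Y y" "step_integral W (F k) y"])
  qed
  also have "\<dots> = 2 * (\<integral>\<^sup>+ y. ennreal ((step_integral W (F k) y - Y y)\<^sup>2) \<partial>M) + 2 * (\<integral>\<^sup>+ y. ennreal ((step_integral W (F k) y - ?J y)\<^sup>2) \<partial>M)"
   by (simp add: nn_integral_add nn_integral_cmult)
  also have "\<dots> \<le> 2 * (\<integral>\<^sup>+ y. ennreal ((step_integral W (F k) y - Y y)\<^sup>2) \<partial>M) + 2 * (2 * d k)"
   by (intro add_left_mono mult_left_mono FJ) simp
  finally show ?thesis .
 qed
 have "(\<lambda>k. 2 * (\<integral>\<^sup>+ y. ennreal ((step_integral W (F k) y - Y y)\<^sup>2) \<partial>M) + 2 * (2 * d k)) \<longlonglongrightarrow> 2 * 0 + 2 * (2 * 0)"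
  by (intro tendsto_add ennreal_tendsto_cmult FY Ff[folded d_def]) auto
 then have "(\<integral>\<^sup>+ y. ennreal ((Y y - ?J y)\<^sup>2) \<partial>M) \<le> 2 * 0 + 2 * (2 * 0)"
  by (rule LIMSEQ_le_const) (use YJ in blast)
 then have "(\<integral>\<^sup>+ y. ennreal ((Y y - ?J y)\<^sup>2) \<partial>M) = 0" by simp
 then have "AE y in M. ennreal ((Y y - ?J y)\<^sup>2) = 0"
  by (subst (asm) nn_integral_0_iff_AE) auto
 then show ?thesis by eventually_elim (simp add: ennreal_eq_0_iff)
qed

end

section \<open>Averaging of the cubic drift\<close>

text \<open>Continuous induction: at the first time where h reaches B, the premise of
  \<open>step\<close> holds on the closed interval up to it, and the conclusion contradicts h =
  B.\<close>

lemma bootstrap: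
 fixes h :: "real \<Rightarrow> real"
 assumes c: "continuous_on {0..T} h" and h0: "h 0 < B"
  and step: "\<And>t. t \<in> {0..T} \<Longrightarrow> (\<And>s. s \<in> {0..t} \<Longrightarrow> h s \<le> B) \<Longrightarrow> h t < B"
  and t: "t \<in> {0..T}"
 shows "h t < B"
proof (rule ccontr)
 assume ht: "\<not> h t < B"
 define A where "A = {0..T} \<inter> h -` {B..}"
 have "compact A" unfolding A_def
  by (intro compact_eq_bounded_closed[THEN iffD2] conjI continuous_closed_preimage c) (auto intro: bounded_subset[of "{0..T}"])
 moreover have "A \<noteq> {}" using ht t by (auto simp: A_def)
 ultimately obtain a where a: "a \<in> A" "\<And>b. b \<in> A \<Longrightarrow> a \<le> b" using compact_attains_inf by metis
 have lt: "h s < B" if "s \<in> {0..<a}" for s using a(1) a(2)[of s] that by (fastforce simp: A_def)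
 have a0: "0 \<le> a" "a \<le> T" "B \<le> h a" using a(1) by (auto simp: A_def)
 have "continuous_on {0..a} h" by (rule continuous_on_subset[OF c]) (use a0 in auto)
 then obtain s where s: "0 \<le> s" "s \<le> a" "h s = B" using IVT'[of h 0 B a] h0 a0 by auto
 then have "s = a" using lt[of s] by fastforce
 then have "h s \<le> B" if "s \<in> {0..a}" for s using lt[of s] that s(3) by (cases "s = a") auto
 from step[of a] this s \<open>s = a\<close> show False using a0 by force
qed

lemma quartic_bounded_above:
 fixes A B C E :: real
 assumes "0 \<le> A" "0 \<le> B" "0 < C" "0 \<le> E"
 obtains D where "0 \<le> D" "\<And>x. 0 \<le> x \<Longrightarrow> A * x\<^sup>2 + B * x + E * x ^ 3 - C * x ^ 4 \<le> D"
proof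
 \<comment> \<open>Beyond y the quartic term dominates; on [0,y] the other terms are bounded by
   their values at y.\<close>
 define y where "y = (A + B + E) / C + 1"
 have y: "1 \<le> y" using assms by (simp add: y_def)
 show "0 \<le> A * y\<^sup>2 + B * y + E * y ^ 3" using assms y by (intro add_nonneg_nonneg mult_nonneg_nonneg) auto
 fix x :: real assume x: "0 \<le> x"
 show "A * x\<^sup>2 + B * x + E * x ^ 3 - C * x ^ 4 \<le> A * y\<^sup>2 + B * y + E * y ^ 3"
 proof (cases "x \<le> y")
  case True
  have "A * x\<^sup>2 + B * x + E * x ^ 3 \<le> A * y\<^sup>2 + B * y + E * y ^ 3"
   using True x assms by (intro add_mono mult_left_mono power_mono) auto
  moreover have "0 \<le> C * x ^ 4" using assms by simp
  ultimately show ?thesis by linarith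
 next
  case False
  then have x1: "1 \<le> x" using y by simp
  have "x\<^sup>2 \<le> x ^ 3" "x ^ 1 \<le> x ^ 3" using x1 by (intro power_increasing; simp)+
  then have "A * x\<^sup>2 + B * x + E * x ^ 3 \<le> A * x ^ 3 + B * x ^ 3 + E * x ^ 3"
   using assms by (intro add_mono mult_left_mono) auto
  also have "\<dots> = (A + B + E) * x ^ 3" by (simp add: algebra_simps)
  also have "\<dots> \<le> (C * x) * x ^ 3"
  proof (intro mult_right_mono)
   have "(A + B + E) / C \<le> x" using False by (simp add: y_def)
   then show "A + B + E \<le> C * x" using assms by (simp add: field_simps)
  qed (use x in simp)
  also have "\<dots> = C * x ^ 4" by (simp add: power_numeral_reduce)
  finally show ?thesis using assms y by (smt (verit) mult_nonneg_nonneg zero_le_power)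
 qed
qed

lemma complex_norm_le_mono: "norm (z :: complex) \<le> a \<Longrightarrow> \<bar>Re (z * w)\<bar> \<le> a * norm w"
 by (rule order_trans[OF abs_Re_le_cmod]) (simp add: norm_mult mult_right_mono)

section \<open>The averaged drift and the a priori bound\<close>

text \<open>The nonlinearity in abstract form: G1 stands for the linear and G3 for the cubic part, V
  for a common bound of the variations; 3 \<rho>^2 is the slope of the cube on [-\<rho>,\<rho>]. The
  plane of critical modes is the complex plane, so that rotations become factors
  \<open>cis\<close>.\<close>

locale averaging =
 fixes r \<omega> V C :: real and \<psi> :: complex and G G1 G3 :: "(real \<Rightarrow> real) \<Rightarrow> real"
 assumes av_r: "0 < r" and av_\<omega>: "0 < \<omega>" and V: "0 \<le> V" and C: "0 < C"
  and G_split: "continuous_on {-r..0} \<eta> \<Longrightarrow> G \<eta> = G1 \<eta> + G3 \<eta>"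
  and G_zero: "G (\<lambda>_. 0) = 0" and G1_zero: "G1 (\<lambda>_. 0) = 0"
  and G_lip: "continuous_on {-r..0} \<eta> \<Longrightarrow> continuous_on {-r..0} \<eta>' \<Longrightarrow>
    (\<And>\<theta>. \<theta> \<in> {-r..0} \<Longrightarrow> \<bar>\<eta> \<theta>\<bar> \<le> \<rho> \<and> \<bar>\<eta>' \<theta>\<bar> \<le> \<rho> \<and> \<bar>\<eta> \<theta> - \<eta>' \<theta>\<bar> \<le> d) \<Longrightarrow>
    \<bar>G \<eta> - G \<eta>'\<bar> \<le> V * (1 + 3 * \<rho>\<^sup>2) * d"
  and G1_lip: "continuous_on {-r..0} \<eta> \<Longrightarrow> continuous_on {-r..0} \<eta>' \<Longrightarrow>
    (\<And>\<theta>. \<theta> \<in> {-r..0} \<Longrightarrow> \<bar>\<eta> \<theta> - \<eta>' \<theta>\<bar> \<le> d) \<Longrightarrow> \<bar>G1 \<eta> - G1 \<eta>'\<bar> \<le> V * d"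
  and stab: "\<zeta> \<noteq> 0 \<Longrightarrow> \<omega> / (2 * pi) * integral {0..2 * pi / \<omega>}
    (\<lambda>t. Re (cnj (\<zeta> * cis (\<omega> * t)) * \<psi>) * G3 (\<lambda>\<theta>. Re (\<zeta> * cis (\<omega> * (t + \<theta>))))) < - C * norm \<zeta> ^ 4"
begin

definition lip :: "real \<Rightarrow> real" where "lip \<rho> = V * (1 + 3 * \<rho>\<^sup>2)"

lemma lip_nonneg: "0 \<le> lip \<rho>" using V by (simp add: lip_def)

lemma G_bound:
 assumes "continuous_on {-r..0} n" "\<And>v. v \<in> {-r..0} \<Longrightarrow> \<bar>n v\<bar> \<le> p"
 shows "\<bar>G n\<bar> \<le> lip p * p"
 using G_lip[of n "\<lambda>_. 0" p p] assms assms(2)[of 0] av_r by (force simp: G_zero lip_def)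

text \<open>On a compact rectangle H is uniformly continuous, hence its segments depend continuously
  on s in the sup norm.\<close>

lemma continuous_on_functional:
 fixes H :: "real \<Rightarrow> real \<Rightarrow> real" and F :: "(real \<Rightarrow> real) \<Rightarrow> real"
 assumes "continuous_on ({a..b} \<times> {-r..0}) (\<lambda>(s, v). H s v)" and l: "\<And>h. 0 \<le> l h"
  and F: "\<And>h n n' d. continuous_on {-r..0} n \<Longrightarrow> continuous_on {-r..0} n' \<Longrightarrow>
   (\<And>v. v \<in> {-r..0} \<Longrightarrow> \<bar>n v\<bar> \<le> h \<and> \<bar>n' v\<bar> \<le> h \<and> \<bar>n v - n' v\<bar> \<le> d) \<Longrightarrow> \<bar>F n - F n'\<bar> \<le> l h * d"
 shows "continuous_on {a..b} (\<lambda>s. F (H s))"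
proof -
 have H: "continuous_on ({a..b} \<times> {-r..0}) (\<lambda>p. H (fst p) (snd p))" using assms(1) by (simp add: case_prod_beta)
 have cpt: "compact ({a..b} \<times> {-r..0::real})" by (intro compact_Times compact_Icc)
 obtain h where "\<forall>p\<in>{a..b} \<times> {-r..0}. \<bar>H (fst p) (snd p)\<bar> \<le> h"
  using compact_imp_bounded[OF compact_continuous_image[OF H cpt]] unfolding bounded_iff real_norm_def ball_simps by blast
 then have h: "\<bar>H s v\<bar> \<le> h" if "s \<in> {a..b}" "v \<in> {-r..0}" for s v using that by force
 have cH: "continuous_on {-r..0} (H s)" if "s \<in> {a..b}" for s
 proof -
  have "continuous_on {-r..0} (\<lambda>v. (s, v))" by (intro continuous_intros)
  moreover have "(\<lambda>v. (s, v)) ` {-r..0} \<subseteq> {a..b} \<times> {-r..0}" using that by auto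
  ultimately show ?thesis using continuous_on_compose2[OF H] by force
 qed
 show ?thesis
  unfolding continuous_on_iff
 proof (intro ballI allI impI)
  fix s and e :: real assume s: "s \<in> {a..b}" and e: "0 < e"
  define e' where "e' = e / (2 * (l h + 1))"
  have e': "0 < e'" "l h * e' < e" using e l[of h] mult_nonneg_nonneg[of "l h" e] by (auto simp: e'_def field_simps add_nonneg_pos)
  obtain d where d: "0 < d" "\<And>p q. p \<in> {a..b} \<times> {-r..0} \<Longrightarrow> q \<in> {a..b} \<times> {-r..0} \<Longrightarrow> dist q p < d \<Longrightarrow>
    dist (H (fst q) (snd q)) (H (fst p) (snd p)) < e'"
   using compact_uniformly_continuous[OF H cpt] e'(1) unfolding uniformly_continuous_on_def by metis
  show "\<exists>d>0. \<forall>x'\<in>{a..b}. dist x' s < d \<longrightarrow> dist (F (H x')) (F (H s)) < e"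
  proof (intro exI[of _ d] conjI ballI impI d(1))
   fix x' assume x': "x' \<in> {a..b}" "dist x' s < d"
   have "\<bar>H x' v - H s v\<bar> \<le> e'" if "v \<in> {-r..0}" for v
    using d(2)[of "(s, v)" "(x', v)"] x' s that by (auto simp: dist_Pair_Pair dist_real_def)
   then have "\<bar>F (H x') - F (H s)\<bar> \<le> l h * e'"
    using h[OF s] h[OF x'(1)] x' s by (intro F cH conjI) auto
   then show "dist (F (H x')) (F (H s)) < e" using e' by (simp add: dist_real_def)
  qed
 qed
qed

lemma continuous_on_G:
 fixes H :: "real \<Rightarrow> real \<Rightarrow> real"
 assumes "continuous_on ({a..b} \<times> {-r..0}) (\<lambda>(s, v). H s v)"
 shows "continuous_on {a..b} (\<lambda>s. G (H s))"
 by (rule continuous_on_functional[where F = G and l = lip, OF assms lip_nonneg]) (unfold lip_def, rule G_lip; blast)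

lemma continuous_on_G1:
 fixes H :: "real \<Rightarrow> real \<Rightarrow> real"
 assumes "continuous_on ({a..b} \<times> {-r..0}) (\<lambda>(s, v). H s v)"
 shows "continuous_on {a..b} (\<lambda>s. G1 (H s))"
 by (rule continuous_on_functional[where F = G1 and l = "\<lambda>_. V", OF assms V], rule G1_lip) blast+

definition wave :: "complex \<Rightarrow> real \<Rightarrow> real \<Rightarrow> real" where
 "wave \<zeta> s \<theta> = Re (\<zeta> * cis (\<omega> * (s + \<theta>)))"

text \<open>The drift of the reduced equation in the fast time scale: the factor \<open>cis\<close>
  stands for exp(-sB), and \<open>wave \<zeta> s\<close> for the element of P with coordinates
  exp(sB) \<zeta>.\<close>

definition drift :: "real \<Rightarrow> complex \<Rightarrow> complex" where
 "drift s \<zeta> = cis (- (\<omega> * s)) * \<psi> * of_real (G (wave \<zeta> s))"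

abbreviation period :: real where "period \<equiv> 2 * pi / \<omega>"

lemma period_pos: "0 < period" using av_\<omega> by simp

lemma wave_bound: "\<bar>wave c s v\<bar> \<le> norm c"
 unfolding wave_def using complex_norm_le_mono[of c "norm c" "cis (\<omega> * (s + v))"] by simp

lemma wave_diff: "wave c s v - wave \<xi> s v = wave (c - \<xi>) s v"
 by (simp add: wave_def algebra_simps)

lemma continuous_wave: "continuous_on A (wave \<zeta> s)"
 unfolding wave_def by (intro continuous_intros)

lemma drift_bound: "norm c \<le> p \<Longrightarrow> norm (drift s c) \<le> norm \<psi> * (lip p * p)"
 unfolding drift_def norm_mult norm_cis norm_of_real
 using order_trans[OF wave_bound[of c s]] by (intro order_trans[OF mult_left_mono[OF G_bound[of "wave c s" p]]] continuous_wave) auto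

lemma drift_lip:
 assumes "norm c \<le> p" "norm \<xi> \<le> p"
 shows "norm (drift s c - drift s \<xi>) \<le> norm \<psi> * (lip p * norm (c - \<xi>))"
proof -
 have "\<bar>G (wave c s) - G (wave \<xi> s)\<bar> \<le> lip p * norm (c - \<xi>)"
  unfolding lip_def using wave_bound[of c s] wave_bound[of \<xi> s] wave_bound[of "c - \<xi>" s] assms
  by (intro G_lip continuous_wave) (auto simp: wave_diff intro: order_trans)
 moreover have "drift s c - drift s \<xi> = cis (- (\<omega> * s)) * \<psi> * of_real (G (wave c s) - G (wave \<xi> s))"
  by (simp add: drift_def algebra_simps)
 ultimately show ?thesis by (simp add: norm_mult mult_left_mono del: of_real_diff)
qed

lemma continuous_on_drift:
 assumes u: "continuous_on {a..b} u"
 shows "continuous_on {a..b} (\<lambda>s. drift s (u s))"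
proof -
 have "continuous_on ({a..b} \<times> {-r..0}) (\<lambda>p. u (fst p))"
  by (rule continuous_on_compose2[OF u]) (auto intro!: continuous_intros)
 then have "continuous_on {a..b} (\<lambda>s. G (wave (u s) s))"
  by (intro continuous_on_G) (auto simp: wave_def case_prod_beta intro!: continuous_intros)
 then show ?thesis unfolding drift_def by (intro continuous_intros)
qed

lemma drift_periodic: "drift (s + real n * period) z = drift s z"
proof -
 have e: "\<omega> * (s + real n * period) = \<omega> * s + 2 * pi * real n" using av_\<omega> by (simp add: field_simps)
 have c: "cis (x + 2 * pi * real n) = cis x" for x
  by (simp add: cis_mult[symmetric] cis_multiple_2pi)
 have "cis (- (\<omega> * (s + real n * period))) = cnj (cis (\<omega> * (s + real n * period)))" by (simp add: cis_cnj)
 also have "\<dots> = cis (- (\<omega> * s))" by (simp only: e c cis_cnj)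
 finally have 1: "cis (- (\<omega> * (s + real n * period))) = cis (- (\<omega> * s))" .
 have "wave z (s + real n * period) = wave z s"
 proof
  fix v
  have "\<omega> * (s + real n * period + v) = \<omega> * (s + v) + 2 * pi * real n" using av_\<omega> by (simp add: field_simps)
  then show "wave z (s + real n * period) v = wave z s v" by (simp only: wave_def c)
 qed
 then show ?thesis using 1 by (simp add: drift_def)
qed

text \<open>Here \<mu> stands for the accumulated noise, since the energy will be taken of the path
  without it. Over a period the cubic part contributes on average at most -C |c|^4 by the
  stabilising condition, while the linear part and all terms with \<mu> grow at most like |c|^3;
  hence a common bound D.\<close>

lemma averaged_energy:
 assumes N: "0 \<le> N"
 obtains D where "0 \<le> D" "\<And>c \<mu>. norm \<mu> \<le> N \<Longrightarrow> integral {0..period} (\<lambda>s. Re (cnj (c - \<mu>) * drift s c)) \<le> period * D"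
proof -
 obtain D where D: "0 \<le> D" "\<And>x. 0 \<le> x \<Longrightarrow>
   (norm \<psi> * V) * x\<^sup>2 + (N * norm \<psi> * V) * x + (3 * N * norm \<psi> * V) * x ^ 3 - C * x ^ 4 \<le> D"
  by (rule quartic_bounded_above[of "norm \<psi> * V" "N * norm \<psi> * V" C "3 * N * norm \<psi> * V"]) (use N V C in auto)
 have "integral {0..period} (\<lambda>s. Re (cnj (c - \<mu>) * drift s c)) \<le> period * D" if \<mu>: "norm \<mu> \<le> N" for c \<mu>
 proof -
  let ?x = "norm c"
  let ?h = "\<lambda>s. Re (cnj (c * cis (\<omega> * s)) * \<psi>) * G3 (wave c s)"
  let ?c = "(norm \<psi> * V) * ?x\<^sup>2 + (N * norm \<psi> * V) * ?x + (3 * N * norm \<psi> * V) * ?x ^ 3"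
  have cont_wave: "continuous_on ({0..period} \<times> {-r..0}) (\<lambda>(s, v). wave c s v)"
   unfolding wave_def case_prod_beta by (intro continuous_intros)
  have cG1: "continuous_on {0..period} (\<lambda>s. G1 (wave c s))" and cG: "continuous_on {0..period} (\<lambda>s. G (wave c s))"
   using continuous_on_G1[OF cont_wave] continuous_on_G[OF cont_wave] by auto
  have "continuous_on {0..period} (\<lambda>s. G (wave c s) - G1 (wave c s))" by (intro continuous_intros cG1 cG)
  moreover have "G (wave c s) - G1 (wave c s) = G3 (wave c s)" for s using G_split[OF continuous_wave] by simp
  ultimately have cG3: "continuous_on {0..period} (\<lambda>s. G3 (wave c s))" by simp
  have pw: "Re (cnj (c - \<mu>) * drift s c) \<le> ?h s + ?c" for s
  proof -
   have G1b: "\<bar>G1 (wave c s)\<bar> \<le> V * ?x"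
    using G1_lip[of "wave c s" "\<lambda>_. 0" ?x] continuous_wave wave_bound by (simp add: G1_zero)
   have Gb: "\<bar>G (wave c s)\<bar> \<le> V * (1 + 3 * ?x\<^sup>2) * ?x"
    using G_bound[OF continuous_wave wave_bound] by (simp add: lip_def)
   have nc: "norm (cnj (c * cis (\<omega> * s))) \<le> ?x" by (simp add: norm_mult del: complex_cnj_mult)
   have 1: "Re (cnj (c * cis (\<omega> * s)) * \<psi>) * G1 (wave c s) \<le> (?x * norm \<psi>) * (V * ?x)"
    by (rule order_trans[OF abs_ge_self]) (unfold abs_mult, intro mult_mono complex_norm_le_mono nc G1b, auto)
   have "norm (cnj \<mu> * cis (- (\<omega> * s))) \<le> N" using \<mu> by (simp add: norm_mult)
   from complex_norm_le_mono[OF this, of \<psi>]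
   have 2: "\<bar>Re (cnj \<mu> * cis (- (\<omega> * s)) * \<psi>) * G (wave c s)\<bar> \<le> (N * norm \<psi>) * (V * (1 + 3 * ?x\<^sup>2) * ?x)"
    unfolding abs_mult by (intro mult_mono Gb) (use N in auto)
   have "Re (cnj (c - \<mu>) * drift s c) = Re (cnj (c * cis (\<omega> * s)) * \<psi>) * G (wave c s) - Re (cnj \<mu> * cis (- (\<omega> * s)) * \<psi>) * G (wave c s)"
    by (simp add: drift_def cis_cnj algebra_simps)
   also have "\<dots> = ?h s + Re (cnj (c * cis (\<omega> * s)) * \<psi>) * G1 (wave c s) - Re (cnj \<mu> * cis (- (\<omega> * s)) * \<psi>) * G (wave c s)"
    by (simp only: G_split[OF continuous_wave] ring_distribs)
   also have "\<dots> \<le> ?h s + (?x * norm \<psi>) * (V * ?x) + (N * norm \<psi>) * (V * (1 + 3 * ?x\<^sup>2) * ?x)"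
    using 1 2 by linarith
   also have "\<dots> = ?h s + ?c" by (simp add: algebra_simps power2_eq_square power3_eq_cube)
   finally show ?thesis .
  qed
  have int_h: "?h integrable_on {0..period}"
   by (intro integrable_continuous_interval continuous_intros cG3)
  have "continuous_on {0..period} (\<lambda>s. drift s c)" by (rule continuous_on_drift) simp
  then have "integral {0..period} (\<lambda>s. Re (cnj (c - \<mu>) * drift s c)) \<le> integral {0..period} (\<lambda>s. ?h s + ?c)"
   by (intro integral_le pw integrable_add int_h integrable_continuous_interval continuous_intros)
  also have "\<dots> = integral {0..period} ?h + period * ?c"
   using period_pos by (subst integral_add[OF int_h]) auto
  also have "\<dots> \<le> - C * ?x ^ 4 * period + period * ?c"
  proof (cases "c = 0")
   case True
   then show ?thesis by simp
  next
   case False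
   have "integral {0..period} ?h / period < - C * ?x ^ 4"
    using stab[OF False] av_\<omega> by (simp add: wave_def[abs_def] field_simps)
   then show ?thesis using period_pos by (simp only: pos_divide_less_eq)
  qed
  also have "\<dots> = period * (?c - C * ?x ^ 4)" by (simp add: algebra_simps)
  also have "\<dots> \<le> period * D" using D(2)[of ?x] period_pos by (intro mult_left_mono) auto
  finally show ?thesis .
 qed
 with D(1) that show thesis by blast
qed

lemma primitive_lipschitz:
 fixes f :: "real \<Rightarrow> complex"
 assumes c: "continuous_on {0..b} f" and B: "\<And>s. s \<in> {0..b} \<Longrightarrow> norm (f s) \<le> B" and a: "0 \<le> a" "a \<le> b"
 shows "norm (integral {0..b} f - integral {0..a} f) \<le> B * (b - a)"
proof -
 have ib: "f integrable_on {0..b}" by (rule integrable_continuous_interval[OF c])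
 have "integral {0..a} f + integral {a..b} f = integral {0..b} f" by (rule Henstock_Kurzweil_Integration.integral_combine[OF a ib])
 then have e: "integral {0..b} f - integral {0..a} f = integral {a..b} f" by (simp add: algebra_simps)
 have "f integrable_on {a..b}" by (rule integrable_on_subinterval[OF ib]) (use a in auto)
 then have "(f has_integral integral {a..b} f) (cbox a b)" by (simp add: integrable_integral)
 from has_integral_bound[OF _ this, of B] have "0 \<le> B \<Longrightarrow> norm (integral {a..b} f) \<le> B * (b - a)"
  using B a by simp
 then show ?thesis using e order_trans[OF norm_ge_zero B[of 0]] a by simp
qed

text \<open>v is the path without its noise term, hence differentiable, and no Ito correction
  arises.\<close>

lemma energy_increment:
 fixes v f :: "real \<Rightarrow> complex"
 assumes c: "continuous_on {0..T} f" and v: "\<And>t. t \<in> {0..T} \<Longrightarrow> v t = u0 + h *\<^sub>R integral {0..t} f"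
  and ab: "0 \<le> a" "a \<le> b" "b \<le> T"
 shows "((\<lambda>s. 2 * h * Re (cnj (v s) * f s)) has_integral ((norm (v b))\<^sup>2 - (norm (v a))\<^sup>2)) {a..b}"
proof -
 have "((\<lambda>s. v s \<bullet> v s) has_vector_derivative 2 * h * Re (cnj (v x) * f x)) (at x within {a..b})" if x: "x \<in> {a..b}" for x
 proof -
  have "((\<lambda>t. u0 + h *\<^sub>R integral {0..t} f) has_vector_derivative 0 + h *\<^sub>R f x) (at x within {0..T})"
   by (intro has_vector_derivative_add has_vector_derivative_const bounded_linear.has_vector_derivative[OF bounded_linear_scaleR_right]
    integral_has_vector_derivative c) (use x ab in auto)
  then have "(v has_vector_derivative h *\<^sub>R f x) (at x within {0..T})"
   by (intro has_vector_derivative_transform[where f = "\<lambda>t. u0 + h *\<^sub>R integral {0..t} f" and g = v]) (use x ab v in auto)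
  then have "(v has_vector_derivative h *\<^sub>R f x) (at x within {a..b})"
   by (rule has_vector_derivative_within_subset) (use ab in auto)
  from bounded_bilinear.has_vector_derivative[OF bounded_bilinear_inner this this]
  show ?thesis by (simp add: inner_complex_def algebra_simps)
 qed
 from fundamental_theorem_of_calculus[OF ab(2) this] show ?thesis by (simp add: dot_square_norm)
qed

text \<open>The energy grows over a period P by an amount of order c P, and there are at most T / (c
  P) periods, which leaves a bound independent of c. On each period u is frozen in the drift; the
  error is of order c + j, because the smooth part moves with speed of order c and the noise
  oscillates by a multiple of j. \<open>bootstrap\<close> supplies the ball in which the Lipschitz
  constants hold.\<close>

lemma a_priori_bound:
 fixes u0 :: complex
 assumes N: "0 \<le> N" and T: "0 < T"
 obtains B e where "0 \<le> B" "0 < e"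
  "\<And>c j u m z. 0 < c \<Longrightarrow> c < e \<Longrightarrow> 0 \<le> j \<Longrightarrow> j < e \<Longrightarrow> continuous_on {0..T/c} u \<Longrightarrow>
   (\<And>z. z \<in> {0..T/c} \<Longrightarrow> u z = u0 + c *\<^sub>R integral {0..z} (\<lambda>s. drift s (u s)) + m z) \<Longrightarrow>
   (\<And>z. z \<in> {0..T/c} \<Longrightarrow> norm (m z) \<le> N) \<Longrightarrow>
   (\<And>s z. s \<in> {0..T/c} \<Longrightarrow> z \<in> {0..T/c} \<Longrightarrow> norm (m z - m s) \<le> j * (1 + \<bar>z - s\<bar>)) \<Longrightarrow>
   z \<in> {0..T/c} \<Longrightarrow> norm (u z) < B"
proof -
 obtain D where D: "0 \<le> D" "\<And>p \<mu>. norm \<mu> \<le> N \<Longrightarrow> integral {0..period} (\<lambda>s. Re (cnj (p - \<mu>) * drift s p)) \<le> period * D"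
  using averaged_energy[OF N] by blast
 \<comment> \<open>Initial energy, 2 c P (D + 1) for each of at most T / (c P) full periods, and 2
   for the incomplete last one. The spare 1 in B makes the final inequality strict.\<close>
 define B1 where "B1 = sqrt ((norm u0)\<^sup>2 + 2 * T * (D + 1) + 2)"
 have B1: "0 \<le> B1" "B1\<^sup>2 = (norm u0)\<^sup>2 + 2 * T * (D + 1) + 2" using T D(1) by (auto simp: B1_def)
 define B where "B = B1 + N + 1"
 have B: "0 \<le> B" using B1 N by (simp add: B_def)
 define b where "b = norm \<psi> * (lip B * B)"
 define l where "l = norm \<psi> * lip B"
 have b: "0 \<le> b" "0 \<le> l" using B lip_nonneg by (auto simp: b_def l_def)
 define P where "P = period"
 have P: "0 < P" using period_pos by (simp add: P_def)
 \<comment> \<open>Per unit of \<open>max c j\<close>: the first two terms bound the freezing error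
   on a period, the last one the change over an incomplete period.\<close>
 define Q where "Q = b * P * b + (B + N) * (l * (b * P + 1 + P)) + P * ((B + N) * b)"
 have Q: "0 \<le> Q" using b B N P by (auto simp: Q_def)
 define e where "e = 1 / (Q + 1)"
 have e: "0 < e" using Q by (simp add: e_def)
 have eQ: "Q * x \<le> 1" if "0 \<le> x" "x < e" for x
 proof -
  have "Q * x \<le> Q * e" using Q that by (intro mult_left_mono) auto
  also have "\<dots> \<le> 1" using Q by (simp add: e_def field_simps)
  finally show ?thesis .
 qed
 have main: "norm (u z) < B"
  if c: "0 < c" "c < e" and j: "0 \<le> j" "j < e" and cu: "continuous_on {0..T/c} u"
   and u: "\<And>z. z \<in> {0..T/c} \<Longrightarrow> u z = u0 + c *\<^sub>R integral {0..z} (\<lambda>s. drift s (u s)) + m z"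
   and mN: "\<And>z. z \<in> {0..T/c} \<Longrightarrow> norm (m z) \<le> N"
   and mm: "\<And>s z. s \<in> {0..T/c} \<Longrightarrow> z \<in> {0..T/c} \<Longrightarrow> norm (m z - m s) \<le> j * (1 + \<bar>z - s\<bar>)"
   and z: "z \<in> {0..T/c}" for c j u m z
 proof (rule bootstrap[where h = "\<lambda>t. norm (u t)", OF _ _ _ z])
  show "continuous_on {0..T/c} (\<lambda>t. norm (u t))" by (intro continuous_intros cu)
  have T_pos: "0 \<le> T / c" using T c by simp
  define f where "f s = drift s (u s)" for s
  define v where "v s = u s - m s" for s
  have cf: "continuous_on {0..T/c} f" unfolding f_def by (rule continuous_on_drift[OF cu])
  have v: "v s = u0 + c *\<^sub>R integral {0..s} f" if "s \<in> {0..T/c}" for s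
   using u[OF that] by (simp add: v_def f_def[abs_def])
  have v0: "v 0 = u0" using v[of 0] T_pos by simp
  have uB: "norm (u s) < B" if "s \<in> {0..T/c}" "(norm (v s))\<^sup>2 \<le> B1\<^sup>2" for s
  proof -
   have "norm (v s) \<le> B1" using power2_le_imp_le[OF that(2) B1(1)] .
   moreover have "norm (u s) \<le> norm (v s) + norm (m s)" using norm_triangle_ineq[of "v s" "m s"] by (simp add: v_def)
   ultimately show ?thesis using mN[OF that(1)] by (simp add: B_def)
  qed
  show "norm (u 0) < B"
   by (rule uB) (use T_pos v0 B1(2) T D(1) in auto)
  fix t assume t: "t \<in> {0..T/c}" and hyp: "\<And>s. s \<in> {0..t} \<Longrightarrow> norm (u s) \<le> B"
  have fb: "norm (f s) \<le> b" if "s \<in> {0..t}" for s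
   unfolding f_def b_def by (rule drift_bound[OF hyp[OF that]])
  have vB: "norm (v s) \<le> B + N" if "s \<in> {0..t}" for s
   using norm_triangle_ineq4[of "u s" "m s"] hyp[OF that] mN[of s] that t by (simp add: v_def)
  have vdiff: "norm (v y - v x) \<le> c * b * (y - x)" if "0 \<le> x" "x \<le> y" "y \<le> t" for x y
  proof -
   have "v y - v x = c *\<^sub>R (integral {0..y} f - integral {0..x} f)" using v[of x] v[of y] that t by (simp add: algebra_simps)
   moreover have "norm (integral {0..y} f - integral {0..x} f) \<le> b * (y - x)"
    by (rule primitive_lipschitz[OF continuous_on_subset[OF cf] fb]) (use that t in auto)
   ultimately show ?thesis using c by (simp add: mult_left_mono mult.assoc)
  qed
  note energy = energy_increment[OF cf v]
  \<comment> \<open>The period starts at a multiple of P, so that periodicity of the drift moves the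
    integral to [0,P].\<close>
  have period_step: "(norm (v (s + P)))\<^sup>2 - (norm (v s))\<^sup>2 \<le> 2 * c * (P * (D + 1))" if s: "s = real n * P" "s + P \<le> t" for s n
  proof -
   have s0: "0 \<le> s" "s \<in> {0..t}" using s P by auto
   let ?fr = "\<lambda>z. Re (cnj (v s) * drift z (u s))"
   have "Re (cnj (v z) * f z) \<le> ?fr z + 1" if z: "z \<in> {s..s + P}" for z
   proof -
    have \<tau>t: "z \<in> {0..t}" using z s(2) s0(1) by auto
    have 1: "norm (v z - v s) \<le> c * b * P"
     by (rule order_trans[OF vdiff]) (use z \<tau>t s0 c b in \<open>auto intro!: mult_left_mono\<close>)
    have "norm (m z - m s) \<le> j * (1 + P)"
     by (rule order_trans[OF mm]) (use z \<tau>t s0 j t in \<open>auto intro!: mult_left_mono\<close>)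
    then have "norm (u z - u s) \<le> c * b * P + j * (1 + P)"
     using 1 norm_triangle_ineq[of "v z - v s" "m z - m s"] by (simp add: v_def)
    then have "l * norm (u z - u s) \<le> l * (c * b * P + j * (1 + P))" using b by (intro mult_left_mono) auto
    then have 2: "norm (f z - drift z (u s)) \<le> l * (c * b * P + j * (1 + P))"
     using drift_lip[OF hyp[OF \<tau>t] hyp[OF s0(2)], of z] by (simp add: f_def l_def mult.assoc)
    define x where "x = max c j"
    have x: "0 \<le> x" "x < e" "c \<le> x" "j \<le> x" using c j by (auto simp: x_def)
    have "cnj (v z) * f z = cnj (v s) * drift z (u s) + (cnj (v z - v s) * f z + cnj (v s) * (f z - drift z (u s)))"
     by (simp add: algebra_simps)
    then have "Re (cnj (v z) * f z) \<le> ?fr z + norm (cnj (v z - v s) * f z + cnj (v s) * (f z - drift z (u s)))"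
     using complex_Re_le_cmod[of "cnj (v z - v s) * f z + cnj (v s) * (f z - drift z (u s))"] by simp
    also have "norm (cnj (v z - v s) * f z + cnj (v s) * (f z - drift z (u s)))
      \<le> (c * b * P) * b + (B + N) * (l * (c * b * P + j * (1 + P)))"
     by (rule order_trans[OF norm_triangle_ineq], unfold norm_mult complex_mod_cnj,
      intro add_mono mult_mono 1 2 fb \<tau>t vB s0(2)) (use c b P B N in auto)
    also have "\<dots> \<le> (x * b * P) * b + (B + N) * (l * (x * b * P + x * (1 + P)))"
     using x c j b P B N by (intro add_mono mult_mono mult_left_mono mult_right_mono) auto
    also have "\<dots> = (b * P * b + (B + N) * (l * (b * P + 1 + P))) * x" by (simp add: algebra_simps)
    also have "\<dots> \<le> Q * x" using x b P B N by (intro mult_right_mono) (auto simp: Q_def)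
    also have "\<dots> \<le> 1" by (rule eQ) (use x in auto)
    finally show ?thesis by simp
   qed
   then have le: "2 * c * Re (cnj (v z) * f z) \<le> 2 * c * (?fr z + 1)" if "z \<in> {s..s + P}" for z
    using that c by (intro mult_left_mono) auto
   have "continuous_on {s..s + P} (\<lambda>z. drift z ((\<lambda>_. u s) z))" by (rule continuous_on_drift) simp
   then have cfr: "continuous_on {s..s + P} ?fr" by (intro continuous_intros)
   have fr: "integral {s..s + P} ?fr \<le> P * D"
   proof -
    have "integral {0 + s..P + s} ?fr = integral {0..P} (?fr \<circ> (+) s)"
     by (rule integral_shift_Icc_real[symmetric])
    also have "(?fr \<circ> (+) s) = ?fr"
    proof
     fix y show "(?fr \<circ> (+) s) y = ?fr y" using drift_periodic[of y n "u s"] s(1) by (simp add: P_def add.commute)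
    qed
    also have "integral {0..P} ?fr \<le> P * D"
     using D(2)[of "m s" "u s"] mN[of s] s0 t by (simp add: P_def v_def)
    finally show ?thesis by (simp add: add.commute)
   qed
   have e: "((\<lambda>z. 2 * c * Re (cnj (v z) * f z)) has_integral ((norm (v (s + P)))\<^sup>2 - (norm (v s))\<^sup>2)) {s..s + P}"
    by (rule energy) (use s s0 P t in auto)
   have ir: "((\<lambda>z. 2 * c * (?fr z + 1)) has_integral (2 * c * (integral {s..s + P} ?fr + P))) {s..s + P}"
   proof (intro has_integral_mult_right has_integral_add)
    show "(?fr has_integral integral {s..s + P} ?fr) {s..s + P}"
     by (intro integrable_integral integrable_continuous_interval cfr)
    show "((\<lambda>_. 1) has_integral P) {s..s + P}" using has_integral_const_real[of "1::real" s "s + P"] P by simp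
   qed
   have "(norm (v (s + P)))\<^sup>2 - (norm (v s))\<^sup>2 \<le> 2 * c * (integral {s..s + P} ?fr + P)"
    by (rule has_integral_le[OF e ir]) (rule le)
   also have "\<dots> \<le> 2 * c * (P * (D + 1))"
    using fr c by (intro mult_left_mono) (auto simp: algebra_simps)
   finally show ?thesis .
  qed
  have periods: "(norm (v (real n * P)))\<^sup>2 \<le> (norm u0)\<^sup>2 + 2 * c * (P * (D + 1)) * real n" if "real n * P \<le> t" for n
   using that
  proof (induction n)
   case 0
   show ?case by (simp add: v0)
  next
   case (Suc n)
   have nP: "real n * P + P \<le> t" using Suc.prems by (simp add: algebra_simps)
   from Suc.IH period_step[OF refl nP] P nP show ?case by (simp add: algebra_simps)
  qed
  define n where "n = nat \<lfloor>t / P\<rfloor>"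
  have tP: "0 \<le> t / P" using t P by simp
  have "real n \<le> t / P" "t / P < real n + 1" using of_nat_floor[OF tP] floor_correct[of "t / P"] tP by (simp_all add: n_def)
  then have n: "real n * P \<le> t" "t < real n * P + P" using P by (auto simp: field_simps)
  have n0: "0 \<le> real n * P" using P by simp
  have e: "((\<lambda>z. 2 * c * Re (cnj (v z) * f z)) has_integral ((norm (v t))\<^sup>2 - (norm (v (real n * P)))\<^sup>2)) {real n * P..t}"
   by (rule energy) (use n n0 t in auto)
  have "norm ((norm (v t))\<^sup>2 - (norm (v (real n * P)))\<^sup>2) \<le> (2 * c * ((B + N) * b)) * measure lborel {real n * P..t}"
  proof (rule has_integral_bound[OF _ e[folded cbox_interval], unfolded cbox_interval])
   fix x assume "x \<in> {real n * P..t}"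
   then have x: "x \<in> {0..t}" using n0 by auto
   have "\<bar>Re (cnj (v x) * f x)\<bar> \<le> (B + N) * b"
    by (rule order_trans[OF abs_Re_le_cmod], unfold norm_mult complex_mod_cnj, intro mult_mono vB fb x) (use B N b in auto)
   then show "norm (2 * c * Re (cnj (v x) * f x)) \<le> 2 * c * ((B + N) * b)" using c by (simp add: abs_mult mult.assoc)
  qed (use c B N b in auto)
  also have "\<dots> \<le> (2 * c * ((B + N) * b)) * P" using n c B N b by (intro mult_left_mono) auto
  also have "\<dots> = 2 * ((P * ((B + N) * b)) * c)" by (simp add: algebra_simps)
  also have "\<dots> \<le> 2 * (Q * c)" using c b P B N by (intro mult_left_mono mult_right_mono) (auto simp: Q_def)
  also have "\<dots> \<le> 2" using eQ[of c] c by simp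
  finally have last: "(norm (v t))\<^sup>2 \<le> (norm (v (real n * P)))\<^sup>2 + 2" by simp
  have "c * (real n * P) \<le> c * (T / c)" using n(1) t c by (intro mult_left_mono) auto
  then have "c * (real n * P) \<le> T" using c by simp
  then have "2 * (c * (real n * P)) * (D + 1) \<le> 2 * T * (D + 1)" using D(1) by (intro mult_right_mono) auto
  then have "(norm (v t))\<^sup>2 \<le> B1\<^sup>2" using last periods[OF n(1)] by (simp add: B1(2) algebra_simps)
  then show "norm (u t) < B" by (rule uB[OF t])
 qed
 show thesis by (rule that[OF B e]) (fact main)
qed

end

section \<open>Decomposition of the delay equation along the critical modes\<close>

lemma Phi_eq_Re: "Phi w v y = Re (Complex (v $ 1) (- (v $ 2)) * cis (w * y))"
 by (simp add: Phi_def)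

lemma conv_exp_bound:
 assumes c: "0 < c" and f: "loc_bdd f" and g: "loc_bdd g" and t: "0 \<le> t" and A: "0 \<le> A"
  and fb: "\<And>s. s \<in> {0..t} \<Longrightarrow> \<bar>f s\<bar> \<le> A * exp (- (c * s))"
  and gb: "\<And>s. s \<in> {0..t} \<Longrightarrow> \<bar>g (t - s)\<bar> \<le> B * (1 + s)"
 shows "\<bar>conv f g t\<bar> \<le> A * B * ((1 + 1 / c) / c)"
proof -
 define h where "h s = A * B * (exp (- (c * s)) * (1 + s))" for s
 define H where "H s = - (A * B * ((1 + s + 1 / c) / c * exp (- (c * s))))" for s
 have B: "0 \<le> B" using order_trans[OF abs_ge_zero gb[of 0]] t by simp
 have h: "loc_bdd h" unfolding h_def by (intro loc_bdd_continuous continuous_intros)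
 have "\<bar>conv f g t\<bar> \<le> (LBINT s. (if 0 \<le> s \<and> s \<le> t then h s else 0))"
  unfolding conv_def
 proof (rule order_trans[OF integral_abs_bound], rule integral_mono)
  show "integrable lborel (\<lambda>s. if 0 \<le> s \<and> s \<le> t then h s else 0)"
   using conv_integrable[OF h loc_bdd_const[of 1], of t] by (simp cong: if_cong)
  show "(\<bar>if 0 \<le> s \<and> s \<le> t then f s * g (t - s) else 0\<bar>) \<le> (if 0 \<le> s \<and> s \<le> t then h s else 0)" for s
   using mult_mono[OF fb gb, of s s] A by (auto simp: h_def abs_mult algebra_simps)
 qed (intro integrable_abs conv_integrable f g)
 also have "\<dots> = conv (\<lambda>_. 1) h t" by (rule conv_one_alt[symmetric])
 also have "conv (\<lambda>_. 1) h t = H t - H 0"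
 proof (rule has_integral_unique[OF conv_one_integral[OF h]], rule fundamental_theorem_of_calculus[OF t])
  fix s
  have "(H has_real_derivative h s) (at s within {0..t})"
   unfolding H_def h_def using c by (auto intro!: derivative_eq_intros simp: field_simps)
  then show "(H has_vector_derivative h s) (at s within {0..t})" by (simp add: has_real_derivative_iff_has_vector_derivative)
 qed
 also have "\<dots> \<le> A * B * ((1 + 1 / c) / c)" using A B t c by (simp add: H_def)
 finally show ?thesis .
qed

lemma loc_bdd_wave: "loc_bdd (\<lambda>s. Re (a * cis (w * s)))"
 by (intro loc_bdd_continuous continuous_intros)

text \<open>The angle w (t - s) splits into a rotation by w t outside the integral and a
  counter-rotation in the integrand, which is the form of the reduced drift.\<close>

lemma conv_wave:
 assumes g: "loc_bdd g" and c: "continuous_on {0..t} g"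
 shows "conv (\<lambda>s. Re (a * cis (w * s))) g t = Re (cis (w * t) * integral {0..t} (\<lambda>s. cis (- (w * s)) * a * of_real (g s)))"
proof -
 define h where "h s = g s * Re (a * cis (w * (t - s)))" for s
 have h: "loc_bdd h"
  unfolding loc_bdd_def
 proof (intro conjI allI)
  note [measurable] = loc_bdd_measurable[OF g]
  have [measurable]: "(\<lambda>s. Re (a * cis (w * (t - s)))) \<in> borel_measurable borel"
   by (intro borel_measurable_continuous_onI continuous_intros)
  show "h \<in> borel_measurable borel" unfolding h_def[abs_def] by measurable
  fix T
  obtain B where B: "0 \<le> B" "\<And>s. 0 \<le> s \<Longrightarrow> s \<le> T \<Longrightarrow> \<bar>g s\<bar> \<le> B" using loc_bdd_obtain[OF g, of T] by blast
  have "\<bar>h s\<bar> \<le> B * norm a" if "s \<in> {0..T}" for s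
   unfolding h_def abs_mult using that B abs_Re_le_cmod[of "a * cis (w * (t - s))"]
   by (intro mult_mono) (auto simp only: norm_mult norm_cis mult_1_right atLeastAtMost_iff abs_ge_zero norm_ge_zero)
  then show "\<exists>B. \<forall>s\<in>{0..T}. \<bar>h s\<bar> \<le> B" by blast
 qed
 have "conv (\<lambda>s. Re (a * cis (w * s))) g t = conv (\<lambda>_. 1) h t"
  unfolding conv_commute[of _ g] conv_one_alt unfolding conv_def h_def ..
 moreover have "(h has_integral conv (\<lambda>_. 1) h t) {0..t}" by (rule conv_one_integral[OF h])
 moreover have "(h has_integral Re (cis (w * t) * integral {0..t} (\<lambda>s. cis (- (w * s)) * a * of_real (g s)))) {0..t}"
 proof -
  have "((\<lambda>s. cis (- (w * s)) * a * of_real (g s)) has_integral integral {0..t} (\<lambda>s. cis (- (w * s)) * a * of_real (g s))) {0..t}"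
   by (intro integrable_integral integrable_continuous_interval continuous_intros c)
  from has_integral_linear[OF has_integral_mult_right[OF this, of "cis (w * t)"] bounded_linear_Re]
  show ?thesis
  proof (rule has_integral_eq[rotated])
   fix s
   have "cis (w * t) * (cis (- (w * s)) * a * of_real (g s)) = of_real (g s) * (a * (cis (w * t) * cis (- (w * s))))"
    by (simp only: mult_ac)
   also have "cis (w * t) * cis (- (w * s)) = cis (w * (t - s))" by (simp add: cis_mult right_diff_distrib)
   finally have "cis (w * t) * (cis (- (w * s)) * a * of_real (g s)) = g s *\<^sub>R (a * cis (w * (t - s)))"
    by (simp only: scaleR_conv_of_real)
   then show "(Re \<circ> (\<lambda>x. cis (w * t) * (cis (- (w * x)) * a * complex_of_real (g x)))) s = h s"
    by (simp only: h_def o_def scaleR_complex.sel)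
  qed
 qed
 ultimately show ?thesis by (simp add: has_integral_unique)
qed

section \<open>Critical and decaying parts of the kernels\<close>

context delay_model
begin

text \<open>The complex coordinate of \<open>Psi_tilde\<close>; \<open>P_part\<close> is then the
  rotation part of S, and \<open>P_part'\<close> its derivative, the rotation part of R.\<close>

definition psi :: complex where
 "psi = Complex (Psi_tilde r L \<omega> $ 1) (- (Psi_tilde r L \<omega> $ 2))"

abbreviation P_part :: "real \<Rightarrow> real" where "P_part t \<equiv> Re (psi * cis (\<omega> * t))"
abbreviation P_part' :: "real \<Rightarrow> real" where "P_part' t \<equiv> Re (\<i> * of_real \<omega> * psi * cis (\<omega> * t))"

lemma P_part_eq_conv: "0 \<le> t \<Longrightarrow> P_part t = Re psi + conv (\<lambda>_. 1) P_part' t"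
proof -
 assume t: "0 \<le> t"
 have "(P_part' has_integral P_part t - P_part 0) {0..t}"
 proof (rule fundamental_theorem_of_calculus[OF t])
  fix s
  have "(P_part has_real_derivative P_part' s) (at s within {0..t})"
   by (auto intro!: derivative_eq_intros simp: algebra_simps)
  then show "(P_part has_vector_derivative P_part' s) (at s within {0..t})" by (simp add: has_real_derivative_iff_has_vector_derivative)
 qed
 from has_integral_unique[OF this conv_one_integral[OF loc_bdd_wave]] show ?thesis by simp
qed

text \<open>For S this is the projection of the indicator. R is the delay term of S, and for t \<ge>
  r the delay term of a rotation is its derivative, so the decay carries over to R with a factor
  exp(g r); earlier times are absorbed in the constant.\<close>

lemma kernel_decay:
 obtains g A where "0 < g" "0 \<le> A"
  "\<And>t. 0 \<le> t \<Longrightarrow> \<bar>S t - P_part t\<bar> \<le> A * exp (- (g * t))"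
  "\<And>t. 0 \<le> t \<Longrightarrow> \<bar>R t - P_part' t\<bar> \<le> A * exp (- (g * t))"
proof -
 let ?v = "Psi_tilde r L \<omega>"
 have P_part: "P_part t = Phi \<omega> ?v t" for t by (simp add: psi_def Phi_eq_Re)
 obtain g A where g: "0 < g" and A: "0 \<le> A"
  and dec: "\<And>t. - r \<le> t \<Longrightarrow> \<bar>sol (indicator {0}) t - Phi \<omega> ?v t\<bar> \<le> A * exp (- (g * t))"
  using projection_decay C_hat_indicator unfolding Psi_tilde_def by blast
 have decS: "\<bar>S t - P_part t\<bar> \<le> A * exp (- (g * t))" if "0 \<le> t" for t
  using dec[of t] that p.r_pos by (simp only: sol_indicator P_part)
 have late: "\<bar>R t - P_part' t\<bar> \<le> K * (A * exp (g * r)) * exp (- (g * t))" if t: "r \<le> t" for t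
 proof -
  have t0: "0 \<le> t" using t p.r_pos by simp
  have m: "(\<lambda>v. if 0 \<le> t + v then P_part (t + v) else 0) \<in> borel_measurable borel"
   using loc_bdd_measurable[OF loc_bdd_wave[of psi \<omega>]] by measurable
  have "hist P_part t = lin (\<lambda>v. P_part (t + v))"
   unfolding hist_def lin_def
  proof (intro arg_cong2[of _ _ _ _ minus] integral_cong_AE)
   show "AE v in \<mu>p. (if 0 \<le> t + v then P_part (t + v) else 0) = P_part (t + v)" using p.support by eventually_elim (use t in auto)
   show "AE v in \<mu>n. (if 0 \<le> t + v then P_part (t + v) else 0) = P_part (t + v)" using n.support by eventually_elim (use t in auto)
  qed (use m loc_bdd_measurable[OF loc_bdd_wave[of psi \<omega>]] in \<open>measurable\<close>)
  also have "\<dots> = P_part' t" unfolding P_part lin_Phi by (simp add: psi_def algebra_simps)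
  finally have hP: "hist P_part t = P_part' t" .
  have "hist (\<lambda>s. S s + (-1) * P_part s) t = hist S t + hist (\<lambda>s. (-1) * P_part s) t"
   by (intro hist_add loc_bdd_S loc_bdd_cmult loc_bdd_wave)
  then have "hist (\<lambda>s. S s - P_part s) t = hist S t + (-1) * P_part' t"
   unfolding hist_cmult hP by (simp only: mult_minus1 add_uminus_conv_diff)
  then have e: "R t - P_part' t = hist (\<lambda>s. S s - P_part s) t"
   by (simp only: R_eq_hist_S[OF t0] mult_minus1 add_uminus_conv_diff)
  have "\<bar>hist (\<lambda>s. S s - P_part s) t\<bar> \<le> K * (A * exp (- (g * (t - r))))"
  proof (rule hist_bound)
   show "(\<lambda>s. S s - P_part s) \<in> borel_measurable borel"
    by (intro loc_bdd_measurable loc_bdd_diff loc_bdd_S loc_bdd_wave)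
   fix s assume "0 \<le> s" "t - r \<le> s"
   then show "\<bar>S s - P_part s\<bar> \<le> A * exp (- (g * (t - r)))"
    using g A by (intro order_trans[OF decS] mult_left_mono) auto
  qed (use A in simp)
  also have "exp (- (g * (t - r))) = exp (g * r) * exp (- (g * t))" by (simp add: exp_add[symmetric] algebra_simps)
  finally show ?thesis unfolding e by (simp add: mult.assoc)
 qed
 define M where "M = (K * exp (K * r) + \<omega> * norm psi) * exp (g * r)"
 have early: "\<bar>R t - P_part' t\<bar> \<le> M * exp (- (g * t))" if t: "0 \<le> t" "t \<le> r" for t
 proof -
  have "\<bar>R t\<bar> \<le> K * exp (K * t)" by (rule R_bound[OF t(1)])
  also have "\<dots> \<le> K * exp (K * r)" using t K_pos by (intro mult_left_mono) auto
  finally have 1: "\<bar>R t\<bar> \<le> K * exp (K * r)" .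
  have 2: "\<bar>P_part' t\<bar> \<le> \<omega> * norm psi"
   using abs_Re_le_cmod[of "\<i> * of_real \<omega> * psi * cis (\<omega> * t)"] \<omega>_pos by (simp add: norm_mult del: times_complex.simps)
  have "\<bar>R t - P_part' t\<bar> \<le> K * exp (K * r) + \<omega> * norm psi" using 1 2 abs_triangle_ineq4[of "R t" "P_part' t"] by linarith
  also have "\<dots> \<le> (K * exp (K * r) + \<omega> * norm psi) * exp (g * (r - t))"
   using t g K_pos \<omega>_pos mult_left_mono[of 1 "exp (g * (r - t))" "K * exp (K * r) + \<omega> * norm psi"] by simp
  also have "\<dots> = M * exp (- (g * t))" by (simp add: M_def exp_add[symmetric] algebra_simps)
  finally show ?thesis .
 qed
 define A' where "A' = max A (max (K * (A * exp (g * r))) M)"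
 have "\<bar>S t - P_part t\<bar> \<le> A' * exp (- (g * t))" if "0 \<le> t" for t
  by (rule order_trans[OF decS[OF that]]) (auto simp: A'_def intro!: mult_right_mono)
 moreover have "\<bar>R t - P_part' t\<bar> \<le> A' * exp (- (g * t))" if "0 \<le> t" for t
 proof (cases "r \<le> t")
  case True
  then show ?thesis by (intro order_trans[OF late]) (auto simp: A'_def intro!: mult_right_mono)
 next
  case False
  then show ?thesis using that by (intro order_trans[OF early]) (auto simp: A'_def intro!: mult_right_mono)
 qed
 moreover have "0 \<le> A'" using A by (simp add: A'_def)
 ultimately show thesis using that g by blast
qed

text \<open>The decaying part of S is integrable over the half-line, so against a bounded drift it
  costs only a constant multiple of the bound.\<close>

lemma drift_remainder:
 obtains A where "0 \<le> A"
  "\<And>g B t. 0 \<le> t \<Longrightarrow> loc_bdd g \<Longrightarrow> continuous_on {0..t} g \<Longrightarrow> (\<And>s. s \<in> {0..t} \<Longrightarrow> \<bar>g s\<bar> \<le> B) \<Longrightarrow>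
   \<bar>conv S g t - Re (cis (\<omega> * t) * integral {0..t} (\<lambda>s. cis (- (\<omega> * s)) * psi * of_real (g s)))\<bar> \<le> A * B"
proof -
 obtain c A where c: "0 < c" and A: "0 \<le> A" and dec: "\<And>t. 0 \<le> t \<Longrightarrow> \<bar>S t - P_part t\<bar> \<le> A * exp (- (c * t))"
  using kernel_decay by metis
 have main: "\<bar>conv S g t - Re (cis (\<omega> * t) * integral {0..t} (\<lambda>s. cis (- (\<omega> * s)) * psi * of_real (g s)))\<bar> \<le> A * ((1 + 1 / c) / c) * B"
  if t: "0 \<le> t" and g: "loc_bdd g" "continuous_on {0..t} g" and B: "\<And>s. s \<in> {0..t} \<Longrightarrow> \<bar>g s\<bar> \<le> B" for g B t
 proof -
  have "conv S g t - conv P_part g t = conv (\<lambda>s. S s - P_part s) g t"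
   by (intro conv_diff_left[symmetric] g loc_bdd_S loc_bdd_wave)
  also have "\<bar>\<dots>\<bar> \<le> A * B * ((1 + 1 / c) / c)"
  proof (rule conv_exp_bound[OF c _ g(1) t A])
   show "loc_bdd (\<lambda>s. S s - P_part s)" by (intro loc_bdd_diff loc_bdd_S loc_bdd_wave)
   fix s assume s: "s \<in> {0..t}"
   then show "\<bar>S s - P_part s\<bar> \<le> A * exp (- (c * s))" by (intro dec) auto
   have "\<bar>g (t - s)\<bar> \<le> B" using s by (intro B) auto
   also have "B \<le> B * (1 + s)" using order_trans[OF abs_ge_zero B[OF s]] s by (simp add: algebra_simps)
   finally show "\<bar>g (t - s)\<bar> \<le> B * (1 + s)" .
  qed
  finally show ?thesis unfolding conv_wave[OF g] by (simp only: mult_ac)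
 qed
 show thesis by (rule that[of "A * ((1 + 1 / c) / c)"]) (use A c in simp, fact main)
qed

text \<open>The integral of exp(-i \<omega> s) psi against dw after integration by parts, for a
  continuous w that starts at 0.\<close>

definition critical_noise :: "(real \<Rightarrow> real) \<Rightarrow> real \<Rightarrow> complex" where
 "critical_noise w t = cis (- (\<omega> * t)) * psi * of_real (w t)
   + integral {0..t} (\<lambda>s. cis (- (\<omega> * s)) * (\<i> * of_real \<omega> * psi) * of_real (w s))"

text \<open>The term w + conv R w is the integral of S (t - s) against dw(s) after integration by
  parts. For the decaying part of the kernels the value w t is subtracted and added, so that
  increments w t - w s occur, and the exponential weight suppresses those over long lags: the
  remainder has the size n of increments over unit time.\<close>

lemma noise_remainder:
 obtains A where "0 \<le> A"
  "\<And>w n t. 0 \<le> t \<Longrightarrow> loc_bdd w \<Longrightarrow> continuous_on {0..t} w \<Longrightarrow> w 0 = 0 \<Longrightarrow>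
   (\<And>s. s \<in> {0..t} \<Longrightarrow> \<bar>w t - w s\<bar> \<le> n * (1 + \<bar>t - s\<bar>)) \<Longrightarrow>
   \<bar>w t + conv R w t - Re (cis (\<omega> * t) * critical_noise w t)\<bar> \<le> A * n"
proof -
 obtain g A where g: "0 < g" and A: "0 \<le> A" and decS: "\<And>t. 0 \<le> t \<Longrightarrow> \<bar>S t - P_part t\<bar> \<le> A * exp (- (g * t))"
  and decR: "\<And>t. 0 \<le> t \<Longrightarrow> \<bar>R t - P_part' t\<bar> \<le> A * exp (- (g * t))"
  using kernel_decay by metis
 define M where "M = A * (1 + 1 / g) + A * ((1 + 1 / g) / g)"
 have main: "\<bar>w t + conv R w t - Re (cis (\<omega> * t) * critical_noise w t)\<bar> \<le> M * n"
  if t: "0 \<le> t" and w: "loc_bdd w" "continuous_on {0..t} w" "w 0 = 0"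
   and n: "\<And>s. s \<in> {0..t} \<Longrightarrow> \<bar>w t - w s\<bar> \<le> n * (1 + \<bar>t - s\<bar>)" for w n t
 proof -
  let ?Q = "\<lambda>s. R s - P_part' s"
  have Q: "loc_bdd ?Q" by (intro loc_bdd_diff loc_bdd_R loc_bdd_wave)
  have c: "loc_bdd (\<lambda>s. w t - w s)" by (intro loc_bdd_diff loc_bdd_const w)
  have \<eta>0: "0 \<le> n" using n[of t] t by simp
  have cc: "cis (\<omega> * t) * (cis (- (\<omega> * t)) * psi * of_real (w t)) = psi * of_real (w t)"
   by (simp add: mult.assoc[symmetric] cis_mult)
  have 1: "Re (cis (\<omega> * t) * critical_noise w t) = Re psi * w t + conv P_part' w t"
   unfolding critical_noise_def distrib_left cc plus_complex.sel conv_wave[OF w(1,2)] by simp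
  have 2: "conv R w t - conv P_part' w t = conv ?Q w t"
   by (intro conv_diff_left[symmetric] w loc_bdd_R loc_bdd_wave)
  have 3: "conv (\<lambda>_. 1) ?Q t = (S t - P_part t) - (1 - Re psi)"
   using conv_diff_right[OF loc_bdd_const loc_bdd_R loc_bdd_wave, of 1 "\<i> * of_real \<omega> * psi" \<omega> t] P_part_eq_conv[OF t]
   by (simp add: S_def del: times_complex.simps)
  have "conv ?Q (\<lambda>_. w t * 1) t = w t * conv (\<lambda>_. 1) ?Q t"
   by (subst conv_cmult_right) (simp only: conv_commute[of ?Q "\<lambda>_. 1"])
  moreover have "conv ?Q (\<lambda>s. w t - (w t - w s)) t = conv ?Q (\<lambda>_. w t) t - conv ?Q (\<lambda>s. w t - w s) t"
   by (intro conv_diff_right Q c loc_bdd_const)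
  ultimately have 4: "conv ?Q w t = w t * ((S t - P_part t) - (1 - Re psi)) - conv ?Q (\<lambda>s. w t - w s) t"
   by (simp only: diff_diff_eq2 add_diff_cancel_left' mult_1_right 3)
  have "a - b * a + (a * ((s - p) - (1 - b)) - y) = a * (s - p) - y" for a b s p y :: real
   by (simp add: algebra_simps)
  note this[of "w t" "Re psi" "S t" "P_part t" "conv ?Q (\<lambda>s. w t - w s) t"]
  then have e: "w t + conv R w t - Re (cis (\<omega> * t) * critical_noise w t) = w t * (S t - P_part t) - conv ?Q (\<lambda>s. w t - w s) t"
   using 1 2 4 by linarith
  \<comment> \<open>As w 0 = 0, the value w t is itself an increment of size at most n (1 + t); the
    exponential absorbs the growth.\<close>
  have "\<bar>w t * (S t - P_part t)\<bar> \<le> n * (1 + t) * (A * exp (- (g * t)))"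
   unfolding abs_mult using n[of 0] t w(3) decS[OF t] \<eta>0 by (intro mult_mono) auto
  also have "\<dots> = n * A * ((1 + t) / exp (g * t))" by (simp add: exp_minus field_simps)
  also have "\<dots> \<le> n * A * (1 + 1 / g)"
  proof (rule mult_left_mono)
   have "1 + t \<le> (1 + 1 / g) * (1 + g * t)" using t g by (simp add: field_simps)
   also have "\<dots> \<le> (1 + 1 / g) * exp (g * t)" using g exp_ge_add_one_self[of "g * t"] by (intro mult_left_mono) auto
   finally show "(1 + t) / exp (g * t) \<le> 1 + 1 / g" by (simp add: field_simps)
  qed (use \<eta>0 A in simp)
  finally have 1: "\<bar>w t * (S t - P_part t)\<bar> \<le> n * A * (1 + 1 / g)" .
  have 2: "\<bar>conv ?Q (\<lambda>s. w t - w s) t\<bar> \<le> A * n * ((1 + 1 / g) / g)"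
  proof (rule conv_exp_bound[OF g Q c t A])
   fix s assume s: "s \<in> {0..t}"
   then show "\<bar>R s - P_part' s\<bar> \<le> A * exp (- (g * s))" by (intro decR) auto
   show "\<bar>w t - w (t - s)\<bar> \<le> n * (1 + s)" using n[of "t - s"] s by auto
  qed
  show ?thesis unfolding e using 1 2 abs_triangle_ineq4[of "w t * (S t - P_part t)" "conv ?Q (\<lambda>s. w t - w s) t"]
   by (simp add: M_def algebra_simps)
 qed
 show thesis by (rule that[of M]) (use A g in \<open>simp add: M_def\<close>, fact main)
qed

text \<open>Integration in time gives a Volterra equation whose inhomogeneity is a primitive plus w.
  The resolvent turns the primitive into terms with S, and w into w + conv R w, so that the rough
  path is never differentiated.\<close>

lemma delay_representation:
 assumes xi: "continuous_on {-r..0} \<xi>" and T: "0 \<le> T" and x: "continuous_on {-r..T} x"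
  and x0: "\<And>t. t \<in> {-r..0} \<Longrightarrow> x t = \<xi> t" and g: "loc_bdd g" and w: "loc_bdd w"
  and eq: "\<And>t. t \<in> {0..T} \<Longrightarrow> x t = \<xi> 0 + integral {0..t} (\<lambda>s. L (\<lambda>v. x (s + v)) + c * g s) + w t"
  and t: "t \<in> {0..T}"
 shows "x t = sol \<xi> t + c * conv S g t + (w t + conv R w t)"
proof -
 \<comment> \<open>x is controlled on [-r,T] only; the clamped function is continuous on the
   line.\<close>
 define y where "y s = x (max 0 (min s T))" for s
 have "continuous_on UNIV y" unfolding y_def
  by (rule continuous_on_compose2[OF x]) (use T p.r_pos in \<open>auto intro!: continuous_intros\<close>)
 then have y: "loc_bdd y" by (rule loc_bdd_continuous)
 have yx: "y s = x s" if "s \<in> {0..T}" for s using that by (simp add: y_def)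
 note phi = C_hat_continuous[OF xi]
 note f = loc_bdd_forcing[OF phi]
 have Lx: "L (\<lambda>v. x (s + v)) = hist y s + forcing \<xi> s" if s: "s \<in> {0..T}" for s
 proof -
  have "L (\<lambda>v. x (s + v)) = L_ext r L (\<lambda>v. x (s + v))"
   by (rule L_cont, rule continuous_on_compose2[OF x]) (use s in \<open>auto intro!: continuous_intros\<close>)
  also have "\<dots> = L_ext r L (\<lambda>v. (\<lambda>t. if t < 0 then \<xi> t else y t) (s + v))"
  proof -
   have "indicator {-r..0} v *\<^sub>R x (s + v) = indicator {-r..0} v *\<^sub>R (if s + v < 0 then \<xi> (s + v) else y (s + v))" for v
    using s x0[of "s + v"] yx[of "s + v"] by (auto simp: indicator_def)
   then show ?thesis unfolding L_ext_def set_lebesgue_integral_def by (simp only:)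
  qed
  also have "\<dots> = hist y s + forcing \<xi> s" by (rule lin_past_split[OF phi y]) (use s in auto)
  finally show ?thesis .
 qed
 define h where "h s = forcing \<xi> s + c * g s" for s
 have h: "loc_bdd h" unfolding h_def by (intro loc_bdd_add loc_bdd_cmult f g)
 have F: "y s - conv k y s = (\<xi> 0 + conv (\<lambda>_. 1) h s) + w s" if s: "0 \<le> s" "s \<le> t" for s
 proof -
  have "((\<lambda>u. L (\<lambda>v. x (u + v)) + c * g u) has_integral conv (\<lambda>_. 1) (\<lambda>u. hist y u + h u) s) {0..s}"
   by (rule has_integral_eq[OF _ conv_one_integral[OF loc_bdd_add[OF loc_bdd_hist[OF y] h]]]) (use s t Lx in \<open>auto simp: h_def\<close>)
  then have "integral {0..s} (\<lambda>u. L (\<lambda>v. x (u + v)) + c * g u) = conv k y s + conv (\<lambda>_. 1) h s"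
   using conv_add_right[OF loc_bdd_const loc_bdd_hist[OF y] h, of 1 s] conv_one_hist[OF y s(1)] by (simp add: integral_unique)
  then show ?thesis using eq[of s] yx[of s] s t by simp
 qed
 have t0: "0 \<le> t" using t by simp
 have "y t = (y t - conv k y t) + conv R (\<lambda>s. y s - conv k y s) t" by (rule volterra_solution[OF y t0])
 also have "conv R (\<lambda>s. y s - conv k y s) t = conv R (\<lambda>s. (\<xi> 0 + conv (\<lambda>_. 1) h s) + w s) t"
  by (rule conv_cong[OF refl F])
 also have "\<dots> = conv R (\<lambda>s. \<xi> 0 + conv (\<lambda>_. 1) h s) t + conv R w t"
  by (intro conv_add_right loc_bdd_R loc_bdd_add loc_bdd_const loc_bdd_conv h w)
 finally have "y t = \<xi> 0 * S t + conv S h t + (w t + conv R w t)"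
  using resolvent_of_primitive[OF h t0, of "\<xi> 0"] F[OF t0] by simp
 moreover have "conv S h t = conv S (forcing \<xi>) t + c * conv S g t"
  unfolding h_def by (subst conv_add_right) (auto simp: conv_cmult_right intro: loc_bdd_S f g loc_bdd_cmult)
 ultimately show ?thesis using yx[OF t] t0 by (simp add: sol_def)
qed

end

section \<open>The pathwise error estimate\<close>

text \<open>A path of the delay equation, of the reduced equation and of the noise, in the time scale of the delay.\<close>

locale path_pair =
 fixes r \<omega> :: real and L :: "(real \<Rightarrow> real) \<Rightarrow> real" and \<psi> :: complex and G :: "(real \<Rightarrow> real) \<Rightarrow> real"
  and \<xi> :: "real \<Rightarrow> real" and u0 :: complex and T' N \<kappa> \<eta> :: real
  and x :: "real \<Rightarrow> real" and u :: "real \<Rightarrow> complex" and w :: "real \<Rightarrow> real" and m :: "real \<Rightarrow> complex"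
 assumes cx: "continuous_on {-r..T'} x" and x0: "\<And>t. t \<in> {-r..0} \<Longrightarrow> x t = \<xi> t"
  and x: "\<And>t. t \<in> {0..T'} \<Longrightarrow> x t = \<xi> 0 + integral {0..t} (\<lambda>s. L (\<lambda>\<theta>. x (s + \<theta>)) + \<kappa> * G (\<lambda>\<theta>. x (s + \<theta>))) + w t"
  and cu: "continuous_on {0..T'} u"
  and u: "\<And>t. t \<in> {0..T'} \<Longrightarrow> u t = u0 + \<kappa> *\<^sub>R integral {0..t} (\<lambda>s. averaging.drift \<omega> \<psi> G s (u s)) + m t"
  and cw: "continuous_on {0..T'} w" and w0: "w 0 = 0"
  and ww: "\<And>s t. s \<in> {0..T'} \<Longrightarrow> t \<in> {0..T'} \<Longrightarrow> \<bar>w t - w s\<bar> \<le> \<eta> * (1 + \<bar>t - s\<bar>)"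
  and mN: "\<And>t. t \<in> {0..T'} \<Longrightarrow> norm (m t) \<le> N"
  and mm: "\<And>s t. s \<in> {0..T'} \<Longrightarrow> t \<in> {0..T'} \<Longrightarrow> norm (m t - m s) \<le> \<eta> * (1 + \<bar>t - s\<bar>)"

text \<open>Z is the slow variable driven by the drift along the delay solution itself, and E the
  remainder of that solution after its rotation and transient. The difference Z - u obeys a Gronwall
  inequality whose inhomogeneity contains the transient Y; this is not small but integrable, and in
  slow time contributes only order j. The Lipschitz constants presuppose |x| \<le> \<rho>, which
  \<open>bootstrap\<close> delivers together with the error bound.\<close>

lemma (in delay_model) reduction_error:
 assumes av: "averaging r \<omega> V C psi G G1 G3" and xi: "continuous_on {-r..0} \<xi>"
  and N: "0 \<le> N" and T: "0 < T"
 defines "u0 \<equiv> Complex (z_init r L \<omega> \<xi> $ 1) (- (z_init r L \<omega> \<xi> $ 2))"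
  and "Y \<equiv> \<lambda>t. sol \<xi> t - Phi \<omega> (z_init r L \<omega> \<xi>) t"
 obtains A e where "0 \<le> A" "0 < e"
  "\<And>j n x u w t. 0 < j \<Longrightarrow> j < e \<Longrightarrow> 0 \<le> n \<Longrightarrow> n < e \<Longrightarrow>
   path_pair r \<omega> L psi G \<xi> u0 (T/j) N j n x u w (critical_noise w) \<Longrightarrow>
   t \<in> {0..T/j} \<Longrightarrow> \<bar>x t - (Re (cis (\<omega> * t) * u t) + Y t)\<bar> \<le> A * (j + n)"
proof -
 interpret av: averaging r \<omega> V C psi G G1 G3 by (rule av)
 have r0: "0 < r" by (rule av.av_r)
 obtain \<gamma> Y1 where \<gamma>: "0 < \<gamma>" and Y1: "0 \<le> Y1" and Yd: "\<And>t. - r \<le> t \<Longrightarrow> \<bar>Y t\<bar> \<le> Y1 * exp (- (\<gamma> * t))"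
  using projection_decay C_hat_continuous[OF xi] unfolding Y_def z_init_def by metis
 obtain B e1 where B: "0 \<le> B" and e1: "0 < e1" and apr:
  "\<And>j n u m \<tau>. 0 < j \<Longrightarrow> j < e1 \<Longrightarrow> 0 \<le> n \<Longrightarrow> n < e1 \<Longrightarrow> continuous_on {0..T/j} u \<Longrightarrow>
   (\<And>\<tau>. \<tau> \<in> {0..T/j} \<Longrightarrow> u \<tau> = u0 + j *\<^sub>R integral {0..\<tau>} (\<lambda>s. av.drift s (u s)) + m \<tau>) \<Longrightarrow>
   (\<And>\<tau>. \<tau> \<in> {0..T/j} \<Longrightarrow> norm (m \<tau>) \<le> N) \<Longrightarrow>
   (\<And>s \<tau>. s \<in> {0..T/j} \<Longrightarrow> \<tau> \<in> {0..T/j} \<Longrightarrow> norm (m \<tau> - m s) \<le> n * (1 + \<bar>\<tau> - s\<bar>)) \<Longrightarrow>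
   \<tau> \<in> {0..T/j} \<Longrightarrow> norm (u \<tau>) < B"
  using av.a_priori_bound[OF N T, of u0 thesis] by blast
 obtain A1 where A1: "0 \<le> A1" and driftr:
  "\<And>g B t. 0 \<le> t \<Longrightarrow> loc_bdd g \<Longrightarrow> continuous_on {0..t} g \<Longrightarrow> (\<And>s. s \<in> {0..t} \<Longrightarrow> \<bar>g s\<bar> \<le> B) \<Longrightarrow>
   \<bar>conv S g t - Re (cis (\<omega> * t) * integral {0..t} (\<lambda>s. cis (- (\<omega> * s)) * psi * of_real (g s)))\<bar> \<le> A1 * B"
  using drift_remainder[of thesis] by blast
 obtain A2 where A2: "0 \<le> A2" and noiser:
  "\<And>w n t. 0 \<le> t \<Longrightarrow> loc_bdd w \<Longrightarrow> continuous_on {0..t} w \<Longrightarrow> w 0 = 0 \<Longrightarrow>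
   (\<And>s. s \<in> {0..t} \<Longrightarrow> \<bar>w t - w s\<bar> \<le> n * (1 + \<bar>t - s\<bar>)) \<Longrightarrow>
   \<bar>w t + conv R w t - Re (cis (\<omega> * t) * critical_noise w t)\<bar> \<le> A2 * n"
  using noise_remainder[of thesis] by blast
 define Y2 where "Y2 = Y1 * exp (\<gamma> * r)"
 \<comment> \<open>B bounds the reduced path, Y2 the transient; the 2 leaves room for the error,
   which stays below 1.\<close>
 define \<rho> where "\<rho> = B + Y2 + 2"
 define l where "l = av.lip \<rho>"
 define b where "b = norm psi * (av.lip B * B)"
 \<comment> \<open>Growth rate of the Gronwall envelope; it exceeds the Lipschitz constant
   \<open>norm psi * l\<close> of the drift, and the 1 keeps it positive.\<close>
 define q where "q = norm psi * l + 1"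
 \<comment> \<open>In units of j + n: c1 bounds the remainder E, c2 the variation of u over a window
   of length r, and c4 the accumulated inhomogeneity including the transient.\<close>
 define c1 where "c1 = A1 * (l * \<rho>) + A2"
 define c2 where "c2 = r * b + 1 + r"
 define c4 where "c4 = norm psi * l * ((c1 + c2) * T + Y2 / \<gamma>)"
 define A where "A = (c4 + 1) * exp (q * T) + c1"
 define e where "e = min e1 (1 / (2 * (A + 1)))"
 have nonneg: "0 \<le> Y2" "0 \<le> l" "0 \<le> b" "0 < \<rho>" "0 < q"
  using Y1 av.lip_nonneg B by (auto simp: Y2_def l_def b_def \<rho>_def q_def add_nonneg_pos)
 have c: "0 \<le> c1" "0 \<le> c2" "0 \<le> c4" using nonneg A1 A2 r0 T \<gamma> by (auto simp: c1_def c2_def c4_def)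
 have A: "0 \<le> A" using c by (simp add: A_def)
 have e: "0 < e" using e1 A by (simp add: e_def)
 have Y2b: "\<bar>Y t\<bar> \<le> Y2 * exp (- (\<gamma> * s))" if "- r \<le> t" "s - r \<le> t" for s t
 proof -
  have "Y1 * exp (- (\<gamma> * t)) \<le> Y1 * exp (- (\<gamma> * (s - r)))" using that \<gamma> Y1 by (intro mult_left_mono) auto
  also have "\<dots> = Y2 * exp (- (\<gamma> * s))" by (simp add: Y2_def exp_add[symmetric] algebra_simps)
  finally show ?thesis using Yd[OF that(1)] by simp
 qed
 have Phi_u0: "Phi \<omega> (z_init r L \<omega> \<xi>) t = Re (u0 * cis (\<omega> * t))" for t by (simp only: Phi_eq_Re u0_def)

 have main: "\<bar>x t - (Re (cis (\<omega> * t) * u t) + Y t)\<bar> \<le> A * (j + n)"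
  if j: "0 < j" "j < e" and n: "0 \<le> n" "n < e"
   and pp: "path_pair r \<omega> L psi G \<xi> u0 (T/j) N j n x u w (critical_noise w)"
   and t: "t \<in> {0..T/j}" for j n x u w t
 proof -
  define T' where "T' = T / j"
  interpret path_pair r \<omega> L psi G \<xi> u0 T' N j n x u w "critical_noise w" using pp by (simp add: T'_def)
  note t = t[folded T'_def]
  have T': "0 < T'" "j * T' = T" using T j by (auto simp: T'_def)
  have scale: "0 < j + n" "A * (j + n) \<le> 1"
  proof -
   have "j + n \<le> 2 * e" using j n by simp
   also have "\<dots> \<le> 1 / (A + 1)" using A by (simp add: e_def min_def field_simps)
   finally have "A * (j + n) \<le> A * (1 / (A + 1))" using A by (intro mult_left_mono) auto
   also have "\<dots> \<le> 1" using A by (simp add: field_simps)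
   finally show "A * (j + n) \<le> 1" .
  qed (use j n in simp)
  have uB: "norm (u s) \<le> B" if "s \<in> {0..T'}" for s
   by (rule less_imp_le, rule apr[of j n u "critical_noise w"])
    (use j n cu u mN mm that in \<open>auto simp: e_def T'_def\<close>)
  have u_0: "u 0 = u0" using u[of 0] T' w0 by (simp add: critical_noise_def)
  define cl where "cl s = max 0 (min s T')" for s
  have cl: "cl s = s" if "s \<in> {0..T'}" for s using that by (simp add: cl_def)
  have cl_range: "cl s \<in> {0..T'}" for s using T' by (simp add: cl_def)
  have cont_cl: "continuous_on A cl" for A unfolding cl_def by (intro continuous_intros)
  define G_x where "G_x s = G (\<lambda>\<theta>. x (s + \<theta>))" for s
  define G_u where "G_u s = G (av.wave (u s) s)" for s
  have shift: "continuous_on {-r..0} (\<lambda>\<theta>. x (s + \<theta>))" if "s \<in> {0..T'}" for s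
   by (rule continuous_on_compose2[OF cx]) (use that in \<open>auto intro!: continuous_intros\<close>)
  have cGx: "continuous_on {0..T'} G_x"
   unfolding G_x_def
   by (rule av.continuous_on_G, unfold case_prod_beta, rule continuous_on_compose2[OF cx]) (auto intro!: continuous_intros)
  have cGu: "continuous_on {0..T'} G_u"
  proof -
   have "continuous_on ({0..T'} \<times> {-r..0}) (\<lambda>p. u (fst p))"
    by (rule continuous_on_compose2[OF cu]) (auto intro!: continuous_intros)
   then show ?thesis unfolding G_u_def
    by (intro av.continuous_on_G) (auto simp: av.wave_def case_prod_beta intro!: continuous_intros)
  qed
  define g where "g s = G_x (cl s)" for s
  define w' where "w' s = w (cl s)" for s
  have gl: "loc_bdd g" unfolding g_def
   by (rule loc_bdd_continuous, rule continuous_on_compose2[OF cGx cont_cl]) (use cl_range in auto)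
  have wl: "loc_bdd w'" unfolding w'_def
   by (rule loc_bdd_continuous, rule continuous_on_compose2[OF cw cont_cl]) (use cl_range in auto)
  have geq: "g s = G_x s" and weq: "w' s = w s" if "s \<in> {0..T'}" for s using cl[OF that] by (auto simp: g_def w'_def)
  have noise_eq: "critical_noise w' s = critical_noise w s" if "s \<in> {0..T'}" for s
   unfolding critical_noise_def using that weq
   by (intro arg_cong2[of _ _ _ _ plus] integral_cong) auto
  define I where "I s = integral {0..s} (\<lambda>s. cis (- (\<omega> * s)) * psi * of_real (G_x s))" for s
  define Z where "Z s = u0 + j *\<^sub>R I s + critical_noise w s" for s
  define E where "E s = x s - Re (cis (\<omega> * s) * Z s) - Y s" for s
  have E_bound: "\<bar>E s\<bar> \<le> c1 * (j + n)" if s: "s \<in> {0..T'}" and gb: "\<And>v. v \<in> {0..s} \<Longrightarrow> \<bar>G_x v\<bar> \<le> l * \<rho>" for s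
  proof -
   have sT: "{0..s} \<subseteq> {0..T'}" using s by auto
   have Ig: "integral {0..s} (\<lambda>s. cis (- (\<omega> * s)) * psi * of_real (g s)) = I s"
    unfolding I_def using geq sT by (intro integral_cong) auto
   have 1: "\<bar>conv S g s - Re (cis (\<omega> * s) * I s)\<bar> \<le> A1 * (l * \<rho>)"
    unfolding Ig[symmetric]
   proof (rule driftr)
    show "continuous_on {0..s} g"
     by (rule continuous_on_eq[OF continuous_on_subset[OF cGx sT]]) (use geq sT in auto)
   qed (use s gl gb geq sT in auto)
   have 2: "\<bar>w' s + conv R w' s - Re (cis (\<omega> * s) * critical_noise w s)\<bar> \<le> A2 * n"
    unfolding noise_eq[OF s, symmetric]
   proof (rule noiser)
    show "continuous_on {0..s} w'"
     by (rule continuous_on_eq[OF continuous_on_subset[OF cw sT]]) (use weq sT in auto)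
    show "\<bar>w' s - w' v\<bar> \<le> n * (1 + \<bar>s - v\<bar>)" if "v \<in> {0..s}" for v
     using ww[of v s] weq[of v] weq[of s] s that by simp
   qed (use s wl w0 weq[of 0] T' in auto)
   have "x s = sol \<xi> s + j * conv S g s + (w' s + conv R w' s)"
   proof (rule delay_representation[OF xi _ cx x0 gl wl _ s])
    fix v assume v: "v \<in> {0..T'}"
    have "integral {0..v} (\<lambda>s. L (\<lambda>\<theta>. x (s + \<theta>)) + j * G (\<lambda>\<theta>. x (s + \<theta>))) = integral {0..v} (\<lambda>s. L (\<lambda>\<theta>. x (s + \<theta>)) + j * g s)"
     using v geq by (intro integral_cong) (auto simp: G_x_def)
    then show "x v = \<xi> 0 + integral {0..v} (\<lambda>s. L (\<lambda>\<theta>. x (s + \<theta>)) + j * g s) + w' v"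
     using x[OF v] weq[OF v] by simp
   qed (use T' in auto)
   moreover have "Re (cis (\<omega> * s) * Z s) = Phi \<omega> (z_init r L \<omega> \<xi>) s + j * Re (cis (\<omega> * s) * I s) + Re (cis (\<omega> * s) * critical_noise w s)"
    unfolding Phi_u0 Z_def distrib_left plus_complex.sel mult_scaleR_right scaleR_complex.sel by (simp only: mult.commute)
   ultimately have "E s = j * (conv S g s - Re (cis (\<omega> * s) * I s)) + (w' s + conv R w' s - Re (cis (\<omega> * s) * critical_noise w s))"
    unfolding E_def Y_def right_diff_distrib by linarith
   also have "\<bar>\<dots>\<bar> \<le> j * (A1 * (l * \<rho>)) + A2 * n"
    by (rule order_trans[OF abs_triangle_ineq], intro add_mono 2, unfold abs_mult) (use 1 j in \<open>auto intro!: mult_left_mono\<close>)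
   also have "\<dots> \<le> c1 * (j + n)"
    using A1 A2 nonneg j n by (simp add: c1_def algebra_simps)
   finally show ?thesis .
  qed
  define f where "f s = cis (- (\<omega> * s)) * psi * of_real (G_x s - G_u s)" for s
  have cf: "continuous_on {0..T'} f" unfolding f_def by (intro continuous_intros cGx cGu)
  have Zu: "Z s - u s = j *\<^sub>R integral {0..s} f" if s: "s \<in> {0..T'}" for s
  proof -
   have sT: "{0..s} \<subseteq> {0..T'}" using s by auto
   have cd: "continuous_on {0..s} (\<lambda>v. av.drift v (u v))" by (rule av.continuous_on_drift[OF continuous_on_subset[OF cu sT]])
   have "integral {0..s} f = integral {0..s} (\<lambda>v. cis (- (\<omega> * v)) * psi * of_real (G_x v) - av.drift v (u v))"
    by (rule integral_cong) (simp add: f_def av.drift_def G_u_def algebra_simps)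
   also have "\<dots> = I s - integral {0..s} (\<lambda>v. av.drift v (u v))" unfolding I_def
    by (intro integral_diff integrable_continuous_interval continuous_intros continuous_on_subset[OF cGx sT] cd)
   finally have e: "I s = integral {0..s} f + integral {0..s} (\<lambda>v. av.drift v (u v))" by simp
   show ?thesis unfolding Z_def e scaleR_add_right by (simp add: u[OF s])
  qed
  \<comment> \<open>The 1 beyond c4 is the slack that makes the improved estimate strict.\<close>
  define a where "a = (c4 + 1) * (j + n)"
  have a: "0 < a" using c scale by (simp add: a_def add_nonneg_pos)
  have u_osc: "norm (u y - u v) \<le> c2 * (j + n)" if vy: "0 \<le> v" "v \<le> y" "y \<le> T'" "y - v \<le> r" for v y
  proof -
   have "norm (integral {0..y} (\<lambda>s. av.drift s (u s)) - integral {0..v} (\<lambda>s. av.drift s (u s))) \<le> b * (y - v)"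
    by (rule av.primitive_lipschitz) (use vy uB in \<open>auto simp: b_def intro!: av.continuous_on_drift av.drift_bound continuous_on_subset[OF cu]\<close>)
   also have "\<dots> \<le> b * r" using vy nonneg by (intro mult_left_mono) auto
   finally have "j * norm (integral {0..y} (\<lambda>s. av.drift s (u s)) - integral {0..v} (\<lambda>s. av.drift s (u s))) \<le> j * (b * r)"
    using j by (intro mult_left_mono) auto
   moreover have "norm (critical_noise w y - critical_noise w v) \<le> n * (1 + r)"
    using mm[of v y] vy n mult_left_mono[of "1 + (y - v)" "1 + r" n] by simp
   moreover have "u y - u v = j *\<^sub>R (integral {0..y} (\<lambda>s. av.drift s (u s)) - integral {0..v} (\<lambda>s. av.drift s (u s))) + (critical_noise w y - critical_noise w v)"
    using u[of y] u[of v] vy by (simp add: algebra_simps)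
   ultimately have "norm (u y - u v) \<le> j * (b * r) + n * (1 + r)"
    using j by (auto intro!: norm_triangle_le add_mono mult_left_mono)
   also have "\<dots> \<le> c2 * (j + n)" using nonneg j n r0 by (simp add: c2_def algebra_simps)
   finally show ?thesis .
  qed
  define good where "good s \<longleftrightarrow> norm (Z s - u s) \<le> a * exp (q * j * s) \<and> \<bar>x s\<bar> \<le> \<rho>" for s
  have x_past: "x v = Re (u0 * cis (\<omega> * v)) + Y v" if "v \<in> {-r..<0}" for v
   unfolding Y_def Phi_u0 using x0[of v] that by (simp add: sol_def init_def)
  have x_le: "\<bar>x (s + \<theta>)\<bar> \<le> \<rho>" if s: "s \<in> {0..T'}" and good: "\<And>v. v \<in> {0..s} \<Longrightarrow> good v" and \<theta>: "\<theta> \<in> {-r..0}" for s \<theta>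
  proof (cases "0 \<le> s + \<theta>")
   case True
   then show ?thesis using good[of "s + \<theta>"] \<theta> by (simp add: good_def)
  next
   case False
   have "norm u0 \<le> B" using uB[of 0] T' by (simp add: u_0)
   then have "\<bar>Re (u0 * cis (\<omega> * (s + \<theta>)))\<bar> \<le> B" using complex_norm_le_mono[of u0 B "cis (\<omega> * (s + \<theta>))"] by simp
   moreover have "\<bar>Y (s + \<theta>)\<bar> \<le> Y2" using Y2b[of "s + \<theta>" 0] \<theta> s by simp
   ultimately show ?thesis using x_past[of "s + \<theta>"] False \<theta> s by (simp add: \<rho>_def)
  qed
  have G_x_bound: "\<bar>G_x s\<bar> \<le> l * \<rho>" if s: "s \<in> {0..T'}" and good: "\<And>v. v \<in> {0..s} \<Longrightarrow> good v" for s
   unfolding G_x_def l_def by (rule av.G_bound[OF shift[OF s] x_le[OF s good]])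
  have E_good: "\<bar>E s\<bar> \<le> c1 * (j + n)" if "s \<in> {0..T'}" "\<And>v. v \<in> {0..s} \<Longrightarrow> good v" for s
   by (rule E_bound) (use that in \<open>auto intro!: G_x_bound\<close>)
  have step: "norm (Z s - u s) < a * exp (q * j * s) \<and> \<bar>x s\<bar> < \<rho>"
   if s: "s \<in> {0..T'}" and good: "\<And>v. v \<in> {0..s} \<Longrightarrow> good v" for s
  proof
   \<comment> \<open>Bounds the distance of the true segment at v from the wave with coordinate u v:
     envelope, then remainder and variation of u, then transient.\<close>
   define d where "d v = a * exp (q * j * v) + (c1 + c2) * (j + n) + Y2 * exp (- (\<gamma> * v))" for v
   have close: "\<bar>x (v + \<theta>) - av.wave (u v) v \<theta>\<bar> \<le> d v" if v: "v \<in> {0..s}" and \<theta>: "\<theta> \<in> {-r..0}" for v \<theta>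
   proof (cases "0 \<le> v + \<theta>")
    case True
    let ?y = "v + \<theta>"
    have y: "?y \<in> {0..s}" "?y \<in> {0..T'}" using True v \<theta> s by auto
    have "x ?y - av.wave (u v) v \<theta> = Re ((Z ?y - u ?y) * cis (\<omega> * ?y)) - Re ((u v - u ?y) * cis (\<omega> * ?y)) + Y ?y + E ?y"
     by (simp add: E_def av.wave_def algebra_simps)
    moreover have "\<bar>Re ((Z ?y - u ?y) * cis (\<omega> * ?y))\<bar> \<le> a * exp (q * j * v)"
    proof -
     have "norm (Z ?y - u ?y) \<le> a * exp (q * j * ?y)" using good[OF y(1)] by (simp add: good_def)
     also have "\<dots> \<le> a * exp (q * j * v)" using a nonneg j \<theta> by (intro mult_left_mono) auto
     finally show ?thesis using complex_norm_le_mono[of "Z ?y - u ?y" _ "cis (\<omega> * ?y)"] by fastforce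
    qed
    moreover have "\<bar>Re ((u v - u ?y) * cis (\<omega> * ?y))\<bar> \<le> c2 * (j + n)"
     using complex_norm_le_mono[OF u_osc[of ?y v], of "cis (\<omega> * ?y)"] True \<theta> v s by simp
    moreover have "\<bar>Y ?y\<bar> \<le> Y2 * exp (- (\<gamma> * v))" by (rule Y2b) (use True \<theta> r0 in auto)
    moreover have "\<bar>E ?y\<bar> \<le> c1 * (j + n)" by (rule E_good[OF y(2)]) (use good y in auto)
    ultimately show ?thesis unfolding d_def distrib_right by linarith
   next
    case False
    have "x (v + \<theta>) - av.wave (u v) v \<theta> = - Re ((u v - u 0) * cis (\<omega> * (v + \<theta>))) + Y (v + \<theta>)"
     using x_past[of "v + \<theta>"] False \<theta> v by (simp add: u_0 av.wave_def algebra_simps)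
    moreover have "\<bar>Re ((u v - u 0) * cis (\<omega> * (v + \<theta>)))\<bar> \<le> c2 * (j + n)"
     using complex_norm_le_mono[OF u_osc[of 0 v], of "cis (\<omega> * (v + \<theta>))"] False \<theta> v s by simp
    moreover have "\<bar>Y (v + \<theta>)\<bar> \<le> Y2 * exp (- (\<gamma> * v))" by (rule Y2b) (use v \<theta> in auto)
    moreover have "0 \<le> a * exp (q * j * v)" "0 \<le> c1 * (j + n)" using a c scale by auto
    ultimately show ?thesis unfolding d_def distrib_right by linarith
   qed
   have f_le: "norm (f v) \<le> norm psi * l * d v" if v: "v \<in> {0..s}" for v
   proof -
    have vT: "v \<in> {0..T'}" using v s by auto
    have "\<bar>G_x v - G_u v\<bar> \<le> V * (1 + 3 * \<rho>\<^sup>2) * d v"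
     unfolding G_x_def G_u_def
    proof (rule av.G_lip[OF shift[OF vT] av.continuous_wave], intro conjI)
     fix \<theta> assume \<theta>: "\<theta> \<in> {-r..0}"
     show "\<bar>x (v + \<theta>) - av.wave (u v) v \<theta>\<bar> \<le> d v" by (rule close[OF v \<theta>])
     show "\<bar>av.wave (u v) v \<theta>\<bar> \<le> \<rho>" using av.wave_bound[of "u v" v \<theta>] uB[OF vT] nonneg by (simp add: \<rho>_def)
     show "\<bar>x (v + \<theta>)\<bar> \<le> \<rho>" by (rule x_le[OF vT good \<theta>]) (use v in auto)
    qed
    then have "norm psi * \<bar>G_x v - G_u v\<bar> \<le> norm psi * (l * d v)" unfolding l_def av.lip_def by (intro mult_left_mono) auto
    then show ?thesis by (simp add: f_def norm_mult mult.assoc del: of_real_diff)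
   qed
   \<comment> \<open>A primitive of d, which evaluates the integral inequality in closed
     form.\<close>
   define H where "H v = a / (q * j) * exp (q * j * v) + (c1 + c2) * (j + n) * v - Y2 / \<gamma> * exp (- (\<gamma> * v))" for v
   have dH: "(d has_integral (H s - H 0)) {0..s}"
   proof (rule fundamental_theorem_of_calculus)
    fix v
    have "(H has_real_derivative d v) (at v within {0..s})"
     unfolding H_def d_def using j nonneg \<gamma> by (auto intro!: derivative_eq_intros simp: field_simps)
    then show "(H has_vector_derivative d v) (at v within {0..s})" by (simp add: has_real_derivative_iff_has_vector_derivative)
   qed (use s in simp)
   have "norm (integral {0..s} f) \<le> integral {0..s} (\<lambda>v. norm psi * l * d v)"
   proof (rule Henstock_Kurzweil_Integration.integral_norm_bound_integral)
    show "f integrable_on {0..s}" by (intro integrable_continuous_interval continuous_on_subset[OF cf]) (use s in auto)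
    show "(\<lambda>v. norm psi * l * d v) integrable_on {0..s}" using has_integral_mult_right[OF dH] by blast
   qed (rule f_le)
   also have "\<dots> = norm psi * l * (H s - H 0)" by (rule integral_unique[OF has_integral_mult_right[OF dH]])
   finally have "j * norm (integral {0..s} f) \<le> j * (norm psi * l * (H s - H 0))" using j by (intro mult_left_mono) auto
   then have Zu_le: "norm (Z s - u s) \<le> norm psi * l * (j * (H s - H 0))" using Zu[OF s] j by (simp add: mult_ac)
   have "j * (H s - H 0) \<le> a / q * (exp (q * j * s) - 1) + ((c1 + c2) * T + Y2 / \<gamma>) * (j + n)"
   proof -
    have "j * ((p * x + c * s - y * z) - (p * 1 + c * 0 - y * 1)) = j * p * (x - 1) + c * (j * s) + j * y * (1 - z)" for p x c y z
     by (simp add: algebra_simps)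
    note this[of "a / (q * j)" "exp (q * j * s)" "(c1 + c2) * (j + n)" "Y2 / \<gamma>" "exp (- (\<gamma> * s))"]
    moreover have "j * (a / (q * j)) = a / q" using j by simp
    ultimately have "j * (H s - H 0) = a / q * (exp (q * j * s) - 1) + (c1 + c2) * (j + n) * (j * s) + j * (Y2 / \<gamma>) * (1 - exp (- (\<gamma> * s)))"
     unfolding H_def by (simp only: mult_zero_right minus_zero exp_zero)
    also have "\<dots> \<le> a / q * (exp (q * j * s) - 1) + (c1 + c2) * (j + n) * T + (j + n) * (Y2 / \<gamma>) * 1"
    proof (intro add_mono mult_mono mult_left_mono order_refl)
     show "j * s \<le> T" using s j mult_left_mono[of s T' j] by (simp add: T'(2))
    qed (use a c scale j n nonneg \<gamma> s in auto)
    finally show ?thesis by (simp add: algebra_simps)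
   qed
   then have "norm psi * l * (j * (H s - H 0)) \<le> norm psi * l * (a / q * (exp (q * j * s) - 1) + ((c1 + c2) * T + Y2 / \<gamma>) * (j + n))"
    using nonneg by (intro mult_left_mono) auto
   also have "\<dots> = (norm psi * l / q) * (a * (exp (q * j * s) - 1)) + c4 * (j + n)" by (simp add: c4_def algebra_simps add_divide_distrib)
   also have "\<dots> \<le> 1 * (a * (exp (q * j * s) - 1)) + c4 * (j + n)"
    using a nonneg s j by (intro add_right_mono mult_right_mono) (auto simp: q_def)
   also have "\<dots> < a * exp (q * j * s)" using scale(1) by (simp add: a_def algebra_simps)
   finally show Zu_lt: "norm (Z s - u s) < a * exp (q * j * s)" using Zu_le by simp
   have "q * j * s \<le> q * T" using s j nonneg mult_left_mono[of s T' "q * j"] by (simp add: T'(2) mult.assoc)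
   then have "a * exp (q * j * s) \<le> a * exp (q * T)" using a by simp
   then have "norm (Z s - u s) \<le> a * exp (q * T)" using Zu_lt by simp
   moreover have "norm (Z s) \<le> norm (u s) + norm (Z s - u s)" using norm_triangle_ineq[of "u s" "Z s - u s"] by simp
   moreover have "\<bar>Re (cis (\<omega> * s) * Z s)\<bar> \<le> norm (Z s)" using abs_Re_le_cmod[of "cis (\<omega> * s) * Z s"] by (simp add: norm_mult)
   moreover have "\<bar>Y s\<bar> \<le> Y2" using Y2b[of s 0] s r0 by simp
   moreover have "x s = Re (cis (\<omega> * s) * Z s) + Y s + E s" by (simp add: E_def)
   moreover have "a * exp (q * T) + c1 * (j + n) \<le> 1" using scale(2) by (simp add: A_def a_def algebra_simps)
   ultimately show "\<bar>x s\<bar> < \<rho>" using uB[OF s] E_good[OF s good] unfolding \<rho>_def by linarith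
  qed
  \<comment> \<open>Both conditions in \<open>good\<close> are scaled to the common bound 1, because
    \<open>bootstrap\<close> handles a single function. The integral stands for Z - u, as its
    continuity is immediate.\<close>
  define h where "h s = max (norm (j *\<^sub>R integral {0..s} f) * exp (- (q * j * s)) / a) (\<bar>x s\<bar> / \<rho>)" for s
  have h_iff: "h s \<le> 1 \<longleftrightarrow> good s" "h s < 1 \<longleftrightarrow> norm (Z s - u s) < a * exp (q * j * s) \<and> \<bar>x s\<bar> < \<rho>" if "s \<in> {0..T'}" for s
   unfolding h_def good_def Zu[OF that, symmetric] using a nonneg(4) by (auto simp: exp_minus field_simps)
  have h_lt: "h s < 1" if "s \<in> {0..T'}" for s
  proof (rule bootstrap[OF _ _ _ that])
   have "continuous_on {0..T'} x" by (rule continuous_on_subset[OF cx]) (use r0 in auto)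
   then show "continuous_on {0..T'} h" unfolding h_def using a nonneg(4)
    by (intro continuous_intros indefinite_integral_continuous_1 integrable_continuous_interval cf) auto
   have good0: "good 0"
   proof -
    have "norm u0 \<le> B" using uB[of 0] T' by (simp add: u_0)
    moreover have "x 0 = Re u0 + Y 0"
     using x0[of 0] r0 Phi_u0[of 0] delay_representation[OF xi order_refl _ _ loc_bdd_const[of 0] loc_bdd_const[of 0], of \<xi> 0 0] xi
     by (simp add: Y_def conv_cmult_right[of _ 0, simplified])
    moreover have "\<bar>Y 0\<bar> \<le> Y2" using Y2b[of 0 0] r0 by simp
    ultimately show ?thesis using Zu[of 0] T' a abs_Re_le_cmod[of u0] by (simp add: good_def \<rho>_def)
   qed
   show "h 0 < 1" using h_iff(2)[of 0] step[of 0] good0 T' by auto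
   fix s assume "s \<in> {0..T'}" and "\<And>v. v \<in> {0..s} \<Longrightarrow> h v \<le> 1"
   then show "h s < 1" using h_iff step[of s] by auto
  qed
  then have good: "good s" if "s \<in> {0..T'}" for s using h_iff(1) that by (auto simp: less_imp_le)
  have "norm (Z t - u t) \<le> a * exp (q * T)"
  proof -
   have "q * j * t \<le> q * T" using t j nonneg mult_left_mono[of t T' "q * j"] by (simp add: T'(2) mult.assoc)
   then have "a * exp (q * j * t) \<le> a * exp (q * T)" using a by simp
   then show ?thesis using good[OF t] by (simp add: good_def)
  qed
  moreover have "\<bar>E t\<bar> \<le> c1 * (j + n)" by (rule E_good[OF t]) (use good t in auto)
  moreover have "\<bar>Re (cis (\<omega> * t) * (Z t - u t))\<bar> \<le> norm (Z t - u t)" using abs_Re_le_cmod[of "cis (\<omega> * t) * (Z t - u t)"] by (simp add: norm_mult)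
  moreover have "x t - (Re (cis (\<omega> * t) * u t) + Y t) = Re (cis (\<omega> * t) * (Z t - u t)) + E t" by (simp add: E_def algebra_simps)
  moreover have "A * (j + n) = a * exp (q * T) + c1 * (j + n)" by (simp add: A_def a_def algebra_simps)
  ultimately show ?thesis by linarith
 qed
 show thesis by (rule that[OF A e]) (fact main)
qed

section \<open>The plane of critical modes as the complex plane\<close>

text \<open>With the conjugate sign below, \<open>exp(t B)\<close> acts as multiplication by \<open>cis (\<omega> t)\<close>.\<close>

definition cplane :: "real^2 \<Rightarrow> complex" where
 "cplane v = Complex (v $ 1) (- (v $ 2))"

text \<open>The matrix of multiplication by z in the coordinate \<open>cplane\<close>; t B is the
  case z = i \<omega> t.\<close>

definition mult_matrix :: "complex \<Rightarrow> real^2^2" where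
 "mult_matrix z = vector [vector [Re z, Im z], vector [- Im z, Re z]]"

lemma mult_matrix_nth:
 "mult_matrix z $ 1 $ 1 = Re z" "mult_matrix z $ 1 $ 2 = Im z"
 "mult_matrix z $ 2 $ 1 = - Im z" "mult_matrix z $ 2 $ 2 = Re z"
 by (simp_all add: mult_matrix_def vector_2)

lemma mult_matrix_mult: "mult_matrix z ** mult_matrix w = mult_matrix (z * w)"
 by (simp add: vec_eq_iff matrix_matrix_mult_def sum_2 forall_2 mult_matrix_nth)

lemma bounded_linear_mult_matrix: "bounded_linear mult_matrix"
 by (intro linear_conv_bounded_linear[THEN iffD1] linearI) (simp_all add: vec_eq_iff forall_2 mult_matrix_nth)

text \<open>The map \<open>mult_matrix\<close> is linear, continuous and multiplicative, so it
  passes through the exponential series.\<close>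

lemma mat_exp_mult_matrix: "mat_exp (mult_matrix z) = mult_matrix (exp z)"
proof -
 have pow: "((**) (mult_matrix z) ^^ n) (mat 1) = mult_matrix (z ^ n)" for n
 proof (induction n)
  case 0
  show ?case by (simp add: vec_eq_iff forall_2 mult_matrix_nth mat_def)
 qed (simp add: mult_matrix_mult)
 have "mat_exp (mult_matrix z) = (\<Sum>n. mult_matrix (z ^ n /\<^sub>R fact n))"
  unfolding mat_exp_def pow by (simp add: linear_scale[OF bounded_linear.linear[OF bounded_linear_mult_matrix]] divide_inverse)
 also have "\<dots> = mult_matrix (\<Sum>n. z ^ n /\<^sub>R fact n)"
  by (rule bounded_linear.suminf[OF bounded_linear_mult_matrix summable_exp_generic, symmetric])
 finally show ?thesis by (simp add: exp_def)
qed

lemma cplane_mult_matrix: "cplane (mult_matrix z *v v) = z * cplane v"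
 by (simp add: cplane_def complex_eq_iff matrix_vector_mult_def sum_2 mult_matrix_nth algebra_simps)

lemma cplane_mat_exp: "cplane (mat_exp (t *\<^sub>R mat_B w) *v v) = cis (w * t) * cplane v"
proof -
 have "t *\<^sub>R mat_B w = mult_matrix (\<i> * of_real (w * t))"
  by (simp add: vec_eq_iff forall_2 mult_matrix_nth mat_B_def vector_2)
 then show ?thesis by (simp only: mat_exp_mult_matrix cplane_mult_matrix cis_conv_exp)
qed

lemma Phi_cplane: "Phi w v y = Re (cplane v * cis (w * y))"
 by (simp only: Phi_eq_Re cplane_def)

lemma Phi_mat_exp: "Phi w (mat_exp (t *\<^sub>R mat_B w) *v v) y = Re (cplane v * cis (w * (t + y)))"
 unfolding Phi_cplane cplane_mat_exp distrib_left cis_mult[symmetric] by (simp only: mult_ac)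

lemma inner_cplane: "v \<bullet> w = Re (cnj (cplane v) * cplane w)"
 by (simp add: cplane_def inner_vec_def sum_2)

lemma bounded_linear_cplane: "bounded_linear cplane"
 by (intro linear_conv_bounded_linear[THEN iffD1] linearI) (simp_all add: cplane_def complex_eq_iff)

lemma norm_cplane: "norm (cplane v) = norm v"
 by (simp add: cplane_def cmod_def norm_vec_def L2_set_def sum_2)

lemma surj_cplane: "\<exists>v. cplane v = c"
 by (rule exI[of _ "vector [Re c, - Im c]"]) (simp add: cplane_def complex_eq_iff vector_2)

section \<open>The concrete nonlinearity, the limit of \<open>p_eps\<close> and rescaling of
  time\<close>

lemma cube_diff_le:
 fixes a b :: real
 assumes "\<bar>a\<bar> \<le> p" "\<bar>b\<bar> \<le> p" "\<bar>a - b\<bar> \<le> d"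
 shows "\<bar>a ^ 3 - b ^ 3\<bar> \<le> 3 * p\<^sup>2 * d"
proof -
 have sq: "\<bar>x * y\<bar> \<le> p\<^sup>2" if "\<bar>x\<bar> \<le> p" "\<bar>y\<bar> \<le> p" for x y
  using mult_mono[OF that] that abs_ge_zero[of x] by (simp add: abs_mult power2_eq_square)
 have "a ^ 3 - b ^ 3 = (a * a + a * b + b * b) * (a - b)" by (simp add: algebra_simps power3_eq_cube)
 moreover have "\<bar>a * a + a * b + b * b\<bar> \<le> 3 * p\<^sup>2"
  using sq[OF assms(1,1)] sq[OF assms(1,2)] sq[OF assms(2,2)] by linarith
 ultimately show ?thesis using assms(3) by (simp only: abs_mult) (intro mult_mono, auto)
qed

text \<open>V is the sum of the bounds for the two integrators. The estimate for differences of
  cubes gives the local Lipschitz constant, and \<open>cplane\<close> translates the stabilising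
  condition.\<close>

lemma (in delay_model) G_fun_averaging:
 assumes \<nu>1: "admissible_BV r \<nu>1" and \<nu>3: "admissible_BV r \<nu>3" and CG: "0 < CG" and stab: "stabilizing r L \<omega> \<nu>3 CG"
 shows "\<exists>V. averaging r \<omega> V CG psi (G_fun r \<nu>1 \<nu>3) (\<lambda>n. RS_integral n \<nu>1 (-r) 0) (\<lambda>n. RS_integral (\<lambda>y. n y ^ 3) \<nu>3 (-r) 0)"
proof -
 note r0 = p.r_pos
 have bv: "bounded_variation \<nu>1 (-r) 0" "bounded_variation \<nu>3 (-r) 0" using \<nu>1 \<nu>3 by (auto simp: admissible_BV_def)
 have ab: "-r \<le> 0" using r0 by simp
 obtain V1 where V1: "0 \<le> V1" "\<And>f B. continuous_on {-r..0} f \<Longrightarrow> (\<And>x. x \<in> {-r..0} \<Longrightarrow> \<bar>f x\<bar> \<le> B) \<Longrightarrow> \<bar>RS_integral f \<nu>1 (-r) 0\<bar> \<le> V1 * B"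
  using RS_integral_bound[OF bv(1) ab] by blast
 obtain V3 where V3: "0 \<le> V3" "\<And>f B. continuous_on {-r..0} f \<Longrightarrow> (\<And>x. x \<in> {-r..0} \<Longrightarrow> \<bar>f x\<bar> \<le> B) \<Longrightarrow> \<bar>RS_integral f \<nu>3 (-r) 0\<bar> \<le> V3 * B"
  using RS_integral_bound[OF bv(2) ab] by blast
 define V where "V = V1 + V3"
 have V: "0 \<le> V" "V1 \<le> V" "V3 \<le> V" using V1(1) V3(1) by (auto simp: V_def)
 have lip1: "\<bar>RS_integral n \<nu>1 (-r) 0 - RS_integral n' \<nu>1 (-r) 0\<bar> \<le> V * d"
  if c: "continuous_on {-r..0} n" "continuous_on {-r..0} n'" and d: "\<And>y. y \<in> {-r..0} \<Longrightarrow> \<bar>n y - n' y\<bar> \<le> d" for n n' d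
 proof -
  have "0 \<le> d" using order_trans[OF abs_ge_zero d[of 0]] r0 by simp
  then have "V1 * d \<le> V * d" using V by (intro mult_right_mono)
  then show ?thesis
   unfolding RS_integral_diff[OF bv(1) c ab, symmetric]
   using V1(2)[of "\<lambda>y. n y - n' y" d] c d by (force intro: continuous_on_diff)
 qed
 have zero1: "RS_integral (\<lambda>_. 0) h (-r) 0 = 0" if "bounded_variation h (-r) 0" for h
  using RS_integral_diff[OF that continuous_on_const continuous_on_const ab, of "0::real" "0::real"] by simp
 have "averaging r \<omega> V CG psi (G_fun r \<nu>1 \<nu>3) (\<lambda>n. RS_integral n \<nu>1 (-r) 0) (\<lambda>n. RS_integral (\<lambda>y. n y ^ 3) \<nu>3 (-r) 0)"
 proof
  show "0 < r" "0 < \<omega>" "0 \<le> V" "0 < CG" by (fact r0 \<omega>_pos V(1) CG)+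
  show "G_fun r \<nu>1 \<nu>3 n = RS_integral n \<nu>1 (-r) 0 + RS_integral (\<lambda>y. n y ^ 3) \<nu>3 (-r) 0" for n
   by (simp add: G_fun_def)
  show "G_fun r \<nu>1 \<nu>3 (\<lambda>_. 0) = 0" "RS_integral (\<lambda>_. 0) \<nu>1 (-r) 0 = 0" using zero1 bv by (auto simp: G_fun_def)
  show "\<bar>RS_integral n \<nu>1 (-r) 0 - RS_integral n' \<nu>1 (-r) 0\<bar> \<le> V * d"
   if "continuous_on {-r..0} n" "continuous_on {-r..0} n'" "\<And>y. y \<in> {-r..0} \<Longrightarrow> \<bar>n y - n' y\<bar> \<le> d" for n n' d
   by (rule lip1[OF that])
  show "\<bar>G_fun r \<nu>1 \<nu>3 n - G_fun r \<nu>1 \<nu>3 n'\<bar> \<le> V * (1 + 3 * q\<^sup>2) * d"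
   if c: "continuous_on {-r..0} n" "continuous_on {-r..0} n'"
    and d: "\<And>y. y \<in> {-r..0} \<Longrightarrow> \<bar>n y\<bar> \<le> q \<and> \<bar>n' y\<bar> \<le> q \<and> \<bar>n y - n' y\<bar> \<le> d" for n n' q d
  proof -
   have "0 \<le> d" using d[of 0] r0 by force
   then have le: "V3 * (3 * q\<^sup>2 * d) \<le> V * (3 * q\<^sup>2 * d)" using V by (intro mult_right_mono) auto
   have c3: "continuous_on {-r..0} (\<lambda>y. n y ^ 3)" "continuous_on {-r..0} (\<lambda>y. n' y ^ 3)" using c by (auto intro!: continuous_intros)
   have "\<bar>RS_integral (\<lambda>y. n y ^ 3 - n' y ^ 3) \<nu>3 (-r) 0\<bar> \<le> V3 * (3 * q\<^sup>2 * d)"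
    using d by (intro V3(2) continuous_on_diff c3 cube_diff_le) auto
   then have 3: "\<bar>RS_integral (\<lambda>y. n y ^ 3) \<nu>3 (-r) 0 - RS_integral (\<lambda>y. n' y ^ 3) \<nu>3 (-r) 0\<bar> \<le> V * (3 * q\<^sup>2 * d)"
    unfolding RS_integral_diff[OF bv(2) c3 ab] using le by linarith
   have "V * (1 + 3 * q\<^sup>2) * d = V * d + V * (3 * q\<^sup>2 * d)" by (simp add: algebra_simps)
   then show ?thesis using 3 lip1[OF c, of d] d unfolding G_fun_def by (smt (verit, best))
  qed
  fix z :: complex assume z: "z \<noteq> 0"
  obtain v where v: "cplane v = z" using surj_cplane by blast
  have v0: "v \<noteq> 0" using z v norm_cplane[of v] by auto
  have psi: "cplane (Psi_tilde r L \<omega>) = psi" by (simp add: cplane_def psi_def)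
  show "\<omega> / (2 * pi) * integral {0..2 * pi / \<omega>}
    (\<lambda>t. Re (cnj (z * cis (\<omega> * t)) * psi) * RS_integral (\<lambda>y. Re (z * cis (\<omega> * (t + y))) ^ 3) \<nu>3 (-r) 0) < - CG * norm z ^ 4"
   using stab[unfolded stabilizing_def, rule_format, OF v0]
   by (simp only: inner_cplane cplane_mat_exp Phi_mat_exp v psi norm_cplane[of v, symmetric] mult.commute[of z])
 qed
 then show ?thesis by blast
qed

text \<open>Moved under the root, the factor x powr (-a) lowers the exponent d to d - 2 a > 0, and a
  positive power beats the logarithm.\<close>

lemma tendsto_p_eps:
 assumes r: "0 < r" and T: "0 < T" and d: "2 * a < d"
 shows "(p_eps 1 r T a d \<longlongrightarrow> 1) (at_right 0)"
proof -
 define b where "b = d - 2 * a"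
 have b: "0 < b" using d by (simp add: b_def)
 have l: "((\<lambda>x::real. x powr b * ln x) \<longlongrightarrow> 0) (at_right 0)" using b by real_asymp
 have l0: "((\<lambda>x::real. x powr b) \<longlongrightarrow> 0) (at_right 0)" using b by real_asymp
 have "((\<lambda>x. 1 - sqrt (r * (ln (T / r) * x powr b - d * (x powr b * ln x)))) \<longlongrightarrow> 1 - sqrt (r * (ln (T / r) * 0 - d * 0))) (at_right 0)"
  by (intro tendsto_intros l l0)
 moreover have "1 - sqrt (r * (ln (T / r) * x powr b - d * (x powr b * ln x))) = p_eps 1 r T a d x" if x: "0 < x" for x
 proof -
  have 1: "ln (T / (r * x powr d)) = ln (T / r) - d * ln x"
   using r T x by (simp add: ln_div ln_mult ln_powr)
  have 2: "x powr (- a) = sqrt (x powr (- 2 * a))"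
   using x by (intro real_sqrt_unique[symmetric]) (auto simp: power2_eq_square powr_add[symmetric])
  have 3: "x powr (- 2 * a) * x powr d = x powr b" using x by (simp add: b_def powr_add[symmetric])
  have "x powr (- a) * sqrt (r * x powr d * ln (T / (r * x powr d))) = sqrt (x powr (- 2 * a) * (r * x powr d * ln (T / (r * x powr d))))"
   by (simp only: 2 real_sqrt_mult)
  also have "x powr (- 2 * a) * (r * x powr d * ln (T / (r * x powr d))) = r * ((x powr (- 2 * a) * x powr d) * (ln (T / r) - d * ln x))"
   by (simp only: 1 mult_ac)
  also have "\<dots> = r * (ln (T / r) * x powr b - d * (x powr b * ln x))" unfolding 3 by (simp only: right_diff_distrib mult_ac)
  finally show ?thesis by (simp add: p_eps_def mult.assoc)
 qed
 ultimately show ?thesis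
  by (auto intro: Lim_transform_eventually simp: eventually_at_right_less elim!: eventually_mono[rotated])
qed

text \<open>The non-integrable case, where both sides are 0, is included because the integral in the
  delay equation comes without a separate integrability claim.\<close>

lemma integral_rescale:
 fixes f :: "real \<Rightarrow> 'b::banach"
 assumes k: "0 < k"
 shows "integral {0..k * t} f = k *\<^sub>R integral {0..t} (\<lambda>s. f (k * s))"
proof -
 have iff: "((\<lambda>s. f (k * s)) has_integral (I /\<^sub>R k)) {0..t} \<longleftrightarrow> (f has_integral I) {0..k * t}" for I
  using has_integral_affinity_iff[OF k, of f 0 I 0 "k * t"] k by (simp add: mult.assoc[symmetric])
 show ?thesis
 proof (cases "f integrable_on {0..k * t}")
  case True
  then have "((\<lambda>s. f (k * s)) has_integral (integral {0..k * t} f /\<^sub>R k)) {0..t}" by (simp only: iff integrable_integral)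
  from integral_unique[OF this] show ?thesis using k by simp
 next
  case False
  have "\<not> (\<lambda>s. f (k * s)) integrable_on {0..t}"
  proof
   assume "(\<lambda>s. f (k * s)) integrable_on {0..t}"
   then obtain J where "((\<lambda>s. f (k * s)) has_integral ((k *\<^sub>R J) /\<^sub>R k)) {0..t}" using k by (auto simp: integrable_on_def)
   then show False using False unfolding iff by blast
  qed
  then show ?thesis using False by (simp add: not_integrable_integral)
 qed
qed

section \<open>Paths of the noise\<close>

context wiener
begin

lemma smooth_wave:
 "((\<lambda>s. Re (c * cis (v * s))) has_real_derivative Re (\<i> * of_real v * c * cis (v * t))) (at t)"
 by (auto intro!: derivative_eq_intros simp: algebra_simps)

lemma paths_integral_wave:
 assumes W: "continuous_on {0..} (\<lambda>s. W s y)" and t: "0 \<le> t"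
 shows "paths_integral (\<lambda>s. Re (c * cis (v * s))) (\<lambda>s. Re (\<i> * of_real v * c * cis (v * s))) t y =
  Re (c * (cis (v * t) * of_real (W t y) - integral {0..t} (\<lambda>s. \<i> * of_real v * cis (v * s) * of_real (W s y))))"
proof -
 have cW: "continuous_on {0..t} (\<lambda>s. W s y)" by (rule continuous_on_subset[OF W]) auto
 have "((\<lambda>s. \<i> * of_real v * cis (v * s) * of_real (W s y)) has_integral integral {0..t} (\<lambda>s. \<i> * of_real v * cis (v * s) * of_real (W s y))) {0..t}"
  by (intro integrable_integral integrable_continuous_interval continuous_intros cW)
 from has_integral_linear[OF has_integral_mult_right[OF this, of c] bounded_linear_Re]
 have "((\<lambda>s. Re (\<i> * of_real v * c * cis (v * s)) * W s y) has_integral Re (c * integral {0..t} (\<lambda>s. \<i> * of_real v * cis (v * s) * of_real (W s y)))) {0..t}"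
  by (rule has_integral_eq[rotated]) (simp add: algebra_simps)
 from integral_unique[OF this] show ?thesis
  unfolding paths_integral_def right_diff_distrib minus_complex.sel by (simp add: algebra_simps)
qed

lemma continuous_on_paths_integral:
 assumes f: "\<And>t. (f has_real_derivative f' t) (at t)" and f': "continuous_on UNIV f'"
  and W: "continuous_on {0..} (\<lambda>s. W s y)"
 shows "continuous_on {0..T} (\<lambda>t. paths_integral f f' t y)"
proof -
 have cW: "continuous_on {0..T} (\<lambda>s. W s y)" by (rule continuous_on_subset[OF W]) auto
 have cf: "continuous_on {0..T} f" using DERIV_isCont[OF f] by (intro continuous_at_imp_continuous_on) auto
 show ?thesis unfolding paths_integral_def
  by (intro continuous_intros indefinite_integral_continuous_1 integrable_continuous_interval cW cf continuous_on_subset[OF f']) auto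
qed

lemma paths_integral_tightness:
 assumes f: "\<And>t. (f has_real_derivative f' t) (at t)" and f': "continuous_on UNIV f'"
  and F: "\<And>x. \<bar>f x\<bar> \<le> F" and T: "0 < T" and N: "0 < N"
 shows "\<exists>B\<in>sets M. measure M B \<le> kolmogorov_const (3 * F ^ 4) T / N ^ 4 \<and>
  (AE y in M. y \<notin> B \<longrightarrow> (\<forall>s\<in>{0..T}. \<forall>t\<in>{0..T}.
   \<bar>paths_integral f f' t y - paths_integral f f' s y\<bar> \<le> N * \<bar>t - s\<bar> powr (1 / 8)))"
proof -
 note eq = wiener_int_eq_paths_integral[OF f f']
 have cont: "AE y in M. continuous_on {0..T} (\<lambda>t. wiener_int f t y)"
  using eq W_continuous
 proof eventually_elim
  case (elim y)
  show ?case by (rule continuous_on_eq[OF continuous_on_paths_integral[OF f f' elim(2)]]) (use elim(1) in auto)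
 qed
 have "\<exists>B\<in>sets M. measure M B \<le> kolmogorov_const (3 * F ^ 4) T / N ^ 4 \<and>
  (AE y in M. y \<notin> B \<longrightarrow> (\<forall>s\<in>{0..T}. \<forall>t\<in>{0..T}. \<bar>wiener_int f t y - wiener_int f s y\<bar> \<le> N * \<bar>t - s\<bar> powr (1 / 8)))"
  by (rule kolmogorov_tightness[OF T _ N wiener_int_measurable cont wiener_int_fourth_moment[OF f f' F]]) auto
 then obtain B where B: "B \<in> sets M" "measure M B \<le> kolmogorov_const (3 * F ^ 4) T / N ^ 4"
  and ae: "AE y in M. y \<notin> B \<longrightarrow> (\<forall>s\<in>{0..T}. \<forall>t\<in>{0..T}. \<bar>wiener_int f t y - wiener_int f s y\<bar> \<le> N * \<bar>t - s\<bar> powr (1 / 8))"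
  by blast
 have "AE y in M. y \<notin> B \<longrightarrow> (\<forall>s\<in>{0..T}. \<forall>t\<in>{0..T}.
   \<bar>paths_integral f f' t y - paths_integral f f' s y\<bar> \<le> N * \<bar>t - s\<bar> powr (1 / 8))"
  using ae eq by eventually_elim simp
 with B show ?thesis by blast
qed

text \<open>The hypothesis gives one exceptional null set for each time. Rational times are
  countable, and both sides are continuous in t.\<close>

lemma wiener_integral_process_eq:
 assumes f: "\<And>t. (f has_real_derivative f' t) (at t)" and f': "continuous_on UNIV f'" and T: "0 < T"
  and Z: "\<And>t. t \<in> {0..T} \<Longrightarrow> has_wiener_integral M W t f (Z t)"
  and c: "\<And>y. y \<in> space M \<Longrightarrow> continuous_on {0..T} (\<lambda>t. Z t y)"
 shows "AE y in M. \<forall>t\<in>{0..T}. Z t y = paths_integral f f' t y"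
proof -
 have "AE y in M. \<forall>t\<in>\<rat> \<inter> {0<..<T}. Z t y = wiener_int f t y"
 proof (rule AE_ball_countable')
  show "AE y in M. Z t y = wiener_int f t y" if "t \<in> \<rat> \<inter> {0<..<T}" for t
   by (rule has_wiener_integral_unique[OF f f' _ Z]) (use that in auto)
  show "countable (\<rat> \<inter> {0<..<T})" by (intro countable_Int1 countable_rat)
 qed
 then show ?thesis
  using wiener_int_eq_paths_integral[OF f f'] W_continuous AE_space
 proof eventually_elim
  case (elim y)
  have cl: "closure (\<rat> \<inter> {0<..<T}) = {0..T}"
   using closure_open_Int_superset[of "{0<..<T}" "\<rat>"] T by (simp add: Int_commute Rats_closure_real)
  have "Z t y - paths_integral f f' t y = 0" if "t \<in> {0..T}" for t
  proof (rule continuous_constant_on_closure[where S = "\<rat> \<inter> {0<..<T}" and f = "\<lambda>t. Z t y - paths_integral f f' t y"])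
   show "continuous_on (closure (\<rat> \<inter> {0<..<T})) (\<lambda>t. Z t y - paths_integral f f' t y)"
    unfolding cl
    by (intro continuous_on_diff c continuous_on_paths_integral[OF f f'] elim)
   show "t \<in> closure (\<rat> \<inter> {0<..<T})" using that cl by simp
   show "Z s y - paths_integral f f' s y = 0" if "s \<in> \<rat> \<inter> {0<..<T}" for s using elim that by auto
  qed
  then show ?case by simp
 qed
qed

end

section \<open>The probability estimate\<close>

text \<open>Three exceptional sets control the Hoelder constants of W and of the two components of
  the reduced noise. Off them, almost every outcome gives a \<open>path_pair\<close> in the time t /
  \<epsilon>^2, and the deterministic estimate applies. Their measure is bounded independently of
  \<epsilon>, because \<open>paths_integral_tightness\<close> sees the rapidly rotating integrand
  only through its bound F.\<close>

lemma (in delay_model) error_probability: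
 fixes M :: "'w measure"
 assumes M: "prob_space M" and W: "wiener_process M W"
  and av: "averaging r \<omega> V CG psi (G_fun r \<nu>1 \<nu>3) G1 G3" and xi: "continuous_on {-r..0} \<xi>" and T: "0 < T"
  and a: "a < 1" and q: "0 < q"
 shows "\<exists>\<epsilon>q>0. \<forall>\<epsilon> X z. 0 < \<epsilon> \<longrightarrow> \<epsilon> < \<epsilon>q \<longrightarrow>
  solves_delay_eq M W r L \<nu>1 \<nu>3 \<sigma> \<xi> T \<epsilon> X \<longrightarrow>
  solves_reduced_eq M W r L \<omega> \<nu>1 \<nu>3 \<sigma> \<xi> T \<epsilon> z \<longrightarrow>
  measure M {x \<in> space M. (SUP s\<in>{0..T}.
   \<bar>X s x - (Phi \<omega> (mat_exp ((s / \<epsilon>\<^sup>2) *\<^sub>R mat_B \<omega>) *v z s x) 0 + Y_frak r L \<omega> \<xi> \<epsilon> s 0)\<bar>) > 6 * \<epsilon> powr (a / 4)} \<le> q"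
proof -
 interpret wiener M W using M W by (simp add: wiener_def wiener_axioms_def)
 interpret av: averaging r \<omega> V CG psi "G_fun r \<nu>1 \<nu>3" G1 G3 by (rule av)
 \<comment> \<open>At least 1, to serve also for W itself, the integral of the constant 1.\<close>
 define F where "F = max 1 (norm (of_real \<sigma> * psi))"
 define Kc where "Kc = kolmogorov_const (3 * F ^ 4) T"
 have Kc: "0 \<le> Kc" by (simp add: Kc_def kolmogorov_const_def)
 \<comment> \<open>Large enough that three sets of measure at most Kc / N^4 together have measure at
   most q.\<close>
 define N where "N = 3 * Kc / q + 1"
 have N: "0 < N" "1 \<le> N" using Kc q by (auto simp: N_def add_nonneg_pos)
 have KN: "3 * (Kc / N ^ 4) \<le> q"
 proof -
  have "N ^ 1 \<le> N ^ 4" using N by (intro power_increasing) auto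
  then have "3 * Kc \<le> q * N ^ 4" using q Kc mult_left_mono[of N "N ^ 4" q] by (simp add: N_def distrib_left)
  then show ?thesis using N by (simp add: pos_divide_le_eq)
 qed
 define N' where "N' = 2 * N * T powr (1 / 8)"
 have N': "0 \<le> N'" using N by (simp add: N'_def)
 define u0 where "u0 = cplane (z_init r L \<omega> \<xi>)"
 define Y where "Y t = sol \<xi> t - Phi \<omega> (z_init r L \<omega> \<xi>) t" for t
 let ?G = "G_fun r \<nu>1 \<nu>3"
 obtain A e where A: "0 \<le> A" and e: "0 < e" and err:
  "\<And>h j x u w t. 0 < h \<Longrightarrow> h < e \<Longrightarrow> 0 \<le> j \<Longrightarrow> j < e \<Longrightarrow>
   path_pair r \<omega> L psi ?G \<xi> u0 (T/h) N' h j x u w (critical_noise w) \<Longrightarrow>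
   t \<in> {0..T/h} \<Longrightarrow> \<bar>x t - (Re (cis (\<omega> * t) * u t) + Y t)\<bar> \<le> A * (h + j)"
  using reduction_error[OF av xi N' T, folded cplane_def u0_def Y_def, of thesis] by blast
 \<comment> \<open>The 2 serves the complex noise, whose norm is at most the sum over two
   components, and \<open>\<bar>\<sigma>\<bar>\<close> the noise in the delay equation.\<close>
 define D where "D = (2 + \<bar>\<sigma>\<bar>) * N"
 have D: "0 < D" using N by (simp add: D_def add_pos_nonneg)
 have "((\<lambda>x::real. x powr 2) \<longlongrightarrow> 0) (at_right 0)" "((\<lambda>x::real. D * x powr (1 / 4)) \<longlongrightarrow> 0) (at_right 0)" by real_asymp+
 moreover have "((\<lambda>x::real. A * (1 + D) * x powr ((1 - a) / 4)) \<longlongrightarrow> 0) (at_right 0)"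
 proof -
  have "((\<lambda>x::real. x powr ((1 - a) / 4)) \<longlongrightarrow> 0) (at_right 0)" using a by real_asymp
  from tendsto_mult_right_zero[OF this] show ?thesis .
 qed
 ultimately have "eventually (\<lambda>x::real. x powr 2 < e \<and> D * x powr (1 / 4) < e \<and> A * (1 + D) * x powr ((1 - a) / 4) < 6 \<and> x < 1) (at_right 0)"
  using e by (intro eventually_conj order_tendstoD(2)) (auto simp: eventually_at_right_less intro: eventually_at_rightI[of 0 1])
 then obtain \<epsilon>q where \<epsilon>q: "0 < \<epsilon>q"
  "\<And>\<epsilon>. 0 < \<epsilon> \<Longrightarrow> \<epsilon> < \<epsilon>q \<Longrightarrow> \<epsilon> powr 2 < e \<and> D * \<epsilon> powr (1 / 4) < e \<and> A * (1 + D) * \<epsilon> powr ((1 - a) / 4) < 6 \<and> \<epsilon> < 1"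
  unfolding eventually_at_right_field by auto
 show ?thesis
 proof (rule exI[of _ \<epsilon>q], intro conjI allI impI \<epsilon>q(1))
  fix \<epsilon> X z
  assume \<epsilon>: "0 < \<epsilon>" "\<epsilon> < \<epsilon>q" and X: "solves_delay_eq M W r L \<nu>1 \<nu>3 \<sigma> \<xi> T \<epsilon> X"
   and z: "solves_reduced_eq M W r L \<omega> \<nu>1 \<nu>3 \<sigma> \<xi> T \<epsilon> z"
  define h where "h = \<epsilon>\<^sup>2"
  define j where "j = D * \<epsilon> powr (1 / 4)"
  have h: "0 < h" "h < e" using \<epsilon>q(2)[OF \<epsilon>] \<epsilon> by (auto simp: h_def)
  have j: "0 \<le> j" "j < e" using \<epsilon>q(2)[OF \<epsilon>] D by (auto simp: j_def)
  have small: "A * (h + j) \<le> 6 * \<epsilon> powr (a / 4)"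
  proof -
   have "\<epsilon> powr 2 \<le> \<epsilon> powr (1 / 4)" using \<epsilon> \<epsilon>q(2)[OF \<epsilon>] by (intro powr_mono') auto
   then have "h \<le> \<epsilon> powr (1 / 4)" using \<epsilon> by (simp add: h_def)
   then have "A * (h + j) \<le> A * ((1 + D) * \<epsilon> powr (1 / 4))" using A by (intro mult_left_mono) (auto simp: j_def algebra_simps)
   also have "\<dots> = (A * (1 + D) * \<epsilon> powr ((1 - a) / 4)) * \<epsilon> powr (a / 4)"
    by (simp add: powr_add[symmetric] field_simps)
   also have "\<dots> \<le> 6 * \<epsilon> powr (a / 4)" using \<epsilon>q(2)[OF \<epsilon>] by (intro mult_right_mono) auto
   finally show ?thesis .
  qed
  have \<kappa>8: "h powr (1 / 8) = \<epsilon> powr (1 / 4)" using \<epsilon> by (simp add: h_def powr_powr flip: powr_numeral)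
  \<comment> \<open>The remainder estimates use the linear modulus 1 + |t - s|, which dominates the
    power with exponent 1/8.\<close>
  have holder_scale: "N * \<bar>h * t - h * s\<bar> powr (1 / 8) \<le> N * \<epsilon> powr (1 / 4) * (1 + \<bar>t - s\<bar>)" for s t
  proof -
   have "\<bar>t - s\<bar> powr (1 / 8) \<le> 1 + \<bar>t - s\<bar>"
   proof (cases "\<bar>t - s\<bar> \<le> 1")
    case True
    then have "\<bar>t - s\<bar> powr (1 / 8) \<le> 1 powr (1 / 8)" by (intro powr_mono2) auto
    then show ?thesis by simp
   next
    case False
    then have "\<bar>t - s\<bar> powr (1 / 8) \<le> \<bar>t - s\<bar> powr 1" by (intro powr_mono) auto
    then show ?thesis using False by simp
   qed
   moreover have "\<bar>h * t - h * s\<bar> powr (1 / 8) = \<epsilon> powr (1 / 4) * \<bar>t - s\<bar> powr (1 / 8)"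
    using h by (simp add: right_diff_distrib[symmetric] abs_mult powr_mult \<kappa>8)
   ultimately show ?thesis using N by (simp add: mult.assoc mult_left_mono)
  qed
  define p where "p = - (\<omega> / h)"
  have p: "p * (h * t) = - (\<omega> * t)" for t using h by (simp add: p_def)
  define f where "f c s = Re (c * cis (p * s))" for c s
  define f' where "f' c s = Re (\<i> * of_real p * c * cis (p * s))" for c s
  have df: "(f c has_real_derivative f' c t) (at t)" for c t unfolding f_def f'_def by (rule smooth_wave)
  have cf': "continuous_on UNIV (f' c)" for c unfolding f'_def by (intro continuous_intros)
  \<comment> \<open>The components of the diffusion coefficient are Re (c1 cis(p s)) and -Im (c1
    cis(p s)); the latter is Re (i c1 cis(p s)), so one family f covers both.\<close>
  define c1 where "c1 = of_real \<sigma> * psi"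
  have bf: "\<bar>f c1 t\<bar> \<le> F" "\<bar>f (\<i> * c1) t\<bar> \<le> F" for t
   using complex_norm_le_mono[of c1 "norm c1" "cis (p * t)"] complex_norm_le_mono[of "\<i> * c1" "norm c1" "cis (p * t)"]
   by (auto simp: f_def F_def c1_def[symmetric] norm_mult)
  obtain B1 where B1: "B1 \<in> sets M" "measure M B1 \<le> Kc / N ^ 4"
   "AE x in M. x \<notin> B1 \<longrightarrow> (\<forall>s\<in>{0..T}. \<forall>t\<in>{0..T}. \<bar>paths_integral (f c1) (f' c1) t x - paths_integral (f c1) (f' c1) s x\<bar> \<le> N * \<bar>t - s\<bar> powr (1 / 8))"
   using paths_integral_tightness[OF df cf' bf(1) T N(1)] unfolding Kc_def by blast
  obtain B2 where B2: "B2 \<in> sets M" "measure M B2 \<le> Kc / N ^ 4"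
   "AE x in M. x \<notin> B2 \<longrightarrow> (\<forall>s\<in>{0..T}. \<forall>t\<in>{0..T}. \<bar>paths_integral (f (\<i> * c1)) (f' (\<i> * c1)) t x - paths_integral (f (\<i> * c1)) (f' (\<i> * c1)) s x\<bar> \<le> N * \<bar>t - s\<bar> powr (1 / 8))"
   using paths_integral_tightness[OF df cf' bf(2) T N(1)] unfolding Kc_def by blast
  have "\<exists>B\<in>sets M. measure M B \<le> Kc / N ^ 4 \<and>
   (AE x in M. x \<notin> B \<longrightarrow> (\<forall>s\<in>{0..T}. \<forall>t\<in>{0..T}. \<bar>paths_integral (\<lambda>_. 1) (\<lambda>_. 0) t x - paths_integral (\<lambda>_. 1) (\<lambda>_. 0) s x\<bar> \<le> N * \<bar>t - s\<bar> powr (1 / 8)))"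
   unfolding Kc_def by (rule paths_integral_tightness[OF _ _ _ T N(1)]) (auto simp: F_def)
  then obtain B3 where B3: "B3 \<in> sets M" "measure M B3 \<le> Kc / N ^ 4"
   "AE x in M. x \<notin> B3 \<longrightarrow> (\<forall>s\<in>{0..T}. \<forall>t\<in>{0..T}. \<bar>W t x - W s x\<bar> \<le> N * \<bar>t - s\<bar> powr (1 / 8))"
   by (auto simp: paths_integral_def)
  have psi: "cplane (Psi_tilde r L \<omega>) = psi" by (simp add: cplane_def psi_def)
  define dr where "dr s x = ?G (Phi \<omega> (mat_exp ((s / \<epsilon>\<^sup>2) *\<^sub>R mat_B \<omega>) *v z s x)) *\<^sub>R
        (mat_exp ((- s / \<epsilon>\<^sup>2) *\<^sub>R mat_B \<omega>) *v Psi_tilde r L \<omega>)" for s x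
  have dr: "cplane (dr s x) = av.drift (s / h) (cplane (z s x))" for s x
  proof -
   have "Phi \<omega> (mat_exp ((s / \<epsilon>\<^sup>2) *\<^sub>R mat_B \<omega>) *v z s x) = av.wave (cplane (z s x)) (s / h)"
    by (rule ext) (simp only: Phi_mat_exp av.wave_def h_def)
   then show ?thesis
    unfolding dr_def av.drift_def linear_scale[OF bounded_linear.linear[OF bounded_linear_cplane]] cplane_mat_exp psi
    by (simp add: h_def scaleR_conv_of_real mult_ac)
  qed
  have zc: "continuous_on {0..T} (\<lambda>t. z t x)" if "x \<in> space M" for x
   using z that by (simp add: solves_reduced_eq_def)
  have czc: "continuous_on {0..T} (\<lambda>t. cplane (z t x))" if "x \<in> space M" for x
   by (rule bounded_linear.continuous_on[OF bounded_linear_cplane zc[OF that]])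
  have cdr: "continuous_on {0..T} (\<lambda>s. dr s x)" if "x \<in> space M" for x
  proof -
   have "continuous_on {0..T/h} (\<lambda>s. cplane (z (h * s) x))"
    by (rule continuous_on_compose2[OF czc[OF that]]) (use h in \<open>auto intro!: continuous_intros simp: field_simps\<close>)
   then have "continuous_on {0..T/h} (\<lambda>s. av.drift s (cplane (z (h * s) x)))" by (rule av.continuous_on_drift)
   then have "continuous_on {0..T} (\<lambda>s. av.drift (s / h) (cplane (z (h * (s / h)) x)))"
    by (rule continuous_on_compose2) (use h in \<open>auto intro!: continuous_intros simp: divide_right_mono\<close>)
   then have c: "continuous_on {0..T} (\<lambda>s. cplane (dr s x))" using h by (simp add: dr)
   have "dr s x = vector [Re (cplane (dr s x)), - Im (cplane (dr s x))]" for s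
    by (simp add: cplane_def vec_eq_iff forall_2 vector_2)
   moreover have "continuous_on {0..T} (\<lambda>s. vector [Re (cplane (dr s x)), - Im (cplane (dr s x))] :: real^2)"
   proof (rule continuous_on_vec_lambda[where f = "\<lambda>i s. if i = 1 then Re (cplane (dr s x)) else - Im (cplane (dr s x))", THEN continuous_on_eq])
    show "continuous_on {0..T} (\<lambda>s. if i = 1 then Re (cplane (dr s x)) else - Im (cplane (dr s x)))" for i :: 2
     by (cases "i = 1") (auto intro!: continuous_intros c)
   qed (simp add: vec_eq_iff forall_2 vector_2)
   ultimately show ?thesis by simp
  qed
  define n where "n t x = z t x - z 0 x - integral {0..t} (\<lambda>s. dr s x)" for t x
  have nc: "continuous_on {0..T} (\<lambda>t. n t x)" if "x \<in> space M" for x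
   unfolding n_def
   by (intro continuous_intros zc that indefinite_integral_continuous_1 integrable_continuous_interval cdr)
  have wi: "has_wiener_integral M W t (\<lambda>s. \<sigma> * (mat_exp ((- s / \<epsilon>\<^sup>2) *\<^sub>R mat_B \<omega>) *v Psi_tilde r L \<omega>) $ i) (\<lambda>x. n t x $ i)"
   if "t \<in> {0..T}" for t i
   using z that unfolding solves_reduced_eq_def n_def dr_def by blast
  have coeff: "cplane (mat_exp ((- s / \<epsilon>\<^sup>2) *\<^sub>R mat_B \<omega>) *v Psi_tilde r L \<omega>) = psi * cis (p * s)" for s
   unfolding cplane_mat_exp psi by (simp add: p_def h_def mult.commute)
  have coeff1: "(\<lambda>s. \<sigma> * (mat_exp ((- s / \<epsilon>\<^sup>2) *\<^sub>R mat_B \<omega>) *v Psi_tilde r L \<omega>) $ 1) = f c1"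
  proof
   fix s
   have "(mat_exp ((- s / \<epsilon>\<^sup>2) *\<^sub>R mat_B \<omega>) *v Psi_tilde r L \<omega>) $ 1 = Re (psi * cis (p * s))"
    unfolding coeff[symmetric] by (simp add: cplane_def)
   then show "\<sigma> * (mat_exp ((- s / \<epsilon>\<^sup>2) *\<^sub>R mat_B \<omega>) *v Psi_tilde r L \<omega>) $ 1 = f c1 s"
    by (simp only: f_def c1_def) (simp add: algebra_simps)
  qed
  have coeff2: "(\<lambda>s. \<sigma> * (mat_exp ((- s / \<epsilon>\<^sup>2) *\<^sub>R mat_B \<omega>) *v Psi_tilde r L \<omega>) $ 2) = f (\<i> * c1)"
  proof
   fix s
   have "(mat_exp ((- s / \<epsilon>\<^sup>2) *\<^sub>R mat_B \<omega>) *v Psi_tilde r L \<omega>) $ 2 = - Im (psi * cis (p * s))"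
    unfolding coeff[symmetric] by (simp add: cplane_def)
   then show "\<sigma> * (mat_exp ((- s / \<epsilon>\<^sup>2) *\<^sub>R mat_B \<omega>) *v Psi_tilde r L \<omega>) $ 2 = f (\<i> * c1) s"
    by (simp only: f_def c1_def) (simp add: algebra_simps)
  qed
  have n1: "AE x in M. \<forall>t\<in>{0..T}. n t x $ 1 = paths_integral (f c1) (f' c1) t x"
   by (rule wiener_integral_process_eq[OF df cf' T]) (use wi[of _ 1, unfolded coeff1] nc in \<open>auto intro!: continuous_intros\<close>)
  have n2: "AE x in M. \<forall>t\<in>{0..T}. n t x $ 2 = paths_integral (f (\<i> * c1)) (f' (\<i> * c1)) t x"
   by (rule wiener_integral_process_eq[OF df cf' T]) (use wi[of _ 2, unfolded coeff2] nc in \<open>auto intro!: continuous_intros\<close>)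
  let ?bad = "{x \<in> space M. (SUP s\<in>{0..T}.
   \<bar>X s x - (Phi \<omega> (mat_exp ((s / \<epsilon>\<^sup>2) *\<^sub>R mat_B \<omega>) *v z s x) 0 + Y_frak r L \<omega> \<xi> \<epsilon> s 0)\<bar>) > 6 * \<epsilon> powr (a / 4)}"
  have Xae: "AE x in M. (\<forall>t\<in>{- (\<epsilon>\<^sup>2 * r)..0}. X t x = \<xi> (t / \<epsilon>\<^sup>2)) \<and>
    (\<forall>t\<in>{0..T}. X t x = \<xi> 0 +
      integral {0..t} (\<lambda>s. L (segment \<epsilon> s (\<lambda>u. X u x)) / \<epsilon>\<^sup>2 + ?G (segment \<epsilon> s (\<lambda>u. X u x))) + \<sigma> * W t x)"
   and z0: "AE x in M. z 0 x = z_init r L \<omega> \<xi>"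
   using X z by (simp_all add: solves_delay_eq_def solves_reduced_eq_def)
  have "AE x in M. x \<in> ?bad \<longrightarrow> x \<in> B1 \<union> B2 \<union> B3"
   using AE_space Xae z0 n1 n2 B1(3) B2(3) B3(3) W_0 W_continuous
  proof eventually_elim
   case (elim x)
   note sp = elim(1) and Xpast = elim(2)[THEN conjunct1, rule_format] and Xeq = elim(2)[THEN conjunct2, rule_format]
    and z0 = elim(3) and n1 = elim(4)[rule_format] and n2 = elim(5)[rule_format] and W0 = elim(9) and Wc = elim(10)
   have "(SUP s\<in>{0..T}. \<bar>X s x - (Phi \<omega> (mat_exp ((s / \<epsilon>\<^sup>2) *\<^sub>R mat_B \<omega>) *v z s x) 0 + Y_frak r L \<omega> \<xi> \<epsilon> s 0)\<bar>) \<le> 6 * \<epsilon> powr (a / 4)"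
    if nB: "x \<notin> B1 \<union> B2 \<union> B3"
   proof (rule cSUP_least)
    show "{0..T} \<noteq> {}" using T by simp
    fix s assume s: "s \<in> {0..T}"
    note H1 = elim(6)[rule_format] and H2 = elim(7)[rule_format] and H3 = elim(8)[rule_format]
    have range: "h * t \<in> {0..T}" if "t \<in> {0..T/h}" for t using that h by (auto simp: field_simps)
    define w where "w t = \<sigma> * W (h * t) x" for t
    define u where "u t = cplane (z (h * t) x)" for t
    define x' where "x' t = X (h * t) x" for t
    have noise: "critical_noise w t = cplane (n (h * t) x)" if t: "t \<in> {0..T/h}" for t
    proof -
     let ?I = "integral {0..h * t} (\<lambda>s. \<i> * of_real p * cis (p * s) * of_real (W s x))"
     let ?m = "cis (p * (h * t)) * of_real (W (h * t) x) - ?I"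
     have "cplane (n (h * t) x) = Complex (Re (c1 * ?m)) (- Re (\<i> * c1 * ?m))"
      unfolding cplane_def n1[OF range[OF t]] n2[OF range[OF t]] f_def f'_def
      using range[OF t] by (simp only: paths_integral_wave[OF Wc] atLeastAtMost_iff)
     also have "\<dots> = c1 * ?m" by (simp add: complex_eq_iff algebra_simps)
     also have "?I = h *\<^sub>R integral {0..t} (\<lambda>s. \<i> * of_real p * cis (p * (h * s)) * of_real (W (h * s) x))"
      by (rule integral_rescale[OF h(1)])
     also have "c1 * (cis (p * (h * t)) * of_real (W (h * t) x) - \<dots>) = cis (- (\<omega> * t)) * psi * of_real (w t)
       + integral {0..t} (\<lambda>s. (- (of_real h * c1)) * (\<i> * of_real p * cis (p * (h * s)) * of_real (W (h * s) x)))"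
      by (simp only: integral_mult_right p) (simp add: w_def c1_def scaleR_conv_of_real algebra_simps)
     also have "(\<lambda>s. (- (of_real h * c1)) * (\<i> * of_real p * cis (p * (h * s)) * of_real (W (h * s) x)))
       = (\<lambda>s. cis (- (\<omega> * s)) * (\<i> * of_real \<omega> * psi) * of_real (w s))"
     proof
      fix s
      have "- (of_real h * of_real p) = (of_real \<omega> :: complex)" using h by (simp add: p_def)
      moreover have "(- (of_real h * c1)) * (\<i> * of_real p * cis (p * (h * s)) * of_real (W (h * s) x))
       = (- (of_real h * of_real p)) * (c1 * \<i> * cis (p * (h * s)) * of_real (W (h * s) x))" by (simp add: algebra_simps)
      ultimately show "(- (of_real h * c1)) * (\<i> * of_real p * cis (p * (h * s)) * of_real (W (h * s) x)) = cis (- (\<omega> * s)) * (\<i> * of_real \<omega> * psi) * of_real (w s)"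
       by (simp only: p) (simp add: w_def c1_def mult_ac)
     qed
     finally show ?thesis by (simp add: critical_noise_def)
    qed
    have cn_diff: "norm (cplane (n t x) - cplane (n s x)) \<le> 2 * (N * \<bar>t - s\<bar> powr (1 / 8))" if "s \<in> {0..T}" "t \<in> {0..T}" for s t
     using H1[OF _ that] H2[OF _ that] nB n1 n2 that cmod_le[of "cplane (n t x) - cplane (n s x)"] by (simp add: cplane_def)
    have n0: "cplane (n 0 x) = 0" by (simp add: n_def cplane_def complex_eq_iff)
    have \<eta>_ge: "2 * (N * \<epsilon> powr (1 / 4)) \<le> j" "\<bar>\<sigma>\<bar> * (N * \<epsilon> powr (1 / 4)) \<le> j"
     using N by (auto simp: j_def D_def algebra_simps)
    have "path_pair r \<omega> L psi ?G \<xi> u0 (T/h) N' h j x' u w (critical_noise w)"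
    proof
     show "continuous_on {-r..T/h} x'" unfolding x'_def
     proof (rule continuous_on_compose2[where f = "\<lambda>t. h * t"])
      show "continuous_on {- (\<epsilon>\<^sup>2 * r)..T} (\<lambda>t. X t x)" using X sp by (simp add: solves_delay_eq_def)
      show "(\<lambda>t. h * t) ` {-r..T/h} \<subseteq> {- (\<epsilon>\<^sup>2 * r)..T}"
      proof
       fix y assume "y \<in> (\<lambda>t. h * t) ` {-r..T/h}"
       then obtain t where t: "y = h * t" "-r \<le> t" "t \<le> T / h" by force
       have "h * (-r) \<le> h * t" "h * t \<le> h * (T / h)" using t h by (intro mult_left_mono; simp)+
       then show "y \<in> {- (\<epsilon>\<^sup>2 * r)..T}" using h t by (simp add: h_def)
      qed
     qed (intro continuous_intros)
     show "x' t = \<xi> t" if "t \<in> {-r..0}" for t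
     proof -
      have "h * (-r) \<le> h * t" "h * t \<le> h * 0" using that h by (intro mult_left_mono; simp)+
      then show ?thesis using Xpast[of "h * t"] h by (simp add: x'_def h_def)
     qed
     show "x' t = \<xi> 0 + integral {0..t} (\<lambda>s. L (\<lambda>g. x' (s + g)) + h * ?G (\<lambda>g. x' (s + g))) + w t" if t: "t \<in> {0..T/h}" for t
     proof -
      have seg: "segment \<epsilon> (h * s) (\<lambda>u. X u x) = (\<lambda>g. x' (s + g))" for s
       by (simp add: segment_def x'_def h_def distrib_left)
      have "x' t = \<xi> 0 + h *\<^sub>R integral {0..t} (\<lambda>s. L (\<lambda>g. x' (s + g)) / h + ?G (\<lambda>g. x' (s + g))) + w t"
       using Xeq[OF range[OF t]] unfolding integral_rescale[OF h(1)] seg by (simp add: x'_def w_def h_def)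
      also have "h *\<^sub>R integral {0..t} (\<lambda>s. L (\<lambda>g. x' (s + g)) / h + ?G (\<lambda>g. x' (s + g)))
        = integral {0..t} (\<lambda>s. L (\<lambda>g. x' (s + g)) + h * ?G (\<lambda>g. x' (s + g)))"
       using h by (simp add: distrib_left flip: integral_mult_right)
      finally show ?thesis .
     qed
     show cu: "continuous_on {0..T/h} u" unfolding u_def
      by (rule continuous_on_compose2[OF czc[OF sp]]) (use range in \<open>auto intro!: continuous_intros\<close>)
     show "u t = u0 + h *\<^sub>R integral {0..t} (\<lambda>s. av.drift s (u s)) + critical_noise w t" if t: "t \<in> {0..T/h}" for t
     proof -
      have "continuous_on {0..h * t} (\<lambda>s. dr s x)" by (rule continuous_on_subset[OF cdr[OF sp]]) (use range[OF t] in auto)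
      then have "cplane (integral {0..h * t} (\<lambda>s. dr s x)) = integral {0..h * t} (\<lambda>s. cplane (dr s x))"
       using integral_linear[OF integrable_continuous_interval bounded_linear_cplane, of 0 "h * t" "\<lambda>s. dr s x"] by (simp add: o_def)
      also have "\<dots> = h *\<^sub>R integral {0..t} (\<lambda>s. av.drift s (u s))"
       using h by (simp add: integral_rescale dr u_def)
      finally have e: "cplane (integral {0..h * t} (\<lambda>s. dr s x)) = h *\<^sub>R integral {0..t} (\<lambda>s. av.drift s (u s))" .
      show ?thesis
       unfolding noise[OF t] n_def linear_diff[OF bounded_linear.linear[OF bounded_linear_cplane]] e z0 u0_def u_def by simp
     qed
     show "continuous_on {0..T/h} w" unfolding w_def
      by (intro continuous_intros continuous_on_compose2[OF Wc]) (use range in auto)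
     show "w 0 = 0" using W0 by (simp add: w_def)
     show "\<bar>w t - w s\<bar> \<le> j * (1 + \<bar>t - s\<bar>)" if st: "s \<in> {0..T/h}" "t \<in> {0..T/h}" for s t
     proof -
      have "\<bar>W (h * t) x - W (h * s) x\<bar> \<le> N * \<epsilon> powr (1 / 4) * (1 + \<bar>t - s\<bar>)"
       by (rule order_trans[OF H3 holder_scale]) (use nB range st in auto)
      then have "\<bar>\<sigma>\<bar> * \<bar>W (h * t) x - W (h * s) x\<bar> \<le> \<bar>\<sigma>\<bar> * (N * \<epsilon> powr (1 / 4) * (1 + \<bar>t - s\<bar>))" by (intro mult_left_mono) auto
      also have "\<dots> = (\<bar>\<sigma>\<bar> * (N * \<epsilon> powr (1 / 4))) * (1 + \<bar>t - s\<bar>)" by (simp only: mult.assoc)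
      also have "\<dots> \<le> j * (1 + \<bar>t - s\<bar>)" using \<eta>_ge by (intro mult_right_mono) auto
      finally show ?thesis by (simp add: w_def right_diff_distrib[symmetric] abs_mult)
     qed
     show "norm (critical_noise w t) \<le> N'" if t: "t \<in> {0..T/h}" for t
     proof -
      have "norm (cplane (n (h * t) x) - cplane (n 0 x)) \<le> 2 * (N * \<bar>h * t - 0\<bar> powr (1 / 8))"
       by (rule cn_diff) (use range[OF t] T in auto)
      also have "\<dots> \<le> 2 * (N * T powr (1 / 8))" using range[OF t] N by (intro mult_left_mono powr_mono2) auto
      finally show ?thesis unfolding noise[OF t] by (simp add: N'_def n0)
     qed
     show "norm (critical_noise w t - critical_noise w s) \<le> j * (1 + \<bar>t - s\<bar>)" if st: "s \<in> {0..T/h}" "t \<in> {0..T/h}" for s t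
     proof -
      have "norm (cplane (n (h * t) x) - cplane (n (h * s) x)) \<le> 2 * (N * \<bar>h * t - h * s\<bar> powr (1 / 8))"
       by (rule cn_diff) (use range st in auto)
      also have "\<dots> \<le> 2 * (N * \<epsilon> powr (1 / 4) * (1 + \<bar>t - s\<bar>))" by (intro mult_left_mono holder_scale) auto
      also have "\<dots> = 2 * (N * \<epsilon> powr (1 / 4)) * (1 + \<bar>t - s\<bar>)" by (simp only: mult.assoc)
      also have "\<dots> \<le> j * (1 + \<bar>t - s\<bar>)" using \<eta>_ge by (intro mult_right_mono) auto
      finally show ?thesis using st by (simp add: noise)
     qed
    qed
    from err[OF h j this, of "s / h"]
    have "\<bar>x' (s / h) - (Re (cis (\<omega> * (s / h)) * u (s / h)) + Y (s / h))\<bar> \<le> A * (h + j)"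
     using s h by (simp add: divide_right_mono)
    moreover have "x' (s / h) = X s x" using h by (simp add: x'_def)
    moreover have "Re (cis (\<omega> * (s / h)) * u (s / h)) = Phi \<omega> (mat_exp ((s / \<epsilon>\<^sup>2) *\<^sub>R mat_B \<omega>) *v z s x) 0"
     using h unfolding Phi_mat_exp u_def by (simp add: h_def mult.commute)
    moreover have "Y (s / h) = Y_frak r L \<omega> \<xi> \<epsilon> s 0" using Y_frak_eq[OF xi, of s \<epsilon>] s by (simp add: Y_def h_def)
    ultimately show "\<bar>X s x - (Phi \<omega> (mat_exp ((s / \<epsilon>\<^sup>2) *\<^sub>R mat_B \<omega>) *v z s x) 0 + Y_frak r L \<omega> \<xi> \<epsilon> s 0)\<bar> \<le> 6 * \<epsilon> powr (a / 4)"
     using small by simp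
   qed
   then show ?case by fastforce
  qed
  then have "measure M ?bad \<le> measure M (B1 \<union> B2 \<union> B3)"
   by (rule finite_measure_mono_AE) (use B1 B2 B3 in auto)
  also have "\<dots> \<le> measure M (B1 \<union> B2) + measure M B3" by (rule measure_Un_le) (use B1 B2 B3 in auto)
  also have "measure M (B1 \<union> B2) \<le> measure M B1 + measure M B2" by (rule measure_Un_le) (use B1 B2 in auto)
  finally show "measure M ?bad \<le> q" using B1(2) B2(2) B3(2) KN by simp
 qed
qed

theorem theorem3p10:
  fixes r T \<sigma> \<omega>c :: real and L0 :: "(real \<Rightarrow> real) \<Rightarrow> real"
  assumes "r > 0" and "T > 0"
    and "bounded_linear_on_C r L0"
    and "critical_spectrum L0 \<omega>c"
  shows "\<exists>Ch>0. \<forall>(M :: 'w measure) W \<nu>1 \<nu>3 \<xi>.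
    prob_space M \<longrightarrow> wiener_process M W \<longrightarrow>
    admissible_BV r \<nu>1 \<longrightarrow> admissible_BV r \<nu>3 \<longrightarrow>
    continuous_on {-r..0} \<xi> \<longrightarrow>
    (\<exists>CG>0. stabilizing r L0 \<omega>c \<nu>3 CG) \<longrightarrow>
    (\<forall>a \<delta>. 0 \<le> a \<longrightarrow> a < 1 \<longrightarrow> 2 * a < \<delta> \<longrightarrow> \<delta> < 2 \<longrightarrow>
      (p_eps Ch r T a \<delta> \<longlongrightarrow> 1) (at_right 0) \<and>
      (\<forall>q>0. \<exists>\<epsilon>q>0. \<forall>\<epsilon> X z.
        0 < \<epsilon> \<longrightarrow> \<epsilon> < \<epsilon>q \<longrightarrow>
        solves_delay_eq M W r L0 \<nu>1 \<nu>3 \<sigma> \<xi> T \<epsilon> X \<longrightarrow>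
        solves_reduced_eq M W r L0 \<omega>c \<nu>1 \<nu>3 \<sigma> \<xi> T \<epsilon> z \<longrightarrow>
        measure M {\<omega> \<in> space M.
          (SUP s\<in>{0..T}.
            \<bar>X s \<omega> - (Phi \<omega>c (mat_exp ((s / \<epsilon>\<^sup>2) *\<^sub>R mat_B \<omega>c) *v z s \<omega>) 0
                       + Y_frak r L0 \<omega>c \<xi> \<epsilon> s 0)\<bar>)
          > 6 * \<epsilon> powr (a / 4)}
        < 3 * q + 4 * (1 - p_eps Ch r T a \<delta> \<epsilon>)))"
proof -
 obtain \<mu>p \<mu>n where "delay_model \<mu>p \<mu>n r \<omega>c L0"
  using delay_model_exists[OF assms(1,3,4)] by blast
 then interpret delay_model \<mu>p \<mu>n r \<omega>c L0 .
 show ?thesis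
 proof (rule exI[of _ 1], intro conjI allI impI, goal_cases)
  case (2 M W \<nu>1 \<nu>3 \<xi> a \<delta>)
  then show ?case using tendsto_p_eps[OF assms(1,2)] by blast
 next
  case (3 M W \<nu>1 \<nu>3 \<xi> a \<delta> q)
  then obtain CG where "0 < CG" "stabilizing r L0 \<omega>c \<nu>3 CG" by blast
  then obtain V where av: "averaging r \<omega>c V CG psi (G_fun r \<nu>1 \<nu>3) (\<lambda>\<eta>. RS_integral \<eta> \<nu>1 (-r) 0) (\<lambda>\<eta>. RS_integral (\<lambda>\<theta>. \<eta> \<theta> ^ 3) \<nu>3 (-r) 0)"
   using G_fun_averaging[OF 3(3,4)] by blast
  \<comment> \<open>For small \<epsilon> the term 4 (1 - p_eps) exceeds -q, so the right-hand side
    of the claim is larger than 2 q.\<close>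
  have "eventually (\<lambda>\<epsilon>. p_eps 1 r T a \<delta> \<epsilon> < 1 + q / 4) (at_right 0)"
   by (rule order_tendstoD(2)[OF tendsto_p_eps[OF assms(1,2) 3(9)]]) (use 3(11) in simp)
  then obtain e1 where e1: "0 < e1" "\<And>\<epsilon>. 0 < \<epsilon> \<Longrightarrow> \<epsilon> < e1 \<Longrightarrow> p_eps 1 r T a \<delta> \<epsilon> < 1 + q / 4"
   unfolding eventually_at_right_field by auto
  obtain e2 where e2: "0 < e2" "\<And>\<epsilon> X z. 0 < \<epsilon> \<Longrightarrow> \<epsilon> < e2 \<Longrightarrow>
   solves_delay_eq M W r L0 \<nu>1 \<nu>3 \<sigma> \<xi> T \<epsilon> X \<Longrightarrow> solves_reduced_eq M W r L0 \<omega>c \<nu>1 \<nu>3 \<sigma> \<xi> T \<epsilon> z \<Longrightarrow>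
   measure M {\<omega> \<in> space M. (SUP s\<in>{0..T}.
    \<bar>X s \<omega> - (Phi \<omega>c (mat_exp ((s / \<epsilon>\<^sup>2) *\<^sub>R mat_B \<omega>c) *v z s \<omega>) 0 + Y_frak r L0 \<omega>c \<xi> \<epsilon> s 0)\<bar>) > 6 * \<epsilon> powr (a / 4)} \<le> q"
   using error_probability[OF 3(1,2) av 3(5) assms(2) 3(8,11), of \<sigma>] by blast
  show ?case
  proof (rule exI[of _ "min e1 e2"], intro conjI allI impI, goal_cases)
   case (2 \<epsilon> X z)
   then show ?case using e1(2)[of \<epsilon>] e2(2)[of \<epsilon> X z] 3(11) by simp
  qed (use e1 e2 in simp)
 qed simp
qed

end
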